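(* Suppose that $\varepsilon^{-d}r_\varepsilon^{d-1}\to\beta\ge0$ as $\varepsilon\searrow0$, let $k$ be a positive integer, and let $\varepsilon\to0$ along a sequence for which $U_k^\varepsilon$ converges weakly in $H^1(\Omega)$ to some $U\in H^1(\Omega)$ and $\sigma_k^\varepsilon$ converges. Then, along this sequence, for each $V\in H^1(\Omega)$, $$\lim_{\varepsilon\to0}\int_{\partial T^\varepsilon}u_k^\varepsilon V\,dA=A_d\,\beta\int_\Omega UV\,dx .$$
   Context: Let $d\ge2$ and let $\Omega\subset\mathbb R^d$ be a bounded connected domain with Lipschitz boundary. $A_d$ is the area of the unit sphere in $\mathbb R^d$; $dA$ is surface measure. Perforated domains: for $0<\varepsilon<1$ and $\mathbf k\in\mathbb Z^d$ let $Q_{\mathbf k}^\varepsilon=\varepsilon\mathbf k+[-\varepsilon/2,\varepsilon/2]^d$ and $I^\varepsilon=\{\mathbf k\in\mathbb Z^d: Q_{\mathbf k}^\varepsilon\subset\Omega\}$. Let $r_\varepsilon$ be an increasing positive function of $\varepsilon$ with $r_\varepsilon<\varepsilon/2$. Put $T_{\mathbf k}^\varepsilon=B(\varepsilon\mathbf k,r_\varepsilon)$, $T^\varepsilon=\bigcup_{\mathbf k\in I^\varepsilon}T_{\mathbf k}^\varepsilon$, and $\Omega^\varepsilon=\Omega\setminus\overline{T^\varepsilon}$. Steklov problem on $\Omega^\varepsilon$: $\Delta u=0$ in $\Omega^\varepsilon$, $\partial_\nu u=\sigma u$ on $\partial\Omega^\varepsilon$ ($\nu$ is the outward normal), understood weakly: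 $u\in H^1(\Omega^\varepsilon)$ and $\int_{\Omega^\varepsilon}\nabla u\cdot\nabla v\,dx=\sigma\int_{\partial\Omega^\varepsilon}uv\,dA$ for all $v\in H^1(\Omega^\varepsilon)$. Its eigenvalues, repeated with multiplicity, are $0=\sigma_0^\varepsilon<\sigma_1^\varepsilon\le\sigma_2^\varepsilon\le\dots\nearrow\infty$, with corresponding real eigenfunctions $u_k^\varepsilon$ whose traces form an orthonormal basis of $L^2(\partial\Omega^\varepsilon)$; in particular $\int_{\partial\Omega^\varepsilon}(u_k^\varepsilon)^2\,dA=1$. $U_k^\varepsilon\in H^1(\Omega)$ is the function with $U_k^\varepsilon=u_k^\varepsilon$ in $\overline{\Omega^\varepsilon}$ and $\Delta U_k^\varepsilon=0$ in $T^\varepsilon$. *)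

theory Defs
  imports "HOL-Analysis.Analysis"
begin

section \<open>Hausdorff measure and surface measure\<close>

text \<open>
  The \<open>m\<close>-dimensional Hausdorff measure, normalised by the volume of the unit ball of
  \<open>\<real>\<^sup>m\<close>, so that for \<open>m = d - 1\<close> it is the usual surface measure on Lipschitz
  hypersurfaces of \<open>\<real>\<^sup>d\<close>. The sets of a covering are required to be bounded because
  \<^const>\<open>diameter\<close> is meaningless for unbounded sets; empty sets of a covering cost nothing
  also for \<open>m = 0\<close>.
\<close>

definition hausdorff_cost :: "nat \<Rightarrow> 'a::metric_space set \<Rightarrow> ennreal" where
  "hausdorff_cost m E =
     (if E = {} then 0 else ennreal (unit_ball_vol (real m) * (diameter E / 2) ^ m))"

definition hausdorff_outer :: "nat \<Rightarrow> 'a::metric_space set \<Rightarrow> ennreal" where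
  "hausdorff_outer m A =
     (SUP \<delta>\<in>{0::real<..}.
        INF E\<in>{E :: nat \<Rightarrow> 'a set.
                 (\<forall>i. bounded (E i) \<and> diameter (E i) \<le> \<delta>) \<and> A \<subseteq> (\<Union>i. E i)}.
          \<Sum>i. hausdorff_cost m (E i))"

definition hausdorff_measure :: "nat \<Rightarrow> 'a::metric_space measure" where
  "hausdorff_measure m = measure_of UNIV (sets borel) (hausdorff_outer m)"

lemma sets_hausdorff_measure [simp, measurable_cong]: "sets (hausdorff_measure m) = sets borel"
  unfolding hausdorff_measure_def by (metis sets.sigma_sets_eq sets_measure_of space_borel top_greatest
      Pow_UNIV)

lemma space_hausdorff_measure [simp]: "space (hausdorff_measure m) = UNIV"
  unfolding hausdorff_measure_def by (simp add: space_measure_of_conv)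

text \<open>Surface measure \<open>dA\<close> on the boundary of \<open>D\<close>.\<close>

definition boundary_measure :: "(real ^ 'n) set \<Rightarrow> (real ^ 'n) measure" where
  "boundary_measure D = restrict_space (hausdorff_measure (CARD('n) - 1)) (frontier D)"

definition unit_sphere_area :: "'n::finite itself \<Rightarrow> real" where
  "unit_sphere_area _ = measure (hausdorff_measure (CARD('n) - 1)) (sphere (0 :: real ^ 'n) 1)"


section \<open>Bounded Lipschitz domains\<close>

text \<open>
  Near each boundary point, after a rotation, \<open>D\<close> is the strict epigraph of a Lipschitz function
  \<open>\<phi>\<close>. The unit vector \<open>e\<close> is the vertical direction, and \<open>\<phi>\<close> lives on the hyperplane
  orthogonal to \<open>e\<close>.
\<close>

definition lipschitz_boundary :: "(real ^ 'n) set \<Rightarrow> bool" where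
  "lipschitz_boundary D \<longleftrightarrow>
     (\<forall>p\<in>frontier D. \<exists>W e L (\<phi> :: real ^ 'n \<Rightarrow> real).
        open W \<and> p \<in> W \<and> norm e = 1 \<and> L-lipschitz_on {y. y \<bullet> e = 0} \<phi> \<and>
        D \<inter> W = {x \<in> W. \<phi> (x - (x \<bullet> e) *\<^sub>R e) < x \<bullet> e})"

definition bounded_lipschitz_domain :: "(real ^ 'n) set \<Rightarrow> bool" where
  "bounded_lipschitz_domain D \<longleftrightarrow>
     open D \<and> connected D \<and> D \<noteq> {} \<and> bounded D \<and> lipschitz_boundary D"


section \<open>Smooth functions and the Sobolev space \<open>H\<^sup>1\<close>\<close>

definition gradient :: "(real ^ 'n \<Rightarrow> real) \<Rightarrow> real ^ 'n \<Rightarrow> real ^ 'n" where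
  "gradient f x = (\<chi> i. frechet_derivative f (at x) (axis i 1))"

fun times_cont_diff :: "nat \<Rightarrow> (real ^ 'n \<Rightarrow> real) \<Rightarrow> bool" where
  "times_cont_diff 0 f \<longleftrightarrow> continuous_on UNIV f"
| "times_cont_diff (Suc m) f \<longleftrightarrow>
     (\<forall>x. f differentiable (at x)) \<and> (\<forall>i. times_cont_diff m (\<lambda>x. gradient f x $ i))"

definition smooth :: "(real ^ 'n \<Rightarrow> real) \<Rightarrow> bool" where
  "smooth f \<longleftrightarrow> (\<forall>m. times_cont_diff m f)"

definition test_function :: "(real ^ 'n) set \<Rightarrow> (real ^ 'n \<Rightarrow> real) \<Rightarrow> bool" where
  "test_function D \<phi> \<longleftrightarrow>
     smooth \<phi> \<and> compact (closure {x. \<phi> x \<noteq> 0}) \<and> closure {x. \<phi> x \<noteq> 0} \<subseteq> D"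

definition square_integrable :: "'a measure \<Rightarrow> ('a \<Rightarrow> 'b::euclidean_space) \<Rightarrow> bool" where
  "square_integrable M f \<longleftrightarrow> f \<in> borel_measurable M \<and> integrable M (\<lambda>x. (norm (f x))\<^sup>2)"

text \<open>
  Elements of \<open>L\<^sup>2(D)\<close> and \<open>H\<^sup>1(D)\<close> are represented by functions on the whole space; their values
  outside \<open>D\<close> are irrelevant.
\<close>

definition weak_gradient ::
    "(real ^ 'n) set \<Rightarrow> (real ^ 'n \<Rightarrow> real) \<Rightarrow> (real ^ 'n \<Rightarrow> real ^ 'n) \<Rightarrow> bool" where
  "weak_gradient D u G \<longleftrightarrow>
     (\<forall>\<phi> i. test_function D \<phi> \<longrightarrow>
        (LINT x|lebesgue_on D. u x * (gradient \<phi> x $ i)) = - (LINT x|lebesgue_on D. (G x $ i) * \<phi> x))"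

definition H1 :: "(real ^ 'n) set \<Rightarrow> (real ^ 'n \<Rightarrow> real) set" where
  "H1 D = {u. square_integrable (lebesgue_on D) u \<and>
              (\<exists>G. square_integrable (lebesgue_on D) G \<and> weak_gradient D u G)}"

text \<open>The weak gradient of an element of \<open>H\<^sup>1(D)\<close>; unique up to null sets.\<close>

definition wgrad :: "(real ^ 'n) set \<Rightarrow> (real ^ 'n \<Rightarrow> real) \<Rightarrow> real ^ 'n \<Rightarrow> real ^ 'n" where
  "wgrad D u = (SOME G. square_integrable (lebesgue_on D) G \<and> weak_gradient D u G)"

definition H1_norm :: "(real ^ 'n) set \<Rightarrow> (real ^ 'n \<Rightarrow> real) \<Rightarrow> real" where
  "H1_norm D u =
     sqrt ((LINT x|lebesgue_on D. (u x)\<^sup>2) + (LINT x|lebesgue_on D. (norm (wgrad D u x))\<^sup>2))"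

definition H1_functional :: "(real ^ 'n) set \<Rightarrow> ((real ^ 'n \<Rightarrow> real) \<Rightarrow> real) \<Rightarrow> bool" where
  "H1_functional D L \<longleftrightarrow>
     (\<forall>u\<in>H1 D. \<forall>v\<in>H1 D. \<forall>a b. L (\<lambda>x. a * u x + b * v x) = a * L u + b * L v) \<and>
     (\<exists>C. \<forall>u\<in>H1 D. \<bar>L u\<bar> \<le> C * H1_norm D u)"

definition H1_weakly_converges ::
    "(real ^ 'n) set \<Rightarrow> (nat \<Rightarrow> real ^ 'n \<Rightarrow> real) \<Rightarrow> (real ^ 'n \<Rightarrow> real) \<Rightarrow> bool" where
  "H1_weakly_converges D f u \<longleftrightarrow>
     (\<forall>n. f n \<in> H1 D) \<and> u \<in> H1 D \<and> (\<forall>L. H1_functional D L \<longrightarrow> (\<lambda>n. L (f n)) \<longlonglongrightarrow> L u)"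

definition weakly_harmonic :: "(real ^ 'n) set \<Rightarrow> (real ^ 'n \<Rightarrow> real) \<Rightarrow> bool" where
  "weakly_harmonic D u \<longleftrightarrow>
     u \<in> H1 D \<and>
     (\<forall>\<phi>. test_function D \<phi> \<longrightarrow> (LINT x|lebesgue_on D. wgrad D u x \<bullet> gradient \<phi> x) = 0)"


section \<open>Boundary traces\<close>

text \<open>
  \<open>g\<close> is the trace of \<open>u \<in> H\<^sup>1(D)\<close> on the boundary of \<open>D\<close>: the trace operator is the continuous
  extension to \<open>H\<^sup>1(D)\<close> of the restriction of functions that are smooth up to the boundary.
  For a bounded open set with Lipschitz boundary each \<open>u \<in> H\<^sup>1(D)\<close> has a trace, and it is unique
  up to null sets of the surface measure.
\<close>

definition has_trace ::
    "(real ^ 'n) set \<Rightarrow> (real ^ 'n \<Rightarrow> real) \<Rightarrow> (real ^ 'n \<Rightarrow> real) \<Rightarrow> bool" where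
  "has_trace D u g \<longleftrightarrow>
     u \<in> H1 D \<and> square_integrable (boundary_measure D) g \<and>
     (\<exists>\<phi> :: nat \<Rightarrow> real ^ 'n \<Rightarrow> real.
        (\<forall>n. smooth (\<phi> n) \<and> \<phi> n \<in> H1 D \<and> square_integrable (boundary_measure D) (\<phi> n)) \<and>
        (\<lambda>n. H1_norm D (\<lambda>x. \<phi> n x - u x)) \<longlonglongrightarrow> 0 \<and>
        (\<lambda>n. LINT x|boundary_measure D. (\<phi> n x - g x)\<^sup>2) \<longlonglongrightarrow> 0)"


section \<open>The Steklov problem\<close>

text \<open>\<open>u\<close>, with trace \<open>g\<close>, solves the weak Steklov problem on \<open>D\<close> with parameter \<open>s\<close>.\<close>

definition steklov_solution ::
    "(real ^ 'n) set \<Rightarrow> real \<Rightarrow> (real ^ 'n \<Rightarrow> real) \<Rightarrow> (real ^ 'n \<Rightarrow> real) \<Rightarrow> bool" where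
  "steklov_solution D s u g \<longleftrightarrow>
     has_trace D u g \<and>
     (\<forall>v h. has_trace D v h \<longrightarrow>
        (LINT x|lebesgue_on D. wgrad D u x \<bullet> wgrad D v x) = s * (LINT x|boundary_measure D. g x * h x))"

definition orthonormal_basis_L2 :: "'a measure \<Rightarrow> (nat \<Rightarrow> 'a \<Rightarrow> real) \<Rightarrow> bool" where
  "orthonormal_basis_L2 M g \<longleftrightarrow>
     (\<forall>j. square_integrable M (g j)) \<and>
     (\<forall>i j. (LINT x|M. g i x * g j x) = (if i = j then 1 else 0)) \<and>
     (\<forall>f. square_integrable M f \<longrightarrow>
        (\<lambda>N. LINT x|M. (f x - (\<Sum>j<N. (LINT y|M. f y * g j y) * g j x))\<^sup>2) \<longlonglongrightarrow> 0)"

text \<open>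
  The Steklov eigenvalues \<open>\<sigma> 0 < \<sigma> 1 \<le> \<sigma> 2 \<le> \<dots>\<close> of \<open>D\<close>, with eigenfunctions \<open>u j\<close> and their traces
  \<open>g j\<close>. As the traces form an orthonormal basis, every eigenvalue is listed, with its multiplicity.
\<close>

definition steklov_system ::
    "(real ^ 'n) set \<Rightarrow> (nat \<Rightarrow> real) \<Rightarrow> (nat \<Rightarrow> real ^ 'n \<Rightarrow> real) \<Rightarrow> (nat \<Rightarrow> real ^ 'n \<Rightarrow> real) \<Rightarrow> bool"
  where
  "steklov_system D \<sigma> u g \<longleftrightarrow>
     \<sigma> 0 = 0 \<and> 0 < \<sigma> 1 \<and> mono \<sigma> \<and> filterlim \<sigma> at_top sequentially \<and>
     (\<forall>j. steklov_solution D (\<sigma> j) (u j) (g j)) \<and>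
     orthonormal_basis_L2 (boundary_measure D) g"


section \<open>Perforated domains\<close>

definition lattice_point :: "real \<Rightarrow> int ^ 'n \<Rightarrow> real ^ 'n" where
  "lattice_point \<epsilon> k = (\<chi> i. \<epsilon> * of_int (k $ i))"

definition cell :: "real \<Rightarrow> int ^ 'n \<Rightarrow> (real ^ 'n) set" where
  "cell \<epsilon> k = cbox (lattice_point \<epsilon> k - (\<chi> i. \<epsilon> / 2)) (lattice_point \<epsilon> k + (\<chi> i. \<epsilon> / 2))"

definition interior_cells :: "(real ^ 'n) set \<Rightarrow> real \<Rightarrow> (int ^ 'n) set" where
  "interior_cells \<Omega> \<epsilon> = {k. cell \<epsilon> k \<subseteq> \<Omega>}"

text \<open>The union of the holes of radius \<open>\<rho>\<close>, and the perforated domain, at scale \<open>\<epsilon>\<close>.\<close>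

definition holes :: "(real ^ 'n) set \<Rightarrow> real \<Rightarrow> real \<Rightarrow> (real ^ 'n) set" where
  "holes \<Omega> \<epsilon> \<rho> = (\<Union>k\<in>interior_cells \<Omega> \<epsilon>. ball (lattice_point \<epsilon> k) \<rho>)"

definition perforated :: "(real ^ 'n) set \<Rightarrow> real \<Rightarrow> real \<Rightarrow> (real ^ 'n) set" where
  "perforated \<Omega> \<epsilon> \<rho> = \<Omega> - closure (holes \<Omega> \<epsilon> \<rho>)"

text \<open>
  \<open>U \<in> H\<^sup>1(\<Omega>)\<close> agrees with \<open>u\<close> off the holes \<open>T\<close> and is harmonic in them. Because \<open>U\<close> is in
  \<open>H\<^sup>1(\<Omega>)\<close>, agreement almost everywhere in \<open>\<Omega> - closure T\<close> entails agreement of the traces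
  from both sides of the boundary of \<open>T\<close>.
\<close>

definition harmonic_extension ::
    "(real ^ 'n) set \<Rightarrow> (real ^ 'n) set \<Rightarrow> (real ^ 'n \<Rightarrow> real) \<Rightarrow> (real ^ 'n \<Rightarrow> real) \<Rightarrow> bool" where
  "harmonic_extension \<Omega> T u U \<longleftrightarrow>
     U \<in> H1 \<Omega> \<and> (AE x in lebesgue_on (\<Omega> - closure T). U x = u x) \<and> weakly_harmonic T U"

end

theory Submission
  imports Defs
begin

text \<open>
  Fix one coordinate direction and compare, in each cell, the surface integral of a smooth function
  over the sphere of radius \<open>r\<^sub>\<epsilon>\<close> with its volume integral over the two halves of the cell that lie on
  either side of a slab containing the hole. Moving along rays from the sphere to an annulus, and
  then applying the Poincare inequality on the two convex halves, bounds the difference by the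
  integral of the gradient with the small weight \<open>\<surd>(r\<^sub>\<epsilon> / \<epsilon>) + \<epsilon>\<close>, except on a bad set near the hole
  and in the slab, whose total measure tends to zero. The halves avoid the hole, so no extension
  operator is needed.

  By density of smooth functions the comparison holds for the product of \<open>u\<^sub>k\<close> and \<open>V\<close>. The gradient
  of \<open>u\<^sub>k\<close> is bounded in \<open>L\<^sup>2\<close> because its energy is the eigenvalue, \<open>U\<^sub>k\<close> is bounded in \<open>L\<^sup>2\<close> as a weakly
  convergent sequence, and \<open>V\<close> and its gradient are fixed, so their parts on the bad set vanish in
  the limit. Finally the volume integrals converge because the halves of the cells exhaust \<open>\<Omega>\<close>;
  only weak convergence is used.
\<close>

section \<open>Hausdorff measure\<close>

text \<open>Surface measure is given by coverings, so integrals over spheres need a computable form.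
  It comes from uniqueness: the Hausdorff measure on the unit sphere and the radial projection of
  Lebesgue measure on a shell are both rotation invariant, hence proportional, and a surface
  integral becomes a shell integral of the radially projected function.

  The gradients of the \<open>u\<close> are merely bounded in L^2 and might concentrate near the
  holes, where the radial weight \<open>(\<rho> / norm x) ^ (d - 1)\<close> is of order one. There
  smallness has to come from \<open>V\<close>. Cutting at the geometric mean
  \<open>sqrt (\<rho> * e)\<close> of hole and cell size makes the weight at most
  \<open>sqrt (\<rho> / e)\<close> outside, while the ball inside has volume fraction of order
  \<open>(\<rho> / e) ^ (d / 2)\<close>. Both vanish because \<open>(\<rho> / e) ^ (d - 1)\<close>
  is \<open>e\<close> times the convergent quantity \<open>\<rho> ^ (d - 1) / e ^ d\<close>.

  A punctured cell is not convex; the boxes left after removing the slab are, which gives an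
  explicit Poincare constant scaling like \<open>e\<close>, and they are mirror images, so one
  coefficient serves both.\<close>

definition hausdorff_cover :: "real \<Rightarrow> 'a::metric_space set \<Rightarrow> (nat \<Rightarrow> 'a set) set" where
  "hausdorff_cover \<delta> A = {E. (\<forall>i. bounded (E i) \<and> diameter (E i) \<le> \<delta>) \<and> A \<subseteq> (\<Union>i. E i)}"

definition hausdorff_pre :: "nat \<Rightarrow> real \<Rightarrow> 'a::metric_space set \<Rightarrow> ennreal" where
  "hausdorff_pre m \<delta> A = (INF E\<in>hausdorff_cover \<delta> A. \<Sum>i. hausdorff_cost m (E i))"

lemma hausdorff_outer_eq_pre: "hausdorff_outer m A = (SUP \<delta>\<in>{0<..}. hausdorff_pre m \<delta> A)"
  unfolding hausdorff_outer_def hausdorff_pre_def hausdorff_cover_def by simp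

lemma hausdorff_cost_empty [simp]: "hausdorff_cost m {} = 0"
  by (simp add: hausdorff_cost_def)

lemma hausdorff_pre_mono: "A \<subseteq> B \<Longrightarrow> hausdorff_pre m \<delta> A \<le> hausdorff_pre m \<delta> B"
  unfolding hausdorff_pre_def by (rule INF_superset_mono) (auto simp: hausdorff_cover_def)

lemma hausdorff_pre_antimono: "\<delta> \<le> \<delta>' \<Longrightarrow> hausdorff_pre m \<delta>' A \<le> hausdorff_pre m \<delta> A"
  unfolding hausdorff_pre_def by (rule INF_superset_mono) (auto simp: hausdorff_cover_def intro: order_trans)

lemma hausdorff_pre_le_outer: "\<delta> > 0 \<Longrightarrow> hausdorff_pre m \<delta> A \<le> hausdorff_outer m A"
  unfolding hausdorff_outer_eq_pre by (rule SUP_upper) simp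

lemma hausdorff_outer_mono: "A \<subseteq> B \<Longrightarrow> hausdorff_outer m A \<le> hausdorff_outer m B"
  unfolding hausdorff_outer_eq_pre by (rule SUP_mono) (auto intro: hausdorff_pre_mono)

lemma hausdorff_outer_empty [simp]: "hausdorff_outer m {} = 0"
proof -
  have "hausdorff_pre m \<delta> {} = 0" if "\<delta> > 0" for \<delta>
  proof -
    have "hausdorff_pre m \<delta> {} \<le> (\<Sum>i::nat. hausdorff_cost m {})"
      unfolding hausdorff_pre_def
      by (rule INF_lower2[where i = "\<lambda>_. {}"])
        (use that in \<open>auto simp: hausdorff_cover_def\<close>)
    then show ?thesis by simp
  qed
  then have "hausdorff_outer m {} \<le> 0" unfolding hausdorff_outer_eq_pre by (intro SUP_least) simp
  then show ?thesis by simp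
qed

lemma hausdorff_pre_countably_subadditive:
  "hausdorff_pre m \<delta> (\<Union>i. A i) \<le> (\<Sum>i. hausdorff_pre m \<delta> (A i))"
proof (rule ennreal_le_epsilon)
  fix e :: real assume fin: "(\<Sum>i. hausdorff_pre m \<delta> (A i)) < top" and e: "0 < e"
  have "\<exists>E. E \<in> hausdorff_cover \<delta> (A i) \<and>
      (\<Sum>j. hausdorff_cost m (E j)) \<le> hausdorff_pre m \<delta> (A i) + ennreal (e * (1/2)^Suc i)" for i
  proof -
    have "hausdorff_pre m \<delta> (A i) < top"
    proof (rule ccontr)
      assume "\<not> hausdorff_pre m \<delta> (A i) < top"
      then have "hausdorff_pre m \<delta> (A i) = top" using top.not_eq_extremum by blast
      moreover have "hausdorff_pre m \<delta> (A i) \<le> (\<Sum>i. hausdorff_pre m \<delta> (A i))"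
        using sum_le_suminf[of "\<lambda>i. hausdorff_pre m \<delta> (A i)" "{i}"] by auto
      ultimately show False using fin by (simp add: top_unique)
    qed
    moreover have "e * (1/2)^Suc i > 0" using e by simp
    ultimately obtain E where "E \<in> hausdorff_cover \<delta> (A i)"
      "(\<Sum>j. hausdorff_cost m (E j)) < hausdorff_pre m \<delta> (A i) + ennreal (e * (1/2)^Suc i)"
      using INF_approx_ennreal[OF _ hausdorff_pre_def[of m \<delta> "A i"], of "e * (1/2)^Suc i"]
      by (auto simp: less_top)
    then show ?thesis by (auto intro: less_imp_le)
  qed
  then obtain E where E: "\<And>i. E i \<in> hausdorff_cover \<delta> (A i)"
    "\<And>i. (\<Sum>j. hausdorff_cost m (E i j)) \<le> hausdorff_pre m \<delta> (A i) + ennreal (e * (1/2)^Suc i)"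
    by metis
  define F where "F n = (case prod_decode n of (i, j) \<Rightarrow> E i j)" for n
  have "F \<in> hausdorff_cover \<delta> (\<Union>i. A i)"
  proof -
    have "x \<in> (\<Union>n. F n)" if x: "x \<in> A i" for x i
    proof -
      obtain j where "x \<in> E i j" using E(1)[of i] x by (auto simp: hausdorff_cover_def)
      then have "x \<in> F (prod_encode (i, j))" by (simp add: F_def)
      then show ?thesis by blast
    qed
    then show ?thesis using E(1) by (auto simp: hausdorff_cover_def F_def split: prod.splits)
  qed
  then have "hausdorff_pre m \<delta> (\<Union>i. A i) \<le> (\<Sum>n. hausdorff_cost m (F n))"
    unfolding hausdorff_pre_def by (rule INF_lower)
  also have "\<dots> = (\<Sum>i. \<Sum>j. hausdorff_cost m (E i j))"
  proof -
    have "(\<Sum>n. hausdorff_cost m (F n)) = (\<Sum>n. (\<lambda>(i, j). hausdorff_cost m (E i j)) (prod_decode n))"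
      by (simp add: F_def case_prod_unfold)
    also have "\<dots> = (\<Sum>i. \<Sum>j. hausdorff_cost m (E i j))"
      by (rule suminf_ennreal_2dimen) simp
    finally show ?thesis .
  qed
  also have "\<dots> \<le> (\<Sum>i. hausdorff_pre m \<delta> (A i) + ennreal (e * (1/2)^Suc i))"
    by (rule suminf_le) (use E(2) in auto)
  also have "\<dots> = (\<Sum>i. hausdorff_pre m \<delta> (A i)) + (\<Sum>i. ennreal (e * (1/2)^Suc i))"
    by (rule suminf_add[symmetric]) auto
  also have "(\<Sum>i. ennreal (e * (1/2)^Suc i)) = ennreal e"
  proof -
    have "(\<lambda>i. e * (1/2)^Suc i) sums (e * 1)" by (rule sums_mult) (rule power_half_series)
    then show ?thesis by (intro suminf_ennreal_eq) (use e in auto)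
  qed
  finally show "hausdorff_pre m \<delta> (\<Union>i. A i) \<le> (\<Sum>i. hausdorff_pre m \<delta> (A i)) + ennreal e" .
qed

lemma hausdorff_outer_countably_subadditive:
  "hausdorff_outer m (\<Union>i. A i) \<le> (\<Sum>i. hausdorff_outer m (A i))"
  unfolding hausdorff_outer_eq_pre[of m "\<Union>i. A i"]
  by (rule SUP_least, rule order_trans[OF hausdorff_pre_countably_subadditive],
      rule suminf_le) (auto intro: hausdorff_pre_le_outer)

text \<open>A covering set of diameter at most \<open>\<delta>\<close> cannot meet both sets, so
  every cover of the union falls apart into a cover of \<open>A\<close> and one of \<open>B\<close>.
  Discarded members are replaced by the empty set, which costs nothing.\<close>

lemma hausdorff_pre_separated:
  assumes "0 < \<delta>" "\<And>a b. a \<in> A \<Longrightarrow> b \<in> B \<Longrightarrow> \<delta> < dist a b"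
  shows "hausdorff_pre m \<delta> A + hausdorff_pre m \<delta> B \<le> hausdorff_pre m \<delta> (A \<union> B)"
  unfolding hausdorff_pre_def[of m \<delta> "A \<union> B"]
proof (rule INF_greatest)
  fix E assume E: "E \<in> hausdorff_cover \<delta> (A \<union> B)"
  define EA where "EA i = (if E i \<inter> A = {} then {} else E i)" for i
  define EB where "EB i = (if E i \<inter> B = {} then {} else E i)" for i
  have "E i \<inter> A = {} \<or> E i \<inter> B = {}" for i
  proof (rule ccontr)
    assume "\<not> ?thesis"
    then obtain a b where "a \<in> E i" "a \<in> A" "b \<in> E i" "b \<in> B" by auto
    moreover from this have "dist a b \<le> \<delta>"
      using E diameter_bounded_bound[of "E i" a b] by (force simp: hausdorff_cover_def intro: order_trans)
    ultimately show False using assms(2) by fastforce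
  qed
  then have "hausdorff_cost m (EA i) + hausdorff_cost m (EB i) \<le> hausdorff_cost m (E i)" for i
    unfolding EA_def EB_def by auto
  then have "(\<Sum>i. hausdorff_cost m (EA i) + hausdorff_cost m (EB i)) \<le> (\<Sum>i. hausdorff_cost m (E i))"
    by (intro suminf_le) auto
  then have "(\<Sum>i. hausdorff_cost m (EA i)) + (\<Sum>i. hausdorff_cost m (EB i)) \<le> (\<Sum>i. hausdorff_cost m (E i))"
    by (simp add: suminf_add)
  moreover have "hausdorff_pre m \<delta> A \<le> (\<Sum>i. hausdorff_cost m (EA i))"
    unfolding hausdorff_pre_def using E assms(1)
    by (intro INF_lower) (force simp: hausdorff_cover_def EA_def)
  moreover have "hausdorff_pre m \<delta> B \<le> (\<Sum>i. hausdorff_cost m (EB i))"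
    unfolding hausdorff_pre_def using E assms(1)
    by (intro INF_lower) (force simp: hausdorff_cover_def EB_def)
  ultimately show "hausdorff_pre m \<delta> A + hausdorff_pre m \<delta> B \<le> (\<Sum>i. hausdorff_cost m (E i))"
    by (meson add_mono order_trans)
qed

text \<open>This is the metric property needed for Caratheodory's criterion. The scale can be taken
  below the distance of the sets; the scales for \<open>A\<close> and \<open>B\<close> are first
  decoupled so that the two suprema can be taken one after the other.\<close>

lemma hausdorff_outer_separated:
  assumes "0 < \<eta>" "\<And>a b. a \<in> A \<Longrightarrow> b \<in> B \<Longrightarrow> \<eta> \<le> dist a b"
  shows "hausdorff_outer m A + hausdorff_outer m B \<le> hausdorff_outer m (A \<union> B)"
proof -
  have *: "hausdorff_pre m \<delta> A + hausdorff_pre m \<delta>' B \<le> hausdorff_outer m (A \<union> B)"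
    if "0 < \<delta>" "0 < \<delta>'" for \<delta> \<delta>'
  proof -
    define d where "d = min (min \<delta> \<delta>') (\<eta> / 2)"
    have d: "0 < d" "d \<le> \<delta>" "d \<le> \<delta>'" "d < \<eta>" using that assms(1) by (auto simp: d_def)
    have "hausdorff_pre m \<delta> A + hausdorff_pre m \<delta>' B \<le> hausdorff_pre m d A + hausdorff_pre m d B"
      using d by (intro add_mono hausdorff_pre_antimono) auto
    also have "\<dots> \<le> hausdorff_pre m d (A \<union> B)"
      using d assms(2) by (intro hausdorff_pre_separated) force+
    also have "\<dots> \<le> hausdorff_outer m (A \<union> B)" by (rule hausdorff_pre_le_outer[OF d(1)])
    finally show ?thesis .
  qed
  have "hausdorff_pre m \<delta> A + hausdorff_outer m B \<le> hausdorff_outer m (A \<union> B)" if "0 < \<delta>" for \<delta>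
  proof -
    have "hausdorff_pre m \<delta> A + (SUP \<delta>'\<in>{0<..}. hausdorff_pre m \<delta>' B)
        = (SUP \<delta>'\<in>{0<..}. hausdorff_pre m \<delta> A + hausdorff_pre m \<delta>' B)"
      by (rule ennreal_SUP_add_right) auto
    also have "\<dots> \<le> hausdorff_outer m (A \<union> B)" by (rule SUP_least) (use * that in auto)
    finally show ?thesis by (simp add: hausdorff_outer_eq_pre[of m B])
  qed
  moreover have "(SUP \<delta>\<in>{0<..}. hausdorff_pre m \<delta> A) + hausdorff_outer m B
      = (SUP \<delta>\<in>{0<..}. hausdorff_pre m \<delta> A + hausdorff_outer m B)"
    by (rule ennreal_SUP_add_left[symmetric]) auto
  moreover have "(SUP \<delta>\<in>{0<..}. hausdorff_pre m \<delta> A + hausdorff_outer m B) \<le> hausdorff_outer m (A \<union> B)"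
    by (rule SUP_least) (use calculation in auto)
  ultimately show ?thesis by (simp add: hausdorff_outer_eq_pre[of m A])
qed

section \<open>Caratheodory's criterion: Borel sets are measurable for a metric outer
  measure\<close>

lemma suminf_ennreal_tail_tendsto_zero:
  fixes f :: "nat \<Rightarrow> ennreal"
  assumes "(\<Sum>k. f k) \<noteq> top"
  shows "(\<lambda>n. \<Sum>k. f (k + n)) \<longlonglongrightarrow> 0"
proof -
  have fin: "f k < top" for k
    using assms sum_le_suminf[of f "{k}"] by (auto simp: less_top[symmetric] top_unique)
  define g where "g k = enn2real (f k)" for k
  have f: "f k = ennreal (g k)" "0 \<le> g k" for k using fin[of k] by (simp_all add: g_def)
  have sm: "summable g" using assms f by (intro summable_suminf_not_top) auto
  have "(\<Sum>k. f (k + n)) = ennreal (\<Sum>k. g (k + n))" for n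
    using f sm by (auto intro!: suminf_ennreal2 summable_ignore_initial_segment)
  then show ?thesis
    using tendsto_ennrealI[OF suminf_exist_split2[OF sm]] by simp
qed

text \<open>The even-numbered rings \<open>A (Suc n) - A n\<close> are pairwise separated, and so are the odd-numbered
  ones; hence the measures of all rings have a finite sum and their tails tend to zero.\<close>

lemma metric_outer_measure_closed:
  fixes \<mu> :: "'a::metric_space set \<Rightarrow> ennreal"
  assumes empty: "\<mu> {} = 0" and mono: "\<And>A B. A \<subseteq> B \<Longrightarrow> \<mu> A \<le> \<mu> B"
    and subadd: "\<And>A :: nat \<Rightarrow> 'a set. \<mu> (\<Union>i. A i) \<le> (\<Sum>i. \<mu> (A i))"
    and sep: "\<And>A B \<eta>. 0 < \<eta> \<Longrightarrow> (\<And>a b. a \<in> A \<Longrightarrow> b \<in> B \<Longrightarrow> \<eta> \<le> dist a b) \<Longrightarrow> \<mu> A + \<mu> B \<le> \<mu> (A \<union> B)"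
    and C: "closed C"
  shows "\<mu> (X \<inter> C) + \<mu> (X - C) \<le> \<mu> X"
\<comment> \<open>By convention \<open>infdist x {} = 0\<close>, so the sets \<open>A n\<close>
  below would be empty for empty \<open>C\<close>; and the rings have a finite total only if
  \<open>\<mu> X\<close> is finite.\<close>
proof (cases "C = {} \<or> \<mu> X = top")
  case True
  then show ?thesis using empty by auto
next
  case False
  define A where "A n = {x \<in> X - C. 1 / real (Suc n) \<le> infdist x C}" for n
  define R where "R n = A (Suc n) - A n" for n
  have A_mono: "A n \<subseteq> A (Suc n)" for n
  proof -
    have "1 / real (Suc (Suc n)) \<le> 1 / real (Suc n)" by (simp add: frac_le)
    then show ?thesis unfolding A_def by fastforce
  qed
  have X_eq: "X - C = A n \<union> (\<Union>k. R (k + n))" for n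
  proof -
    have "x \<in> A n \<union> (\<Union>k. R (k + n))" if x: "x \<in> X - C" for x
    proof (rule ccontr)
      assume neg: "x \<notin> A n \<union> (\<Union>k. R (k + n))"
      have "x \<notin> A (k + n)" for k
        by (induction k) (use neg in \<open>auto simp: R_def\<close>)
      then have lt: "infdist x C < 1 / real (Suc (k + n))" for k using x by (auto simp: A_def not_le)
      have "0 < infdist x C"
        using x C False infdist_nonneg[of x C] in_closed_iff_infdist_zero[of C x] by (auto simp: less_le)
      then obtain k where "1 / real (Suc k) < infdist x C" using nat_approx_posE by blast
      moreover have "1 / real (Suc (k + n)) \<le> 1 / real (Suc k)" by (simp add: frac_le)
      ultimately show False using lt[of k] by linarith
    qed
    then show ?thesis by (auto simp: A_def R_def)
  qed
  have ring_sep: "1 / real (j + 2) - 1 / real (j + 3) \<le> dist x y"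
    if "x \<in> R i" "y \<in> R k" "i \<le> j" "j + 2 \<le> k" for i j k x y
  proof -
    have "1 / real (i + 2) \<le> infdist x C" using that(1) by (simp add: R_def A_def)
    moreover have "1 / real (j + 2) \<le> 1 / real (i + 2)" using that(3) by (simp add: frac_le)
    moreover have "infdist y C < 1 / real (k + 1)" using that(2) by (auto simp: R_def A_def)
    moreover have "1 / real (k + 1) \<le> 1 / real (j + 3)" using that(4) by (simp add: frac_le)
    ultimately show ?thesis using infdist_triangle[of x C y] by linarith
  qed
  have half: "(\<Sum>k<n. \<mu> (R (2 * k + p))) \<le> \<mu> X" for n p
  proof -
    have "(\<Sum>k<n. \<mu> (R (2 * k + p))) \<le> \<mu> (\<Union>k<n. R (2 * k + p))"
    proof (induction n)
      case (Suc n)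
      show ?case
      proof (cases n)
        case (Suc l)
        have "(\<Sum>k<Suc n. \<mu> (R (2 * k + p))) \<le> \<mu> (\<Union>k<n. R (2 * k + p)) + \<mu> (R (2 * n + p))"
          using Suc.IH by (simp add: add_mono add.commute)
        also have "\<dots> \<le> \<mu> ((\<Union>k<n. R (2 * k + p)) \<union> R (2 * n + p))"
        proof (rule sep)
          let ?j = "2 * l + p"
          show "0 < 1 / real (?j + 2) - 1 / real (?j + 3)" by (simp add: frac_less2)
          fix a b assume "a \<in> (\<Union>k<n. R (2 * k + p))" "b \<in> R (2 * n + p)"
          then obtain k where "k < n" "a \<in> R (2 * k + p)" by auto
          then show "1 / real (?j + 2) - 1 / real (?j + 3) \<le> dist a b"
            using Suc \<open>b \<in> _\<close> by (intro ring_sep[of a "2 * k + p" b "2 * n + p"]) auto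
        qed
        also have "(\<Union>k<n. R (2 * k + p)) \<union> R (2 * n + p) = (\<Union>k<Suc n. R (2 * k + p))"
          by (auto simp: less_Suc_eq)
        finally show ?thesis .
      qed (simp add: lessThan_Suc)
    qed (simp add: empty)
    also have "\<dots> \<le> \<mu> X" by (rule mono) (auto simp: R_def A_def)
    finally show ?thesis .
  qed
  have sum_le: "(\<Sum>k<n. \<mu> (R k)) \<le> 2 * \<mu> X" for n
  proof -
    have "(\<Sum>k<n. \<mu> (R k)) \<le> (\<Sum>k<2*n. \<mu> (R k))" by (rule sum_mono2) auto
    also have "\<dots> = (\<Sum>k<n. \<mu> (R (2 * k + 0))) + (\<Sum>k<n. \<mu> (R (2 * k + 1)))"
      by (induction n) (auto simp: algebra_simps)
    also have "\<dots> \<le> \<mu> X + \<mu> X" by (intro add_mono half)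
    finally show ?thesis by (simp add: mult_2)
  qed
  have fin: "(\<Sum>k. \<mu> (R k)) \<noteq> top"
  proof -
    have "(\<Sum>k. \<mu> (R k)) \<le> 2 * \<mu> X" by (rule suminf_le_const) (auto intro: sum_le)
    then show ?thesis using False by (auto simp: top_unique ennreal_mult_eq_top_iff)
  qed
  have tail: "(\<lambda>n. \<Sum>k. \<mu> (R (k + n))) \<longlonglongrightarrow> 0"
    by (rule suminf_ennreal_tail_tendsto_zero) fact
  have bound: "\<mu> (X \<inter> C) + \<mu> (X - C) \<le> \<mu> X + (\<Sum>k. \<mu> (R (k + n)))" for n
  proof -
    have "\<mu> (X - C) \<le> \<mu> (A n) + (\<Sum>k. \<mu> (R (k + n)))"
    proof -
      define F where "F k = (if k = 0 then A n else R (k - 1 + n))" for k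
      have "X - C = (\<Union>k. F k)"
      proof -
        have "(\<Union>k. F k) = F 0 \<union> (\<Union>k. F (Suc k))"
          by (subst UNIV_nat_eq) (simp add: image_image)
        then show ?thesis using X_eq[of n] by (simp add: F_def)
      qed
      then have "\<mu> (X - C) \<le> (\<Sum>k. \<mu> (F k))" using subadd by metis
      also have "\<dots> = \<mu> (F 0) + (\<Sum>k. \<mu> (F (Suc k)))"
        using suminf_offset[of "\<lambda>k. \<mu> (F k)" 1] by simp
      finally show ?thesis by (simp add: F_def)
    qed
    then have "\<mu> (X \<inter> C) + \<mu> (X - C) \<le> (\<mu> (X \<inter> C) + \<mu> (A n)) + (\<Sum>k. \<mu> (R (k + n)))"
      by (simp add: add_mono add.assoc)
    also have "\<mu> (X \<inter> C) + \<mu> (A n) \<le> \<mu> ((X \<inter> C) \<union> A n)"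
    proof (rule sep[of "1 / real (Suc n)"])
      fix a b assume "a \<in> X \<inter> C" "b \<in> A n"
      then have "1 / real (Suc n) \<le> infdist b C" "infdist b C \<le> dist b a"
        by (auto simp: A_def intro: infdist_le)
      then show "1 / real (Suc n) \<le> dist a b" by (simp add: dist_commute)
    qed simp
    also have "\<mu> ((X \<inter> C) \<union> A n) \<le> \<mu> X" by (rule mono) (auto simp: A_def)
    finally show ?thesis by (simp add: add_mono)
  qed
  have "(\<lambda>n. \<mu> X + (\<Sum>k. \<mu> (R (k + n)))) \<longlonglongrightarrow> \<mu> X + 0"
    by (intro tendsto_add tail tendsto_const)
  then show ?thesis by (intro LIMSEQ_le_const[of _ "\<mu> X"]) (use bound in auto)
qed

text \<open>The sets that split every set additively form a sigma-algebra on which an outer measure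
  is countably additive. By the metric property it contains the closed sets, hence all Borel
  sets.\<close>

lemma measure_space_hausdorff_outer:
  "measure_space UNIV (sets borel) (hausdorff_outer m :: 'a::metric_space set \<Rightarrow> ennreal)"
proof -
  let ?\<mu> = "hausdorff_outer m :: 'a set \<Rightarrow> ennreal"
  let ?L = "lambda_system UNIV (Pow UNIV) ?\<mu>"
  interpret P: sigma_algebra UNIV "Pow (UNIV :: 'a set)" by (rule sigma_algebra_Pow)
  have oms: "outer_measure_space (Pow UNIV) ?\<mu>"
    unfolding outer_measure_space_def positive_def increasing_def countably_subadditive_def
    using hausdorff_outer_mono hausdorff_outer_countably_subadditive by auto
  have L: "measure_space UNIV ?L ?\<mu>" by (rule P.caratheodory_lemma[OF oms])
  then interpret L: sigma_algebra UNIV ?L by (simp add: measure_space_def)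
  have closed_L: "C \<in> ?L" if "closed C" for C
  proof -
    have "?\<mu> (X \<inter> C) + ?\<mu> (X - C) = ?\<mu> X" for X
    proof (rule antisym)
      show "?\<mu> (X \<inter> C) + ?\<mu> (X - C) \<le> ?\<mu> X"
        by (rule metric_outer_measure_closed[OF hausdorff_outer_empty hausdorff_outer_mono
              hausdorff_outer_countably_subadditive hausdorff_outer_separated that])
      have "subadditive (Pow UNIV) ?\<mu>"
        using oms unfolding outer_measure_space_def by (intro P.countably_subadditive_subadditive) blast+
      then have "?\<mu> ((X \<inter> C) \<union> (X - C)) \<le> ?\<mu> (X \<inter> C) + ?\<mu> (X - C)"
        unfolding subadditive_def by (elim ballE impE) auto
      then show "?\<mu> X \<le> ?\<mu> (X \<inter> C) + ?\<mu> (X - C)" by (simp add: Int_Diff_Un)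
    qed
    then show ?thesis unfolding P.lambda_system_eq by blast
  qed
  have "sets (borel :: 'a measure) \<subseteq> ?L"
  proof -
    have "sets (borel :: 'a measure) = sigma_sets UNIV (Collect closed)"
      unfolding borel_eq_closed by (rule sets_measure_of) simp
    moreover have "sigma_sets UNIV (Collect closed) \<subseteq> ?L"
      by (rule L.sigma_sets_subset) (use closed_L in blast)
    ultimately show ?thesis by simp
  qed
  moreover have "sigma_algebra UNIV (sets (borel :: 'a measure))"
    using sets.sigma_algebra_axioms[of "borel :: 'a measure"] by simp
  moreover have "countably_additive ?L ?\<mu>" using L by (simp add: measure_space_def)
  ultimately show ?thesis
    unfolding measure_space_def positive_def countably_additive_def
    by (simp add: subset_trans subset_iff)
qed

text \<open>\<open>measure_of\<close> falls back to the zero measure unless the set function is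
  countably additive on the sigma-algebra, so it takes the Caratheodory argument to give
  \<open>hausdorff_measure\<close> its intended values.\<close>

lemma emeasure_hausdorff_measure:
  assumes "A \<in> sets borel"
  shows "emeasure (hausdorff_measure m) A = hausdorff_outer m A"
proof -
  note ms = measure_space_hausdorff_outer[of m, unfolded measure_space_def]
  show ?thesis
    unfolding hausdorff_measure_def
    by (rule emeasure_measure_of_sigma[OF _ _ _ assms]) (use ms in blast)+
qed

section \<open>Hausdorff measure under similarities\<close>

lemma diameter_similarity_le:
  fixes f :: "'a::metric_space \<Rightarrow> 'b::metric_space"
  assumes "0 < c" "\<And>x y. dist (f x) (f y) = c * dist x y" "bounded S"
  shows "diameter (f ` S) \<le> c * diameter S"
proof (cases "S = {}")
  case False
  have "(SUP p\<in>f ` S \<times> f ` S. case p of (x, y) \<Rightarrow> dist x y) \<le> c * diameter S"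
    using False assms by (intro cSUP_least) (auto intro!: mult_left_mono diameter_bounded_bound)
  then show ?thesis using False by (simp add: diameter_def[of "f ` S"])
qed simp

lemma bounded_similarity:
  fixes f :: "'a::metric_space \<Rightarrow> 'b::metric_space"
  assumes "0 < c" "\<And>x y. dist (f x) (f y) = c * dist x y" "bounded S"
  shows "bounded (f ` S)"
proof -
  obtain x e where "\<forall>y\<in>S. dist x y \<le> e" using assms(3) by (auto simp: bounded_def)
  then have "\<forall>y\<in>f ` S. dist (f x) y \<le> c * e" using assms(1,2) by auto
  then show ?thesis unfolding bounded_def by blast
qed

text \<open>The image of a cover at scale \<open>\<delta> / c\<close> is a cover at scale
  \<open>\<delta>\<close>, and each cost grows at most by the factor \<open>c ^ m\<close>.\<close>

lemma hausdorff_outer_similarity_le: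
  fixes f :: "'a::metric_space \<Rightarrow> 'b::metric_space"
  assumes c: "0 < c" and f: "\<And>x y. dist (f x) (f y) = c * dist x y"
  shows "hausdorff_outer m (f ` A) \<le> ennreal (c ^ m) * hausdorff_outer m A"
  unfolding hausdorff_outer_eq_pre[of m "f ` A"]
proof (rule SUP_least)
  fix \<delta> :: real assume "\<delta> \<in> {0<..}"
  then have \<delta>: "0 < \<delta> / c" using c by simp
  have "hausdorff_pre m \<delta> (f ` A) \<le> ennreal (c ^ m) * (\<Sum>i. hausdorff_cost m (E i))"
    if E: "E \<in> hausdorff_cover (\<delta> / c) A" for E
  proof -
    have "hausdorff_pre m \<delta> (f ` A) \<le> (\<Sum>i. hausdorff_cost m (f ` E i))"
      unfolding hausdorff_pre_def
    proof (rule INF_lower)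
      have "diameter (f ` E i) \<le> \<delta>" for i
      proof -
        have "diameter (f ` E i) \<le> c * diameter (E i)"
          using E by (intro diameter_similarity_le[OF c f]) (auto simp: hausdorff_cover_def)
        also have "\<dots> \<le> \<delta>" using E c by (auto simp: hausdorff_cover_def field_simps)
        finally show ?thesis .
      qed
      then show "(\<lambda>i. f ` E i) \<in> hausdorff_cover \<delta> (f ` A)"
        using E bounded_similarity[OF c f] by (fastforce simp: hausdorff_cover_def)
    qed
    also have "\<dots> \<le> (\<Sum>i. ennreal (c ^ m) * hausdorff_cost m (E i))"
    proof (rule suminf_le)
      fix i
      have "diameter (f ` E i) \<le> c * diameter (E i)"
        using E by (intro diameter_similarity_le[OF c f]) (auto simp: hausdorff_cover_def)
      then have "(diameter (f ` E i) / 2) ^ m \<le> (c * (diameter (E i) / 2)) ^ m"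
        using E bounded_similarity[OF c f]
        by (intro power_mono) (auto simp: hausdorff_cover_def intro!: divide_nonneg_nonneg diameter_ge_0)
      then have "unit_ball_vol (real m) * (diameter (f ` E i) / 2) ^ m
          \<le> c ^ m * (unit_ball_vol (real m) * (diameter (E i) / 2) ^ m)"
        unfolding power_mult_distrib[of c] by (simp add: mult.left_commute mult_left_mono)
      then show "hausdorff_cost m (f ` E i) \<le> ennreal (c ^ m) * hausdorff_cost m (E i)"
        using c by (auto simp: hausdorff_cost_def ennreal_mult'[symmetric] intro!: ennreal_leI)
    qed auto
    finally show ?thesis by simp
  qed
  \<comment> \<open>The factor is moved to the left side before the infimum over covers is taken,
    and restored afterwards.\<close>
  then have "ennreal (1 / c ^ m) * hausdorff_pre m \<delta> (f ` A)
      \<le> ennreal (1 / c ^ m) * (ennreal (c ^ m) * (\<Sum>i. hausdorff_cost m (E i)))"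
    if "E \<in> hausdorff_cover (\<delta> / c) A" for E
    using that by (intro mult_left_mono) auto
  moreover have cancel: "ennreal (1 / c ^ m) * (ennreal (c ^ m) * x) = x" for x
    using c by (simp add: mult.assoc[symmetric] ennreal_mult'[symmetric])
  ultimately have "ennreal (1 / c ^ m) * hausdorff_pre m \<delta> (f ` A) \<le> hausdorff_pre m (\<delta> / c) A"
    unfolding hausdorff_pre_def[of m "\<delta> / c"] by (intro INF_greatest) simp
  then have "ennreal (c ^ m) * (ennreal (1 / c ^ m) * hausdorff_pre m \<delta> (f ` A))
      \<le> ennreal (c ^ m) * hausdorff_pre m (\<delta> / c) A"
    by (intro mult_left_mono) auto
  then have "hausdorff_pre m \<delta> (f ` A) \<le> ennreal (c ^ m) * hausdorff_pre m (\<delta> / c) A"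
    using cancel[of "hausdorff_pre m \<delta> (f ` A)"] by (simp add: mult.left_commute)
  also have "\<dots> \<le> ennreal (c ^ m) * hausdorff_outer m A"
    by (intro mult_left_mono hausdorff_pre_le_outer \<delta>) auto
  finally show "hausdorff_pre m \<delta> (f ` A) \<le> ennreal (c ^ m) * hausdorff_outer m A" .
qed

text \<open>The inverse of \<open>f\<close> is a similarity of ratio \<open>1 / c\<close>, so the
  one-sided bound applies in both directions. Ratio 1 gives rotation invariance, ratio
  \<open>\<rho>\<close> the scaling of spheres.\<close>

lemma hausdorff_outer_similarity:
  fixes f :: "'a::metric_space \<Rightarrow> 'b::metric_space"
  assumes c: "0 < c" and f: "\<And>x y. dist (f x) (f y) = c * dist x y" and "surj f"
  shows "hausdorff_outer m (f ` A) = ennreal (c ^ m) * hausdorff_outer m A"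
proof (rule antisym)
  show "hausdorff_outer m (f ` A) \<le> ennreal (c ^ m) * hausdorff_outer m A"
    by (rule hausdorff_outer_similarity_le[OF c f])
  have "inj f"
  proof (rule injI)
    fix x y assume "f x = f y"
    then have "c * dist x y = 0" using f[of x y] by simp
    then show "x = y" using c by simp
  qed
  define g where "g = inv f"
  have g: "dist (g x) (g y) = (1 / c) * dist x y" for x y
    using f[of "g x" "g y"] \<open>surj f\<close> c by (simp add: g_def surj_f_inv_f field_simps)
  have "hausdorff_outer m (g ` (f ` A)) \<le> ennreal ((1 / c) ^ m) * hausdorff_outer m (f ` A)"
    by (rule hausdorff_outer_similarity_le[OF _ g]) (use c in simp)
  also have "g ` (f ` A) = A" using \<open>inj f\<close> by (auto simp: g_def image_image)
  finally have "ennreal (c ^ m) * hausdorff_outer m A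
      \<le> ennreal (c ^ m) * (ennreal ((1 / c) ^ m) * hausdorff_outer m (f ` A))"
    by (intro mult_left_mono) auto
  also have "\<dots> = hausdorff_outer m (f ` A)"
    using c by (simp add: mult.assoc[symmetric] ennreal_mult'[symmetric] power_mult_distrib[symmetric])
  finally show "ennreal (c ^ m) * hausdorff_outer m A \<le> hausdorff_outer m (f ` A)" .
qed

section \<open>Finiteness of the surface measure of the unit sphere\<close>

lemma power_diff_le:
  fixes x y :: real
  assumes "0 \<le> y" "y \<le> x" "x \<le> 2"
  shows "x ^ n - y ^ n \<le> real n * 2 ^ n * (x - y)"
proof (induction n)
  case (Suc n)
  have "x ^ Suc n - y ^ Suc n = x * (x ^ n - y ^ n) + y ^ n * (x - y)" by (simp add: algebra_simps)
  also have "x * (x ^ n - y ^ n) \<le> 2 * (real n * 2 ^ n * (x - y))"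
  proof (rule mult_mono)
    show "0 \<le> x ^ n - y ^ n" using assms by (simp add: power_mono)
  qed (use assms Suc.IH in auto)
  also have "y ^ n * (x - y) \<le> 2 ^ n * (x - y)"
    using assms by (intro mult_right_mono power_mono) auto
  also have "2 ^ n * (x - y) \<le> 2 * 2 ^ n * (x - y)" using assms by (intro mult_right_mono) auto
  finally show ?case by (simp add: algebra_simps)
qed simp

text \<open>The balls of radius \<open>\<delta> / 2\<close> around the points of \<open>F\<close> are disjoint and lie in a shell of
  thickness \<open>\<delta>\<close>.\<close>

lemma card_separated_sphere_le:
  fixes F :: "'a::euclidean_space set"
  assumes F: "finite F" "F \<subseteq> sphere 0 1" and \<delta>: "0 < \<delta>" "\<delta> \<le> 1"
    and sep: "\<And>x y. x \<in> F \<Longrightarrow> y \<in> F \<Longrightarrow> x \<noteq> y \<Longrightarrow> \<delta> \<le> dist x y"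
  shows "real (card F) * \<delta> ^ (DIM('a) - 1) \<le> DIM('a) * 4 ^ DIM('a)"
proof -
  let ?d = "DIM('a)" and ?w = "unit_ball_vol (real DIM('a))"
  let ?U = "\<Union>x\<in>F. ball x (\<delta> / 2)" and ?B = "ball (0::'a) (1 + \<delta> / 2)" and ?b = "ball (0::'a) (1 - \<delta> / 2)"
  have w: "0 < ?w" by simp
  have disj: "disjoint_family_on (\<lambda>x. ball x (\<delta> / 2)) F"
    unfolding disjoint_family_on_def
  proof (intro ballI impI)
    fix x y assume xy: "x \<in> F" "y \<in> F" "x \<noteq> y"
    show "ball x (\<delta> / 2) \<inter> ball y (\<delta> / 2) = {}"
      by (rule disjoint_ballI) (use sep[OF xy] in simp)
  qed
  have "real (card F) * (?w * (\<delta> / 2) ^ ?d) = (\<Sum>x\<in>F. measure lborel (ball x (\<delta> / 2)))"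
    using \<delta> by (simp add: content_ball)
  also have "\<dots> = measure lborel ?U"
    by (rule measure_finite_Union[symmetric])
      (use F disj in \<open>auto simp: emeasure_ball \<delta> less_imp_le\<close>)
  also have "\<dots> \<le> measure lborel (?B - ?b)"
  proof (rule measure_mono_fmeasurable)
    show "?U \<subseteq> ?B - ?b"
    proof
      fix y assume "y \<in> ?U"
      then obtain x where x: "x \<in> F" "dist x y < \<delta> / 2" by auto
      then have "norm x = 1" using F by auto
      moreover have "norm y \<le> norm x + dist x y" "norm x \<le> norm y + dist x y"
        by (metis dist_commute dist_norm norm_triangle_sub, metis dist_norm norm_triangle_sub)
      ultimately show "y \<in> ?B - ?b" using x by simp
    qed
    show "?B - ?b \<in> fmeasurable lborel"
      by (intro fmeasurable.Diff fmeasurableI) (use \<delta> in \<open>auto simp: emeasure_ball\<close>)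
    show "?U \<in> sets lborel" by (simp add: borel_open open_UN)
  qed
  also have "\<dots> = measure lborel ?B - measure lborel ?b"
    using \<delta> by (intro measure_Diff) (auto simp: emeasure_ball)
  also have "\<dots> = ?w * ((1 + \<delta> / 2) ^ ?d - (1 - \<delta> / 2) ^ ?d)"
    using \<delta> by (simp add: content_ball algebra_simps)
  also have "\<dots> \<le> ?w * (real ?d * 2 ^ ?d * \<delta>)"
    using w \<delta> power_diff_le[of "1 - \<delta> / 2" "1 + \<delta> / 2" ?d] by (intro mult_left_mono) auto
  finally have "?w * (real (card F) * (\<delta> / 2) ^ ?d) \<le> ?w * (real ?d * 2 ^ ?d * \<delta>)"
    by (simp only: ac_simps)
  then have "real (card F) * (\<delta> / 2) ^ ?d \<le> real ?d * 2 ^ ?d * \<delta>"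
    using w by (simp only: mult_le_cancel_left_pos)
  moreover have "\<delta> ^ ?d = \<delta> * \<delta> ^ (?d - 1)" by (metis DIM_positive power_eq_if not_less0)
  ultimately have "\<delta> * (real (card F) * \<delta> ^ (?d - 1)) \<le> \<delta> * (real ?d * (2 ^ ?d * 2 ^ ?d))"
    by (simp add: field_simps power_divide)
  then show ?thesis using \<delta> by (simp add: power_mult_distrib[symmetric])
qed

text \<open>The packing bound makes a \<open>\<delta>\<close>-separated subset of largest
  cardinality exist. By maximality the balls of radius \<open>\<delta>\<close> around its points
  cover the sphere; there are at most of order \<open>\<delta> ^ - (d - 1)\<close> of them, each of
  cost of order \<open>\<delta> ^ (d - 1)\<close>, so the total is bounded uniformly in
  \<open>\<delta>\<close>.\<close>

lemma emeasure_hausdorff_unit_sphere_finite: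
  "emeasure (hausdorff_measure (DIM('a) - 1)) (sphere (0::'a::euclidean_space) 1) < top"
proof -
  let ?d = "DIM('a)" and ?m = "DIM('a) - 1" and ?S = "sphere (0::'a) 1"
  define C where "C = real ?d * 4 ^ ?d * unit_ball_vol (real ?m)"
  have pre: "hausdorff_pre ?m (2 * \<delta>) ?S \<le> ennreal C" if \<delta>: "0 < \<delta>" "\<delta> \<le> 1" for \<delta> :: real
  proof -
    define P where "P F \<longleftrightarrow> finite F \<and> F \<subseteq> ?S \<and> (\<forall>x\<in>F. \<forall>y\<in>F. x \<noteq> y \<longrightarrow> \<delta> \<le> dist x y)" for F
    have bound: "real (card F) * \<delta> ^ ?m \<le> real ?d * 4 ^ ?d" if "P F" for F
      using that \<delta> card_separated_sphere_le[of F \<delta>] by (auto simp: P_def)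
    have "\<exists>F. P F \<and> (\<forall>F'. P F' \<longrightarrow> card F' \<le> card F)"
    proof (rule ex_has_greatest_nat)
      show "P {}" by (simp add: P_def)
      show "\<forall>F. P F \<longrightarrow> card F < Suc (nat \<lceil>real ?d * 4 ^ ?d / \<delta> ^ ?m\<rceil>)"
      proof (intro allI impI)
        fix F assume "P F"
        then have "real (card F) \<le> real ?d * 4 ^ ?d / \<delta> ^ ?m"
          using bound[of F] \<delta> by (simp add: pos_le_divide_eq)
        then show "card F < Suc (nat \<lceil>real ?d * 4 ^ ?d / \<delta> ^ ?m\<rceil>)" by linarith
      qed
    qed
    then obtain F where F: "P F" and max: "\<And>F'. P F' \<Longrightarrow> card F' \<le> card F" by blast
    have finF: "finite F" using F by (simp add: P_def)
    have cover: "\<exists>x\<in>F. dist x y < \<delta>" if y: "y \<in> ?S" for y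
    proof (rule ccontr)
      assume neg: "\<not> (\<exists>x\<in>F. dist x y < \<delta>)"
      then have "y \<notin> F" using \<delta> by force
      moreover have "P (insert y F)" using F y neg by (auto simp: P_def not_less dist_commute)
      ultimately show False using max[of "insert y F"] finF by simp
    qed
    obtain h where h: "bij_betw h {..<card F} F" using ex_bij_betw_nat_finite[OF finF] by (auto simp: atLeast0LessThan)
    define E where "E i = (if i < card F then cball (h i) \<delta> else {})" for i
    have diam: "diameter (E i) \<le> 2 * \<delta>" for i
      using \<delta> by (auto simp: E_def)
    have "hausdorff_pre ?m (2 * \<delta>) ?S \<le> (\<Sum>i. hausdorff_cost ?m (E i))"
      unfolding hausdorff_pre_def
    proof (rule INF_lower)
      have "?S \<subseteq> (\<Union>i. E i)"
      proof
        fix y assume "y \<in> ?S"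
        then obtain x where "x \<in> F" "dist x y < \<delta>" using cover by blast
        moreover from this obtain i where "i < card F" "x = h i" using h by (auto simp: bij_betw_def)
        ultimately show "y \<in> (\<Union>i. E i)" by (auto simp: E_def intro!: exI[of _ i])
      qed
      then show "E \<in> hausdorff_cover (2 * \<delta>) ?S"
        using diam by (auto simp: hausdorff_cover_def E_def)
    qed
    also have "\<dots> = (\<Sum>i<card F. hausdorff_cost ?m (E i))"
      by (rule suminf_finite) (auto simp: E_def)
    also have "\<dots> \<le> (\<Sum>i<card F. ennreal (unit_ball_vol (real ?m) * \<delta> ^ ?m))"
    proof (rule sum_mono)
      fix i
      have "(diameter (E i) / 2) ^ ?m \<le> \<delta> ^ ?m"
        using diam[of i] by (intro power_mono) (auto intro!: divide_nonneg_nonneg diameter_ge_0 simp: E_def)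
      then show "hausdorff_cost ?m (E i) \<le> ennreal (unit_ball_vol (real ?m) * \<delta> ^ ?m)"
        by (auto simp: hausdorff_cost_def intro!: ennreal_leI mult_left_mono)
    qed
    also have "\<dots> = ennreal (real (card F) * (unit_ball_vol (real ?m) * \<delta> ^ ?m))"
      by (simp add: ennreal_of_nat_eq_real_of_nat ennreal_mult')
    also have "\<dots> \<le> ennreal C"
      using mult_left_mono[OF bound[OF F], of "unit_ball_vol (real ?m)"]
      by (intro ennreal_leI) (simp add: C_def algebra_simps)
    finally show ?thesis .
  qed
  have "hausdorff_pre ?m \<delta> ?S \<le> ennreal C" if "0 < \<delta>" for \<delta> :: real
  proof -
    have "hausdorff_pre ?m \<delta> ?S \<le> hausdorff_pre ?m (2 * (min \<delta> 1 / 2)) ?S"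
      by (rule hausdorff_pre_antimono) simp
    also have "\<dots> \<le> ennreal C" by (rule pre) (use that in auto)
    finally show ?thesis .
  qed
  then have "hausdorff_outer ?m ?S \<le> ennreal C"
    unfolding hausdorff_outer_eq_pre by (intro SUP_least) simp
  then show ?thesis
    by (simp add: emeasure_hausdorff_measure) (meson ennreal_less_top le_less_trans)
qed

section \<open>Uniformly distributed measures\<close>

text \<open>Average the indicator of \<open>dist x y < r\<close> over \<open>U \<times> U\<close>
  and divide by \<open>k r\<close>. For \<open>x\<close> in \<open>U\<close> a small ball lies
  inside \<open>U\<close>, so the inner integral over \<open>y\<close> is eventually 1, and Fatou
  bounds \<open>\<mu> U\<close> by the lower limit of the double integrals. Integrated in the other
  order, each of these is at most \<open>h r / k r\<close> times \<open>\<nu> U\<close>.\<close>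

lemma uniformly_distributed_le:
  fixes \<mu> \<nu> :: "'a::{metric_space, second_countable_topology} measure"
  assumes sets [measurable_cong]: "sets \<mu> = sets borel" "sets \<nu> = sets borel"
    and fin: "sigma_finite_measure \<mu>" "sigma_finite_measure \<nu>"
    and S: "AE x in \<mu>. x \<in> S" "AE x in \<nu>. x \<in> S"
    and h: "\<And>x r. x \<in> S \<Longrightarrow> 0 < r \<Longrightarrow> emeasure \<mu> (ball x r) = h r"
    and k: "\<And>x r. x \<in> S \<Longrightarrow> 0 < r \<Longrightarrow> emeasure \<nu> (ball x r) = k r"
    and k_pos: "\<And>r. 0 < r \<Longrightarrow> 0 < k r" and k_fin: "\<And>r. 0 < r \<Longrightarrow> k r < top"
    and r: "\<And>n. 0 < r n" "r \<longlonglongrightarrow> 0"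
    and l: "(\<lambda>n. h (r n) / k (r n)) \<longlonglongrightarrow> l"
    and U: "open U" "emeasure \<nu> U < top"
  shows "emeasure \<mu> U \<le> l * emeasure \<nu> U"
proof (cases "S = {}")
  case True
  then have "AE x in \<mu>. False" using S by simp
  then have "emeasure \<mu> {x \<in> space \<mu>. x \<in> U} = 0" by (intro emeasure_eq_0_AE) auto
  moreover have "{x \<in> space \<mu>. x \<in> U} = U" using sets_eq_imp_space_eq[OF sets(1)] by auto
  ultimately show ?thesis by simp
next
  case False
  interpret \<mu>: sigma_finite_measure \<mu> by fact
  interpret \<nu>: sigma_finite_measure \<nu> by fact
  have [measurable]: "U \<in> sets borel" using U by simp
  have U_sets: "U \<in> sets \<mu>" "U \<in> sets \<nu>" using U sets by auto
  define G :: "nat \<Rightarrow> 'a \<Rightarrow> 'a \<Rightarrow> ennreal"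
    where "G n x y = indicator U x * indicator U y * indicator {z. dist (fst z) (snd z) < r n} (x, y) / k (r n)" for n x y
  have [measurable]: "{z::'a \<times> 'a. dist (fst z) (snd z) < r n} \<in> sets (borel \<Otimes>\<^sub>M borel)" for n
  proof -
    have "{z::'a \<times> 'a. dist (fst z) (snd z) < r n} \<in> sets borel"
      by (intro borel_open open_Collect_less continuous_intros)
    then show ?thesis by (simp flip: borel_prod)
  qed
  have G_meas [measurable]: "(\<lambda>(x, y). G n x y) \<in> borel_measurable (borel \<Otimes>\<^sub>M borel)" for n
    unfolding G_def by measurable
  have G_meas1 [measurable]: "(\<lambda>(x, y). G n x y) \<in> borel_measurable (\<mu> \<Otimes>\<^sub>M \<nu>)" for n
    by (subst measurable_cong_sets[OF sets_pair_measure_cong[OF sets] refl]) (rule G_meas)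
  have inner: "(\<integral>\<^sup>+y. G n x y \<partial>\<nu>) = indicator U x * (emeasure \<nu> (U \<inter> ball x (r n)) / k (r n))" for n x
  proof -
    have "(\<integral>\<^sup>+y. G n x y \<partial>\<nu>) = (\<integral>\<^sup>+y. (indicator U x / k (r n)) * indicator (U \<inter> ball x (r n)) y \<partial>\<nu>)"
      by (intro nn_integral_cong) (auto simp: G_def indicator_def divide_ennreal_def)
    also have "\<dots> = (indicator U x / k (r n)) * emeasure \<nu> (U \<inter> ball x (r n))"
      by (rule nn_integral_cmult_indicator) (use U sets in auto)
    finally show ?thesis by (simp add: divide_ennreal_def mult_ac)
  qed
  have "emeasure \<mu> U = (\<integral>\<^sup>+x. indicator U x \<partial>\<mu>)" using U_sets by simp
  also have "\<dots> \<le> (\<integral>\<^sup>+x. liminf (\<lambda>n. \<integral>\<^sup>+y. G n x y \<partial>\<nu>) \<partial>\<mu>)"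
  proof (rule nn_integral_mono_AE, rule AE_mp[OF S(1)], rule AE_I2, rule impI)
    fix x assume x: "x \<in> S"
    show "indicator U x \<le> liminf (\<lambda>n. \<integral>\<^sup>+y. G n x y \<partial>\<nu>)"
    proof (cases "x \<in> U")
      case True
      then obtain e where e: "0 < e" "ball x e \<subseteq> U" using U(1) openE by blast
      have "eventually (\<lambda>n. r n < e) sequentially" using r(2) e(1) by (rule order_tendstoD)
      then have "eventually (\<lambda>n. 1 \<le> (\<integral>\<^sup>+y. G n x y \<partial>\<nu>)) sequentially"
      proof eventually_elim
        case (elim n)
        then have "U \<inter> ball x (r n) = ball x (r n)" using e by (auto simp: subset_iff)
        then show ?case
          using True k[OF x r(1)[of n]] k_pos[OF r(1)[of n]] k_fin[OF r(1)[of n]] by (simp add: inner)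
      qed
      then show ?thesis using True by (simp add: Liminf_bounded)
    qed simp
  qed
  also have "\<dots> \<le> liminf (\<lambda>n. \<integral>\<^sup>+x. \<integral>\<^sup>+y. G n x y \<partial>\<nu> \<partial>\<mu>)"
    by (rule nn_integral_liminf) (use \<nu>.borel_measurable_nn_integral[OF G_meas1] in simp)
  also have "\<dots> \<le> liminf (\<lambda>n. emeasure \<nu> U * (h (r n) / k (r n)))"
  proof (rule Liminf_mono, rule always_eventually, rule allI)
    fix n
    have "(\<integral>\<^sup>+x. \<integral>\<^sup>+y. G n x y \<partial>\<nu> \<partial>\<mu>) = (\<integral>\<^sup>+y. \<integral>\<^sup>+x. G n x y \<partial>\<mu> \<partial>\<nu>)"
    proof -
      interpret pair_sigma_finite \<mu> \<nu> ..
      show ?thesis by (rule Fubini'[symmetric]) (rule G_meas1)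
    qed
    \<comment> \<open>In this order the restriction of \<open>x\<close> to \<open>U\<close> is
      dropped, which leaves a full ball around \<open>y\<close>, of measure
      \<open>h (r n)\<close>.\<close>
    also have "\<dots> \<le> (\<integral>\<^sup>+y. (h (r n) / k (r n)) * indicator U y \<partial>\<nu>)"
    proof (rule nn_integral_mono_AE, rule AE_mp[OF S(2)], rule AE_I2, rule impI)
      fix y assume y: "y \<in> S"
      have "(\<integral>\<^sup>+x. G n x y \<partial>\<mu>) \<le> (\<integral>\<^sup>+x. (indicator U y / k (r n)) * indicator (ball y (r n)) x \<partial>\<mu>)"
        by (intro nn_integral_mono) (auto simp: G_def indicator_def divide_ennreal_def dist_commute)
      also have "\<dots> = (indicator U y / k (r n)) * emeasure \<mu> (ball y (r n))"
        by (rule nn_integral_cmult_indicator) (use sets in auto)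
      finally show "(\<integral>\<^sup>+x. G n x y \<partial>\<mu>) \<le> (h (r n) / k (r n)) * indicator U y"
        using h[OF y r(1)[of n]] by (simp add: divide_ennreal_def mult_ac)
    qed
    also have "\<dots> = emeasure \<nu> U * (h (r n) / k (r n))"
      using U_sets by (subst nn_integral_cmult_indicator) (auto simp: mult.commute)
    finally show "(\<integral>\<^sup>+x. \<integral>\<^sup>+y. G n x y \<partial>\<nu> \<partial>\<mu>) \<le> emeasure \<nu> U * (h (r n) / k (r n))" .
  qed
  also have "\<dots> = emeasure \<nu> U * l"
    by (intro lim_imp_Liminf ennreal_tendsto_cmult l) (use U in auto)
  finally show ?thesis by (simp add: mult.commute)
qed

text \<open>If balls of one radius were null, finitely many of them would cover the compact set
  \<open>S\<close>, which carries the whole measure.\<close>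

lemma uniformly_distributed_pos:
  fixes \<mu> :: "'a::{metric_space, second_countable_topology} measure"
  assumes sets: "sets \<mu> = sets borel" and S: "AE x in \<mu>. x \<in> S" "compact S"
    and h: "\<And>x r. x \<in> S \<Longrightarrow> 0 < r \<Longrightarrow> emeasure \<mu> (ball x r) = h r"
    and nonzero: "emeasure \<mu> UNIV \<noteq> 0" and r: "0 < r"
  shows "0 < h r"
proof (rule ccontr)
  assume "\<not> 0 < h r"
  then have zero: "ball x r \<in> null_sets \<mu>" if "x \<in> S" for x
    using h[OF that r] sets by auto
  obtain F where F: "F \<subseteq> S" "finite F" "S \<subseteq> (\<Union>x\<in>F. ball x r)"
    using compactE_image[OF S(2), of S "\<lambda>x. ball x r"] r by (metis UN_I centre_in_ball open_ball subsetI)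
  have "(\<Union>x\<in>F. ball x r) \<in> null_sets \<mu>"
    using F zero by (intro null_sets_UN') (auto intro: countable_finite)
  then have "AE x in \<mu>. x \<notin> (\<Union>x\<in>F. ball x r)" by (rule AE_not_in)
  with S(1) have "AE x in \<mu>. False" by eventually_elim (use F(3) in auto)
  then have "emeasure \<mu> {x \<in> space \<mu>. True} = 0" by (intro emeasure_eq_0_AE) simp
  then show False using nonzero sets_eq_imp_space_eq[OF sets] by simp
qed

text \<open>Christensen's uniqueness argument: the one-sided comparison is applied with a limit
  \<open>l\<close> of the ratios of ball measures, and again with the roles exchanged and limit
  \<open>inverse l\<close>. Equality on open sets then determines the measures.\<close>

theorem uniformly_distributed_unique:
  fixes \<mu> \<nu> :: "'a::{metric_space, second_countable_topology} measure"
  assumes sets: "sets \<mu> = sets borel" "sets \<nu> = sets borel"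
    and fin: "finite_measure \<mu>" "finite_measure \<nu>"
    and S: "AE x in \<mu>. x \<in> S" "AE x in \<nu>. x \<in> S" "S \<noteq> {}" "compact S"
    and h: "\<And>x r. x \<in> S \<Longrightarrow> 0 < r \<Longrightarrow> emeasure \<mu> (ball x r) = h r"
    and k: "\<And>x r. x \<in> S \<Longrightarrow> 0 < r \<Longrightarrow> emeasure \<nu> (ball x r) = k r"
    and nonzero: "emeasure \<mu> UNIV \<noteq> 0" "emeasure \<nu> UNIV \<noteq> 0"
  shows "\<exists>l. \<mu> = scale_measure l \<nu>"
proof -
  interpret \<mu>: finite_measure \<mu> by fact
  interpret \<nu>: finite_measure \<nu> by fact
  have pos: "0 < h r" "0 < k r" if "0 < r" for r
    using uniformly_distributed_pos[OF sets(1) S(1,4) h nonzero(1) that]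
      uniformly_distributed_pos[OF sets(2) S(2,4) k nonzero(2) that] by auto
  have fin_hk: "h s < top" "k s < top" if "0 < s" for s
    using S(3) h[of _ s] k[of _ s] that \<nu>.emeasure_finite[of "ball _ s"] \<mu>.emeasure_finite[of "ball _ s"]
    by (metis ex_in_conv less_top)+
  \<comment> \<open>Convergence of the ratios is not known in advance. The extended half-line is
    compact, so a subsequence converges, a priori possibly to 0 or to infinity.\<close>
  obtain l and s :: "nat \<Rightarrow> nat" where s: "strict_mono s"
    and l: "((\<lambda>n. h (1 / real (Suc n)) / k (1 / real (Suc n))) \<circ> s) \<longlonglongrightarrow> l"
    using compact_complete_linorder[of "\<lambda>n. h (1 / real (Suc n)) / k (1 / real (Suc n))"] by blast
  define r where "r n = 1 / real (Suc (s n))" for n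
  have r: "0 < r n" for n by (simp add: r_def)
  have r0: "r \<longlonglongrightarrow> 0"
    using LIMSEQ_subseq_LIMSEQ[OF LIMSEQ_Suc[OF lim_1_over_n] s]
    by (simp add: r_def[abs_def] o_def del: of_nat_Suc)
  have l: "(\<lambda>n. h (r n) / k (r n)) \<longlonglongrightarrow> l" using l by (simp add: r_def o_def)
  have "(\<lambda>n. inverse (h (r n) / k (r n))) \<longlonglongrightarrow> inverse l"
    by (rule continuous_on_tendsto_compose[OF continuous_on_inverse_ennreal[OF continuous_on_id], where s = UNIV])
      (use l in auto)
  moreover have "inverse (h (r n) / k (r n)) = k (r n) / h (r n)" for n
    using pos[OF r[of n]] fin_hk[OF r[of n]]
    by (cases "h (r n)"; cases "k (r n)") (auto simp: divide_ennreal inverse_ennreal)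
  ultimately have l': "(\<lambda>n. k (r n) / h (r n)) \<longlonglongrightarrow> inverse l" by simp
  have eq: "emeasure \<mu> U = l * emeasure \<nu> U" if U: "open U" for U
  proof (rule antisym)
    show "emeasure \<mu> U \<le> l * emeasure \<nu> U"
      by (rule uniformly_distributed_le[OF sets _ _ S(1,2) h k pos(2) fin_hk(2) r r0 l U])
        (simp_all add: less_top[symmetric] \<mu>.sigma_finite_measure_axioms \<nu>.sigma_finite_measure_axioms)
    have "emeasure \<nu> U \<le> inverse l * emeasure \<mu> U"
      by (rule uniformly_distributed_le[OF sets(2,1) _ _ S(2,1) k h pos(1) fin_hk(1) r r0 l' U])
        (simp_all add: less_top[symmetric] \<mu>.sigma_finite_measure_axioms \<nu>.sigma_finite_measure_axioms)
    then have "l * emeasure \<nu> U \<le> (l * inverse l) * emeasure \<mu> U"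
      by (simp add: mult.assoc mult_left_mono)
    \<comment> \<open>In the degenerate cases \<open>l = 0\<close> and \<open>l = top\<close> the
      product is 0, which still satisfies the inequality.\<close>
    also have "l * inverse l \<le> 1"
      using ennreal_divide_self[of l]
      by (cases "l = 0 \<or> l = top") (auto simp: less_top[symmetric] divide_ennreal_def)
    finally show "l * emeasure \<nu> U \<le> emeasure \<mu> U" by (simp add: mult_right_mono)
  qed
  have "\<mu> = scale_measure l \<nu>"
  proof (rule measure_eqI_generator_eq[where E = "Collect open" and \<Omega> = UNIV and A = "\<lambda>_. UNIV"])
    show "sets \<mu> = sigma_sets UNIV (Collect open)" "sets (scale_measure l \<nu>) = sigma_sets UNIV (Collect open)"
      using sets by (auto simp: borel_def)
    show "emeasure \<mu> UNIV \<noteq> \<infinity>" by simp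
  qed (auto simp: Int_stable_def eq simp del: \<mu>.emeasure_finite)
  then show ?thesis by blast
qed

section \<open>Surface integrals over spheres\<close>

text \<open>An isometry maps balls to balls of the same volume, so its push-forward of Lebesgue measure is
  again uniformly distributed.\<close>

lemma emeasure_lborel_isometry:
  fixes f :: "'a::euclidean_space \<Rightarrow> 'a"
  assumes f: "\<And>x y. dist (f x) (f y) = dist x y" "surj f" and B: "B \<in> sets borel"
  shows "emeasure lborel (f -` B) = emeasure lborel B"
proof -
  have "continuous_on UNIV f" unfolding continuous_on_iff by (metis f(1))
  then have meas [measurable]: "f \<in> borel_measurable borel" by (rule borel_measurable_continuous_onI)
  define \<nu> where "\<nu> = distr lborel borel f"
  have sets_\<nu> [measurable_cong]: "sets \<nu> = sets borel" by (simp add: \<nu>_def)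
  have \<nu>: "emeasure \<nu> E = emeasure lborel (f -` E)" if "E \<in> sets borel" for E
    using that by (simp add: \<nu>_def emeasure_distr)
  define h where "h r = ennreal (unit_ball_vol (real DIM('a)) * r ^ DIM('a))" for r
  have lborel_ball: "emeasure lborel (ball x r :: 'a set) = h r" if "0 < r" for x r
    using that by (simp add: h_def emeasure_ball)
  have \<nu>_ball: "emeasure \<nu> (ball x r) = h r" if "0 < r" for x r
  proof -
    obtain y where y: "f y = x" using f(2) by (metis surjD)
    have "f -` ball x r = ball y r" by (auto simp: y[symmetric] f(1))
    then show ?thesis using lborel_ball[OF that] by (simp add: \<nu>)
  qed
  have sf: "sigma_finite_measure \<nu>"
  proof
    show "\<exists>A. countable A \<and> A \<subseteq> sets \<nu> \<and> \<Union> A = space \<nu> \<and> (\<forall>a\<in>A. emeasure \<nu> a \<noteq> \<infinity>)"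
    proof (intro exI conjI ballI)
      show "\<Union> (range (\<lambda>n. ball (0::'a) (real (Suc n)))) = space \<nu>"
      proof -
        have "x \<in> (\<Union>n. ball 0 (real (Suc n)))" for x :: 'a
        proof -
          obtain n where "norm x < real n" using reals_Archimedean2 by blast
          then show ?thesis by (intro UN_I[of n]) auto
        qed
        then show ?thesis by (auto simp: \<nu>_def)
      qed
      fix a assume "a \<in> range (\<lambda>n. ball (0::'a) (real (Suc n)))"
      then show "emeasure \<nu> a \<noteq> \<infinity>" by (auto simp: \<nu>_ball h_def)
    qed (auto simp: sets_\<nu>)
  qed
  have h_pos: "0 < h r" if "0 < r" for r using that by (simp add: h_def)
  have h_fin: "h r < top" for r by (simp add: h_def)
  have r: "0 < 1 / real (Suc n)" "(\<lambda>n. 1 / real (Suc n)) \<longlonglongrightarrow> 0" for n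
    using LIMSEQ_Suc[OF lim_1_over_n] by auto
  have one: "(\<lambda>n. h (1 / real (Suc n)) / h (1 / real (Suc n))) \<longlonglongrightarrow> 1"
  proof -
    have "h (1 / real (Suc n)) / h (1 / real (Suc n)) = 1" for n
      using h_pos[of "1 / real (Suc n)"] h_fin by (intro ennreal_divide_self) auto
    then show ?thesis by simp
  qed
  have "lborel = \<nu>"
  proof (rule lborel_eqI)
    fix l u :: 'a assume le: "\<And>b. b \<in> Basis \<Longrightarrow> l \<bullet> b \<le> u \<bullet> b"
    have fin1: "emeasure lborel (box l u) < top" by (simp add: emeasure_lborel_box_eq)
    have le1: "emeasure \<nu> (box l u) \<le> 1 * emeasure lborel (box l u)"
      by (rule uniformly_distributed_le[OF sets_\<nu> _ sf _ _ _ \<nu>_ball lborel_ball h_pos h_fin r one _ fin1, of UNIV])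
        (auto intro: lborel.sigma_finite_measure_axioms)
    then have fin2: "emeasure \<nu> (box l u) < top" using fin1 by (simp add: le_less_trans)
    have "emeasure lborel (box l u) \<le> 1 * emeasure \<nu> (box l u)"
      by (rule uniformly_distributed_le[OF _ sets_\<nu> _ sf _ _ lborel_ball \<nu>_ball h_pos h_fin r one _ fin2, of UNIV])
        (auto intro: lborel.sigma_finite_measure_axioms)
    with le1 have "emeasure \<nu> (box l u) = emeasure lborel (box l u)" by (simp add: antisym)
    then show "emeasure \<nu> (box l u) = (\<Prod>b\<in>Basis. (u - l) \<bullet> b)"
      using le by (simp add: emeasure_lborel_box)
  qed (simp add: sets_\<nu>)
  then show ?thesis using \<nu>[OF B] by simp
qed

lemma sphere_borel [measurable]: "sphere (a::'a::euclidean_space) r \<in> sets borel"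
  by (intro borel_closed closed_sphere)

lemma emeasure_density_indicator:
  assumes "A \<in> sets M" "E \<in> sets M"
  shows "emeasure (density M (indicator A)) E = emeasure M (A \<inter> E)"
proof -
  have "emeasure (density M (indicator A)) E = (\<integral>\<^sup>+x. indicator A x * indicator E x \<partial>M)"
    using assms by (subst emeasure_density) auto
  also have "\<dots> = (\<integral>\<^sup>+x. indicator (A \<inter> E) x \<partial>M)" by (simp add: indicator_inter_arith)
  finally have "emeasure (density M (indicator A)) E = (\<integral>\<^sup>+x. indicator (A \<inter> E) x \<partial>M)" .
  then show ?thesis using assms by simp
qed

lemma emeasure_distr_density_indicator:
  assumes [measurable]: "A \<in> sets M" "g \<in> measurable M N" "E \<in> sets N"
  shows "emeasure (distr (density M (indicator A)) N g) E = emeasure M (A \<inter> g -` E)"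
proof -
  have "emeasure (distr (density M (indicator A)) N g) E = emeasure M (A \<inter> (g -` E \<inter> space M))"
    by (subst emeasure_distr) (auto simp: emeasure_density_indicator measurable_sets)
  also have "A \<inter> (g -` E \<inter> space M) = A \<inter> g -` E" using sets.sets_into_space[OF assms(1)] by auto
  finally show ?thesis .
qed

abbreviation annulus :: "real \<Rightarrow> real \<Rightarrow> 'a::euclidean_space set" where
  "annulus s R \<equiv> ball 0 R - cball 0 s"

lemma emeasure_annulus_pos:
  assumes "0 \<le> s" "s < R"
  shows "0 < emeasure lborel (annulus s R :: 'a::euclidean_space set)" "emeasure lborel (annulus s R :: 'a set) < top"
proof -
  have "s ^ DIM('a) < R ^ DIM('a)" using assms by (intro power_strict_mono) auto
  moreover have "emeasure lborel (annulus s R :: 'a set) = emeasure lborel (ball (0::'a) R) - emeasure lborel (cball (0::'a) s)"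
    by (rule emeasure_Diff) (use assms in \<open>auto simp: emeasure_cball\<close>)
  ultimately show "0 < emeasure lborel (annulus s R :: 'a set)" "emeasure lborel (annulus s R :: 'a set) < top"
    using assms by (auto simp: emeasure_ball emeasure_cball ennreal_minus)
qed

text \<open>Rotations preserve the shell and commute with the radial projection, and they preserve
  Hausdorff measure as isometries. Under either measure, therefore, all caps of a given radius have
  equal measure, and uniqueness of uniformly distributed measures applies.\<close>

lemma unit_sphere_measure_eq:
  assumes sR: "0 \<le> s" "s < R"
  defines "A \<equiv> annulus s R :: (real ^ 'n) set" and "m \<equiv> CARD('n) - 1"
  shows "\<exists>l. density (hausdorff_measure m) (indicator (sphere (0 :: real ^ 'n) 1))
    = scale_measure l (distr (density lborel (indicator A)) borel (\<lambda>x. x /\<^sub>R norm x))"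
    (is "\<exists>l. ?\<mu> = scale_measure l ?\<nu>")
proof (cases "hausdorff_outer m (sphere (0 :: real ^ 'n) 1) = 0")
  \<comment> \<open>The uniqueness theorem asks for nonzero measures; if the sphere were a null set,
    the factor 0 would do.\<close>
  case True
  let ?S = "sphere (0 :: real ^ 'n) 1"
  have "emeasure ?\<mu> E = 0" if "E \<in> sets borel" for E
  proof -
    have "emeasure ?\<mu> E = hausdorff_outer m (?S \<inter> E)"
      using that by (simp add: emeasure_density_indicator emeasure_hausdorff_measure)
    also have "\<dots> \<le> hausdorff_outer m ?S" by (rule hausdorff_outer_mono) auto
    finally show ?thesis using True by simp
  qed
  then have "?\<mu> = scale_measure 0 ?\<nu>" by (intro measure_eqI) auto
  then show ?thesis by blast
next
  case False
  let ?S = "sphere (0 :: real ^ 'n) 1" 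
  have [measurable]: "A \<in> sets borel" by (simp add: A_def)
  have H_fin: "emeasure (hausdorff_measure m) (sphere (0 :: real ^ 'n) 1) < top"
    using emeasure_hausdorff_unit_sphere_finite[where 'a = "real ^ 'n"] by (simp add: m_def)
  have \<mu>: "emeasure ?\<mu> E = hausdorff_outer m (?S \<inter> E)" if "E \<in> sets borel" for E
    using that by (simp add: emeasure_density_indicator emeasure_hausdorff_measure)
  have \<nu>: "emeasure ?\<nu> E = emeasure lborel (A \<inter> (\<lambda>x. x /\<^sub>R norm x) -` E)" if [measurable]: "E \<in> sets borel" for E
    by (rule emeasure_distr_density_indicator) auto
  define e0 :: "real ^ 'n" where "e0 = axis (SOME i. True) 1"
  define h where "h r = hausdorff_outer m (?S \<inter> ball e0 r)" for r
  define k where "k r = emeasure lborel (A \<inter> (\<lambda>x. x /\<^sub>R norm x) -` ball e0 r)" for r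
  show ?thesis
  proof (rule uniformly_distributed_unique[where S = ?S and h = h and k = k])
    show "finite_measure ?\<mu>"
      using H_fin
      by (intro finite_measureI) (simp add: \<mu> emeasure_hausdorff_measure less_top)
    show "finite_measure ?\<nu>"
    proof (rule finite_measureI)
      have "emeasure ?\<nu> (space ?\<nu>) = emeasure lborel A" by (simp add: \<nu>)
      then show "emeasure ?\<nu> (space ?\<nu>) \<noteq> \<infinity>" using emeasure_annulus_pos(2)[OF sR] by (simp add: A_def less_top)
    qed
    show "AE x in ?\<mu>. x \<in> ?S" by (subst AE_density) (auto simp: indicator_def)
    show "AE x in ?\<nu>. x \<in> ?S"
    proof -
      have "x /\<^sub>R norm x \<in> ?S" if "(0::ennreal) < indicator A x" for x
      proof -
        have "x \<in> A" using that by (cases "x \<in> A") auto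
        then have "norm x \<noteq> 0" using sR by (auto simp: A_def)
        then show ?thesis by simp
      qed
      then have "AE x in density lborel (indicator A). x /\<^sub>R norm x \<in> ?S"
        by (subst AE_density) auto
      then show ?thesis by (subst AE_distr_iff) auto
    qed
    show "?S \<noteq> {}" by simp
    show "compact ?S" by simp
    show "emeasure ?\<mu> UNIV \<noteq> 0" using False by (simp add: \<mu>)
    have "emeasure ?\<nu> UNIV = emeasure lborel A" by (simp add: \<nu>)
    then show "emeasure ?\<nu> UNIV \<noteq> 0" using emeasure_annulus_pos(1)[where 'a = "real ^ 'n", OF sR] by (simp add: A_def)
    fix x :: "real ^ 'n" and r :: real assume x: "x \<in> ?S" and r: "0 < r"
    \<comment> \<open>A rotation takes the reference pole \<open>e0\<close> to \<open>x\<close>; the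
      cap functions \<open>h\<close> and \<open>k\<close> were defined at the pole.\<close>
    have "norm (e0) = norm x" using x by (simp add: e0_def)
    then obtain f where f: "orthogonal_transformation f" and fx: "f e0 = x"
      by (rule orthogonal_transformation_exists)
    have dist_f: "dist (f y) (f z) = dist y z" for y z
      using f by (simp add: orthogonal_transformation_isometry)
    have norm_f: "norm (f y) = norm y" for y using f by (simp add: orthogonal_transformation_norm)
    have f_scale: "f (c *\<^sub>R y) = c *\<^sub>R f y" for c y
      using f by (simp add: linear_scale orthogonal_transformation_linear)
    have "f ` (?S \<inter> ball e0 r) = ?S \<inter> ball x r"
    proof -
      have "y \<in> f ` (?S \<inter> ball e0 r)" if "y \<in> ?S \<inter> ball x r" for y
      proof -
        obtain z where "y = f z" using orthogonal_transformation_surj[OF f] by (metis surjD)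
        then show ?thesis using that dist_f norm_f fx by (metis IntE IntI dist_0_norm imageI mem_ball mem_sphere)
      qed
      then show ?thesis using dist_f norm_f fx by (auto simp: norm_f)
    qed
    then have "hausdorff_outer m (?S \<inter> ball x r) = h r"
      using hausdorff_outer_similarity[of 1 f m "?S \<inter> ball e0 r"] dist_f orthogonal_transformation_surj[OF f]
      by (simp add: h_def)
    then show "emeasure ?\<mu> (ball x r) = h r" by (simp add: \<mu>)
    let ?W = "\<lambda>x. A \<inter> (\<lambda>x. x /\<^sub>R norm x) -` ball x r"
    have W: "?W x \<in> sets borel" by (intro sets.Int measurable_sets_borel[of _ borel]) auto
    have "emeasure lborel (?W x) = emeasure lborel (f -` ?W x)"
      by (rule emeasure_lborel_isometry[OF dist_f orthogonal_transformation_surj[OF f] W, symmetric])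
    also have "f -` ?W x = ?W e0"
      by (auto simp: A_def norm_f f_scale[symmetric] fx[symmetric] dist_f)
    finally have "emeasure lborel (?W x) = k r" by (simp only: k_def)
    then show "emeasure ?\<nu> (ball x r) = k r" by (simp add: \<nu>)
  qed auto
qed

text \<open>The constant is found by evaluating both sides on the whole sphere.\<close>

lemma sphere_measure_eq:
  fixes a :: "real ^ 'n"
  assumes sR: "0 \<le> s" "s < R" and \<rho>: "0 < \<rho>"
  defines "A \<equiv> annulus s R :: (real ^ 'n) set" and "m \<equiv> CARD('n) - 1"
  shows "density (hausdorff_measure m) (indicator (sphere a \<rho>))
    = distr (density lborel
        (\<lambda>x. ennreal (unit_sphere_area TYPE('n) * \<rho> ^ m / measure lborel A * indicator A x)))
      borel (\<lambda>x. a + (\<rho> / norm x) *\<^sub>R x)"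
    (is "?\<mu> = distr (density lborel (\<lambda>x. ennreal (?c * _))) borel ?g")
proof (rule measure_eqI)
  let ?S = "sphere (0 :: real ^ 'n) 1"  and ?p = "\<lambda>x::real ^ 'n. x /\<^sub>R norm x"
  let ?H = "hausdorff_outer m :: (real ^ 'n) set \<Rightarrow> ennreal"
  have A [measurable]: "A \<in> sets borel" by (simp add: A_def)
  have A_pos: "0 < emeasure lborel A" "emeasure lborel A < top"
    using emeasure_annulus_pos[where 'a = "real ^ 'n", OF sR] by (simp_all only: A_def)
  then have A_eq: "emeasure lborel A = ennreal (measure lborel A)" and A_pos': "0 < measure lborel A"
    by (auto intro!: emeasure_eq_ennreal_measure simp: enn2real_positive_iff measure_def)
  have g [measurable]: "?g \<in> borel_measurable borel" by measurable
  obtain l where l: "density (hausdorff_measure m) (indicator ?S)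
      = scale_measure l (distr (density lborel (indicator A)) borel ?p)"
    using unit_sphere_measure_eq[where 'n = 'n, OF sR, folded m_def A_def] by blast
  have unit: "?H (?S \<inter> E) = l * emeasure lborel (A \<inter> ?p -` E)" if [measurable]: "E \<in> sets borel" for E
  proof -
    have "?H (?S \<inter> E) = emeasure (density (hausdorff_measure m) (indicator ?S)) E"
      using that by (simp add: emeasure_density_indicator emeasure_hausdorff_measure)
    also have "\<dots> = l * emeasure lborel (A \<inter> ?p -` E)"
      unfolding l by (simp add: emeasure_distr_density_indicator)
    finally show ?thesis .
  qed
  have H_fin: "emeasure (hausdorff_measure m) (sphere (0 :: real ^ 'n) 1) < top"
    using emeasure_hausdorff_unit_sphere_finite[where 'a = "real ^ 'n"] by (simp add: m_def)
  have area: "?H ?S = ennreal (unit_sphere_area TYPE('n))"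
  proof -
    have "unit_sphere_area TYPE('n) = measure (hausdorff_measure m) ?S"
      by (simp only: unit_sphere_area_def m_def)
    then show ?thesis
      using H_fin by (simp add: emeasure_eq_ennreal_measure emeasure_hausdorff_measure[symmetric] less_top)
  qed
  have l_eq: "l = ennreal (unit_sphere_area TYPE('n) / measure lborel A)"
  proof -
    have "ennreal (unit_sphere_area TYPE('n)) = l * ennreal (measure lborel A)"
      using unit[of UNIV] area A_eq by simp
    then have "l = ennreal (unit_sphere_area TYPE('n)) / ennreal (measure lborel A)"
      using A_pos' by (simp add: ennreal_mult_divide_eq)
    then show ?thesis using A_pos' by (simp add: divide_ennreal unit_sphere_area_def)
  qed
  fix E assume "E \<in> sets ?\<mu>"
  then have E [measurable]: "E \<in> sets borel" by simp
  let ?T = "\<lambda>x. a + \<rho> *\<^sub>R x"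
  have T [measurable]: "?T \<in> borel_measurable borel" by measurable
  have TE [measurable]: "?T -` E \<in> sets borel" by (rule measurable_sets_borel[OF T E])
  have "emeasure ?\<mu> E = ?H (sphere a \<rho> \<inter> E)"
    by (simp add: emeasure_density_indicator emeasure_hausdorff_measure)
  also have "sphere a \<rho> \<inter> E = ?T ` (?S \<inter> ?T -` E)"
  proof -
    have "y \<in> ?T ` (?S \<inter> ?T -` E)" if "y \<in> sphere a \<rho> \<inter> E" for y
      using that \<rho> by (intro image_eqI[of _ _ "(y - a) /\<^sub>R \<rho>"]) (auto simp: dist_norm norm_minus_commute)
    then show ?thesis using \<rho> by (auto simp: dist_norm)
  qed
  also have "?H (?T ` (?S \<inter> ?T -` E)) = ennreal (\<rho> ^ m) * ?H (?S \<inter> ?T -` E)"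
  proof (rule hausdorff_outer_similarity[OF \<rho>])
    show "dist (?T x) (?T y) = \<rho> * dist x y" for x y
      using \<rho> by (simp add: dist_norm flip: scaleR_diff_right)
    show "surj ?T" by (rule surjI[of _ "\<lambda>y. (y - a) /\<^sub>R \<rho>"]) (use \<rho> in simp)
  qed
  also have "\<dots> = ennreal (\<rho> ^ m) * (l * emeasure lborel (A \<inter> ?p -` (?T -` E)))"
    by (simp add: unit)
  also have "?p -` (?T -` E) = ?g -` E" by (auto simp: divide_inverse)
  also have "ennreal (\<rho> ^ m) * (l * emeasure lborel (A \<inter> ?g -` E)) = ennreal ?c * emeasure lborel (A \<inter> ?g -` E)"
    using \<rho> A_pos'
    by (simp add: l_eq mult.assoc[symmetric] ennreal_mult'[symmetric] unit_sphere_area_def mult.commute)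
  also have "\<dots> = (\<integral>\<^sup>+x. ennreal ?c * indicator (A \<inter> ?g -` E) x \<partial>lborel)"
    using measurable_sets_borel[OF g E] by (subst nn_integral_cmult_indicator) auto
  also have "\<dots> = emeasure (distr (density lborel (\<lambda>x. ennreal (?c * indicator A x))) borel ?g) E"
  proof -
    have gE [measurable]: "?g -` E \<in> sets borel" by (rule measurable_sets_borel[OF g E])
    have "emeasure (distr (density lborel (\<lambda>x. ennreal (?c * indicator A x))) borel ?g) E
        = emeasure (density lborel (\<lambda>x. ennreal (?c * indicator A x))) (?g -` E)"
      by (subst emeasure_distr) auto
    also have "\<dots> = (\<integral>\<^sup>+x. ennreal (?c * indicator A x) * indicator (?g -` E) x \<partial>lborel)"
      by (subst emeasure_density) auto
    also have "\<dots> = (\<integral>\<^sup>+x. ennreal ?c * indicator (A \<inter> ?g -` E) x \<partial>lborel)"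
      by (intro nn_integral_cong) (auto split: split_indicator)
    finally show ?thesis by simp
  qed
  finally show "emeasure ?\<mu> E = emeasure (distr (density lborel (\<lambda>x. ennreal (?c * indicator A x))) borel ?g) E" .
qed simp

text \<open>In this form the values of \<open>f\<close> on a sphere can be compared with those in a
  shell ray by ray, with volume integrals only. Both sides integrate against one push-forward
  measure, so they also take the default value 0 together when \<open>f\<close> is not
  integrable.\<close>

lemma integral_sphere_eq:
  fixes a :: "real ^ 'n" and f :: "real ^ 'n \<Rightarrow> real"
  assumes sR: "0 \<le> s" "s < R" and \<rho>: "0 < \<rho>" and f [measurable]: "f \<in> borel_measurable borel"
  defines "A \<equiv> annulus s R :: (real ^ 'n) set" and "m \<equiv> CARD('n) - 1"
  shows "(LINT x|hausdorff_measure m. indicator (sphere a \<rho>) x * f x)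
    = unit_sphere_area TYPE('n) * \<rho> ^ m / measure lborel A
      * (LINT x|lborel. indicator A x * f (a + (\<rho> / norm x) *\<^sub>R x))"
proof -
  let ?H = "hausdorff_measure m :: (real ^ 'n) measure"
  let ?c = "unit_sphere_area TYPE('n) * \<rho> ^ m / measure lborel A"
  have [measurable]: "A \<in> sets borel" by (simp add: A_def)
  have c: "0 \<le> ?c" using \<rho> by (simp add: unit_sphere_area_def)
  have "(LINT x|?H. indicator (sphere a \<rho>) x * f x) = (LINT x|density ?H (\<lambda>x. ennreal (indicator (sphere a \<rho>) x)). f x)"
    by (subst integral_density) auto
  also have "density ?H (\<lambda>x. ennreal (indicator (sphere a \<rho>) x)) = density ?H (indicator (sphere a \<rho>))"
    by (simp add: ennreal_indicator)
  also have "(LINT x|density ?H (indicator (sphere a \<rho>)). f x)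
      = (LINT x|density lborel (\<lambda>x. ennreal (?c * indicator A x)). f (a + (\<rho> / norm x) *\<^sub>R x))"
    unfolding sphere_measure_eq[OF sR \<rho>, of a, folded m_def A_def] by (subst integral_distr) auto
  also have "\<dots> = (LINT x|lborel. (?c * indicator A x) *\<^sub>R f (a + (\<rho> / norm x) *\<^sub>R x))"
    by (subst integral_density) (use c in \<open>auto simp: indicator_def\<close>)
  also have "\<dots> = ?c * (LINT x|lborel. indicator A x * f (a + (\<rho> / norm x) *\<^sub>R x))"
    by (simp add: mult.assoc)
  finally show ?thesis .
qed

section \<open>Radial and Poincare estimates\<close>

text \<open>\<open>N\<close> plays the role of the norm of the gradient of \<open>f\<close>; only its integrals along segments matter.\<close>

definition upper_gradient :: "('a::euclidean_space \<Rightarrow> real) \<Rightarrow> ('a \<Rightarrow> real) \<Rightarrow> bool" where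
  "upper_gradient f N \<longleftrightarrow> continuous_on UNIV f \<and> continuous_on UNIV N \<and> (\<forall>x. 0 \<le> N x) \<and>
     (\<forall>p v a b. a \<le> b \<longrightarrow> ennreal \<bar>f (p + b *\<^sub>R v) - f (p + a *\<^sub>R v)\<bar>
        \<le> (\<integral>\<^sup>+t. indicator {a..b} t * ennreal (norm v * N (p + t *\<^sub>R v)) \<partial>lborel))"

lemma upper_gradientD:
  assumes "upper_gradient f N"
  shows "continuous_on UNIV f" "continuous_on UNIV N" "0 \<le> N x"
    and "f \<in> borel_measurable borel" "N \<in> borel_measurable borel"
    and "a \<le> b \<Longrightarrow> ennreal \<bar>f (p + b *\<^sub>R v) - f (p + a *\<^sub>R v)\<bar>
        \<le> (\<integral>\<^sup>+t. indicator {a..b} t * ennreal (norm v * N (p + t *\<^sub>R v)) \<partial>lborel)"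
  using assms by (auto simp: upper_gradient_def intro: borel_measurable_continuous_onI)

lemma upper_gradient_translate:
  assumes "upper_gradient f N"
  shows "upper_gradient (\<lambda>x. f (a + x)) (\<lambda>x. N (a + x))"
proof -
  have "continuous_on UNIV (\<lambda>x. g (a + x))" if "continuous_on UNIV g" for g :: "'a \<Rightarrow> real"
    by (rule continuous_on_compose2[OF that]) (auto intro: continuous_intros)
  then show ?thesis
    using assms unfolding upper_gradient_def by (simp add: add.assoc[symmetric])
qed

lemma nn_integral_lborel_affine:
  fixes c :: real and t :: "'a::euclidean_space"
  assumes c: "c \<noteq> 0" and f [measurable]: "f \<in> borel_measurable borel"
  shows "(\<integral>\<^sup>+x. f x \<partial>lborel) = ennreal (\<bar>c\<bar> ^ DIM('a)) * (\<integral>\<^sup>+x. f (t + c *\<^sub>R x) \<partial>lborel)"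
  by (subst lborel_affine[OF c, of t])
    (simp add: nn_integral_density nn_integral_distr nn_integral_cmult)

text \<open>Polar coordinates are avoided: on each ray one scales the integration variable, and the weight
  arises from the integral over the scaling factor.\<close>

lemma radial_weight_le:
  fixes y :: "'a::euclidean_space"
  assumes "0 < norm y" "0 < R"
  shows "(\<integral>\<^sup>+t. indicator {norm y / R..1} t * ennreal (norm y / t ^ Suc (DIM('a))) \<partial>lborel)
    \<le> ennreal (R * (R / norm y) ^ (DIM('a) - 1))"
proof (cases "norm y / R \<le> 1")
  case True
  obtain m where m: "DIM('a) = Suc m" using DIM_positive[where 'a = 'a] gr0_implies_Suc by blast
  define n where "n = norm y"
  let ?s = "n / R"
  have s: "0 < ?s" using assms by (simp add: n_def)
  let ?F = "\<lambda>t. - (n / real (Suc m)) * (1 / t) ^ Suc m"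
  have "(\<integral>\<^sup>+t. ennreal (n / t ^ Suc (Suc m)) * indicator {?s..1} t \<partial>lborel) = ennreal (?F 1 - ?F ?s)"
  proof (rule nn_integral_FTC_Icc)
    fix t assume "t \<in> {?s..1}"
    then have t0: "0 < t" using s less_le_trans[of 0 ?s t] by simp
    have "((\<lambda>t. 1 / t) has_real_derivative - (1 / t\<^sup>2)) (at t)"
      using t0 by (auto intro!: derivative_eq_intros simp: power2_eq_square)
    from DERIV_power[OF this, of "Suc m"]
    have "((\<lambda>t. (1 / t) ^ Suc m) has_real_derivative real (Suc m) * (- (1 / t\<^sup>2) * (1 / t) ^ m)) (at t)"
      by (simp only: diff_Suc_1 One_nat_def[symmetric])
    from DERIV_cmult[OF this, of "- (n / real (Suc m))"]
    have "(?F has_real_derivative - (n / real (Suc m)) * (real (Suc m) * (- (1 / t\<^sup>2) * (1 / t) ^ m))) (at t)" .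
    moreover have "- (n / real (Suc m)) * (real (Suc m) * (- (1 / t\<^sup>2) * (1 / t) ^ m)) = n * (1 / t\<^sup>2 * (1 / t) ^ m)"
    proof -
      have "- (n / c) * (c * (- a * b)) = n * (a * b)" if "c \<noteq> 0" for a b c :: real using that by simp
      then show ?thesis by (metis of_nat_0_eq_iff nat.distinct(1))
    qed
    moreover have "n * (1 / t\<^sup>2 * (1 / t) ^ m) = n / t ^ Suc (Suc m)"
      by (simp add: power_divide power2_eq_square mult.assoc)
    ultimately show "(?F has_real_derivative n / t ^ Suc (Suc m)) (at t)" by simp
    show "0 \<le> n / t ^ Suc (Suc m)" using t0 by (simp add: n_def)
  qed (use True in \<open>auto simp: n_def\<close>)
  also have "?F 1 - ?F ?s \<le> R * (R / n) ^ m"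
  proof -
    have "- ?F ?s = (1 / real (Suc m)) * (n * (R / n) ^ Suc m)" by simp
    also have "\<dots> \<le> 1 * (n * (R / n) ^ Suc m)"
      using assms by (intro mult_right_mono) (auto simp: n_def)
    also have "\<dots> = R * (R / n) ^ m" using assms by (simp add: n_def)
    finally have "- ?F ?s \<le> R * (R / n) ^ m" .
    moreover have "?F 1 \<le> 0" by (simp add: n_def)
    ultimately show ?thesis by linarith
  qed
  finally show ?thesis by (simp add: ennreal_leI mult.commute m n_def)
qed (auto simp: not_le)

text \<open>The difference along a ray is at most the integral of \<open>norm x * N (t x)\<close>
  over \<open>t\<close> from \<open>\<rho> / norm x\<close> to 1. After exchanging the integrals,
  the substitution \<open>y = t x\<close> contributes \<open>t ^ - d\<close> from the volume and
  \<open>norm x = norm y / t\<close>, while \<open>norm x < R\<close> turns into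
  \<open>t > norm y / R\<close>. The remaining integral over \<open>t\<close> is the one bounded in
  \<open>radial_weight_le\<close>.\<close>

lemma radial_estimate:
  fixes f N :: "'a::euclidean_space \<Rightarrow> real"
  assumes ug: "upper_gradient f N" and \<rho>: "0 < \<rho>" "\<rho> < R"
  defines "A \<equiv> ball 0 R - cball 0 \<rho>"
  shows "(\<integral>\<^sup>+x. indicator A x * ennreal \<bar>f x - f ((\<rho> / norm x) *\<^sub>R x)\<bar> \<partial>lborel)
    \<le> (\<integral>\<^sup>+y. indicator (ball 0 R - ball 0 \<rho>) y * ennreal (R * (R / norm y) ^ (DIM('a) - 1) * N y) \<partial>lborel)"
proof -
  let ?d = "DIM('a)"
  have [measurable]: "f \<in> borel_measurable borel" "N \<in> borel_measurable borel" and N0: "\<And>x. 0 \<le> N x"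
    using upper_gradientD[OF ug] by auto
  have [measurable]: "A \<in> sets borel" by (simp add: A_def)
  have [measurable]: "ball 0 R - ball 0 \<rho> \<in> sets (borel :: 'a measure)" by simp
  \<comment> \<open>The range of \<open>t\<close> is encoded through indicators of expressions in
    \<open>t\<close> and \<open>x\<close>, so that joint measurability is immediate. Positivity of
    \<open>t\<close> is already implied by \<open>\<rho> \<le> t * norm x\<close>.\<close>
  define G :: "real \<Rightarrow> 'a \<Rightarrow> ennreal" where
    "G t x = indicator A x * indicator {\<rho>..} (t * norm x) * indicator {0<..1} t
       * ennreal (norm x * N (t *\<^sub>R x))" for t x
  have G_meas [measurable]: "(\<lambda>(t, x). G t x) \<in> borel_measurable (lborel \<Otimes>\<^sub>M lborel)"
    unfolding G_def by measurable
  have "(\<integral>\<^sup>+x. indicator A x * ennreal \<bar>f x - f ((\<rho> / norm x) *\<^sub>R x)\<bar> \<partial>lborel)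
      \<le> (\<integral>\<^sup>+x. \<integral>\<^sup>+t. G t x \<partial>lborel \<partial>lborel)"
  proof (rule nn_integral_mono)
    fix x :: 'a
    show "indicator A x * ennreal \<bar>f x - f ((\<rho> / norm x) *\<^sub>R x)\<bar> \<le> (\<integral>\<^sup>+t. G t x \<partial>lborel)"
    proof (cases "x \<in> A")
      case True
      then have x: "\<rho> < norm x" by (simp add: A_def)
      have "ennreal \<bar>f (0 + 1 *\<^sub>R x) - f (0 + (\<rho> / norm x) *\<^sub>R x)\<bar>
          \<le> (\<integral>\<^sup>+t. indicator {\<rho> / norm x..1} t * ennreal (norm x * N (0 + t *\<^sub>R x)) \<partial>lborel)"
        by (rule upper_gradientD(6)[OF ug]) (use x \<rho> in \<open>simp add: divide_le_eq\<close>)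
      also have "\<dots> = (\<integral>\<^sup>+t. G t x \<partial>lborel)"
      proof (rule nn_integral_cong)
        fix t :: real
        have "\<rho> / norm x \<le> t \<longleftrightarrow> \<rho> \<le> t * norm x" using x \<rho> by (intro pos_divide_le_eq) linarith
        moreover have "0 < t" if "\<rho> \<le> t * norm x"
        proof (rule ccontr)
          assume "\<not> 0 < t"
          then have "t * norm x \<le> 0" by (intro mult_nonpos_nonneg) auto
          then show False using that \<rho>(1) by simp
        qed
        ultimately show "indicator {\<rho> / norm x..1} t * ennreal (norm x * N (0 + t *\<^sub>R x)) = G t x"
          using True by (auto simp: G_def indicator_def)
      qed
      finally show ?thesis using True by simp
    qed simp
  qed
  also have "\<dots> = (\<integral>\<^sup>+t. \<integral>\<^sup>+x. G t x \<partial>lborel \<partial>lborel)"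
    by (rule lborel_pair.Fubini') (simp add: G_meas)
  also have "\<dots> \<le> (\<integral>\<^sup>+t. \<integral>\<^sup>+y. indicator (ball 0 R - ball 0 \<rho>) y *
      (indicator {0..} (t - norm y / R) * indicator {..1} t * ennreal (norm y / t ^ Suc ?d)) * ennreal (N y) \<partial>lborel \<partial>lborel)"
    (is "_ \<le> (\<integral>\<^sup>+t. \<integral>\<^sup>+y. ?H t y \<partial>lborel \<partial>lborel)")
  proof (rule nn_integral_mono)
    fix t :: real
    show "(\<integral>\<^sup>+x. G t x \<partial>lborel) \<le> (\<integral>\<^sup>+y. ?H t y \<partial>lborel)"
    proof (cases "0 < t \<and> t \<le> 1")
      case True
      then have t: "0 < t" "t \<le> 1" by auto
      have [measurable]: "(\<lambda>x. G t x) \<in> borel_measurable borel"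
        unfolding G_def by measurable
      have "(\<integral>\<^sup>+x. G t x \<partial>lborel) = ennreal ((1 / t) ^ ?d) * (\<integral>\<^sup>+y. G t ((1 / t) *\<^sub>R y) \<partial>lborel)"
        using nn_integral_lborel_affine[of "1 / t" "G t" 0] t by simp
      also have "\<dots> = (\<integral>\<^sup>+y. ennreal ((1 / t) ^ ?d) * G t ((1 / t) *\<^sub>R y) \<partial>lborel)"
        by (rule nn_integral_cmult[symmetric]) measurable
      also have "\<dots> \<le> (\<integral>\<^sup>+y. ?H t y \<partial>lborel)"
      proof (rule nn_integral_mono)
        fix y :: 'a
        show "ennreal ((1 / t) ^ ?d) * G t ((1 / t) *\<^sub>R y) \<le> ?H t y"
        proof (cases "(1 / t) *\<^sub>R y \<in> A \<and> \<rho> \<le> norm y")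
          case True
          then have *: "\<rho> \<le> norm y" "norm y < R * t" using t by (auto simp: A_def divide_less_eq)
          then have "norm y < R" using t \<rho> mult_left_le[of t R] by linarith
          moreover have "norm y / R \<le> t" using * \<rho> by (simp add: divide_le_eq mult.commute)
          ultimately have "?H t y = ennreal (norm y / t ^ Suc ?d) * ennreal (N y)" using t * by simp
          moreover have "ennreal ((1 / t) ^ ?d) * G t ((1 / t) *\<^sub>R y) = ennreal ((1 / t) ^ ?d) * ennreal (norm y / t * N y)"
            using t * True by (simp add: G_def)
          moreover have "(1 / t) ^ ?d * (norm y / t * N y) = norm y / t ^ Suc ?d * N y"
            using t by (simp add: power_divide)
          ultimately show ?thesis using t N0 by (simp add: ennreal_mult'[symmetric])
        next
          case False
          then show ?thesis using t by (auto simp: G_def)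
        qed
      qed
      finally show ?thesis .
    next
      case False
      then have "G t x = 0" for x by (auto simp: G_def)
      then show ?thesis by simp
    qed
  qed
  also have "\<dots> = (\<integral>\<^sup>+y. \<integral>\<^sup>+t. ?H t y \<partial>lborel \<partial>lborel)"
    by (rule lborel_pair.Fubini'[symmetric]) measurable
  also have "\<dots> \<le> (\<integral>\<^sup>+y. indicator (ball 0 R - ball 0 \<rho>) y * ennreal (R * (R / norm y) ^ (DIM('a) - 1) * N y) \<partial>lborel)"
  proof (rule nn_integral_mono)
    fix y :: 'a
    show "(\<integral>\<^sup>+t. ?H t y \<partial>lborel) \<le> indicator (ball 0 R - ball 0 \<rho>) y * ennreal (R * (R / norm y) ^ (DIM('a) - 1) * N y)"
    proof (cases "y \<in> ball 0 R - ball 0 \<rho>")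
      case True
      then have y: "0 < norm y" and R: "0 < R" using \<rho> by auto
      have "(\<integral>\<^sup>+t. ?H t y \<partial>lborel)
          = (\<integral>\<^sup>+t. (indicator {norm y / R..1} t * ennreal (norm y / t ^ Suc ?d)) * ennreal (N y) \<partial>lborel)"
        using True by (intro nn_integral_cong) (auto simp: indicator_def)
      also have "\<dots> = (\<integral>\<^sup>+t. indicator {norm y / R..1} t * ennreal (norm y / t ^ Suc ?d) \<partial>lborel) * ennreal (N y)"
        by (rule nn_integral_multc) measurable
      also have "\<dots> \<le> ennreal (R * (R / norm y) ^ (?d - 1)) * ennreal (N y)"
        by (intro mult_right_mono radial_weight_le[OF y R]) auto
      finally show ?thesis using True N0 R by (simp add: ennreal_mult')
    qed auto
  qed
  finally show ?thesis .
qed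

text \<open>For \<open>t \<le> 1 / 2\<close> one substitutes for the first endpoint of the segment, otherwise for the second.\<close>

lemma convex_segment_le:
  fixes N :: "'a::euclidean_space \<Rightarrow> real"
  assumes N [measurable]: "N \<in> borel_measurable borel"
    and K: "convex K" "K \<in> sets borel" and y: "y \<in> K" and t: "0 \<le> t" "t \<le> 1 / 2"
  shows "(\<integral>\<^sup>+x. indicator K x * ennreal (N (x + t *\<^sub>R (y - x))) \<partial>lborel)
    \<le> 2 ^ DIM('a) * (\<integral>\<^sup>+x. indicator K x * ennreal (N x) \<partial>lborel)"
proof -
  let ?c = "1 - t"
  have c: "?c \<noteq> 0" "1 / 2 \<le> ?c" using t by auto
  have [measurable]: "K \<in> sets borel" by fact
  have "(\<integral>\<^sup>+x. indicator K x * ennreal (N (x + t *\<^sub>R (y - x))) \<partial>lborel)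
      \<le> (\<integral>\<^sup>+x. indicator K (t *\<^sub>R y + ?c *\<^sub>R x) * ennreal (N (t *\<^sub>R y + ?c *\<^sub>R x)) \<partial>lborel)"
  proof (rule nn_integral_mono)
    fix x :: 'a
    have "x + t *\<^sub>R (y - x) = t *\<^sub>R y + ?c *\<^sub>R x" by (simp add: algebra_simps)
    moreover have "x \<in> K \<Longrightarrow> t *\<^sub>R y + ?c *\<^sub>R x \<in> K"
      using K(1) y t by (intro convexD) auto
    ultimately show "indicator K x * ennreal (N (x + t *\<^sub>R (y - x)))
        \<le> indicator K (t *\<^sub>R y + ?c *\<^sub>R x) * ennreal (N (t *\<^sub>R y + ?c *\<^sub>R x))"
      by (cases "x \<in> K") auto
  qed
  \<comment> \<open>The substitution costs the Jacobian \<open>(1 - t) ^ - d\<close>, which is at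
    most \<open>2 ^ d\<close> as \<open>1 - t \<ge> 1 / 2\<close>. The factor is inserted first and
    the substitution carried out next.\<close>
  also have "\<dots> \<le> 2 ^ DIM('a) * (ennreal (\<bar>?c\<bar> ^ DIM('a)) * \<dots>)"
  proof -
    have "1 \<le> 2 ^ DIM('a) * \<bar>?c\<bar> ^ DIM('a)"
      using c by (subst power_mult_distrib[symmetric]) (intro one_le_power, simp)
    then have "1 \<le> ennreal (2 ^ DIM('a) * \<bar>?c\<bar> ^ DIM('a))" by simp
    then have "1 \<le> 2 ^ DIM('a) * ennreal (\<bar>?c\<bar> ^ DIM('a))"
      by (simp add: ennreal_mult ennreal_power[symmetric] del: ennreal_power)
    from mult_right_mono[OF this] show ?thesis by (simp add: mult.assoc)
  qed
  also have "ennreal (\<bar>?c\<bar> ^ DIM('a)) * (\<integral>\<^sup>+x. indicator K (t *\<^sub>R y + ?c *\<^sub>R x) * ennreal (N (t *\<^sub>R y + ?c *\<^sub>R x)) \<partial>lborel)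
      = (\<integral>\<^sup>+x. indicator K x * ennreal (N x) \<partial>lborel)"
    by (rule nn_integral_lborel_affine[OF c(1), symmetric]) measurable
  finally show ?thesis .
qed

text \<open>Convexity keeps the segment from \<open>x\<close> to \<open>y\<close> inside
  \<open>K\<close>, so the difference is at most \<open>D\<close> times an average of
  \<open>N\<close> along it. For each fixed \<open>t\<close> the points \<open>x + t (y - x)\<close>
  are spread out enough for the double integral to be bounded by that of \<open>N\<close> times the
  volume of \<open>K\<close>. Stating it for differences avoids mean values at this stage.\<close>

lemma convex_poincare:
  fixes f N :: "'a::euclidean_space \<Rightarrow> real"
  assumes ug: "upper_gradient f N" and K: "convex K" "K \<in> sets borel"
    and D: "\<And>x y. x \<in> K \<Longrightarrow> y \<in> K \<Longrightarrow> norm (y - x) \<le> D"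
  shows "(\<integral>\<^sup>+x. \<integral>\<^sup>+y. indicator K x * indicator K y * ennreal \<bar>f y - f x\<bar> \<partial>lborel \<partial>lborel)
    \<le> ennreal D * 2 ^ DIM('a) * emeasure lborel K * (\<integral>\<^sup>+x. indicator K x * ennreal (N x) \<partial>lborel)"
proof -
  let ?I = "(\<integral>\<^sup>+x. indicator K x * ennreal (N x) \<partial>lborel)"
  have [measurable]: "f \<in> borel_measurable borel" "N \<in> borel_measurable borel" and N0: "\<And>x. 0 \<le> N x"
    using upper_gradientD[OF ug] by auto
  have [measurable]: "K \<in> sets borel" by fact
  define G :: "real \<Rightarrow> 'a \<Rightarrow> 'a \<Rightarrow> ennreal" where
    "G t x y = indicator K x * indicator K y * ennreal (N (x + t *\<^sub>R (y - x)))" for t x y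
  \<comment> \<open>Reversing the segment exchanges \<open>t\<close> and \<open>1 - t\<close>, so
    parameters up to \<open>1 / 2\<close> suffice.\<close>
  have sym: "G t x y = G (1 - t) y x" for t x y
    by (simp add: G_def algebra_simps)
  have half: "(\<integral>\<^sup>+y. \<integral>\<^sup>+x. G t x y \<partial>lborel \<partial>lborel) \<le> 2 ^ DIM('a) * emeasure lborel K * ?I"
    if t: "0 \<le> t" "t \<le> 1 / 2" for t
  proof -
    have "(\<integral>\<^sup>+y. \<integral>\<^sup>+x. G t x y \<partial>lborel \<partial>lborel) \<le> (\<integral>\<^sup>+y. (2 ^ DIM('a) * ?I) * indicator K y \<partial>lborel)"
    proof (rule nn_integral_mono)
      fix y :: 'a
      show "(\<integral>\<^sup>+x. G t x y \<partial>lborel) \<le> (2 ^ DIM('a) * ?I) * indicator K y"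
        using convex_segment_le[OF _ K _ t, of N y] by (cases "y \<in> K") (simp_all add: G_def)
    qed
    also have "\<dots> = (2 ^ DIM('a) * ?I) * emeasure lborel K"
      by (rule nn_integral_cmult_indicator) simp
    finally show ?thesis by (simp add: ac_simps)
  qed
  have swap: "(\<integral>\<^sup>+x. \<integral>\<^sup>+y. G t x y \<partial>lborel \<partial>lborel) = (\<integral>\<^sup>+y. \<integral>\<^sup>+x. G t x y \<partial>lborel \<partial>lborel)" for t
    by (rule lborel_pair.Fubini'[symmetric]) (unfold G_def, measurable)
  have all: "(\<integral>\<^sup>+x. \<integral>\<^sup>+y. G t x y \<partial>lborel \<partial>lborel) \<le> 2 ^ DIM('a) * emeasure lborel K * ?I"
    if t: "0 \<le> t" "t \<le> 1" for t
  proof (cases "t \<le> 1 / 2")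
    case True
    then show ?thesis using half[of t] t swap by simp
  next
    case False
    then have "(\<integral>\<^sup>+x. \<integral>\<^sup>+y. G (1 - t) y x \<partial>lborel \<partial>lborel) \<le> 2 ^ DIM('a) * emeasure lborel K * ?I"
      using t by (intro half) auto
    then show ?thesis using sym[of t] by simp
  qed
  have "(\<integral>\<^sup>+x. \<integral>\<^sup>+y. indicator K x * indicator K y * ennreal \<bar>f y - f x\<bar> \<partial>lborel \<partial>lborel)
      \<le> (\<integral>\<^sup>+x. \<integral>\<^sup>+y. \<integral>\<^sup>+t. indicator {0..1} t * (ennreal D * G t x y) \<partial>lborel \<partial>lborel \<partial>lborel)"
  proof (intro nn_integral_mono)
    fix x y :: 'a
    show "indicator K x * indicator K y * ennreal \<bar>f y - f x\<bar> \<le> (\<integral>\<^sup>+t. indicator {0..1} t * (ennreal D * G t x y) \<partial>lborel)"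
    proof (cases "x \<in> K \<and> y \<in> K")
      case True
      have "ennreal \<bar>f (x + 1 *\<^sub>R (y - x)) - f (x + 0 *\<^sub>R (y - x))\<bar>
          \<le> (\<integral>\<^sup>+t. indicator {0..1} t * ennreal (norm (y - x) * N (x + t *\<^sub>R (y - x))) \<partial>lborel)"
        by (rule upper_gradientD(6)[OF ug]) simp
      also have "\<dots> \<le> (\<integral>\<^sup>+t. indicator {0..1} t * (ennreal D * G t x y) \<partial>lborel)"
      proof (rule nn_integral_mono, rule mult_left_mono)
        fix t
        have "0 \<le> D" using D[of x y] True norm_ge_zero[of "y - x"] by linarith
        have "norm (y - x) * N (x + t *\<^sub>R (y - x)) \<le> D * N (x + t *\<^sub>R (y - x))"
          using True D N0 by (intro mult_right_mono) auto
        then show "ennreal (norm (y - x) * N (x + t *\<^sub>R (y - x))) \<le> ennreal D * G t x y"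
          using True \<open>0 \<le> D\<close> by (simp add: G_def ennreal_mult'[symmetric] ennreal_leI)
      qed simp
      finally show ?thesis using True by simp
    qed auto
  qed
  also have "\<dots> = (\<integral>\<^sup>+x. \<integral>\<^sup>+t. \<integral>\<^sup>+y. indicator {0..1} t * (ennreal D * G t x y) \<partial>lborel \<partial>lborel \<partial>lborel)"
    by (intro nn_integral_cong lborel_pair.Fubini') (unfold G_def, measurable)
  also have "\<dots> = (\<integral>\<^sup>+t. \<integral>\<^sup>+x. \<integral>\<^sup>+y. indicator {0..1} t * (ennreal D * G t x y) \<partial>lborel \<partial>lborel \<partial>lborel)"
    by (rule lborel_pair.Fubini') (unfold G_def, measurable)
  also have "\<dots> = (\<integral>\<^sup>+t. indicator {0..1} t * (ennreal D * (\<integral>\<^sup>+x. \<integral>\<^sup>+y. G t x y \<partial>lborel \<partial>lborel)) \<partial>lborel)"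
  proof (rule nn_integral_cong)
    fix t :: real
    have [measurable]: "G t x \<in> borel_measurable borel" for x unfolding G_def by measurable
    have [measurable]: "(\<lambda>x. \<integral>\<^sup>+y. G t x y \<partial>lborel) \<in> borel_measurable borel" unfolding G_def by measurable
    show "(\<integral>\<^sup>+x. \<integral>\<^sup>+y. indicator {0..1} t * (ennreal D * G t x y) \<partial>lborel \<partial>lborel)
        = indicator {0..1} t * (ennreal D * (\<integral>\<^sup>+x. \<integral>\<^sup>+y. G t x y \<partial>lborel \<partial>lborel))"
      by (simp add: nn_integral_cmult)
  qed
  also have "\<dots> \<le> (\<integral>\<^sup>+t. (ennreal D * (2 ^ DIM('a) * emeasure lborel K * ?I)) * indicator {0..1::real} t \<partial>lborel)"
    using all by (intro nn_integral_mono) (auto simp: indicator_def intro!: mult_left_mono)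
  also have "\<dots> = ennreal D * (2 ^ DIM('a) * emeasure lborel K * ?I) * emeasure lborel {0..1::real}"
    by (rule nn_integral_cmult_indicator) simp
  finally show ?thesis by (simp add: mult.assoc)
qed

section \<open>Smooth functions\<close>

lemma gradient_inner:
  assumes "f differentiable (at x)"
  shows "frechet_derivative f (at x) h = gradient f x \<bullet> h"
proof -
  have lin: "linear (frechet_derivative f (at x))"
    using assms by (rule linear_frechet_derivative)
  have "frechet_derivative f (at x) h = frechet_derivative f (at x) (\<Sum>i\<in>UNIV. h $ i *\<^sub>R axis i 1)"
    by (simp add: basis_expansion scalar_mult_eq_scaleR[symmetric])
  also have "\<dots> = (\<Sum>i\<in>UNIV. h $ i * frechet_derivative f (at x) (axis i 1))"
    using lin by (simp add: linear_sum linear_scale)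
  finally show ?thesis by (simp add: gradient_def inner_vec_def mult.commute)
qed

lemma has_derivative_gradient:
  assumes "f differentiable (at x)"
  shows "(f has_derivative (\<lambda>h. gradient f x \<bullet> h)) (at x)"
proof -
  have "(f has_derivative frechet_derivative f (at x)) (at x)"
    using assms by (simp add: frechet_derivative_works)
  moreover have "frechet_derivative f (at x) = (\<lambda>h. gradient f x \<bullet> h)"
    using gradient_inner[OF assms] by auto
  ultimately show ?thesis by simp
qed

lemma gradient_eqI:
  assumes "(f has_derivative (\<lambda>h. g \<bullet> h)) (at x)"
  shows "gradient f x = g"
  using frechet_derivative_at[OF assms]
  by (simp add: gradient_def vec_eq_iff inner_axis flip: fun_eq_iff) (metis inner_axis inner_real_def mult.right_neutral)

lemma has_derivative_mult_inner:
  assumes "f differentiable (at x)" "g differentiable (at x)"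
  shows "((\<lambda>x. f x * g x) has_derivative (\<lambda>h. (f x *\<^sub>R gradient g x + g x *\<^sub>R gradient f x) \<bullet> h)) (at x)"
  using has_derivative_mult[OF has_derivative_gradient[OF assms(1)] has_derivative_gradient[OF assms(2)]]
  by (simp add: inner_add_left mult.commute)

lemma gradient_mult:
  "f differentiable (at x) \<Longrightarrow> g differentiable (at x) \<Longrightarrow>
    gradient (\<lambda>x. f x * g x) x = f x *\<^sub>R gradient g x + g x *\<^sub>R gradient f x"
  by (rule gradient_eqI) (rule has_derivative_mult_inner)

lemma gradient_add:
  "f differentiable (at x) \<Longrightarrow> g differentiable (at x) \<Longrightarrow>
    gradient (\<lambda>x. f x + g x) x = gradient f x + gradient g x"
  by (rule gradient_eqI) (simp add: inner_add_left has_derivative_add has_derivative_gradient)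

lemma gradient_const: "gradient (\<lambda>x. c) x = 0"
  by (rule gradient_eqI) simp

lemma times_cont_diff_continuous: "times_cont_diff m f \<Longrightarrow> continuous_on UNIV f"
  by (cases m) (auto intro!: continuous_at_imp_continuous_on differentiable_imp_continuous_within)

lemma times_cont_diff_SucD: "times_cont_diff (Suc m) f \<Longrightarrow> times_cont_diff m f"
proof (induction m arbitrary: f)
  case 0
  then show ?case using times_cont_diff_continuous[of "Suc 0" f] by simp
qed auto

lemma times_cont_diff_const: "times_cont_diff m (\<lambda>x. c)"
proof (induction m arbitrary: c)
  case (Suc m)
  then show ?case by (simp add: gradient_const)
qed simp

lemma times_cont_diff_add:
  "times_cont_diff m f \<Longrightarrow> times_cont_diff m g \<Longrightarrow> times_cont_diff m (\<lambda>x. f x + g x)"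
proof (induction m arbitrary: f g)
  case 0
  then show ?case by (auto intro: continuous_intros)
next
  case (Suc m)
  then show ?case by (simp add: gradient_add)
qed

lemma times_cont_diff_mult:
  "times_cont_diff m f \<Longrightarrow> times_cont_diff m g \<Longrightarrow> times_cont_diff m (\<lambda>x. f x * g x)"
proof (induction m arbitrary: f g)
  case 0
  then show ?case by (auto intro: continuous_intros)
next
  case (Suc m)
  have "times_cont_diff m f" "times_cont_diff m g" using Suc.prems times_cont_diff_SucD by blast+
  with Suc show ?case by (simp add: gradient_mult times_cont_diff_add)
qed

lemma smooth_mult: "smooth f \<Longrightarrow> smooth g \<Longrightarrow> smooth (\<lambda>x. f x * g x)"
  by (simp add: smooth_def times_cont_diff_mult)

lemma smooth_prod: "(\<And>i. i \<in> I \<Longrightarrow> smooth (f i)) \<Longrightarrow> smooth (\<lambda>x. \<Prod>i\<in>I. f i x)"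
proof (induction I rule: infinite_finite_induct)
  case (insert i I)
  then show ?case by (simp add: smooth_mult)
qed (simp_all add: smooth_def times_cont_diff_const)

lemma smoothD:
  assumes "smooth f"
  shows "continuous_on UNIV f" "f differentiable (at x)" "continuous_on UNIV (\<lambda>x. gradient f x $ i)"
    "continuous_on UNIV (gradient f)" "f \<in> borel_measurable borel" "gradient f \<in> borel_measurable borel"
proof -
  have "times_cont_diff (Suc 0) f" using assms by (simp add: smooth_def)
  then show "f differentiable (at x)" "continuous_on UNIV (\<lambda>x. gradient f x $ i)" by auto
  show c: "continuous_on UNIV f"
    using \<open>times_cont_diff (Suc 0) f\<close> by (rule times_cont_diff_continuous)
  have "continuous_on UNIV (\<lambda>x. \<chi> i. gradient f x $ i)"
    using \<open>times_cont_diff (Suc 0) f\<close> by (intro continuous_on_vec_lambda) auto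
  then show g: "continuous_on UNIV (gradient f)" by simp
  show "f \<in> borel_measurable borel" "gradient f \<in> borel_measurable borel"
    using c g by (auto intro: borel_measurable_continuous_onI)
qed

lemma has_derivative_along_line:
  assumes "smooth f"
  shows "((\<lambda>t. f (p + t *\<^sub>R v)) has_real_derivative (gradient f (p + t *\<^sub>R v) \<bullet> v)) (at t)"
proof -
  have "((\<lambda>t. f (p + t *\<^sub>R v)) has_derivative (\<lambda>s. gradient f (p + t *\<^sub>R v) \<bullet> (s *\<^sub>R v))) (at t)"
    by (rule has_derivative_compose[OF _ has_derivative_gradient[OF smoothD(2)[OF assms]]])
      (auto intro!: derivative_eq_intros)
  then show ?thesis
    unfolding has_field_derivative_def by (rule has_derivative_eq_rhs) (auto simp: mult.commute)
qed

lemma continuous_gradient_along_line: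
  fixes f :: "real ^ 'n \<Rightarrow> real"
  assumes "smooth f"
  shows "continuous_on S (\<lambda>t. gradient f (p + t *\<^sub>R v) \<bullet> v)"
  by (intro continuous_on_inner continuous_on_const continuous_on_compose2[OF smoothD(4)[OF assms]] continuous_intros) auto

lemma upper_gradient_smooth:
  fixes f :: "real ^ 'n \<Rightarrow> real"
  assumes f: "smooth f" and N: "continuous_on UNIV N" "\<And>x. norm (gradient f x) \<le> N x"
  shows "upper_gradient f N"
  unfolding upper_gradient_def
proof (intro conjI allI impI)
  show "continuous_on UNIV f" using f by (rule smoothD)
  show "continuous_on UNIV N" by fact
  show N0: "0 \<le> N x" for x using N(2)[of x] norm_ge_zero order_trans by blast
  fix p v :: "real ^ 'n" and a b :: real assume ab: "a \<le> b"
  let ?g = "\<lambda>t. gradient f (p + t *\<^sub>R v) \<bullet> v"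
  have int: "integrable lborel (\<lambda>t. indicator {a..b} t *\<^sub>R ?g t)"
    by (rule borel_integrable_compact) (auto intro: continuous_gradient_along_line f)
  have "f (p + b *\<^sub>R v) - f (p + a *\<^sub>R v) = (LINT t|lborel. indicator {a..b} t *\<^sub>R ?g t)"
    by (rule integral_FTC_Icc[OF ab, symmetric])
      (use has_derivative_along_line[OF f] continuous_gradient_along_line[OF f] in
        \<open>auto simp: has_real_derivative_iff_has_vector_derivative[symmetric] intro: has_field_derivative_at_within\<close>)
  then have "ennreal \<bar>f (p + b *\<^sub>R v) - f (p + a *\<^sub>R v)\<bar> \<le> (\<integral>\<^sup>+t. ennreal (norm (indicator {a..b} t *\<^sub>R ?g t)) \<partial>lborel)"
    using integral_norm_bound_ennreal[OF int] by simp
  also have "\<dots> \<le> (\<integral>\<^sup>+t. indicator {a..b} t * ennreal (norm v * N (p + t *\<^sub>R v)) \<partial>lborel)"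
  proof (rule nn_integral_mono)
    fix t
    have "\<bar>?g t\<bar> \<le> norm (gradient f (p + t *\<^sub>R v)) * norm v" by (rule Cauchy_Schwarz_ineq2)
    also have "\<dots> \<le> norm v * N (p + t *\<^sub>R v)" by (simp add: mult.commute mult_left_mono N)
    finally show "ennreal (norm (indicator {a..b} t *\<^sub>R ?g t)) \<le> indicator {a..b} t * ennreal (norm v * N (p + t *\<^sub>R v))"
      by (auto simp: indicator_def ennreal_leI)
  qed
  finally show "ennreal \<bar>f (p + b *\<^sub>R v) - f (p + a *\<^sub>R v)\<bar>
      \<le> (\<integral>\<^sup>+t. indicator {a..b} t * ennreal (norm v * N (p + t *\<^sub>R v)) \<partial>lborel)" .
qed

text \<open>The product-rule bound is taken instead of the norm of the gradient of the product: each
  of its summands is a product of two factors that converge separately in L^2 when \<open>f\<close>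
  and \<open>g\<close> are approximants.\<close>

lemma upper_gradient_smooth_mult:
  assumes f: "smooth f" and g: "smooth g"
  shows "upper_gradient (\<lambda>x. f x * g x) (\<lambda>x. \<bar>f x\<bar> * norm (gradient g x) + \<bar>g x\<bar> * norm (gradient f x))"
proof (rule upper_gradient_smooth[OF smooth_mult[OF f g]])
  show "continuous_on UNIV (\<lambda>x. \<bar>f x\<bar> * norm (gradient g x) + \<bar>g x\<bar> * norm (gradient f x))"
    using smoothD[OF f] smoothD[OF g] by (intro continuous_intros)
  show "norm (gradient (\<lambda>x. f x * g x) x) \<le> \<bar>f x\<bar> * norm (gradient g x) + \<bar>g x\<bar> * norm (gradient f x)" for x
    using smoothD(2)[OF f] smoothD(2)[OF g]
    by (simp add: gradient_mult) (metis norm_scaleR norm_triangle_ineq)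
qed

section \<open>Bump functions\<close>

text \<open>The polynomial \<open>p\<close> makes the family closed under differentiation, which
  reduces smoothness to one induction. The classical function \<open>exp (- 1 / t)\<close> is the
  case \<open>p = [:1:]\<close>.\<close>

definition flat :: "real poly \<Rightarrow> real \<Rightarrow> real" where
  "flat p t = (if 0 < t then poly p (1 / t) * exp (- (1 / t)) else 0)"

lemma poly_exp_tendsto_0:
  fixes p :: "real poly"
  shows "((\<lambda>s. poly p s * exp (- s)) \<longlongrightarrow> 0) at_top"
proof -
  have "((\<lambda>s. \<Sum>i\<le>degree p. coeff p i * (s ^ i / exp s)) \<longlongrightarrow> (\<Sum>i\<le>degree p. coeff p i * 0)) at_top"
    by (intro tendsto_sum tendsto_mult tendsto_const tendsto_power_div_exp_0)
  then show ?thesis by (simp add: poly_altdef sum_distrib_right exp_minus divide_inverse mult.assoc)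
qed

lemma flat_tendsto_0: "((\<lambda>t. flat p t) \<longlongrightarrow> 0) (at 0)"
proof -
  have "((\<lambda>t. poly p (1 / t) * exp (- (1 / t))) \<longlongrightarrow> 0) (at_right 0)"
    using filterlim_compose[OF poly_exp_tendsto_0 filterlim_inverse_at_top_right] by (simp add: inverse_eq_divide)
  then have "((\<lambda>t. flat p t) \<longlongrightarrow> 0) (at_right 0)"
    by (rule Lim_transform_eventually) (auto simp: flat_def eventually_at_filter)
  moreover have "((\<lambda>t. flat p t) \<longlongrightarrow> 0) (at_left 0)"
    by (rule tendsto_eventually) (auto simp: flat_def eventually_at_filter)
  ultimately show ?thesis by (simp add: filterlim_split_at)
qed

lemma has_real_derivative_flat:
  "(flat p has_real_derivative flat ([:0, 0, 1:] * (p - pderiv p)) t) (at t)"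
proof -
  consider "t < 0" | "t = 0" | "0 < t" by linarith
  then show ?thesis
  proof cases
    case 1
    have "(flat p has_real_derivative 0) (at t)"
    proof (rule has_field_derivative_transform_within_open[where f = "\<lambda>_. 0" and S = "{..<0}"])
      show "(0::real) = flat p s" if "s \<in> {..<0}" for s using that by (simp add: flat_def)
    qed (use 1 in auto)
    then show ?thesis using 1 by (simp add: flat_def)
  next
    case 2
    \<comment> \<open>Dividing by \<open>h\<close> multiplies the polynomial in \<open>1 / h\<close>
      by its variable, so the difference quotient at 0 is again of the form \<open>flat\<close> and
      tends to 0.\<close>
    have "((\<lambda>h. flat ([:0, 1:] * p) h) \<longlongrightarrow> 0) (at 0)" by (rule flat_tendsto_0)
    moreover have "flat ([:0, 1:] * p) h = (flat p (0 + h) - flat p 0) / h" for h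
      by (simp add: flat_def)
    ultimately have "(flat p has_real_derivative 0) (at 0)" by (simp add: DERIV_def)
    then show ?thesis using 2 by (simp add: flat_def)
  next
    case 3
    have "((\<lambda>t. poly p (1 / t) * exp (- (1 / t))) has_real_derivative
        poly ([:0, 0, 1:] * (p - pderiv p)) (1 / t) * exp (- (1 / t))) (at t)"
      using 3 by (auto intro!: derivative_eq_intros simp: power2_eq_square algebra_simps)
    then have "(flat p has_real_derivative poly ([:0, 0, 1:] * (p - pderiv p)) (1 / t) * exp (- (1 / t))) (at t)"
      by (rule has_field_derivative_transform_within_open[where S = "{0<..}"]) (use 3 in \<open>auto simp: flat_def\<close>)
    then show ?thesis using 3 by (simp add: flat_def)
  qed
qed

text \<open>Induction on the order for all \<open>p\<close> at once: a partial derivative is either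
  0 or a multiple of such a function with another polynomial. Functions of one coordinate are
  enough, since bumps on boxes are products of them.\<close>

lemma smooth_flat_coordinate: "smooth (\<lambda>x::real ^ 'n. flat p (c * x $ i + d))"
proof -
  have "times_cont_diff m (\<lambda>x::real ^ 'n. flat p (c * x $ i + d))" for m
  proof (induction m arbitrary: p)
    case 0
    have "continuous_on UNIV (flat p)"
      by (intro continuous_at_imp_continuous_on ballI) (rule DERIV_isCont[OF has_real_derivative_flat])
    then show ?case
      by (auto intro!: continuous_on_compose2[of UNIV "flat p"] continuous_intros)
  next
    case (Suc m)
    let ?q = "[:0, 0, 1:] * (p - pderiv p)"
    have der: "((\<lambda>x. flat p (c * x $ i + d)) has_derivative (\<lambda>h. (flat ?q (c * x $ i + d) * c) *\<^sub>R axis i 1 \<bullet> h)) (at x)"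
      for x :: "real ^ 'n"
    proof -
      have "((\<lambda>x::real ^ 'n. c * x $ i + d) has_derivative (\<lambda>h. c * h $ i)) (at x)"
        by (auto intro!: derivative_eq_intros bounded_linear.has_derivative[OF bounded_linear_vec_nth])
      from has_derivative_compose[OF this has_real_derivative_flat[unfolded has_field_derivative_def]]
      show ?thesis by (simp add: inner_axis' mult_ac)
    qed
    have "times_cont_diff m (\<lambda>x. gradient (\<lambda>x. flat p (c * x $ i + d)) x $ k)" for k
    proof -
      have "gradient (\<lambda>x::real ^ 'n. flat p (c * x $ i + d)) x $ k = flat ?q (c * x $ i + d) * (c * (if k = i then 1 else 0))"
        for x :: "real ^ 'n"
        by (simp add: gradient_eqI[OF der] axis_def)
      then show ?thesis
        using times_cont_diff_mult[OF Suc.IH[of ?q] times_cont_diff_const[of m "c * (if k = i then 1 else 0)"]] by simp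
    qed
    then show ?case using der by (auto simp: differentiable_def)
  qed
  then show ?thesis by (simp add: smooth_def)
qed

text \<open>For \<open>j \<rightarrow> \<infinity>\<close> these functions increase to the indicator of the open box.\<close>

definition box_bump :: "real ^ 'n \<Rightarrow> real ^ 'n \<Rightarrow> nat \<Rightarrow> real ^ 'n \<Rightarrow> real" where
  "box_bump a b j x = (\<Prod>i\<in>UNIV. flat [:1:] (real j * x $ i + - (real j * a $ i)) * flat [:1:] (- real j * x $ i + real j * b $ i))"

lemma flat_bounds: "0 \<le> flat [:1:] t" "flat [:1:] t \<le> 1"
  by (auto simp: flat_def)

lemma box_bump_bounds: "0 \<le> box_bump a b j x" "box_bump a b j x \<le> 1"
  unfolding box_bump_def by (auto intro!: prod_nonneg prod_le_1 mult_nonneg_nonneg mult_le_one flat_bounds)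

lemma box_bump_eq_0: "x \<notin> box a b \<Longrightarrow> box_bump a b j x = 0"
proof -
  assume "x \<notin> box a b"
  then obtain i where "x $ i \<le> a $ i \<or> b $ i \<le> x $ i" by (auto simp: mem_box_cart not_less)
  then have "real j * x $ i + - (real j * a $ i) \<le> 0 \<or> - real j * x $ i + real j * b $ i \<le> 0"
    by (auto intro: mult_left_mono)
  then have "flat [:1:] (real j * x $ i + - (real j * a $ i)) * flat [:1:] (- real j * x $ i + real j * b $ i) = 0"
    unfolding flat_def by auto
  then show ?thesis unfolding box_bump_def by (intro prod_zero) auto
qed

lemma flat_tendsto_1: "0 < c \<Longrightarrow> (\<lambda>j. flat [:1:] (real j * c)) \<longlonglongrightarrow> 1"
proof -
  assume c: "0 < c"
  have "filterlim (\<lambda>j. real j * c) at_top sequentially"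
    by (rule filterlim_at_top_mult_tendsto_pos[OF tendsto_const c filterlim_real_sequentially])
  then have "(\<lambda>j. exp (- (inverse (real j * c)))) \<longlonglongrightarrow> exp (- 0)"
    by (intro tendsto_intros tendsto_inverse_0_at_top)
  then have "(\<lambda>j. exp (- (1 / (real j * c)))) \<longlonglongrightarrow> 1" by (simp add: inverse_eq_divide)
  then show ?thesis
    by (rule Lim_transform_eventually)
      (use c in \<open>auto simp: flat_def eventually_sequentially intro!: exI[of _ 1]\<close>)
qed

lemma box_bump_tendsto: "(\<lambda>j. box_bump a b j x) \<longlonglongrightarrow> indicator (box a b) x"
proof (cases "x \<in> box a b")
  case True
  have "(\<lambda>j. \<Prod>i\<in>UNIV. flat [:1:] (real j * (x $ i - a $ i)) * flat [:1:] (real j * (b $ i - x $ i))) \<longlonglongrightarrow> (\<Prod>i\<in>(UNIV::'a set). 1 * 1)"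
    using True by (intro tendsto_prod tendsto_mult flat_tendsto_1) (auto simp: mem_box_cart)
  then show ?thesis using True by (simp add: box_bump_def algebra_simps)
qed (simp add: box_bump_eq_0)

lemma test_function_box_bump:
  assumes "cbox a b \<subseteq> D"
  shows "test_function D (box_bump a b j)"
proof -
  have "smooth (box_bump a b j)"
    unfolding box_bump_def by (intro smooth_prod smooth_mult smooth_flat_coordinate)
  moreover have "closure {x. box_bump a b j x \<noteq> 0} \<subseteq> cbox a b"
    by (rule closure_minimal) (use box_bump_eq_0[of _ a b j] box_subset_cbox in auto)
  moreover from this have "compact (closure {x. box_bump a b j x \<noteq> 0})"
    by (metis closed_closure compact_cbox compact_Int_closed inf.absorb2 inf.commute)
  ultimately show ?thesis using assms by (auto simp: test_function_def)
qed

section \<open>Square integrable functions\<close>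

definition l2norm :: "'a measure \<Rightarrow> ('a \<Rightarrow> 'b::euclidean_space) \<Rightarrow> real" where
  "l2norm M f = sqrt (LINT x|M. (norm (f x))\<^sup>2)"

lemma l2norm_nonneg [simp]: "0 \<le> l2norm M f"
  by (simp add: l2norm_def)

lemma l2norm_power2: "(l2norm M f)\<^sup>2 = (LINT x|M. (norm (f x))\<^sup>2)"
  by (simp add: l2norm_def)

lemma square_integrable_measurable: "square_integrable M f \<Longrightarrow> f \<in> borel_measurable M"
  by (simp add: square_integrable_def)

lemma square_integrable_norm: "square_integrable M f \<Longrightarrow> square_integrable M (\<lambda>x. norm (f x))"
  by (auto simp: square_integrable_def)

lemma square_integrable_power2:
  fixes f :: "'a \<Rightarrow> real"
  shows "square_integrable M f \<Longrightarrow> integrable M (\<lambda>x. (f x)\<^sup>2)"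
  by (simp add: square_integrable_def)

lemma integrable_norm_mult:
  assumes f: "square_integrable M f" and g: "square_integrable M g"
  shows "integrable M (\<lambda>x. norm (f x) * norm (g x))"
proof (rule Bochner_Integration.integrable_bound)
  show "integrable M (\<lambda>x. (norm (f x))\<^sup>2 + (norm (g x))\<^sup>2)"
    using f g by (auto simp: square_integrable_def)
  show "(\<lambda>x. norm (f x) * norm (g x)) \<in> borel_measurable M"
    using f g by (auto simp: square_integrable_def)
  have "norm (norm (f x) * norm (g x)) \<le> norm ((norm (f x))\<^sup>2 + (norm (g x))\<^sup>2)" for x
  proof -
    have "0 \<le> norm (f x) * norm (g x)" by simp
    then have "norm (f x) * norm (g x) \<le> (norm (f x))\<^sup>2 + (norm (g x))\<^sup>2"
      using sum_squares_bound[of "norm (f x)" "norm (g x)"] by linarith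
    then show ?thesis by (simp add: abs_mult)
  qed
  then show "AE x in M. norm (norm (f x) * norm (g x)) \<le> norm ((norm (f x))\<^sup>2 + (norm (g x))\<^sup>2)" by simp
qed

lemma integrable_mult_square_integrable:
  fixes f g :: "'a \<Rightarrow> real"
  assumes f: "square_integrable M f" and g: "square_integrable M g"
  shows "integrable M (\<lambda>x. f x * g x)"
  by (rule Bochner_Integration.integrable_bound[OF integrable_norm_mult[OF f g]])
    (use f g in \<open>auto simp: square_integrable_def abs_mult\<close>)

lemma integrable_bounded_mult:
  fixes f w :: "'a \<Rightarrow> real"
  assumes f: "integrable M f" and w: "w \<in> borel_measurable M" "\<And>x. \<bar>w x\<bar> \<le> C"
  shows "integrable M (\<lambda>x. w x * f x)"
proof (rule Bochner_Integration.integrable_bound[OF integrable_mult_right[OF integrable_abs[OF f], of C]])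
  have "\<bar>w x\<bar> * \<bar>f x\<bar> \<le> \<bar>C\<bar> * \<bar>f x\<bar>" for x
    by (rule mult_right_mono) (use w(2)[of x] in auto)
  then show "AE x in M. norm (w x * f x) \<le> norm (C * \<bar>f x\<bar>)" by (simp add: abs_mult)
qed (use f w in auto)

lemma l2norm_cauchy_schwarz:
  assumes f: "square_integrable M f" and g: "square_integrable M g"
  shows "(LINT x|M. norm (f x) * norm (g x)) \<le> l2norm M f * l2norm M g"
proof -
  let ?F = "LINT x|M. (norm (f x))\<^sup>2" and ?G = "LINT x|M. (norm (g x))\<^sup>2" and ?I = "LINT x|M. norm (f x) * norm (g x)"
  have int: "integrable M (\<lambda>x. (norm (f x))\<^sup>2)" "integrable M (\<lambda>x. (norm (g x))\<^sup>2)"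
    using f g by (auto simp: square_integrable_def)
  note fg = integrable_norm_mult[OF f g]
  have I0: "0 \<le> ?I" "0 \<le> ?F" "0 \<le> ?G" by simp_all
  have quad: "2 * t * ?I \<le> t\<^sup>2 * ?F + ?G" for t
  proof -
    have "0 \<le> (LINT x|M. (t * norm (f x) - norm (g x))\<^sup>2)" by simp
    also have "\<dots> = (LINT x|M. t\<^sup>2 * (norm (f x))\<^sup>2 - (2 * t) * (norm (f x) * norm (g x)) + (norm (g x))\<^sup>2)"
      by (intro Bochner_Integration.integral_cong) (auto simp: power2_diff power_mult_distrib)
    also have "\<dots> = t\<^sup>2 * ?F - 2 * t * ?I + ?G"
      using int fg by simp
    finally show ?thesis by simp
  qed
  have "?I\<^sup>2 \<le> ?F * ?G"
  proof (cases "?F = 0")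
    case True
    have "?I \<le> 0"
    proof (rule ccontr)
      assume "\<not> ?I \<le> 0"
      then have "2 * ((?G + 1) / ?I) * ?I = 2 * (?G + 1)" by simp
      then show False using quad[of "(?G + 1) / ?I"] True I0 by simp
    qed
    then show ?thesis using True I0 by simp
  next
    case False
    then have "0 < ?F" using I0(2) by (metis order_le_less)
    then show ?thesis using quad[of "?I / ?F"] by (simp add: field_simps power2_eq_square)
  qed
  then have "sqrt (?I\<^sup>2) \<le> sqrt (?F * ?G)" by (rule real_sqrt_le_mono)
  then show ?thesis using I0 by (simp add: l2norm_def real_sqrt_mult)
qed

lemma integral_mult_le_l2norm:
  fixes f g :: "'a \<Rightarrow> real"
  assumes f: "square_integrable M f" and g: "square_integrable M g"
  shows "\<bar>LINT x|M. f x * g x\<bar> \<le> l2norm M f * l2norm M g"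
proof -
  have "\<bar>LINT x|M. f x * g x\<bar> \<le> (LINT x|M. \<bar>f x * g x\<bar>)" by simp
  also have "\<dots> \<le> l2norm M f * l2norm M g"
    using l2norm_cauchy_schwarz[OF f g] by (simp add: abs_mult)
  finally show ?thesis .
qed

lemma square_integrable_add:
  assumes f: "square_integrable M f" and g: "square_integrable M g"
  shows "square_integrable M (\<lambda>x. f x + g x)"
  unfolding square_integrable_def
proof
  have m [measurable]: "f \<in> borel_measurable M" "g \<in> borel_measurable M" using f g by (auto simp: square_integrable_def)
  show "(\<lambda>x. f x + g x) \<in> borel_measurable M" by measurable
  show "integrable M (\<lambda>x. (norm (f x + g x))\<^sup>2)"
  proof (rule Bochner_Integration.integrable_bound)
    show "integrable M (\<lambda>x. 2 * (norm (f x))\<^sup>2 + 2 * (norm (g x))\<^sup>2)"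
      using f g by (auto simp: square_integrable_def)
    have "(norm (f x + g x))\<^sup>2 \<le> 2 * (norm (f x))\<^sup>2 + 2 * (norm (g x))\<^sup>2" for x
    proof -
      have "(norm (f x + g x))\<^sup>2 \<le> (norm (f x) + norm (g x))\<^sup>2"
        by (intro power_mono norm_triangle_ineq) simp
      also have "\<dots> \<le> 2 * (norm (f x))\<^sup>2 + 2 * (norm (g x))\<^sup>2"
        using sum_squares_bound[of "norm (f x)" "norm (g x)"] by (simp add: power2_sum)
      finally show ?thesis .
    qed
    then show "AE x in M. norm ((norm (f x + g x))\<^sup>2) \<le> norm (2 * (norm (f x))\<^sup>2 + 2 * (norm (g x))\<^sup>2)" by simp
  qed measurable
qed

lemma square_integrable_scaleR:
  "square_integrable M f \<Longrightarrow> square_integrable M (\<lambda>x. c *\<^sub>R f x)"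
  by (auto simp: square_integrable_def power_mult_distrib)

lemma square_integrable_cmult:
  fixes f :: "'a \<Rightarrow> real"
  shows "square_integrable M f \<Longrightarrow> square_integrable M (\<lambda>x. c * f x)"
  using square_integrable_scaleR[of M f c] by simp

lemma square_integrable_diff:
  assumes "square_integrable M f" "square_integrable M g"
  shows "square_integrable M (\<lambda>x. f x - g x)"
  using square_integrable_add[OF assms(1) square_integrable_scaleR[OF assms(2), of "-1"]] by simp

lemma square_integrable_bounded_mult:
  fixes f w :: "'a \<Rightarrow> real"
  assumes f: "square_integrable M f" and w: "w \<in> borel_measurable M" "\<And>x. \<bar>w x\<bar> \<le> C"
  shows "square_integrable M (\<lambda>x. w x * f x)"
  unfolding square_integrable_def
proof
  show "(\<lambda>x. w x * f x) \<in> borel_measurable M" using f w by (auto simp: square_integrable_def)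
  have "integrable M (\<lambda>x. (w x)\<^sup>2 * (f x)\<^sup>2)"
  proof (rule integrable_bounded_mult[where C = "C\<^sup>2"])
    show "\<bar>(w x)\<^sup>2\<bar> \<le> C\<^sup>2" for x
      using power_mono[OF w(2)[of x], of 2] by simp
  qed (use f w in \<open>auto simp: square_integrable_def\<close>)
  then show "integrable M (\<lambda>x. (norm (w x * f x))\<^sup>2)" by (simp add: power_mult_distrib)
qed

text \<open>The difference of the products is expanded into three terms, each with a factor that is
  small in L^2. This carries the cell estimates from smooth approximants over to \<open>H1\<close>
  functions and their traces; the bounded \<open>w\<close> stands for indicators of regions.\<close>

lemma integral_mult_tendsto:
  fixes a b w :: "'a \<Rightarrow> real"
  assumes a: "\<And>j. square_integrable M (aj j)" "square_integrable M a"
      "(\<lambda>j. l2norm M (\<lambda>x. aj j x - a x)) \<longlonglongrightarrow> 0"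
    and b: "\<And>j. square_integrable M (bj j)" "square_integrable M b"
      "(\<lambda>j. l2norm M (\<lambda>x. bj j x - b x)) \<longlonglongrightarrow> 0"
    and w: "w \<in> borel_measurable M" "\<And>x. \<bar>w x\<bar> \<le> C"
  shows "(\<lambda>j. LINT x|M. w x * (aj j x * bj j x)) \<longlonglongrightarrow> (LINT x|M. w x * (a x * b x))"
proof -
  let ?A = "\<lambda>j x. aj j x - a x" and ?B = "\<lambda>j x. bj j x - b x"
  have A: "square_integrable M (?A j)" and B: "square_integrable M (?B j)" for j
    using a b by (auto intro: square_integrable_diff)
  note W = square_integrable_bounded_mult[OF _ w]
  have eq: "(LINT x|M. w x * (aj j x * bj j x)) - (LINT x|M. w x * (a x * b x))
      = (LINT x|M. (w x * ?A j x) * ?B j x) + (LINT x|M. ?A j x * (w x * b x)) + (LINT x|M. (w x * a x) * ?B j x)" for j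
  proof -
    note i0 = integrable_bounded_mult[OF integrable_mult_square_integrable[OF a(2) b(2)] w]
    note i1 = integrable_mult_square_integrable[OF W[OF A[of j]] B[of j]]
    note i2 = integrable_mult_square_integrable[OF A[of j] W[OF b(2)]]
    note i3 = integrable_mult_square_integrable[OF W[OF a(2)] B[of j]]
    have "(LINT x|M. w x * (aj j x * bj j x))
        = (LINT x|M. w x * (a x * b x) + ((w x * ?A j x) * ?B j x + ?A j x * (w x * b x) + (w x * a x) * ?B j x))"
      by (intro Bochner_Integration.integral_cong) (auto simp: algebra_simps)
    also have "\<dots> = (LINT x|M. w x * (a x * b x)) + (LINT x|M. (w x * ?A j x) * ?B j x + ?A j x * (w x * b x) + (w x * a x) * ?B j x)"
      by (intro Bochner_Integration.integral_add Bochner_Integration.integrable_add i0 i1 i2 i3)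
    also have "(LINT x|M. (w x * ?A j x) * ?B j x + ?A j x * (w x * b x) + (w x * a x) * ?B j x)
        = (LINT x|M. (w x * ?A j x) * ?B j x + ?A j x * (w x * b x)) + (LINT x|M. (w x * a x) * ?B j x)"
      by (intro Bochner_Integration.integral_add Bochner_Integration.integrable_add i1 i2 i3)
    also have "(LINT x|M. (w x * ?A j x) * ?B j x + ?A j x * (w x * b x))
        = (LINT x|M. (w x * ?A j x) * ?B j x) + (LINT x|M. ?A j x * (w x * b x))"
      by (intro Bochner_Integration.integral_add i1 i2)
    finally show ?thesis by linarith
  qed
  have C0: "0 \<le> C" using w(2)[of undefined] by linarith
  have WA: "l2norm M (\<lambda>x. w x * ?A j x) \<le> C * l2norm M (?A j)" for j
  proof -
    have "(LINT x|M. (norm (w x * ?A j x))\<^sup>2) \<le> (LINT x|M. C\<^sup>2 * (norm (?A j x))\<^sup>2)"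
    proof (rule integral_mono)
      show "integrable M (\<lambda>x. (norm (w x * ?A j x))\<^sup>2)" using W[OF A[of j]] by (simp add: square_integrable_def)
      show "integrable M (\<lambda>x. C\<^sup>2 * (norm (?A j x))\<^sup>2)" using A[of j] by (simp add: square_integrable_def)
      show "(norm (w x * ?A j x))\<^sup>2 \<le> C\<^sup>2 * (norm (?A j x))\<^sup>2" for x
        using power_mono[OF w(2)[of x], of 2] by (simp add: power_mult_distrib mult_right_mono)
    qed
    then have "l2norm M (\<lambda>x. w x * ?A j x) \<le> sqrt (C\<^sup>2 * (LINT x|M. (norm (?A j x))\<^sup>2))"
      unfolding l2norm_def by (intro real_sqrt_le_mono) simp
    then show ?thesis using C0 by (simp add: l2norm_def real_sqrt_mult)
  qed
  have bound: "norm ((LINT x|M. w x * (aj j x * bj j x)) - (LINT x|M. w x * (a x * b x)))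
      \<le> C * l2norm M (?A j) * l2norm M (?B j) + l2norm M (?A j) * l2norm M (\<lambda>x. w x * b x)
        + l2norm M (\<lambda>x. w x * a x) * l2norm M (?B j)" for j
  proof -
    have "\<bar>LINT x|M. (w x * ?A j x) * ?B j x\<bar> \<le> C * l2norm M (?A j) * l2norm M (?B j)"
      using integral_mult_le_l2norm[OF W[OF A] B] mult_right_mono[OF WA l2norm_nonneg] by (rule order_trans)
    moreover note integral_mult_le_l2norm[OF A[of j] W[OF b(2)]] integral_mult_le_l2norm[OF W[OF a(2)] B[of j]]
    ultimately show ?thesis unfolding eq real_norm_def by linarith
  qed
  have "(\<lambda>j. C * l2norm M (?A j) * l2norm M (?B j) + l2norm M (?A j) * l2norm M (\<lambda>x. w x * b x)
        + l2norm M (\<lambda>x. w x * a x) * l2norm M (?B j)) \<longlonglongrightarrow> C * 0 * 0 + 0 * l2norm M (\<lambda>x. w x * b x)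
        + l2norm M (\<lambda>x. w x * a x) * 0"
    by (intro tendsto_add tendsto_mult tendsto_const a(3) b(3))
  then have lim: "(\<lambda>j. C * l2norm M (?A j) * l2norm M (?B j) + l2norm M (?A j) * l2norm M (\<lambda>x. w x * b x)
        + l2norm M (\<lambda>x. w x * a x) * l2norm M (?B j)) \<longlonglongrightarrow> 0" by simp
  have "(\<lambda>j. (LINT x|M. w x * (aj j x * bj j x)) - (LINT x|M. w x * (a x * b x))) \<longlonglongrightarrow> 0"
    by (rule Lim_null_comparison[OF always_eventually lim]) (rule allI, rule bound)
  then show ?thesis by (simp add: LIM_zero_iff)
qed

lemma l2norm_diff_norm_le:
  assumes f: "square_integrable M f" and g: "square_integrable M g"
  shows "l2norm M (\<lambda>x. norm (f x) - norm (g x)) \<le> l2norm M (\<lambda>x. f x - g x)"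
proof -
  have "(LINT x|M. (norm (norm (f x) - norm (g x)))\<^sup>2) \<le> (LINT x|M. (norm (f x - g x))\<^sup>2)"
  proof (rule integral_mono)
    show "integrable M (\<lambda>x. (norm (norm (f x) - norm (g x)))\<^sup>2)"
      using square_integrable_diff[OF square_integrable_norm[OF f] square_integrable_norm[OF g]]
      by (simp add: square_integrable_def)
    show "integrable M (\<lambda>x. (norm (f x - g x))\<^sup>2)"
      using square_integrable_diff[OF f g] by (simp add: square_integrable_def)
    show "(norm (norm (f x) - norm (g x)))\<^sup>2 \<le> (norm (f x - g x))\<^sup>2" for x
      unfolding real_norm_def by (rule power_mono) (auto intro: norm_triangle_ineq3)
  qed
  then show ?thesis by (simp add: l2norm_def)
qed

lemma integral_norm_mult_tendsto:
  fixes w :: "'a \<Rightarrow> real"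
  assumes a: "\<And>j. square_integrable M (aj j)" "square_integrable M a"
      "(\<lambda>j. l2norm M (\<lambda>x. aj j x - a x)) \<longlonglongrightarrow> 0"
    and b: "\<And>j. square_integrable M (bj j)" "square_integrable M b"
      "(\<lambda>j. l2norm M (\<lambda>x. bj j x - b x)) \<longlonglongrightarrow> 0"
    and w: "w \<in> borel_measurable M" "\<And>x. \<bar>w x\<bar> \<le> C"
  shows "(\<lambda>j. LINT x|M. w x * (norm (aj j x) * norm (bj j x))) \<longlonglongrightarrow> (LINT x|M. w x * (norm (a x) * norm (b x)))"
proof (rule integral_mult_tendsto[OF _ _ _ _ _ _ w])
  show "(\<lambda>j. l2norm M (\<lambda>x. norm (aj j x) - norm (a x))) \<longlonglongrightarrow> 0"
    by (rule tendsto_sandwich[OF _ _ tendsto_const a(3)]) (auto intro!: always_eventually l2norm_diff_norm_le a)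
  show "(\<lambda>j. l2norm M (\<lambda>x. norm (bj j x) - norm (b x))) \<longlonglongrightarrow> 0"
    by (rule tendsto_sandwich[OF _ _ tendsto_const b(3)]) (auto intro!: always_eventually l2norm_diff_norm_le b)
qed (auto intro: square_integrable_norm a b)

lemma square_integrable_indicator:
  assumes "square_integrable M f" "E \<in> sets M"
  shows "square_integrable M (\<lambda>x. indicator E x *\<^sub>R f x)"
proof -
  have m: "(indicator E :: _ \<Rightarrow> real) \<in> borel_measurable M" using assms(2) by (rule borel_measurable_indicator)
  have "square_integrable M (\<lambda>x. indicator E x * norm (f x))"
    by (rule square_integrable_bounded_mult[OF square_integrable_norm[OF assms(1)] m, of 1]) (auto split: split_indicator)
  then have "integrable M (\<lambda>x. (indicator E x * norm (f x))\<^sup>2)" by (rule square_integrable_power2)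
  then show ?thesis
    using m square_integrable_measurable[OF assms(1)] by (simp add: square_integrable_def)
qed

text \<open>The indicator of \<open>Z\<close> is left with \<open>b\<close>. In the application
  \<open>a\<close> is merely bounded in norm, whereas \<open>b\<close> is a fixed function or its
  gradient, whose norm over shrinking sets tends to 0.\<close>

lemma integral_weighted_le_l2norm:
  assumes a: "square_integrable M a" and b: "square_integrable M b" and Z: "Z \<in> sets M" and "0 \<le> \<delta>"
  shows "(LINT x|M. (\<delta> + indicator Z x) * (norm (a x) * norm (b x)))
    \<le> l2norm M a * (\<delta> * l2norm M b + l2norm M (\<lambda>x. indicator Z x *\<^sub>R b x))"
proof -
  have b': "square_integrable M (\<lambda>x. indicator Z x *\<^sub>R b x)" by (rule square_integrable_indicator[OF b Z])
  have "(LINT x|M. (\<delta> + indicator Z x) * (norm (a x) * norm (b x)))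
      = (LINT x|M. \<delta> * (norm (a x) * norm (b x)) + norm (a x) * norm (indicator Z x *\<^sub>R b x))"
    by (intro Bochner_Integration.integral_cong) (auto simp: algebra_simps)
  also have "\<dots> = \<delta> * (LINT x|M. norm (a x) * norm (b x)) + (LINT x|M. norm (a x) * norm (indicator Z x *\<^sub>R b x))"
    using integrable_norm_mult[OF a b] integrable_norm_mult[OF a b']
    by (subst Bochner_Integration.integral_add) auto
  also have "\<dots> \<le> \<delta> * (l2norm M a * l2norm M b) + l2norm M a * l2norm M (\<lambda>x. indicator Z x *\<^sub>R b x)"
    by (intro add_mono mult_left_mono l2norm_cauchy_schwarz a b b' \<open>0 \<le> \<delta>\<close>)
  finally show ?thesis by (simp add: algebra_simps)
qed

text \<open>Truncation at a level \<open>k\<close>: the excess over \<open>k\<close> has small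
  integral by dominated convergence, and the truncated part contributes at most \<open>k\<close>
  times the measure of \<open>E n\<close>.\<close>

lemma integral_shrinking_sets_tendsto_0:
  fixes h :: "'a \<Rightarrow> real"
  assumes h: "integrable M h" "\<And>x. 0 \<le> h x"
    and E: "\<And>n::nat. E n \<in> sets M" "\<And>n. emeasure M (E n) < top" "(\<lambda>n. measure M (E n)) \<longlonglongrightarrow> 0"
  shows "(\<lambda>n. LINT x|M. indicator (E n) x * h x) \<longlonglongrightarrow> 0"
proof (rule LIMSEQ_I)
  fix e :: real assume e: "0 < e"
  have [measurable]: "h \<in> borel_measurable M" using h(1) by simp
  have [measurable]: "E n \<in> sets M" for n by (rule E)
  have "(\<lambda>k. LINT x|M. h x - min (h x) (real k)) \<longlonglongrightarrow> (LINT x|M. 0)"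
  proof (rule integral_dominated_convergence[where w = h])
    show "AE x in M. (\<lambda>k. h x - min (h x) (real k)) \<longlonglongrightarrow> 0"
    proof (rule AE_I2)
      fix x
      obtain k0 where "h x \<le> real k0" using real_arch_simple by blast
      then show "(\<lambda>k. h x - min (h x) (real k)) \<longlonglongrightarrow> 0"
        by (intro tendsto_eventually eventually_sequentiallyI[of k0]) auto
    qed
    show "AE x in M. norm (h x - min (h x) (real k)) \<le> h x" for k
      using h(2) by (intro AE_I2) (auto simp: min_def)
  qed (use h in auto)
  then have "\<forall>\<^sub>F k in sequentially. (LINT x|M. h x - min (h x) (real k)) < e / 2"
    by (rule order_tendstoD) (use e in auto)
  then obtain k where k: "(LINT x|M. h x - min (h x) (real k)) < e / 2"
    by (auto simp: eventually_sequentially)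
  have int_min: "integrable M (\<lambda>x. min (h x) (real k))"
    by (rule Bochner_Integration.integrable_bound[OF h(1)]) (use h(2) in \<open>auto intro!: AE_I2\<close>)
  have int_ind: "integrable M (indicator (E n) :: 'a \<Rightarrow> real)" for n
    using E(1,2)[of n] by simp
  have "(\<lambda>n. real k * measure M (E n)) \<longlonglongrightarrow> real k * 0" by (intro tendsto_intros E)
  then have "\<forall>\<^sub>F n in sequentially. real k * measure M (E n) < e / 2"
    by (rule order_tendstoD) (use e in auto)
  then obtain n0 where n0: "\<And>n. n0 \<le> n \<Longrightarrow> real k * measure M (E n) < e / 2"
    by (auto simp: eventually_sequentially)
  have "norm ((LINT x|M. indicator (E n) x * h x) - 0) < e" if n: "n0 \<le> n" for n
  proof -
    have "(LINT x|M. indicator (E n) x * h x) \<le> (LINT x|M. (h x - min (h x) (real k)) + real k * indicator (E n) x)"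
    proof (rule integral_mono)
      show "integrable M (\<lambda>x. indicator (E n) x * h x)"
        by (rule integrable_bounded_mult[OF h(1), of _ 1]) (auto simp: indicator_def)
      show "integrable M (\<lambda>x. (h x - min (h x) (real k)) + real k * indicator (E n) x)"
        using h int_min int_ind by simp
      show "indicator (E n) x * h x \<le> (h x - min (h x) (real k)) + real k * indicator (E n) x" for x
        using h(2)[of x] by (auto simp: indicator_def min_def)
    qed
    also have "\<dots> = (LINT x|M. h x - min (h x) (real k)) + real k * measure M (E n)"
      using h int_min int_ind E(1,2)[of n] by simp
    also have "\<dots> < e" using k n0[OF n] by linarith
    finally show ?thesis using h(2) by (simp add: integral_nonneg_AE)
  qed
  then show "\<exists>n0. \<forall>n\<ge>n0. norm ((LINT x|M. indicator (E n) x * h x) - 0) < e" by blast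
qed

section \<open>Uniform boundedness in the space of square integrable functions\<close>

text \<open>Cauchy-Schwarz with weights \<open>c\<close>. It bounds the square of a tail of the
  gliding-hump series by a series that can be integrated term by term.\<close>

lemma suminf_square_le:
  fixes c a :: "nat \<Rightarrow> real"
  assumes "summable c" "\<And>i. 0 \<le> c i" "\<And>i. 0 \<le> a i" "summable (\<lambda>i. c i * (a i)\<^sup>2)"
  shows "summable (\<lambda>i. c i * a i)" "(\<Sum>i. c i * a i)\<^sup>2 \<le> (\<Sum>i. c i) * (\<Sum>i. c i * (a i)\<^sup>2)"
proof -
  show s: "summable (\<lambda>i. c i * a i)"
  proof (rule summable_comparison_test')
    show "summable (\<lambda>i. c i + c i * (a i)\<^sup>2)" using assms by (intro summable_add)
    fix n
    have "a n \<le> 1 + (a n)\<^sup>2" using sum_squares_bound[of 1 "a n"] assms(3)[of n] by simp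
    then have "c n * a n \<le> c n * (1 + (a n)\<^sup>2)" by (intro mult_left_mono assms)
    then show "norm (c n * a n) \<le> c n + c n * (a n)\<^sup>2" using assms by (simp add: algebra_simps)
  qed
  have "(\<lambda>n. (\<Sum>i<n. c i * a i)\<^sup>2) \<longlonglongrightarrow> (\<Sum>i. c i * a i)\<^sup>2"
    by (intro tendsto_power summable_LIMSEQ s)
  moreover have "(\<Sum>i<n. c i * a i)\<^sup>2 \<le> (\<Sum>i. c i) * (\<Sum>i. c i * (a i)\<^sup>2)" for n
  proof -
    have "(\<Sum>i<n. c i * a i)\<^sup>2 = (\<Sum>i<n. sqrt (c i) * (sqrt (c i) * a i))\<^sup>2"
      using assms by (simp add: mult.assoc[symmetric])
    also have "\<dots> \<le> (\<Sum>i<n. (sqrt (c i))\<^sup>2) * (\<Sum>i<n. (sqrt (c i) * a i)\<^sup>2)"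
      by (rule Cauchy_Schwarz_ineq_sum)
    also have "\<dots> = (\<Sum>i<n. c i) * (\<Sum>i<n. c i * (a i)\<^sup>2)" using assms by (simp add: power_mult_distrib)
    also have "\<dots> \<le> (\<Sum>i. c i) * (\<Sum>i. c i * (a i)\<^sup>2)"
      using assms by (intro mult_mono sum_le_suminf sum_nonneg suminf_nonneg) auto
    finally show ?thesis .
  qed
  ultimately show "(\<Sum>i. c i * a i)\<^sup>2 \<le> (\<Sum>i. c i) * (\<Sum>i. c i * (a i)\<^sup>2)"
    by (intro LIMSEQ_le_const2) auto
qed

text \<open>A gliding hump: the signs are chosen such that the partial sum up to \<open>j\<close> pairs with the \<open>j\<close>-th
  function to at least \<open>3 ^ - j\<close> times its norm, while the tail contributes at most half of this.\<close>

lemma l2_weakly_bounded_imp_bounded: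
  fixes f :: "nat \<Rightarrow> 'a \<Rightarrow> real"
  assumes f: "\<And>n. square_integrable M (f n)"
    and weak: "\<And>w. square_integrable M w \<Longrightarrow> \<exists>C. \<forall>n. \<bar>LINT x|M. f n x * w x\<bar> \<le> C"
  shows "\<exists>C. \<forall>n. l2norm M (f n) \<le> C"
proof (rule ccontr)
  assume "\<not> ?thesis"
  \<comment> \<open>With coefficients \<open>3 ^ - j\<close>, the new term pairs to at least
    \<open>3 ^ - j\<close> times the norm of the function and the tail takes away at most half of
    this. Half of \<open>3 ^ - j\<close> times the threshold exceeds \<open>j\<close>; the summand 1
    keeps the norm positive for \<open>j = 0\<close>.\<close>
  then have "\<exists>n. 2 * 3 ^ j * real j + 1 < l2norm M (f n)" for j by (meson not_le)
  then obtain N where N: "\<And>j. 2 * 3 ^ j * real j + 1 < l2norm M (f (N j))" by metis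
  define F where "F j = f (N j)" for j
  define c :: "nat \<Rightarrow> real" where "c j = (1 / 3) ^ j" for j
  define e where "e j x = F j x / l2norm M (F j)" for j x
  define sg where "sg j S = (if 0 \<le> (LINT x|M. F j x * S x) then 1 else - 1 :: real)" for j S
  define S where "S = rec_nat (\<lambda>x. 0) (\<lambda>j T x. T x + sg j T * c j * e j x)"
  have S0: "S 0 = (\<lambda>x. 0)" and SSuc: "S (Suc j) = (\<lambda>x. S j x + sg j (S j) * c j * e j x)" for j
    by (simp_all add: S_def)
  define h where "h j x = sg j (S j) * c j * e j x" for j x
  have nF: "2 * 3 ^ j * real j + 1 < l2norm M (F j)" for j using N by (simp add: F_def)
  have nF_pos: "0 < l2norm M (F j)" for j
  proof -
    have "0 \<le> 2 * 3 ^ j * real j" by simp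
    then show ?thesis using nF[of j] by linarith
  qed
  have sqF: "square_integrable M (F j)" for j by (simp add: F_def f)
  have sqe: "square_integrable M (e j)" for j
    using square_integrable_cmult[OF sqF[of j], of "1 / l2norm M (F j)"] by (simp add: e_def[abs_def])
  have [measurable]: "e j \<in> borel_measurable M" for j using sqe by (rule square_integrable_measurable)
  have sqh: "square_integrable M (h j)" for j
    unfolding h_def[abs_def] by (rule square_integrable_cmult[OF sqe])
  have sqS: "square_integrable M (S j)" for j
  proof (induction j)
    case (Suc j)
    then show ?case using square_integrable_add[OF Suc sqh[of j]] by (simp add: SSuc h_def)
  qed (simp add: S0 square_integrable_def)
  have [measurable]: "S j \<in> borel_measurable M" "h j \<in> borel_measurable M" for j
    using sqS sqh by (auto intro: square_integrable_measurable)
  have S_sum: "S j x = (\<Sum>i<j. h i x)" for j x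
    by (induction j) (simp_all add: S0 SSuc h_def)
  have c: "0 < c j" "summable c" "summable (\<lambda>i. c (i + j))" "(\<Sum>i. c (i + j)) = 3 / 2 * c j" for j
  proof -
    show "0 < c j" by (simp add: c_def)
    have "(\<lambda>i. c j * (1 / 3) ^ i) sums (c j * (1 / (1 - 1 / 3)))"
      by (intro sums_mult geometric_sums) simp
    then have *: "(\<lambda>i. c (i + j)) sums (3 / 2 * c j)" by (simp add: c_def power_add mult.commute)
    then show "summable (\<lambda>i. c (i + j))" "(\<Sum>i. c (i + j)) = 3 / 2 * c j" by (simp_all add: sums_iff)
    show "summable c" unfolding c_def[abs_def] by (intro summable_geometric) simp
  qed
  have abs_h: "\<bar>h j x\<bar> = c j * \<bar>e j x\<bar>" for j x
    using c(1)[of j] by (simp add: h_def sg_def abs_mult)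
  have e_norm: "(\<integral>\<^sup>+x. ennreal ((e j x)\<^sup>2) \<partial>M) = 1" for j
  proof -
    have "(LINT x|M. (e j x)\<^sup>2) = (l2norm M (F j))\<^sup>2 / (l2norm M (F j))\<^sup>2"
      by (simp add: e_def power_divide l2norm_power2)
    then have "(LINT x|M. (e j x)\<^sup>2) = 1" using nF_pos[of j] by simp
    then show ?thesis using square_integrable_power2[OF sqe[of j]] by (subst nn_integral_eq_integral) auto
  qed
  have tail: "(\<integral>\<^sup>+x. (\<Sum>i. ennreal (c (i + j) * (e (i + j) x)\<^sup>2)) \<partial>M) = ennreal (3 / 2 * c j)" for j
  proof -
    have "(\<integral>\<^sup>+x. (\<Sum>i. ennreal (c (i + j) * (e (i + j) x)\<^sup>2)) \<partial>M)
        = (\<Sum>i. \<integral>\<^sup>+x. ennreal (c (i + j) * (e (i + j) x)\<^sup>2) \<partial>M)"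
      by (rule nn_integral_suminf) measurable
    also have "\<dots> = (\<Sum>i. ennreal (c (i + j)))"
      using c(1) by (simp add: ennreal_mult' less_imp_le nn_integral_cmult e_norm)
    also have "\<dots> = ennreal (\<Sum>i. c (i + j))"
      using c(1,3) by (intro suminf_ennreal2) (auto simp: less_imp_le)
    finally show ?thesis by (simp only: c(4))
  qed
  have good: "AE x in M. summable (\<lambda>i. c i * (e i x)\<^sup>2)"
  proof -
    have "AE x in M. (\<Sum>i. ennreal (c (i + 0) * (e (i + 0) x)\<^sup>2)) \<noteq> \<infinity>"
    proof (rule nn_integral_noteq_infinite)
      show "(\<lambda>x. \<Sum>i. ennreal (c (i + 0) * (e (i + 0) x)\<^sup>2)) \<in> borel_measurable M" by measurable
      show "(\<integral>\<^sup>+x. (\<Sum>i. ennreal (c (i + 0) * (e (i + 0) x)\<^sup>2)) \<partial>M) \<noteq> \<infinity>"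
        unfolding tail by simp
    qed
    then show ?thesis
    proof eventually_elim
      case (elim x)
      then have "(\<Sum>i. ennreal (c i * (e i x)\<^sup>2)) \<noteq> top" by simp
      moreover have "0 \<le> c i * (e i x)\<^sup>2" for i using c(1)[of i] by simp
      ultimately show ?case by (intro summable_suminf_not_top)
    qed
  qed
  define w where "w x = (\<Sum>i. h i x)" for x
  have [measurable]: "w \<in> borel_measurable M" unfolding w_def[abs_def] by measurable
  \<comment> \<open>The sum \<open>w\<close> is built pointwise almost everywhere. Its distance to
    the partial sum is controlled by the tail of \<open>c\<close> times a series of squares of
    normalised functions, whose integral is again the tail of \<open>c\<close>.\<close>
  have w_le: "AE x in M. ennreal ((w x - S j x)\<^sup>2) \<le> ennreal (3 / 2 * c j) * (\<Sum>i. ennreal (c (i + j) * (e (i + j) x)\<^sup>2))" for j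
    using good
  proof eventually_elim
    case (elim x)
    have sm: "summable (\<lambda>i. c (i + j) * \<bar>e (i + j) x\<bar>\<^sup>2)"
      using summable_ignore_initial_segment[OF elim, of j] by simp
    note sq = suminf_square_le[OF c(3) _ _ sm] 
    have s1: "summable (\<lambda>i. \<bar>h (i + j) x\<bar>)" and s2: "(\<Sum>i. \<bar>h (i + j) x\<bar>)\<^sup>2 \<le> (\<Sum>i. c (i + j)) * (\<Sum>i. c (i + j) * (e (i + j) x)\<^sup>2)"
      using sq c(1) by (auto simp: abs_h less_imp_le)
    have "summable (\<lambda>i. h i x)"
      using summable_rabs_cancel[OF s1] summable_iff_shift[of "\<lambda>i. h i x" j] by (rule iffD1[rotated])
    then have "w x - S j x = (\<Sum>i. h (i + j) x)"
      unfolding w_def S_sum by (subst suminf_split_initial_segment[of _ j]) auto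
    then have "\<bar>w x - S j x\<bar> \<le> (\<Sum>i. \<bar>h (i + j) x\<bar>)" using summable_rabs[OF s1] by simp
    then have "(w x - S j x)\<^sup>2 \<le> (\<Sum>i. \<bar>h (i + j) x\<bar>)\<^sup>2"
      using power_mono[of "\<bar>w x - S j x\<bar>" _ 2] by simp
    also note s2
    finally have "ennreal ((w x - S j x)\<^sup>2) \<le> ennreal (3 / 2 * c j * (\<Sum>i. c (i + j) * (e (i + j) x)\<^sup>2))"
      by (intro ennreal_leI) (simp add: c(4))
    also have "\<dots> = ennreal (3 / 2 * c j) * (\<Sum>i. ennreal (c (i + j) * (e (i + j) x)\<^sup>2))"
    proof -
      have nn: "0 \<le> c (i + j) * (e (i + j) x)\<^sup>2" for i using c(1)[of "i + j"] by simp
      have sm': "summable (\<lambda>i. c (i + j) * (e (i + j) x)\<^sup>2)" using sm by simp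
      have "(\<Sum>i. ennreal (c (i + j) * (e (i + j) x)\<^sup>2)) = ennreal (\<Sum>i. c (i + j) * (e (i + j) x)\<^sup>2)"
        using nn sm' by (rule suminf_ennreal2)
      moreover have "0 \<le> (\<Sum>i. c (i + j) * (e (i + j) x)\<^sup>2)" using sm' nn by (rule suminf_nonneg)
      ultimately show ?thesis
        by (simp only: ennreal_mult'')
    qed
    finally show ?case .
  qed
  have w_int: "(\<integral>\<^sup>+x. ennreal ((w x - S j x)\<^sup>2) \<partial>M) \<le> ennreal ((3 / 2 * c j)\<^sup>2)" for j
  proof -
    have "(\<integral>\<^sup>+x. ennreal ((w x - S j x)\<^sup>2) \<partial>M)
        \<le> (\<integral>\<^sup>+x. ennreal (3 / 2 * c j) * (\<Sum>i. ennreal (c (i + j) * (e (i + j) x)\<^sup>2)) \<partial>M)"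
      by (rule nn_integral_mono_AE[OF w_le])
    also have "\<dots> = ennreal (3 / 2 * c j) * (\<integral>\<^sup>+x. (\<Sum>i. ennreal (c (i + j) * (e (i + j) x)\<^sup>2)) \<partial>M)"
      by (rule nn_integral_cmult) measurable
    also have "\<dots> = ennreal (3 / 2 * c j) * ennreal (3 / 2 * c j)" by (simp only: tail)
    finally show ?thesis using c(1)[of j] by (simp add: ennreal_mult'[symmetric] power2_eq_square)
  qed
  have sq_wS: "square_integrable M (\<lambda>x. w x - S j x)" for j
    unfolding square_integrable_def
  proof
    show "integrable M (\<lambda>x. (norm (w x - S j x))\<^sup>2)"
      using le_less_trans[OF w_int[of j] ennreal_less_top] by (intro integrableI_bounded) auto
  qed measurable
  have sq_w: "square_integrable M w" using sq_wS[of 0] by (simp add: S0)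
  have l2_wS: "l2norm M (\<lambda>x. w x - S j x) \<le> 3 / 2 * c j" for j
  proof -
    have "(\<integral>\<^sup>+x. ennreal ((w x - S j x)\<^sup>2) \<partial>M) = ennreal (LINT x|M. (w x - S j x)\<^sup>2)"
      by (rule nn_integral_eq_integral[OF square_integrable_power2[OF sq_wS]]) simp
    with w_int[of j] have "ennreal (LINT x|M. (w x - S j x)\<^sup>2) \<le> ennreal ((3 / 2 * c j)\<^sup>2)"
      by (simp only:)
    then have "(LINT x|M. (w x - S j x)\<^sup>2) \<le> (3 / 2 * c j)\<^sup>2"
      by (rule ennreal_le_iff[THEN iffD1, rotated]) (rule zero_le_power2)
    then have "(l2norm M (\<lambda>x. w x - S j x))\<^sup>2 \<le> (3 / 2 * c j)\<^sup>2"
      by (simp only: l2norm_power2 real_norm_def power2_abs)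
    then show ?thesis by (rule power2_le_imp_le) (use c(1)[of j] in simp)
  qed
  have large: "real j \<le> \<bar>LINT x|M. F j x * w x\<bar>" for j
  proof -
    have "(LINT x|M. F j x * e j x) = (LINT x|M. (F j x)\<^sup>2 / l2norm M (F j))"
      by (simp add: e_def power2_eq_square)
    also have "\<dots> = (l2norm M (F j))\<^sup>2 / l2norm M (F j)" by (simp add: l2norm_power2)
    finally have Fe: "(LINT x|M. F j x * e j x) = l2norm M (F j)" by (simp add: power2_eq_square)
    have "(LINT x|M. F j x * S (Suc j) x) = (LINT x|M. F j x * S j x + sg j (S j) * c j * (F j x * e j x))"
      by (intro Bochner_Integration.integral_cong) (auto simp: SSuc algebra_simps)
    also have "\<dots> = (LINT x|M. F j x * S j x) + sg j (S j) * c j * l2norm M (F j)"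
      using integrable_mult_square_integrable[OF sqF sqS] integrable_mult_square_integrable[OF sqF sqe] by (simp add: Fe)
    finally have "c j * l2norm M (F j) \<le> \<bar>LINT x|M. F j x * S (Suc j) x\<bar>"
      using c(1)[of j] nF_pos[of j] by (auto simp: sg_def)
    moreover have "\<bar>LINT x|M. F j x * (w x - S (Suc j) x)\<bar> \<le> l2norm M (F j) * (1 / 2 * c j)"
    proof -
      have "\<bar>LINT x|M. F j x * (w x - S (Suc j) x)\<bar> \<le> l2norm M (F j) * l2norm M (\<lambda>x. w x - S (Suc j) x)"
        by (rule integral_mult_le_l2norm[OF sqF sq_wS])
      also have "\<dots> \<le> l2norm M (F j) * (1 / 2 * c j)"
        using l2_wS[of "Suc j"] by (intro mult_left_mono) (auto simp: c_def)
      finally show ?thesis .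
    qed
    moreover have "(LINT x|M. F j x * w x) = (LINT x|M. F j x * S (Suc j) x) + (LINT x|M. F j x * (w x - S (Suc j) x))"
      using integrable_mult_square_integrable[OF sqF sqS] integrable_mult_square_integrable[OF sqF sq_wS]
      by (subst Bochner_Integration.integral_add[symmetric]) (simp_all add: right_diff_distrib)
    ultimately have "1 / 2 * c j * l2norm M (F j) \<le> \<bar>LINT x|M. F j x * w x\<bar>"
      by (simp only: mult.commute[of "l2norm M (F j)"])
    moreover have "real j \<le> 1 / 2 * c j * l2norm M (F j)"
    proof -
      have "real j = 1 / 2 * c j * (2 * 3 ^ j * real j)" by (simp add: c_def power_divide)
      also have "\<dots> \<le> 1 / 2 * c j * l2norm M (F j)"
        using nF[of j] c(1)[of j] by (intro mult_left_mono) auto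
      finally show ?thesis .
    qed
    ultimately show ?thesis by linarith
  qed
  obtain C where C: "\<And>n. \<bar>LINT x|M. f n x * w x\<bar> \<le> C" using weak[OF sq_w] by blast
  obtain j where "C < real j" using reals_Archimedean2 by blast
  then show False using large[of j] C[of "N j"] by (simp add: F_def)
qed

section \<open>Weak gradients\<close>

lemma integral_lebesgue_on_eq_lborel:
  fixes f :: "'a::euclidean_space \<Rightarrow> real"
  assumes D: "D \<in> sets lebesgue" and f: "f \<in> borel_measurable borel" "\<And>x. x \<notin> D \<Longrightarrow> f x = 0"
  shows "(LINT x|lebesgue_on D. f x) = (LINT x|lborel. f x)"
proof -
  have "(LINT x|lebesgue_on D. f x) = (LINT x|lebesgue. indicator D x *\<^sub>R f x)"
    using D by (intro integral_restrict_space) simp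
  also have "(\<lambda>x. indicator D x *\<^sub>R f x) = f" using f(2) by (intro ext) (auto split: split_indicator)
  also have "(LINT x|lebesgue. f x) = (LINT x|lborel. f x)"
    using f(1) by (intro integral_completion) simp
  finally show ?thesis .
qed

lemma integrable_compact_support:
  fixes f :: "'a::euclidean_space \<Rightarrow> real"
  assumes "continuous_on UNIV f" "\<And>x. R < norm x \<Longrightarrow> f x = 0"
  shows "integrable lborel f"
proof -
  have "integrable lborel (\<lambda>x. indicator (cball 0 R) x *\<^sub>R f x)"
    by (rule borel_integrable_compact) (use continuous_on_subset[OF assms(1)] in auto)
  moreover have "(\<lambda>x. indicator (cball 0 R) x *\<^sub>R f x) = f"
    using assms(2) by (intro ext) (auto split: split_indicator simp: not_le)
  ultimately show ?thesis by simp
qed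

lemma gradient_eq_0_outside_support:
  assumes "x \<notin> closure {x. f x \<noteq> 0}"
  shows "gradient f x = 0"
proof (rule gradient_eqI)
  have "((\<lambda>x. 0) has_derivative (\<lambda>h. 0 \<bullet> h)) (at x)" by simp
  then show "(f has_derivative (\<lambda>h. 0 \<bullet> h)) (at x)"
    by (rule has_derivative_transform_within_open[where s = "- closure {x. f x \<noteq> 0}"])
      (use assms closure_subset[of "{x. f x \<noteq> 0}"] in auto)
qed

lemma test_functionD:
  fixes D :: "(real ^ 'n) set"
  assumes "test_function D \<eta>"
  shows "smooth \<eta>" "x \<notin> D \<Longrightarrow> \<eta> x = 0" "x \<notin> D \<Longrightarrow> gradient \<eta> x = 0"
    and "\<exists>R. \<forall>x. R < norm x \<longrightarrow> \<eta> x = 0 \<and> gradient \<eta> x = 0"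
proof -
  let ?S = "closure {x. \<eta> x \<noteq> 0}"
  have S: "compact ?S" "?S \<subseteq> D" using assms by (auto simp: test_function_def)
  show "smooth \<eta>" using assms by (simp add: test_function_def)
  have out: "\<eta> x = 0 \<and> gradient \<eta> x = 0" if "x \<notin> ?S" for x
    using that closure_subset[of "{x. \<eta> x \<noteq> 0}"] gradient_eq_0_outside_support[of x \<eta>] by auto
  show "x \<notin> D \<Longrightarrow> \<eta> x = 0" "x \<notin> D \<Longrightarrow> gradient \<eta> x = 0" using out S(2) by blast+
  obtain R where R: "\<And>x. x \<in> ?S \<Longrightarrow> norm x \<le> R"
    using compact_imp_bounded[OF S(1)] unfolding bounded_iff by blast
  show "\<exists>R. \<forall>x. R < norm x \<longrightarrow> \<eta> x = 0 \<and> gradient \<eta> x = 0"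
  proof (intro exI[of _ R] allI impI)
    fix x :: "real ^ 'n" assume "R < norm x"
    then have "x \<notin> ?S" using R[of x] by linarith
    then show "\<eta> x = 0 \<and> gradient \<eta> x = 0" by (rule out)
  qed
qed

lemma test_function_subset: "test_function D \<eta> \<Longrightarrow> D \<subseteq> D' \<Longrightarrow> test_function D' \<eta>"
  by (auto simp: test_function_def)

lemma integral_lborel_translate:
  fixes f :: "'a::euclidean_space \<Rightarrow> real"
  assumes [measurable]: "f \<in> borel_measurable borel"
  shows "(LINT x|lborel. f (x + c)) = (LINT x|lborel. f x)"
proof -
  have "(LINT x|lborel. f x) = (LINT x|distr lborel borel ((+) c). f x)" by (simp add: lborel_distr_plus)
  also have "\<dots> = (LINT x|lborel. f (c + x))" by (rule integral_distr) auto
  finally show ?thesis by (simp add: add.commute)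
qed

text \<open>Integrate \<open>F (x + e) - F x = \<integral>\<^sub>0\<^sup>1 \<partial>\<^sub>i F (x + t e) dt\<close> over \<open>x\<close> and use translation invariance on both sides.\<close>

lemma integral_gradient_compact_support:
  fixes F :: "real ^ 'n \<Rightarrow> real"
  assumes F: "smooth F" and supp: "\<And>x. R < norm x \<Longrightarrow> F x = 0 \<and> gradient F x = 0"
  shows "(LINT x|lborel. gradient F x $ i) = 0"
proof -
  let ?e = "axis i 1 :: real ^ 'n" and ?G = "\<lambda>x. gradient F x $ i"
  have contG: "continuous_on UNIV ?G" using smoothD(3)[OF F] .
  have [measurable]: "F \<in> borel_measurable borel" "?G \<in> borel_measurable borel"
    using smoothD[OF F] by (auto intro: borel_measurable_continuous_onI)
  have intF: "integrable lborel F" using supp smoothD(1)[OF F] by (intro integrable_compact_support[where R = R]) auto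
  have intG: "integrable lborel ?G" using supp contG by (intro integrable_compact_support[where R = R]) auto
  \<comment> \<open>The points \<open>x + t e\<close> with \<open>t\<close> between 0 and 1 lie
    within distance 1 of \<open>x\<close>, so the integrand vanishes when
    \<open>norm x > R + 1\<close>, and joint integrability follows from compactness.\<close>
  let ?K = "cball (0 :: real ^ 'n) (R + 1) \<times> {0..1::real}"
  have "integrable lborel (\<lambda>z. indicator ?K z *\<^sub>R ?G (fst z + snd z *\<^sub>R ?e))"
    by (intro borel_integrable_compact compact_Times continuous_on_compose2[OF contG] continuous_intros) auto
  moreover have "indicator ?K z *\<^sub>R ?G (fst z + snd z *\<^sub>R ?e) = indicator {0..1} (snd z) * ?G (fst z + snd z *\<^sub>R ?e)" for z
  proof (cases "norm (fst z) \<le> R + 1")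
    case False
    have "R < norm (fst z + snd z *\<^sub>R ?e)" if "snd z \<in> {0..1}"
      using False that norm_triangle_ineq4[of "fst z + snd z *\<^sub>R ?e" "snd z *\<^sub>R ?e"] by simp
    then show ?thesis using supp by (auto simp: indicator_def)
  qed (auto simp: indicator_def mem_Times_iff)
  ultimately have "integrable lborel (\<lambda>z. indicator {0..1} (snd z) * ?G (fst z + snd z *\<^sub>R ?e))" by (simp only:)
  then have int: "integrable (lborel \<Otimes>\<^sub>M lborel) (case_prod (\<lambda>x t. indicator {0..1::real} t * ?G (x + t *\<^sub>R ?e)))"
    by (simp add: lborel_prod case_prod_unfold)
  have transl: "(LINT x|lborel. ?G (x + c)) = (LINT x|lborel. ?G x)" for c
    by (rule integral_lborel_translate) measurable
  have line: "F (x + ?e) - F x = (LINT t|lborel. indicator {0..1} t * ?G (x + t *\<^sub>R ?e))" for x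
  proof -
    have "F (x + 1 *\<^sub>R ?e) - F (x + 0 *\<^sub>R ?e) = (LINT t|lborel. indicator {0..1} t *\<^sub>R (gradient F (x + t *\<^sub>R ?e) \<bullet> ?e))"
      by (rule integral_FTC_Icc[symmetric])
        (use has_derivative_along_line[OF F] continuous_gradient_along_line[OF F] in
          \<open>auto simp: has_real_derivative_iff_has_vector_derivative[symmetric] intro: has_field_derivative_at_within\<close>)
    then show ?thesis by (simp add: inner_axis)
  qed
  have "(LINT x|lborel. F (x + ?e)) = (LINT x|lborel. F x)" by (rule integral_lborel_translate) simp
  moreover have "integrable lborel (\<lambda>x. F (x + ?e))"
  proof (rule integrable_compact_support[where R = "R + 1"])
    show "continuous_on UNIV (\<lambda>x. F (x + ?e))"
      by (intro continuous_on_compose2[OF smoothD(1)[OF F]] continuous_intros) auto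
    show "F (x + ?e) = 0" if "R + 1 < norm x" for x
      using that supp norm_triangle_ineq4[of "x + ?e" ?e] by simp
  qed
  ultimately have "0 = (LINT x|lborel. F (x + ?e) - F x)" using intF by simp
  also have "\<dots> = (LINT x|lborel. LINT t|lborel. indicator {0..1} t * ?G (x + t *\<^sub>R ?e))"
    by (simp only: line)
  also have "\<dots> = (LINT t|lborel. LINT x|lborel. indicator {0..1} t * ?G (x + t *\<^sub>R ?e))"
    by (rule lborel_pair.Fubini_integral[OF int, symmetric])
  also have "\<dots> = (LINT t|lborel. indicator {0..1::real} t * (LINT x|lborel. ?G x))"
    by (simp add: transl)
  also have "\<dots> = (LINT x|lborel. ?G x)" by simp
  finally show ?thesis by simp
qed

text \<open>The product of \<open>f\<close> with a test function has compact support, so the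
  integral of its gradient vanishes; the product rule turns this into integration by parts.\<close>

lemma weak_gradient_smooth:
  fixes D :: "(real ^ 'n) set"
  assumes D: "open D" and f: "smooth f"
  shows "weak_gradient D f (gradient f)"
  unfolding weak_gradient_def
proof (intro allI impI)
  fix \<eta> :: "real ^ 'n \<Rightarrow> real" and i assume \<eta>: "test_function D \<eta>"
  note t = test_functionD[OF \<eta>]
  obtain R where R: "\<And>x. R < norm x \<Longrightarrow> \<eta> x = 0 \<and> gradient \<eta> x = 0" using t(4) by blast
  note sf = smoothD[OF f] and s\<eta> = smoothD[OF t(1)]
  have D': "D \<in> sets lebesgue" using D by simp
  have grad: "gradient (\<lambda>x. f x * \<eta> x) x $ i = f x * gradient \<eta> x $ i + gradient f x $ i * \<eta> x" for x
    using sf(2) s\<eta>(2) by (simp add: gradient_mult mult.commute)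
  have c1: "continuous_on UNIV (\<lambda>x. f x * gradient \<eta> x $ i)" and c2: "continuous_on UNIV (\<lambda>x. gradient f x $ i * \<eta> x)"
    using sf s\<eta> by (auto intro: continuous_intros)
  have i1: "integrable lborel (\<lambda>x. f x * gradient \<eta> x $ i)" and i2: "integrable lborel (\<lambda>x. gradient f x $ i * \<eta> x)"
    using c1 c2 R by (auto intro!: integrable_compact_support[where R = R])
  have "0 = (LINT x|lborel. gradient (\<lambda>x. f x * \<eta> x) x $ i)"
    by (rule integral_gradient_compact_support[OF smooth_mult[OF f t(1)], symmetric])
      (use R sf(2) s\<eta>(2) in \<open>auto simp: gradient_mult\<close>)
  also have "\<dots> = (LINT x|lborel. f x * gradient \<eta> x $ i) + (LINT x|lborel. gradient f x $ i * \<eta> x)"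
    using i1 i2 by (simp add: grad)
  finally have "(LINT x|lborel. f x * gradient \<eta> x $ i) = - (LINT x|lborel. gradient f x $ i * \<eta> x)" by simp
  moreover have "(LINT x|lebesgue_on D. f x * gradient \<eta> x $ i) = (LINT x|lborel. f x * gradient \<eta> x $ i)"
    by (rule integral_lebesgue_on_eq_lborel[OF D']) (use c1 t in \<open>auto intro: borel_measurable_continuous_onI\<close>)
  moreover have "(LINT x|lebesgue_on D. gradient f x $ i * \<eta> x) = (LINT x|lborel. gradient f x $ i * \<eta> x)"
    by (rule integral_lebesgue_on_eq_lborel[OF D']) (use c2 t in \<open>auto intro: borel_measurable_continuous_onI\<close>)
  ultimately show "(LINT x|lebesgue_on D. f x * gradient \<eta> x $ i) = - (LINT x|lebesgue_on D. gradient f x $ i * \<eta> x)"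
    by simp
qed

lemma borel_measurable_lebesgue_on:
  "f \<in> borel_measurable borel \<Longrightarrow> f \<in> borel_measurable (lebesgue_on D)"
  by (intro measurable_restrict_space1 measurable_completion) simp

lemma square_integrable_continuous:
  fixes f :: "'a::euclidean_space \<Rightarrow> 'b::euclidean_space"
  assumes f: "continuous_on UNIV f" and D: "bounded D" "D \<in> sets lebesgue"
  shows "square_integrable (lebesgue_on D) f"
proof -
  obtain R where R: "D \<subseteq> cball 0 R" using D(1) by (auto simp: bounded_iff subset_iff)
  have [measurable]: "f \<in> borel_measurable borel" using f by (rule borel_measurable_continuous_onI)
  have "continuous_on (cball 0 R) (\<lambda>x. (norm (f x))\<^sup>2)"
    by (intro continuous_intros continuous_on_subset[OF f]) auto
  then have "integrable lborel (\<lambda>x. indicator (cball 0 R) x *\<^sub>R (norm (f x))\<^sup>2)"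
    by (intro borel_integrable_compact) auto
  then have "integrable lebesgue (\<lambda>x. indicator (cball 0 R) x *\<^sub>R (norm (f x))\<^sup>2)"
    by (rule integrable_completion[THEN iffD2, rotated])
      (intro borel_measurable_scaleR borel_measurable_power borel_measurable_norm; simp add: borel_measurable_indicator)
  moreover have "(\<lambda>x. indicator D x *\<^sub>R (norm (f x))\<^sup>2) \<in> borel_measurable lebesgue"
  proof -
    have "(\<lambda>x. (norm (f x))\<^sup>2) \<in> borel_measurable lebesgue" by (intro measurable_completion) simp
    then show ?thesis by (intro borel_measurable_scaleR borel_measurable_indicator D(2))
  qed
  ultimately have "integrable lebesgue (\<lambda>x. indicator D x *\<^sub>R (norm (f x))\<^sup>2)"
    using R by (elim Bochner_Integration.integrable_bound) (auto intro!: AE_I2 simp: indicator_def)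
  then have "integrable (lebesgue_on D) (\<lambda>x. (norm (f x))\<^sup>2)"
    using D(2) by (simp add: integrable_restrict_space)
  moreover have "f \<in> borel_measurable (lebesgue_on D)"
    by (intro measurable_restrict_space1 measurable_completion) simp
  ultimately show ?thesis by (simp add: square_integrable_def)
qed

lemma finite_measure_lebesgue_on_bounded:
  assumes "bounded D" "D \<in> sets lebesgue"
  shows "finite_measure (lebesgue_on D)"
proof (rule finite_measureI)
  have "D \<in> lmeasurable" using assms by (rule bounded_set_imp_lmeasurable)
  then show "emeasure (lebesgue_on D) (space (lebesgue_on D)) \<noteq> \<infinity>"
    using assms by (simp add: emeasure_restrict_space fmeasurable_def less_top)
qed

lemma integrable_square_integrable:
  fixes f :: "'a \<Rightarrow> real"
  assumes "finite_measure M" "square_integrable M f"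
  shows "integrable M f"
proof -
  interpret finite_measure M by fact
  have "square_integrable M (\<lambda>x. 1 :: real)" by (simp add: square_integrable_def)
  from integrable_mult_square_integrable[OF assms(2) this] show ?thesis by simp
qed

section \<open>The fundamental lemma of the calculus of variations and uniqueness of weak
  gradients\<close>

text \<open>Two finite measures on a box that agree on all sub-boxes agree; apply this to the positive and the
  negative part of \<open>f\<close>.\<close>

lemma AE_0_if_box_integrals_0:
  fixes f :: "'a::euclidean_space \<Rightarrow> real"
  assumes f: "integrable lborel f" and box: "\<And>l u. (LINT x|lborel. indicator (box l u) x * f x) = 0"
  shows "AE x in lborel. f x = 0"
proof -
  have [measurable]: "f \<in> borel_measurable borel" using f by (simp add: borel_measurable_integrable)
  define P where "P = density lborel (\<lambda>x. ennreal (f x))"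
  define N where "N = density lborel (\<lambda>x. ennreal (- f x))"
  have fin: "(\<integral>\<^sup>+x. ennreal (f x) * indicator E x \<partial>lborel) < top" for E
  proof -
    have "(\<integral>\<^sup>+x. ennreal (f x) * indicator E x \<partial>lborel) \<le> (\<integral>\<^sup>+x. ennreal (norm (f x)) \<partial>lborel)"
      by (intro nn_integral_mono) (auto simp: indicator_def intro!: ennreal_leI)
    then show ?thesis using f by (auto simp: integrable_iff_bounded)
  qed
  have "P = N"
  proof (rule measure_eqI_generator_eq)
    let ?E = "range (\<lambda>(a, b). box a b::'a set)"
    show "Int_stable ?E" by (auto simp: Int_stable_def box_Int_box)
    show "?E \<subseteq> Pow UNIV" "sets P = sigma_sets UNIV ?E" "sets N = sigma_sets UNIV ?E"
      by (simp_all add: borel_eq_box P_def N_def)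
    let ?A = "\<lambda>n::nat. box (- (real n *\<^sub>R One)) (real n *\<^sub>R One) :: 'a set"
    show "range ?A \<subseteq> ?E" "(\<Union>i. ?A i) = UNIV" unfolding UN_box_eq_UNIV by auto
    show "emeasure P (?A i) \<noteq> \<infinity>" for i
      using fin by (simp add: P_def emeasure_density less_top)
    fix X assume "X \<in> ?E"
    then obtain l u where X: "X = box l u" by auto
    have int: "integrable lborel (\<lambda>x. indicator X x * f x)"
      by (rule integrable_bounded_mult[OF f, of _ 1]) (auto simp: X indicator_def)
    have "emeasure P X = (\<integral>\<^sup>+x. ennreal (indicator X x * f x) \<partial>lborel)"
      unfolding P_def X by (subst emeasure_density) (auto intro!: nn_integral_cong simp: indicator_def)
    moreover have "emeasure N X = (\<integral>\<^sup>+x. ennreal (- (indicator X x * f x)) \<partial>lborel)"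
      unfolding N_def X by (subst emeasure_density) (auto intro!: nn_integral_cong simp: indicator_def)
    moreover have "enn2real (\<integral>\<^sup>+x. ennreal (indicator X x * f x) \<partial>lborel)
        = enn2real (\<integral>\<^sup>+x. ennreal (- (indicator X x * f x)) \<partial>lborel)"
      using box[of l u] real_lebesgue_integral_def[OF int] by (simp add: X)
    moreover have "(\<integral>\<^sup>+x. ennreal (indicator X x * f x) \<partial>lborel) \<noteq> top"
      "(\<integral>\<^sup>+x. ennreal (- (indicator X x * f x)) \<partial>lborel) \<noteq> top"
      using integrableD(2,3)[OF int] by (auto simp: infinity_ennreal_def)
    ultimately show "emeasure P X = emeasure N X" by (metis ennreal_enn2real_if)
  qed
  then have "AE x in lborel. ennreal (f x) = ennreal (- f x)"
    unfolding P_def N_def by (intro sigma_finite_measure.density_unique[OF lborel.sigma_finite_measure_axioms]) auto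
  then show ?thesis
  proof eventually_elim
    case (elim x)
    then show ?case by (cases "0 \<le> f x") (auto simp: ennreal_neg)
  qed
qed

text \<open>Box bumps converge boundedly to indicators of boxes, so the integral of \<open>f\<close>
  over every box with closure in \<open>D\<close> is 0. An open set is a countable union of such
  closed boxes, and on each of them the lemma on box integrals applies.\<close>

lemma AE_0_if_test_integrals_0:
  fixes f :: "real ^ 'n \<Rightarrow> real"
  assumes D: "open D" and f: "integrable (lebesgue_on D) f"
    and test: "\<And>\<eta>. test_function D \<eta> \<Longrightarrow> (LINT x|lebesgue_on D. f x * \<eta> x) = 0"
  shows "AE x in lebesgue_on D. f x = 0"
proof -
  have D' [measurable]: "D \<in> sets lebesgue" "D \<in> sets borel" using D by auto
  have meas: "f \<in> borel_measurable (lebesgue_on D)" using f by simp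
  have ball0: "(LINT x|lebesgue_on D. f x * indicator (box a b) x) = 0" if ab: "cbox a b \<subseteq> D" for a b
  proof -
    have "(\<lambda>j. LINT x|lebesgue_on D. f x * box_bump a b j x) \<longlonglongrightarrow> (LINT x|lebesgue_on D. f x * indicator (box a b) x)"
    proof (rule integral_dominated_convergence[where w = "\<lambda>x. \<bar>f x\<bar>"])
      have bm: "box_bump a b j \<in> borel_measurable (lebesgue_on D)" for j
        by (intro measurable_restrict_space1 measurable_completion)
          (use smoothD(5)[OF test_functionD(1)[OF test_function_box_bump[OF ab]]] in simp)
      show "(\<lambda>x. f x * box_bump a b j x) \<in> borel_measurable (lebesgue_on D)" for j
        by (intro borel_measurable_times meas bm)
      have "indicator (box a b) \<in> borel_measurable (lebesgue_on D)"
        by (intro measurable_restrict_space1 measurable_completion) simp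
      then show "(\<lambda>x. f x * indicator (box a b) x) \<in> borel_measurable (lebesgue_on D)"
        by (intro borel_measurable_times meas)
      show "AE x in lebesgue_on D. (\<lambda>j. f x * box_bump a b j x) \<longlonglongrightarrow> f x * indicator (box a b) x"
        by (intro AE_I2 tendsto_mult tendsto_const box_bump_tendsto)
      show "AE x in lebesgue_on D. norm (f x * box_bump a b j x) \<le> \<bar>f x\<bar>" for j
      proof (rule AE_I2)
        fix x
        show "norm (f x * box_bump a b j x) \<le> \<bar>f x\<bar>"
          using box_bump_bounds[of a b j x] mult_left_le[of "box_bump a b j x" "\<bar>f x\<bar>"] by (simp add: abs_mult)
      qed
    qed (use f in auto)
    moreover have "(LINT x|lebesgue_on D. f x * box_bump a b j x) = 0" for j
      by (rule test[OF test_function_box_bump[OF ab]])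
    ultimately show ?thesis by (simp add: LIMSEQ_unique)
  qed
  obtain \<D> where \<D>: "countable \<D>" "\<D> \<subseteq> Pow D" "\<And>X. X \<in> \<D> \<Longrightarrow> \<exists>a b. X = cbox a b" "\<Union>\<D> = D"
    using open_countable_Union_open_cbox[OF D] by metis
  have box_AE: "AE x in lebesgue. x \<in> box a b \<longrightarrow> f x = 0" if ab: "cbox a b \<subseteq> D" for a b
  proof -
    have "(\<lambda>x. indicator D x *\<^sub>R f x) \<in> borel_measurable lebesgue"
      using meas D' by (simp add: borel_measurable_restrict_space_iff)
    moreover have ib: "indicator (box a b) \<in> borel_measurable lebesgue" by (intro measurable_completion) simp
    ultimately have m: "(\<lambda>x. indicator (box a b) x * (indicator D x *\<^sub>R f x)) \<in> borel_measurable lebesgue"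
      by (intro borel_measurable_times)
    \<comment> \<open>The lemma on boxes concerns \<open>lborel\<close>, while \<open>f\<close> is
      only Lebesgue measurable; \<open>g\<close> is a Borel representative of \<open>f\<close> cut
      off to one box.\<close>
    obtain g where g: "g \<in> borel_measurable lborel" "AE x in lborel. indicator (box a b) x * (indicator D x *\<^sub>R f x) = g x"
      using completion_ex_borel_measurable_real[OF m] by blast
    have gAE: "AE x in lebesgue. indicator (box a b) x * (indicator D x *\<^sub>R f x) = g x"
      using AE_completion[OF g(2)] .
    have intf: "integrable lebesgue (\<lambda>x. indicator D x *\<^sub>R f x)"
      using f D' by (simp add: integrable_restrict_space)
    have "integrable lebesgue (\<lambda>x. indicator (box a b) x * (indicator D x *\<^sub>R f x))"
      by (rule integrable_bounded_mult[OF intf ib, of 1]) (simp add: indicator_def)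
    then have "integrable lebesgue g"
      by (rule integrable_cong_AE_imp) (use gAE g(1) in \<open>auto intro: measurable_completion\<close>)
    then have ig: "integrable lborel g" using g(1) by (simp add: integrable_completion)
    have "AE x in lborel. g x = 0"
    proof (rule AE_0_if_box_integrals_0[OF ig])
      fix l u :: "real ^ 'n"
      \<comment> \<open>An arbitrary test box meets \<open>box a b\<close> in a box whose closure
        still lies in \<open>D\<close>, where vanishing of the integral is known.\<close>
      obtain l' u' where lu: "box l u \<inter> box a b = box l' u'" unfolding box_Int_box by blast
      have sub: "cbox l' u' \<subseteq> D \<or> box l' u' = {}"
      proof (cases "box l' u' = {}")
        case False
        have "box l' u' \<subseteq> box a b" using lu by auto
        then have "closure (box l' u') \<subseteq> cbox a b" by (intro closure_minimal) (use box_subset_cbox in auto)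
        then have "cbox l' u' \<subseteq> cbox a b" using closure_box[OF False] by simp
        then show ?thesis using ab by auto
      qed simp
      have "(LINT x|lborel. indicator (box l u) x * g x) = (LINT x|lebesgue. indicator (box l u) x * g x)"
        by (rule integral_completion[symmetric]) (use g(1) in auto)
      also have "\<dots> = (LINT x|lebesgue. indicator (box l u) x * (indicator (box a b) x * (indicator D x *\<^sub>R f x)))"
      proof (rule integral_cong_AE)
        show "AE x in lebesgue. indicator (box l u) x * g x = indicator (box l u) x * (indicator (box a b) x * (indicator D x *\<^sub>R f x))"
          using gAE by eventually_elim simp
        have il: "indicator (box l u) \<in> borel_measurable lebesgue" by (intro measurable_completion) simp
        show "(\<lambda>x. indicator (box l u) x * g x) \<in> borel_measurable lebesgue"
          by (intro borel_measurable_times il measurable_completion g(1))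
        show "(\<lambda>x. indicator (box l u) x * (indicator (box a b) x * (indicator D x *\<^sub>R f x))) \<in> borel_measurable lebesgue"
          by (intro borel_measurable_times il m)
      qed
      also have "\<dots> = (LINT x|lebesgue. indicator D x *\<^sub>R (f x * indicator (box l' u') x))"
        by (intro Bochner_Integration.integral_cong) (auto simp: lu[symmetric] indicator_def)
      also have "\<dots> = (LINT x|lebesgue_on D. f x * indicator (box l' u') x)"
        using D' by (subst integral_restrict_space) auto
      also have "\<dots> = 0" using sub ball0 by auto
      finally show "(LINT x|lborel. indicator (box l u) x * g x) = 0" .
    qed
    then have "AE x in lebesgue. g x = 0" by (rule AE_completion)
    with gAE show ?thesis
    proof eventually_elim
      case (elim x)
      then show ?case using ab box_subset_cbox[of a b] by (auto simp: indicator_def)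
    qed
  qed
  have "AE x in lebesgue. \<forall>X\<in>\<D>. x \<in> X \<longrightarrow> f x = 0"
  proof (subst AE_ball_countable[OF \<D>(1)], rule ballI)
    fix X assume X: "X \<in> \<D>"
    then obtain a b where ab: "X = cbox a b" using \<D>(3) by blast
    have "negligible (cbox a b - box a b)" by (rule negligible_frontier_interval)
    then have "AE x in lebesgue. x \<notin> cbox a b - box a b"
      by (intro AE_not_in) (simp add: negligible_iff_null_sets)
    moreover have "AE x in lebesgue. x \<in> box a b \<longrightarrow> f x = 0"
      using X ab \<D>(2) by (intro box_AE) auto
    ultimately show "AE x in lebesgue. x \<in> X \<longrightarrow> f x = 0" unfolding ab by eventually_elim auto
  qed
  then have "AE x in lebesgue. x \<in> D \<longrightarrow> f x = 0"
    by eventually_elim (use \<D>(4) in auto)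
  then show ?thesis using D' by (subst AE_restrict_space_iff) auto
qed

lemma H1D:
  assumes "u \<in> H1 D"
  shows "square_integrable (lebesgue_on D) u" "square_integrable (lebesgue_on D) (wgrad D u)"
    and "weak_gradient D u (wgrad D u)"
proof -
  show "square_integrable (lebesgue_on D) u" using assms by (simp add: H1_def)
  have "\<exists>G. square_integrable (lebesgue_on D) G \<and> weak_gradient D u G" using assms by (simp add: H1_def)
  from someI_ex[OF this] show "square_integrable (lebesgue_on D) (wgrad D u)" "weak_gradient D u (wgrad D u)"
    by (auto simp: wgrad_def)
qed

lemma H1I:
  "square_integrable (lebesgue_on D) u \<Longrightarrow> square_integrable (lebesgue_on D) G \<Longrightarrow> weak_gradient D u G \<Longrightarrow> u \<in> H1 D"
  by (auto simp: H1_def)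

lemma square_integrable_component:
  fixes G :: "'a \<Rightarrow> real ^ 'n"
  assumes "square_integrable M G"
  shows "square_integrable M (\<lambda>x. G x $ i)"
  unfolding square_integrable_def
proof
  have G: "G \<in> borel_measurable M" "integrable M (\<lambda>x. (norm (G x))\<^sup>2)"
    using assms by (auto simp: square_integrable_def)
  show m: "(\<lambda>x. G x $ i) \<in> borel_measurable M"
    by (rule measurable_compose[OF G(1)]) (intro borel_measurable_continuous_onI continuous_intros)
  show "integrable M (\<lambda>x. (norm (G x $ i))\<^sup>2)"
  proof (rule Bochner_Integration.integrable_bound[OF G(2)])
    show "(\<lambda>x. (norm (G x $ i))\<^sup>2) \<in> borel_measurable M" using m by measurable
    show "AE x in M. norm ((norm (G x $ i))\<^sup>2) \<le> norm ((norm (G x))\<^sup>2)"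
    proof (rule AE_I2)
      fix x
      have "(norm (G x $ i))\<^sup>2 \<le> (norm (G x))\<^sup>2"
        by (intro power_mono) (auto simp: norm_nth_le component_le_norm_cart)
      then show "norm ((norm (G x $ i))\<^sup>2) \<le> norm ((norm (G x))\<^sup>2)" by simp
    qed
  qed
qed

lemma square_integrable_test_function:
  assumes "test_function D' \<eta>" "bounded D" "D \<in> sets lebesgue"
  shows "square_integrable (lebesgue_on D) \<eta>" "square_integrable (lebesgue_on D) (\<lambda>x. gradient \<eta> x $ i)"
  using smoothD[OF test_functionD(1)[OF assms(1)]] assms(2,3)
  by (auto intro: square_integrable_continuous)

lemma weak_gradient_diff:
  assumes D: "bounded D" "D \<in> sets lebesgue"
    and u: "square_integrable (lebesgue_on D) u" "square_integrable (lebesgue_on D) G" "weak_gradient D u G"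
    and v: "square_integrable (lebesgue_on D) v" "square_integrable (lebesgue_on D) H" "weak_gradient D v H"
  shows "weak_gradient D (\<lambda>x. u x - v x) (\<lambda>x. G x - H x)"
  unfolding weak_gradient_def
proof (intro allI impI)
  fix \<eta> i assume \<eta>: "test_function D \<eta>"
  note s\<eta> = square_integrable_test_function[OF \<eta> D]
  note int = integrable_mult_square_integrable
  have "(LINT x|lebesgue_on D. (u x - v x) * gradient \<eta> x $ i)
      = (LINT x|lebesgue_on D. u x * gradient \<eta> x $ i) - (LINT x|lebesgue_on D. v x * gradient \<eta> x $ i)"
    unfolding left_diff_distrib
    by (intro Bochner_Integration.integral_diff int u v s\<eta>)
  also have "\<dots> = - (LINT x|lebesgue_on D. G x $ i * \<eta> x) + (LINT x|lebesgue_on D. H x $ i * \<eta> x)"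
    using u(3) v(3) \<eta> by (simp add: weak_gradient_def)
  also have "\<dots> = - (LINT x|lebesgue_on D. G x $ i * \<eta> x - H x $ i * \<eta> x)"
    by (subst Bochner_Integration.integral_diff)
      (auto intro!: int square_integrable_component u v s\<eta>)
  finally show "(LINT x|lebesgue_on D. (u x - v x) * gradient \<eta> x $ i) = - (LINT x|lebesgue_on D. (G x - H x) $ i * \<eta> x)"
    by (simp add: left_diff_distrib)
qed

lemma weak_gradient_unique:
  fixes G H :: "real ^ 'n \<Rightarrow> real ^ 'n"
  assumes D: "bounded D" "open D"
    and G: "square_integrable (lebesgue_on D) G" "weak_gradient D u G"
    and H: "square_integrable (lebesgue_on D) H" "weak_gradient D u H"
  shows "AE x in lebesgue_on D. G x = H x"
proof -
  have D': "D \<in> sets lebesgue" using D by auto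
  have "AE x in lebesgue_on D. G x $ i - H x $ i = 0" for i
  proof (rule AE_0_if_test_integrals_0[OF D(2)])
    have sq: "square_integrable (lebesgue_on D) (\<lambda>x. G x $ i - H x $ i)"
      by (intro square_integrable_diff square_integrable_component G H)
    show "integrable (lebesgue_on D) (\<lambda>x. G x $ i - H x $ i)"
      by (rule integrable_square_integrable[OF finite_measure_lebesgue_on_bounded[OF D(1) D'] sq])
    fix \<eta> assume \<eta>: "test_function D \<eta>"
    note s\<eta> = square_integrable_test_function[OF \<eta> D(1) D']
    have "(LINT x|lebesgue_on D. G x $ i * \<eta> x) = (LINT x|lebesgue_on D. H x $ i * \<eta> x)"
      using G(2)[unfolded weak_gradient_def, rule_format, OF \<eta>, of i]
        H(2)[unfolded weak_gradient_def, rule_format, OF \<eta>, of i] by linarith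
    then show "(LINT x|lebesgue_on D. (G x $ i - H x $ i) * \<eta> x) = 0"
      unfolding left_diff_distrib
      by (subst Bochner_Integration.integral_diff)
        (auto intro!: integrable_mult_square_integrable square_integrable_component G H s\<eta>)
  qed
  then have "AE x in lebesgue_on D. \<forall>i. G x $ i - H x $ i = 0" by (subst AE_all_countable) auto
  then show ?thesis by eventually_elim (auto simp: vec_eq_iff)
qed

lemma weak_gradient_subset:
  fixes D :: "(real ^ 'n) set"
  assumes D: "D \<subseteq> D'" "D \<in> sets lebesgue" "D' \<in> sets lebesgue" and u: "weak_gradient D' u G"
  shows "weak_gradient D u G"
  unfolding weak_gradient_def
proof (intro allI impI)
  fix \<eta> :: "real ^ 'n \<Rightarrow> real" and i assume \<eta>: "test_function D \<eta>"
  note t = test_functionD(2,3)[OF \<eta>]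
  have eq: "(LINT x|lebesgue_on D. f x) = (LINT x|lebesgue_on D'. f x)" if "\<And>x. x \<notin> D \<Longrightarrow> f x = 0" for f :: "real ^ 'n \<Rightarrow> real"
  proof -
    have "(\<lambda>x. indicator D x *\<^sub>R f x) = (\<lambda>x. indicator D' x *\<^sub>R f x)"
      using that D(1) by (intro ext) (auto split: split_indicator)
    then show ?thesis using D(2,3) by (simp add: integral_restrict_space)
  qed
  have "(LINT x|lebesgue_on D'. u x * gradient \<eta> x $ i) = - (LINT x|lebesgue_on D'. G x $ i * \<eta> x)"
    using u test_function_subset[OF \<eta> D(1)] by (simp add: weak_gradient_def)
  then show "(LINT x|lebesgue_on D. u x * gradient \<eta> x $ i) = - (LINT x|lebesgue_on D. G x $ i * \<eta> x)"
    using eq[of "\<lambda>x. u x * gradient \<eta> x $ i"] eq[of "\<lambda>x. G x $ i * \<eta> x"] t by simp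
qed

lemma square_integrable_lebesgue_on_subset:
  fixes f :: "'a::euclidean_space \<Rightarrow> 'b::euclidean_space"
  assumes D: "D \<subseteq> D'" "D \<in> sets lebesgue" "D' \<in> sets lebesgue" and f: "square_integrable (lebesgue_on D') f"
  shows "square_integrable (lebesgue_on D) f"
proof -
  have "f \<in> borel_measurable (lebesgue_on D)"
    by (rule measurable_restrict_mono[OF square_integrable_measurable[OF f] D(1)])
  moreover have "integrable (lebesgue_on D) (\<lambda>x. (norm (f x))\<^sup>2)"
  proof -
    have "integrable lebesgue (\<lambda>x. indicator D' x *\<^sub>R (norm (f x))\<^sup>2)"
      using f D(3) by (simp add: square_integrable_def integrable_restrict_space)
    from integrable_bounded_mult[OF this borel_measurable_indicator[OF D(2)], of 1]
    have "integrable lebesgue (\<lambda>x. indicator D x * (indicator D' x *\<^sub>R (norm (f x))\<^sup>2))"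
      by (simp add: indicator_def)
    moreover have "(\<lambda>x. indicator D x * (indicator D' x *\<^sub>R (norm (f x))\<^sup>2)) = (\<lambda>x. indicator D x *\<^sub>R (norm (f x))\<^sup>2)"
      using D(1) by (intro ext) (auto split: split_indicator)
    ultimately show ?thesis using D(2) by (simp add: integrable_restrict_space)
  qed
  ultimately show ?thesis by (simp add: square_integrable_def)
qed

text \<open>\<open>wgrad\<close> is an arbitrary choice made separately for each domain, so
  gradients on a subdomain can be compared only almost everywhere, by uniqueness. This lets the
  fixed gradient of \<open>V\<close> on \<open>\<Omega>\<close> control its gradients on all
  perforated domains.\<close>

lemma H1_subset:
  fixes D :: "(real ^ 'n) set"
  assumes D: "D \<subseteq> D'" "open D" "open D'" "bounded D'" and u: "u \<in> H1 D'"
  shows "u \<in> H1 D" "AE x in lebesgue_on D. wgrad D u x = wgrad D' u x"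
proof -
  have D': "D \<in> sets lebesgue" "D' \<in> sets lebesgue" using D by auto
  note h = H1D[OF u]
  have sq: "square_integrable (lebesgue_on D) u" "square_integrable (lebesgue_on D) (wgrad D' u)"
    by (rule square_integrable_lebesgue_on_subset[OF D(1) D'], rule h)+
  have wg: "weak_gradient D u (wgrad D' u)" by (rule weak_gradient_subset[OF D(1) D' h(3)])
  show H: "u \<in> H1 D" by (rule H1I[OF sq wg])
  show "AE x in lebesgue_on D. wgrad D u x = wgrad D' u x"
    by (rule weak_gradient_unique[OF bounded_subset[OF D(4,1)] D(2) H1D(2,3)[OF H] sq(2) wg])
qed

lemma l2norm_cong_AE:
  assumes "AE x in M. f x = g x" "f \<in> borel_measurable M" "g \<in> borel_measurable M"
  shows "l2norm M f = l2norm M g"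
  unfolding l2norm_def using assms by (intro arg_cong[where f = sqrt] integral_cong_AE) auto

lemma H1_norm_eq: "H1_norm D u = sqrt ((l2norm (lebesgue_on D) u)\<^sup>2 + (l2norm (lebesgue_on D) (wgrad D u))\<^sup>2)"
  by (simp add: H1_norm_def l2norm_power2)

lemma l2norm_le_H1_norm: "l2norm (lebesgue_on D) v \<le> H1_norm D v" "l2norm (lebesgue_on D) (wgrad D v) \<le> H1_norm D v"
  unfolding H1_norm_eq by (auto intro!: real_le_rsqrt)

text \<open>Uniqueness of weak gradients is what makes the gradients of the approximants converge to the
  chosen weak gradient.\<close>

lemma has_trace_approx:
  fixes D :: "(real ^ 'n) set"
  assumes D: "open D" "bounded D" and tr: "has_trace D u g"
  shows "\<exists>\<phi>. (\<forall>j::nat. smooth (\<phi> j) \<and> square_integrable (boundary_measure D) (\<phi> j)) \<and>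
    (\<lambda>j. l2norm (lebesgue_on D) (\<lambda>x. \<phi> j x - u x)) \<longlonglongrightarrow> 0 \<and>
    (\<lambda>j. l2norm (lebesgue_on D) (\<lambda>x. gradient (\<phi> j) x - wgrad D u x)) \<longlonglongrightarrow> 0 \<and>
    (\<lambda>j. l2norm (boundary_measure D) (\<lambda>x. \<phi> j x - g x)) \<longlonglongrightarrow> 0"
proof -
  let ?M = "lebesgue_on D"
  have D': "D \<in> sets lebesgue" using D by auto
  have u: "u \<in> H1 D" using tr by (simp add: has_trace_def)
  obtain \<phi> where \<phi>: "\<And>j::nat. smooth (\<phi> j) \<and> square_integrable (boundary_measure D) (\<phi> j)"
    and lim: "(\<lambda>j. H1_norm D (\<lambda>x. \<phi> j x - u x)) \<longlonglongrightarrow> 0"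
    and blim: "(\<lambda>j. LINT x|boundary_measure D. (\<phi> j x - g x)\<^sup>2) \<longlonglongrightarrow> 0"
    using tr by (auto simp: has_trace_def)
  have 1: "(\<lambda>j. l2norm ?M (\<lambda>x. \<phi> j x - u x)) \<longlonglongrightarrow> 0"
    by (rule tendsto_sandwich[OF _ _ tendsto_const lim]) (auto simp: l2norm_le_H1_norm)
  have 2: "(\<lambda>j. l2norm ?M (wgrad D (\<lambda>x. \<phi> j x - u x))) \<longlonglongrightarrow> 0"
    by (rule tendsto_sandwich[OF _ _ tendsto_const lim]) (auto simp: l2norm_le_H1_norm)
  have "l2norm ?M (wgrad D (\<lambda>x. \<phi> j x - u x)) = l2norm ?M (\<lambda>x. gradient (\<phi> j) x - wgrad D u x)" for j
  proof -
    have sm: "smooth (\<phi> j)" using \<phi> by simp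
    have s: "square_integrable ?M (\<phi> j)" "square_integrable ?M (gradient (\<phi> j))"
      using smoothD[OF sm] by (auto intro!: square_integrable_continuous D(2) D')
    have w: "weak_gradient D (\<lambda>x. \<phi> j x - u x) (\<lambda>x. gradient (\<phi> j) x - wgrad D u x)"
      by (rule weak_gradient_diff[OF D(2) D' s weak_gradient_smooth[OF D(1) sm] H1D[OF u]])
    have sq: "square_integrable ?M (\<lambda>x. \<phi> j x - u x)" "square_integrable ?M (\<lambda>x. gradient (\<phi> j) x - wgrad D u x)"
      by (intro square_integrable_diff s H1D[OF u])+
    have H: "(\<lambda>x. \<phi> j x - u x) \<in> H1 D" by (rule H1I[OF sq w])
    show ?thesis
      by (rule l2norm_cong_AE[OF weak_gradient_unique[OF D(2,1) H1D(2,3)[OF H] sq(2) w]])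
        (auto intro: square_integrable_measurable H1D[OF H] sq)
  qed
  with 2 have 3: "(\<lambda>j. l2norm ?M (\<lambda>x. gradient (\<phi> j) x - wgrad D u x)) \<longlonglongrightarrow> 0" by simp
  have 4: "(\<lambda>j. l2norm (boundary_measure D) (\<lambda>x. \<phi> j x - g x)) \<longlonglongrightarrow> 0"
    using tendsto_real_sqrt[OF blim] by (simp add: l2norm_def)
  show ?thesis using \<phi> 1 3 4 by blast
qed

section \<open>The estimate on one cell\<close>

lemma integrable_indicator_continuous:
  fixes f :: "'a::euclidean_space \<Rightarrow> real"
  assumes "continuous_on UNIV f" "bounded B" "B \<in> sets borel"
  shows "integrable lborel (\<lambda>x. indicator B x * f x)"
proof -
  obtain R where R: "B \<subseteq> cball 0 R" using assms(2) by (auto simp: bounded_iff subset_iff)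
  have "integrable lborel (\<lambda>x. indicator (cball 0 R) x *\<^sub>R f x)"
    by (rule borel_integrable_compact) (use continuous_on_subset[OF assms(1)] in auto)
  then have "integrable lborel (\<lambda>x. indicator B x * (indicator (cball 0 R) x *\<^sub>R f x))"
    by (rule integrable_bounded_mult[where C = 1]) (use assms(3) in \<open>auto simp: indicator_def\<close>)
  moreover have "(\<lambda>x. indicator B x * (indicator (cball 0 R) x *\<^sub>R f x)) = (\<lambda>x. indicator B x * f x)"
    using R by (intro ext) (auto split: split_indicator)
  ultimately show ?thesis by simp
qed

text \<open>Multiplied by the volume of \<open>K\<close>, the difference is the double integral of
  \<open>f x - f y\<close> over \<open>x\<close> in \<open>B\<close> and \<open>y\<close> in
  \<open>K\<close>, to which \<open>convex_poincare\<close> applies. In the application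
  \<open>B\<close> is the portion of the shell in one half of a cell.\<close>

lemma convex_average_le:
  fixes f N :: "'a::euclidean_space \<Rightarrow> real"
  assumes ug: "upper_gradient f N" and K: "convex K" "K \<in> sets borel" "bounded K" "0 < measure lborel K"
    and D: "\<And>x y. x \<in> K \<Longrightarrow> y \<in> K \<Longrightarrow> norm (y - x) \<le> D"
    and B: "B \<subseteq> K" "B \<in> sets borel"
  shows "ennreal \<bar>(LINT x|lborel. indicator B x * f x) - measure lborel B / measure lborel K * (LINT x|lborel. indicator K x * f x)\<bar>
    \<le> ennreal (D * 2 ^ DIM('a)) * (\<integral>\<^sup>+x. indicator K x * ennreal (N x) \<partial>lborel)"
proof -
  let ?p = "measure lborel K" and ?J = "LINT x|lborel. indicator K x * f x" and ?I = "LINT x|lborel. indicator B x * f x"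
  have f: "continuous_on UNIV f" and [measurable]: "f \<in> borel_measurable borel" using upper_gradientD[OF ug] by auto
  have [measurable]: "K \<in> sets borel" "B \<in> sets borel" by fact+
  have bB: "bounded B" using bounded_subset[OF K(3) B(1)] .
  have intK: "integrable lborel (\<lambda>x. indicator K x * f x)" and intB: "integrable lborel (\<lambda>x. indicator B x * f x)"
    by (intro integrable_indicator_continuous f K B bB)+
  have fin: "emeasure lborel K < top" "emeasure lborel B < top"
    using emeasure_bounded_finite[OF K(3)] emeasure_bounded_finite[OF bB] by auto
  have ind: "integrable lborel (indicator K :: 'a \<Rightarrow> real)" "integrable lborel (indicator B :: 'a \<Rightarrow> real)"
    using fin by auto
  have inner: "(LINT y|lborel. indicator K y * (f x - f y)) = ?p * f x - ?J" for x
  proof -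
    have "(LINT y|lborel. indicator K y * (f x - f y)) = (LINT y|lborel. f x * indicator K y - indicator K y * f y)"
      by (intro Bochner_Integration.integral_cong) (auto simp: algebra_simps)
    also have "\<dots> = (LINT y|lborel. f x * indicator K y) - ?J"
      by (rule Bochner_Integration.integral_diff) (use ind intK in auto)
    finally show ?thesis by (simp add: mult.commute)
  qed
  have int_in: "integrable lborel (\<lambda>y. indicator K y * (f x - f y))" for x
    by (rule integrable_indicator_continuous) (intro continuous_intros f, fact+)
  have outer: "?p * ?I - measure lborel B * ?J = (LINT x|lborel. indicator B x * (?p * f x - ?J))"
  proof -
    have "(LINT x|lborel. indicator B x * (?p * f x - ?J)) = (LINT x|lborel. ?p * (indicator B x * f x) - ?J * indicator B x)"
      by (intro Bochner_Integration.integral_cong) (auto simp: algebra_simps)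
    also have "\<dots> = (LINT x|lborel. ?p * (indicator B x * f x)) - (LINT x|lborel. ?J * indicator B x)"
      by (rule Bochner_Integration.integral_diff) (use ind intB in auto)
    finally show ?thesis by (simp add: mult.commute)
  qed
  have "ennreal \<bar>?p * ?I - measure lborel B * ?J\<bar> \<le> (\<integral>\<^sup>+x. ennreal (norm (indicator B x * (?p * f x - ?J))) \<partial>lborel)"
    unfolding outer real_norm_def[symmetric]
    by (rule integral_norm_bound_ennreal, rule integrable_indicator_continuous) (intro continuous_intros f, fact+)
  also have "\<dots> \<le> (\<integral>\<^sup>+x. \<integral>\<^sup>+y. indicator K x * indicator K y * ennreal \<bar>f y - f x\<bar> \<partial>lborel \<partial>lborel)"
  proof (rule nn_integral_mono)
    fix x
    show "ennreal (norm (indicator B x * (?p * f x - ?J))) \<le> (\<integral>\<^sup>+y. indicator K x * indicator K y * ennreal \<bar>f y - f x\<bar> \<partial>lborel)"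
    proof (cases "x \<in> B")
      case True
      then have "ennreal (norm (indicator B x * (?p * f x - ?J))) = ennreal (norm (LINT y|lborel. indicator K y * (f x - f y)))"
        by (simp add: inner)
      also have "\<dots> \<le> (\<integral>\<^sup>+y. ennreal (norm (indicator K y * (f x - f y))) \<partial>lborel)"
        by (rule integral_norm_bound_ennreal[OF int_in])
      also have "\<dots> = (\<integral>\<^sup>+y. indicator K x * indicator K y * ennreal \<bar>f y - f x\<bar> \<partial>lborel)"
        using True B(1) by (intro nn_integral_cong) (auto simp: indicator_def abs_minus_commute)
      finally show ?thesis .
    qed simp
  qed
  also have "\<dots> \<le> ennreal D * 2 ^ DIM('a) * emeasure lborel K * (\<integral>\<^sup>+x. indicator K x * ennreal (N x) \<partial>lborel)"
    by (rule convex_poincare[OF ug K(1,2) D])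
  finally have le: "ennreal \<bar>?p * ?I - measure lborel B * ?J\<bar>
      \<le> ennreal D * 2 ^ DIM('a) * ennreal ?p * (\<integral>\<^sup>+x. indicator K x * ennreal (N x) \<partial>lborel)"
    using fin by (simp add: emeasure_eq_ennreal_measure)
  have "?I - measure lborel B / ?p * ?J = (1 / ?p) * (?p * ?I - measure lborel B * ?J)"
    using K(4) by (simp add: field_simps)
  then have "\<bar>?I - measure lborel B / ?p * ?J\<bar> = (1 / ?p) * \<bar>?p * ?I - measure lborel B * ?J\<bar>"
    using K(4) by (simp only: abs_mult) simp
  then have "ennreal \<bar>?I - measure lborel B / ?p * ?J\<bar> = ennreal ((1 / ?p) * \<bar>?p * ?I - measure lborel B * ?J\<bar>)"
    by (simp only:)
  also have "\<dots> = ennreal (1 / ?p) * ennreal \<bar>?p * ?I - measure lborel B * ?J\<bar>"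
    by (rule ennreal_mult') simp
  also have "\<dots> \<le> ennreal (1 / ?p) * (ennreal D * 2 ^ DIM('a) * ennreal ?p * (\<integral>\<^sup>+x. indicator K x * ennreal (N x) \<partial>lborel))"
    by (intro mult_left_mono le) simp
  also have "\<dots> = (ennreal (1 / ?p) * ennreal ?p) * (ennreal D * 2 ^ DIM('a)) * (\<integral>\<^sup>+x. indicator K x * ennreal (N x) \<partial>lborel)"
    by (simp add: ac_simps)
  also have "ennreal (1 / ?p) * ennreal ?p = 1"
    using K(4) by (simp add: ennreal_mult'[symmetric])
  also have "ennreal D * 2 ^ DIM('a) = ennreal (D * 2 ^ DIM('a))"
    by (simp add: ennreal_mult'' ennreal_power[symmetric] del: ennreal_power)
  finally show ?thesis by simp
qed

section \<open>The pieces of a cell and their volumes\<close>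

definition open_cell :: "real \<Rightarrow> (real ^ 'n) set" where
  "open_cell e = box (\<chi> i. - e / 2) (\<chi> i. e / 2)"

text \<open>The two convex pieces of a cell that lie on either side of a slab containing the hole.\<close>

definition upper_part :: "real \<Rightarrow> real \<Rightarrow> 'n \<Rightarrow> (real ^ 'n) set" where
  "upper_part e \<rho> i = box (\<chi> j. if j = i then \<rho> else - e / 2) (\<chi> j. e / 2)"

definition lower_part :: "real \<Rightarrow> real \<Rightarrow> 'n \<Rightarrow> (real ^ 'n) set" where
  "lower_part e \<rho> i = box (\<chi> j. - e / 2) (\<chi> j. if j = i then - \<rho> else e / 2)"

text \<open>Besides the slab it contains the ball whose radius is the geometric mean of
  \<open>\<rho>\<close> and \<open>e\<close>: outside this ball \<open>\<rho> / norm x\<close> is at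
  most \<open>sqrt (\<rho> / e)\<close>, and inside only smallness of the volume helps.\<close>

definition bad_part :: "real \<Rightarrow> real \<Rightarrow> 'n \<Rightarrow> (real ^ 'n) set" where
  "bad_part e \<rho> i = {x \<in> open_cell e. \<bar>x $ i\<bar> \<le> \<rho> \<or> norm x < sqrt (\<rho> * e)} - cball 0 \<rho>"

lemma open_cell_iff: "x \<in> open_cell e \<longleftrightarrow> (\<forall>j. \<bar>x $ j\<bar> < e / 2)"
proof -
  have "(- e / 2 < t \<and> t < e / 2) = (\<bar>t\<bar> < e / 2)" for t :: real by arith
  then show ?thesis by (simp add: open_cell_def mem_box_cart)
qed

lemma upper_part_iff:
  assumes "0 \<le> \<rho>" "\<rho> < e / 2"
  shows "x \<in> upper_part e \<rho> i \<longleftrightarrow> x \<in> open_cell e \<and> \<rho> < x $ i"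
proof -
  have "x \<in> upper_part e \<rho> i \<longleftrightarrow> (\<forall>j. (if j = i then \<rho> else - e / 2) < x $ j \<and> x $ j < e / 2)"
    by (simp add: upper_part_def mem_box_cart)
  also have "\<dots> \<longleftrightarrow> (\<forall>j. \<bar>x $ j\<bar> < e / 2 \<and> (j = i \<longrightarrow> \<rho> < x $ j))"
  proof (rule all_cong1)
    fix j
    show "((if j = i then \<rho> else - e / 2) < x $ j \<and> x $ j < e / 2) \<longleftrightarrow> (\<bar>x $ j\<bar> < e / 2 \<and> (j = i \<longrightarrow> \<rho> < x $ j))"
      using assms by (cases "j = i") (simp_all, arith+)
  qed
  finally show ?thesis by (auto simp: open_cell_iff)
qed

lemma lower_part_iff:
  assumes "0 \<le> \<rho>" "\<rho> < e / 2"
  shows "x \<in> lower_part e \<rho> i \<longleftrightarrow> x \<in> open_cell e \<and> x $ i < - \<rho>"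
proof -
  have "x \<in> lower_part e \<rho> i \<longleftrightarrow> (\<forall>j. - e / 2 < x $ j \<and> x $ j < (if j = i then - \<rho> else e / 2))"
    by (simp add: lower_part_def mem_box_cart)
  also have "\<dots> \<longleftrightarrow> (\<forall>j. \<bar>x $ j\<bar> < e / 2 \<and> (j = i \<longrightarrow> x $ j < - \<rho>))"
  proof (rule all_cong1)
    fix j
    show "(- e / 2 < x $ j \<and> x $ j < (if j = i then - \<rho> else e / 2)) \<longleftrightarrow> (\<bar>x $ j\<bar> < e / 2 \<and> (j = i \<longrightarrow> x $ j < - \<rho>))"
      using assms by (cases "j = i") (simp_all, arith+)
  qed
  finally show ?thesis by (auto simp: open_cell_iff)
qed

lemma part_borel [measurable]:
  "open_cell e \<in> sets borel" "upper_part e \<rho> i \<in> sets borel" "lower_part e \<rho> i \<in> sets borel"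
  by (auto simp: open_cell_def upper_part_def lower_part_def)

lemma ball_borel [measurable]:
  "ball (a::'a::euclidean_space) r \<in> sets borel" "cball (a::'a) r \<in> sets borel"
  by auto

lemma bad_part_borel [measurable]:
  fixes i :: "'n::finite"
  shows "bad_part e \<rho> i \<in> sets borel"
proof -
  have "bad_part e \<rho> i = (open_cell e \<inter> ({x. \<bar>x $ i\<bar> \<le> \<rho>} \<union> ball 0 (sqrt (\<rho> * e)))) - cball 0 \<rho>"
    by (auto simp: bad_part_def)
  moreover have "closed {x::real ^ 'n. \<bar>x $ i\<bar> \<le> \<rho>}" by (intro closed_Collect_le continuous_intros)
  ultimately show ?thesis by (auto intro: borel_closed)
qed

lemma measure_box_cart:
  fixes a b :: "real ^ 'n"
  assumes "\<And>j. a $ j \<le> b $ j"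
  shows "measure lborel (box a b) = (\<Prod>j\<in>UNIV. b $ j - a $ j)"
proof -
  have "cbox a b \<noteq> {}" using assms by (auto simp: interval_ne_empty_cart)
  then have "measure lborel (cbox a b) = (\<Prod>j\<in>UNIV. b $ j - a $ j)" by (rule content_cbox_cart)
  then show ?thesis by (simp add: measure_lborel_box_eq measure_lborel_cbox_eq)
qed

lemma measure_open_cell: "0 < e \<Longrightarrow> measure lborel (open_cell e :: (real ^ 'n) set) = e ^ CARD('n)"
  unfolding open_cell_def by (subst measure_box_cart) auto

lemma measure_upper_part:
  assumes "0 < \<rho>" "\<rho> < e / 2"
  shows "measure lborel (upper_part e \<rho> i :: (real ^ 'n) set) = (e / 2 - \<rho>) * e ^ (CARD('n) - 1)"
proof -
  have "measure lborel (upper_part e \<rho> i) = (\<Prod>j\<in>UNIV. e / 2 - (if j = i then \<rho> else - e / 2))"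
    unfolding upper_part_def using assms by (subst measure_box_cart) auto
  also have "\<dots> = (e / 2 - \<rho>) * (\<Prod>j\<in>UNIV - {i}. e / 2 - (if j = i then \<rho> else - e / 2))"
    by (subst prod.remove[of UNIV i]) auto
  also have "(\<Prod>j\<in>UNIV - {i}. e / 2 - (if j = i then \<rho> else - e / 2)) = (\<Prod>j\<in>UNIV - {i}. e)"
    by (intro prod.cong) auto
  also have "\<dots> = e ^ (CARD('n) - 1)" by (simp add: card_Diff_singleton)
  finally show ?thesis .
qed

lemma measure_lborel_uminus:
  fixes B :: "'a::euclidean_space set"
  assumes "B \<in> sets borel"
  shows "measure lborel (uminus -` B) = measure lborel B"
proof -
  have "emeasure lborel (uminus -` B) = emeasure lborel B"
    by (rule emeasure_lborel_isometry[OF _ _ assms]) (auto simp: dist_norm norm_minus_commute)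
  then show ?thesis by (simp add: measure_def)
qed

lemma measure_lower_part:
  assumes "0 < \<rho>" "\<rho> < e / 2"
  shows "measure lborel (lower_part e \<rho> i :: (real ^ 'n) set) = (e / 2 - \<rho>) * e ^ (CARD('n) - 1)"
proof -
  have "lower_part e \<rho> i = uminus -` upper_part e \<rho> i"
    using assms by (auto simp: lower_part_iff upper_part_iff open_cell_iff)
  then show ?thesis using measure_upper_part[OF assms] by (simp add: measure_lborel_uminus)
qed

lemma measure_slab:
  assumes "0 < \<rho>" "\<rho> < e / 2"
  shows "measure lborel {x \<in> open_cell e :: (real ^ 'n) set. \<bar>x $ i\<bar> \<le> \<rho>} = 2 * \<rho> * e ^ (CARD('n) - 1)"
proof -
  let ?S = "{x \<in> open_cell e :: (real ^ 'n) set. \<bar>x $ i\<bar> \<le> \<rho>}" and ?U = "upper_part e \<rho> i" and ?L = "lower_part e \<rho> i"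
  have fin: "B \<in> fmeasurable lborel" if "B \<in> sets borel" "B \<subseteq> open_cell e" for B :: "(real ^ 'n) set"
  proof (rule fmeasurableI)
    have "bounded B" by (rule bounded_subset[OF _ that(2)]) (simp add: open_cell_def)
    then show "emeasure lborel B < \<infinity>" using emeasure_bounded_finite by simp
  qed (use that in simp)
  have sub: "?U \<subseteq> open_cell e" "?L \<subseteq> open_cell e" using assms by (auto simp: upper_part_iff lower_part_iff)
  have S: "?S = open_cell e - (?U \<union> ?L)" using assms by (auto simp: upper_part_iff lower_part_iff)
  have disj: "?U \<inter> ?L = {}" using assms by (auto simp: upper_part_iff lower_part_iff)
  have "measure lborel ?S = measure lborel (open_cell e :: (real ^ 'n) set) - measure lborel (?U \<union> ?L)"
    unfolding S by (rule measure_Diff) (use fin[of "open_cell e"] sub in \<open>auto simp: fmeasurable_def\<close>)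
  also have "measure lborel (?U \<union> ?L) = measure lborel ?U + measure lborel ?L"
    by (rule measure_Union) (use fin[of ?U] fin[of ?L] sub disj in \<open>auto simp: fmeasurable_def\<close>)
  also have "measure lborel (open_cell e :: (real ^ 'n) set) = e * e ^ (CARD('n) - 1)"
    using assms by (simp add: measure_open_cell power_eq_if)
  finally show ?thesis using assms by (simp add: measure_upper_part measure_lower_part algebra_simps)
qed

text \<open>Two proportions are multiplied: the area of the sphere over the volume of the shell, and
  the volume of the upper half of the shell over that of the upper part. By reflection the lower
  parts give the same number. As \<open>\<rho> / e\<close> tends to 0 it behaves like the area of
  the sphere over the volume of the cell.\<close>

definition cell_coeff :: "real \<Rightarrow> real \<Rightarrow> 'n::finite \<Rightarrow> real" where
  "cell_coeff e \<rho> i = unit_sphere_area TYPE('n) * \<rho> ^ (CARD('n) - 1)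
      / measure lborel (annulus \<rho> (e / 2) :: (real ^ 'n) set)
      * (measure lborel (annulus \<rho> (e / 2) \<inter> upper_part e \<rho> i) / measure lborel (upper_part e \<rho> i))"

lemma measure_annulus:
  assumes "0 \<le> s" "s < R"
  shows "measure lborel (annulus s R :: 'a::euclidean_space set) = unit_ball_vol (real DIM('a)) * (R ^ DIM('a) - s ^ DIM('a))"
proof -
  have "measure lborel (annulus s R :: 'a set) = measure lborel (ball (0::'a) R) - measure lborel (cball (0::'a) s)"
    by (rule measure_Diff) (use assms in \<open>auto simp: emeasure_ball\<close>)
  then show ?thesis using assms by (simp add: content_ball content_cball algebra_simps)
qed

text \<open>The hole has at most half the radius of the inscribed ball, so at least half of that
  ball's volume remains. This keeps the normalising denominator from degenerating.\<close>

lemma annulus_lower_bound: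
  assumes "0 < \<rho>" "4 * \<rho> \<le> e"
  shows "unit_ball_vol (real DIM('a)) * (e / 2) ^ DIM('a) / 2 \<le> measure lborel (annulus \<rho> (e / 2) :: 'a::euclidean_space set)"
proof -
  let ?d = "DIM('a)"
  have "\<rho> ^ ?d \<le> (e / 2 * (1 / 2)) ^ ?d" using assms by (intro power_mono) auto
  also have "\<dots> = (e / 2) ^ ?d * (1 / 2) ^ ?d" by (rule power_mult_distrib)
  also have "\<dots> \<le> (e / 2) ^ ?d * (1 / 2)"
    using assms power_decreasing[of 1 ?d "1 / 2 :: real"] by (intro mult_left_mono) (auto simp: Suc_leI)
  finally have "(e / 2) ^ ?d / 2 \<le> (e / 2) ^ ?d - \<rho> ^ ?d" by simp
  then have "unit_ball_vol (real ?d) * ((e / 2) ^ ?d / 2) \<le> unit_ball_vol (real ?d) * ((e / 2) ^ ?d - \<rho> ^ ?d)"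
    by (intro mult_left_mono) auto
  then show ?thesis using assms by (simp add: measure_annulus)
qed

lemma annulus_subset_cell: "annulus \<rho> (e / 2) \<subseteq> open_cell e"
proof
  fix x :: "real ^ 'n" assume x: "x \<in> annulus \<rho> (e / 2)"
  have "\<bar>x $ j\<bar> < e / 2" for j
  proof -
    have "\<bar>x $ j\<bar> \<le> norm x" by (rule component_le_norm_cart)
    then show ?thesis using x by simp
  qed
  then show "x \<in> open_cell e" by (simp add: open_cell_iff)
qed

lemma norm_diff_open_cell:
  fixes x y :: "real ^ 'n"
  assumes "x \<in> open_cell e" "y \<in> open_cell e"
  shows "norm (y - x) \<le> real CARD('n) * e"
proof -
  have "norm (y - x) \<le> (\<Sum>j\<in>UNIV. \<bar>(y - x) $ j\<bar>)" by (rule norm_le_l1_cart)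
  also have "\<dots> \<le> (\<Sum>j\<in>(UNIV::'n set). e)"
  proof (rule sum_mono)
    fix j
    have "\<bar>x $ j\<bar> < e / 2" "\<bar>y $ j\<bar> < e / 2" using assms by (auto simp: open_cell_iff)
    then show "\<bar>(y - x) $ j\<bar> \<le> e" by simp
  qed
  finally show ?thesis by simp
qed

lemma bounded_open_cell: "bounded (open_cell e)"
  by (simp add: open_cell_def)

text \<open>With \<open>R = e / 2\<close> the radial estimate carries the weight
  \<open>unit_sphere_area * R ^ d / |A|\<close> times \<open>(\<rho> / norm y) ^ m\<close>. The
  first factor is at most the stated constant because the shell fills half the ball; the second is
  at most \<open>sqrt (\<rho> / e)\<close> once \<open>norm y \<ge> sqrt (\<rho> * e)\<close>, and
  at most 1 closer to the hole, where \<open>y\<close> is in the bad part.\<close>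

lemma sphere_to_annulus:
  fixes f N :: "real ^ 'n \<Rightarrow> real"
  assumes d: "2 \<le> CARD('n)" and ug: "upper_gradient f N" and \<rho>: "0 < \<rho>" "4 * \<rho> \<le> e"
  defines "m \<equiv> CARD('n) - 1" and "A \<equiv> annulus \<rho> (e / 2) :: (real ^ 'n) set"
  defines "lam \<equiv> unit_sphere_area TYPE('n) * \<rho> ^ m / measure lborel A"
  shows "ennreal \<bar>(LINT x|hausdorff_measure m. indicator (sphere 0 \<rho>) x * f x) - lam * (LINT x|lborel. indicator A x * f x)\<bar>
    \<le> ennreal (2 * unit_sphere_area TYPE('n) / unit_ball_vol (real CARD('n)))
      * (\<integral>\<^sup>+x. indicator (open_cell e - cball 0 \<rho>) x * (ennreal (sqrt (\<rho> / e)) + indicator (bad_part e \<rho> i) x) * ennreal (N x) \<partial>lborel)"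
    (is "_ \<le> ennreal ?C * _")
proof -
  let ?R = "e / 2" and ?g = "\<lambda>x::real ^ 'n. (\<rho> / norm x) *\<^sub>R x" and ?w = "unit_ball_vol (real CARD('n))"
  let ?Ad = "unit_sphere_area TYPE('n)"
  have e: "0 < e" "\<rho> < ?R" using \<rho> by auto
  have f: "continuous_on UNIV f" and [measurable]: "f \<in> borel_measurable borel" "N \<in> borel_measurable borel"
    and N0: "\<And>x. 0 \<le> N x" using upper_gradientD[OF ug] by auto
  have [measurable]: "A \<in> sets borel" "ball 0 ?R - ball 0 \<rho> \<in> sets (borel :: (real ^ 'n) measure)"
    by (simp_all add: A_def)
  have Ad0: "0 \<le> ?Ad" by (simp add: unit_sphere_area_def)
  have w: "0 < ?w" by simp
  have A_lower: "?w * ?R ^ CARD('n) / 2 \<le> measure lborel A"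
    using annulus_lower_bound[OF \<rho>, where 'a = "real ^ 'n"] by (simp add: A_def)
  moreover have RR: "0 < ?w * ?R ^ CARD('n) / 2" using e w by simp
  ultimately have A_pos: "0 < measure lborel A" by linarith
  have lam0: "0 \<le> lam" using Ad0 \<rho> A_pos by (simp add: lam_def)
  have bA: "bounded A" by (simp add: A_def bounded_diff)
  have int1: "integrable lborel (\<lambda>x. indicator A x * f x)"
    by (rule integrable_indicator_continuous[OF f bA]) simp
  have int2: "integrable lborel (\<lambda>x. indicator A x * f (?g x))"
  proof -
    have "compact (f ` cball 0 \<rho>)"
      by (rule compact_continuous_image[OF continuous_on_subset[OF f]]) auto
    from compact_imp_bounded[OF this] obtain B where B: "\<forall>z\<in>f ` cball 0 \<rho>. norm z \<le> B"
      unfolding bounded_iff by blast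
    have gB: "\<bar>f (?g x)\<bar> \<le> B" for x
    proof -
      have "?g x \<in> cball 0 \<rho>" using \<rho> by simp
      then show ?thesis using B by simp
    qed
    have "integrable lborel (indicator A :: real ^ 'n \<Rightarrow> real)"
      using emeasure_bounded_finite[OF bA] by simp
    then have "integrable lborel (\<lambda>x. f (?g x) * indicator A x)"
      by (rule integrable_bounded_mult[where C = B]) (use gB in auto)
    then show ?thesis by (simp add: mult.commute)
  qed
  have "(LINT x|hausdorff_measure m. indicator (sphere 0 \<rho>) x * f x) = lam * (LINT x|lborel. indicator A x * f (?g x))"
    using integral_sphere_eq[of \<rho> ?R \<rho> f 0] \<rho> e by (simp add: lam_def m_def A_def)
  then have "(LINT x|hausdorff_measure m. indicator (sphere 0 \<rho>) x * f x) - lam * (LINT x|lborel. indicator A x * f x)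
      = lam * (LINT x|lborel. indicator A x * f (?g x) - indicator A x * f x)"
    using int1 int2 by (simp add: right_diff_distrib)
  then have "ennreal \<bar>(LINT x|hausdorff_measure m. indicator (sphere 0 \<rho>) x * f x) - lam * (LINT x|lborel. indicator A x * f x)\<bar>
      = ennreal lam * ennreal (norm (LINT x|lborel. indicator A x * f (?g x) - indicator A x * f x))"
    using lam0 by (simp add: abs_mult ennreal_mult')
  also have "\<dots> \<le> ennreal lam * (\<integral>\<^sup>+x. ennreal (norm (indicator A x * f (?g x) - indicator A x * f x)) \<partial>lborel)"
    by (intro mult_left_mono integral_norm_bound_ennreal Bochner_Integration.integrable_diff int1 int2) simp
  also have "(\<integral>\<^sup>+x. ennreal (norm (indicator A x * f (?g x) - indicator A x * f x)) \<partial>lborel)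
      = (\<integral>\<^sup>+x. indicator A x * ennreal \<bar>f x - f (?g x)\<bar> \<partial>lborel)"
    by (intro nn_integral_cong) (auto split: split_indicator simp: abs_minus_commute)
  also have "ennreal lam * \<dots> \<le> ennreal lam * (\<integral>\<^sup>+y. indicator (ball 0 ?R - ball 0 \<rho>) y * ennreal (?R * (?R / norm y) ^ m * N y) \<partial>lborel)"
    using radial_estimate[OF ug \<rho>(1) e(2)] by (intro mult_left_mono) (simp_all add: A_def m_def)
  also have "\<dots> = (\<integral>\<^sup>+y. ennreal lam * (indicator (ball 0 ?R - ball 0 \<rho>) y * ennreal (?R * (?R / norm y) ^ m * N y)) \<partial>lborel)"
    by (rule nn_integral_cmult[symmetric]) measurable
  also have "\<dots> \<le> (\<integral>\<^sup>+y. ennreal ?C * (indicator (open_cell e - cball 0 \<rho>) y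
      * (ennreal (sqrt (\<rho> / e)) + indicator (bad_part e \<rho> i) y) * ennreal (N y)) \<partial>lborel)"
  proof (rule nn_integral_mono_AE)
    \<comment> \<open>The radial estimate integrates over a region that includes the sphere itself,
      the claim over the complement of the closed ball; they differ by a null set.\<close>
    have "negligible (sphere (0 :: real ^ 'n) \<rho>)" by (rule negligible_sphere)
    then have "sphere (0 :: real ^ 'n) \<rho> \<in> null_sets lborel"
      by (simp add: negligible_iff_null_sets null_sets_completion_iff)
    then have "AE y in lborel. y \<notin> sphere (0 :: real ^ 'n) \<rho>" by (rule AE_not_in)
    then show "AE y in lborel. ennreal lam * (indicator (ball 0 ?R - ball 0 \<rho>) y * ennreal (?R * (?R / norm y) ^ m * N y))
        \<le> ennreal ?C * (indicator (open_cell e - cball 0 \<rho>) y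
          * (ennreal (sqrt (\<rho> / e)) + indicator (bad_part e \<rho> i) y) * ennreal (N y))"
    proof eventually_elim
      case (elim y)
      show ?case
      proof (cases "y \<in> ball 0 ?R - ball 0 \<rho>")
        case True
        then have yA: "y \<in> annulus \<rho> ?R" and y: "\<rho> < norm y" "norm y < ?R" using elim by auto
        have yc: "y \<in> open_cell e - cball 0 \<rho>" using annulus_subset_cell[of e \<rho>] yA by auto
        define q where "q = \<rho> / norm y"
        have q: "0 \<le> q" "q \<le> 1" using y \<rho> by (auto simp: q_def divide_le_eq_1)
        define th where "th = sqrt (\<rho> / e) + indicator (bad_part e \<rho> i) y"
        have "q \<le> th"
        proof (cases "norm y < sqrt (\<rho> * e)")
          case True
          then have "y \<in> bad_part e \<rho> i" using yc y by (auto simp: bad_part_def)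
          then show ?thesis using q \<rho> e by (simp add: th_def add_increasing)
        next
          case False
          then have "q \<le> \<rho> / sqrt (\<rho> * e)"
            unfolding q_def using \<rho> e by (intro divide_left_mono) (auto simp: not_less intro!: mult_pos_pos order_less_trans[OF \<rho>(1) y(1)])
          also have "\<dots> = sqrt (\<rho> / e)"
            using \<rho> e by (simp add: real_sqrt_mult real_sqrt_divide real_div_sqrt flip: divide_divide_eq_left)
          finally show ?thesis by (simp add: th_def add_increasing2)
        qed
        \<comment> \<open>This is where \<open>m \<ge> 1\<close>, that is dimension at least 2,
          enters.\<close>
        moreover have "q ^ m \<le> q" using q d power_decreasing[of 1 m q] by (simp add: m_def)
        ultimately have qth: "q ^ m \<le> th" by linarith
        have "lam * (?R * (?R / norm y) ^ m) = (?Ad * ?R ^ CARD('n) / measure lborel A) * q ^ m"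
        proof -
          have "?R ^ CARD('n) = ?R * ?R ^ m" using d by (simp add: m_def power_eq_if)
          then show ?thesis by (simp add: lam_def q_def power_divide mult_ac)
        qed
        also have "\<dots> \<le> ?C * th"
        proof (rule mult_mono[OF _ qth])
          have "?Ad * ?R ^ CARD('n) / measure lborel A \<le> ?Ad * ?R ^ CARD('n) / (?w * ?R ^ CARD('n) / 2)"
            using A_lower RR Ad0 e by (intro divide_left_mono mult_pos_pos A_pos mult_nonneg_nonneg) auto
          also have "\<dots> = ?C" using e by simp
          finally show "?Ad * ?R ^ CARD('n) / measure lborel A \<le> ?C" .
        qed (use q Ad0 w in auto)
        finally have "lam * (?R * (?R / norm y) ^ m) * N y \<le> ?C * th * N y"
          using N0 by (rule mult_right_mono)
        then have "ennreal (lam * (?R * (?R / norm y) ^ m) * N y) \<le> ennreal (?C * th * N y)" by (rule ennreal_leI)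
        moreover have "ennreal lam * (indicator (ball 0 ?R - ball 0 \<rho>) y * ennreal (?R * (?R / norm y) ^ m * N y))
            = ennreal (lam * (?R * (?R / norm y) ^ m) * N y)"
          using True lam0 by (simp add: ennreal_mult'[symmetric] mult.assoc)
        moreover have "ennreal (sqrt (\<rho> / e)) + indicator (bad_part e \<rho> i) y = ennreal th"
          using \<rho> e by (simp add: th_def ennreal_indicator[symmetric] del: ennreal_indicator)
        moreover have "ennreal (?C * th * N y) = ennreal ?C * (ennreal th * ennreal (N y))"
        proof -
          have "0 \<le> th" using \<open>q \<le> th\<close> q by linarith
          moreover have "0 \<le> ?C" using Ad0 w by simp
          ultimately show ?thesis using N0 by (simp only: ennreal_mult mult_nonneg_nonneg mult.assoc)
        qed
        ultimately show ?thesis using yc by simp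
      qed simp
    qed
  qed
  also have "\<dots> = ennreal ?C * (\<integral>\<^sup>+x. indicator (open_cell e - cball 0 \<rho>) x
      * (ennreal (sqrt (\<rho> / e)) + indicator (bad_part e \<rho> i) x) * ennreal (N x) \<partial>lborel)"
    by (rule nn_integral_cmult) measurable
  finally show ?thesis by (simp add: mult.assoc)
qed

text \<open>The shell density is at most
  \<open>2 ^ (d + 1) * unit_sphere_area / unit_ball_vol\<close> times
  \<open>\<rho> ^ m / e ^ d\<close>, and the Poincare constant of a half cell is
  \<open>d * e * 2 ^ d\<close>; their product, without the powers of \<open>\<rho>\<close> and
  \<open>e\<close>, is this number. It also dominates the constant of the passage from sphere to
  shell.\<close>

definition cell_const :: "'n::finite itself \<Rightarrow> real" where
  "cell_const _ = 2 ^ (2 * CARD('n) + 1) * real CARD('n) * unit_sphere_area TYPE('n) / unit_ball_vol (real CARD('n))"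

text \<open>Four errors are added: from the sphere to the shell, the share of the shell in the slab,
  and for each half of the cell the passage from its portion of the shell to the whole half. The
  first has an absolute constant, the others carry the shell density of order
  \<open>\<rho> ^ m / e ^ d\<close>; hence the factor \<open>1 + \<rho> ^ m / e ^ d\<close>.\<close>

lemma cell_estimate_centered:
  fixes f N :: "real ^ 'n \<Rightarrow> real"
  assumes d: "2 \<le> CARD('n)" and ug: "upper_gradient f N" and \<rho>: "0 < \<rho>" "4 * \<rho> \<le> e"
  defines "m \<equiv> CARD('n) - 1"
  shows "ennreal \<bar>(LINT x|hausdorff_measure m. indicator (sphere 0 \<rho>) x * f x)
      - cell_coeff e \<rho> i * (LINT x|lborel. indicator (upper_part e \<rho> i \<union> lower_part e \<rho> i) x * f x)\<bar>
    \<le> ennreal (cell_const TYPE('n) * (1 + \<rho> ^ m / e ^ CARD('n)))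
      * ((\<integral>\<^sup>+x. indicator (open_cell e - cball 0 \<rho>) x * (ennreal (sqrt (\<rho> / e) + e) + indicator (bad_part e \<rho> i) x) * ennreal (N x) \<partial>lborel)
        + (\<integral>\<^sup>+x. indicator (bad_part e \<rho> i) x * ennreal \<bar>f x\<bar> \<partial>lborel))"
proof -
  let ?Ad = "unit_sphere_area TYPE('n)" and ?w = "unit_ball_vol (real CARD('n))" and ?K = "cell_const TYPE('n)"
  let ?U = "upper_part e \<rho> i" and ?L = "lower_part e \<rho> i" and ?W = "open_cell e - cball 0 \<rho> :: (real ^ 'n) set"
  let ?d = "CARD('n)"
  define q where "q = \<rho> ^ m / e ^ ?d"
  define A where "A = (annulus \<rho> (e / 2) :: (real ^ 'n) set)"
  define A0 where "A0 = {x \<in> A. \<bar>x $ i\<bar> \<le> \<rho>}"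
  define lam where "lam = ?Ad * \<rho> ^ m / measure lborel A"
  define b where "b = sqrt (\<rho> / e)"
  have e: "0 < e" "\<rho> < e / 2" "0 \<le> \<rho>" using \<rho> by auto
  have f: "continuous_on UNIV f" and [measurable]: "f \<in> borel_measurable borel" "N \<in> borel_measurable borel"
    and N0: "\<And>x. 0 \<le> N x" using upper_gradientD[OF ug] by auto
  have [measurable]: "A \<in> sets borel" by (simp add: A_def)
  have A0_eq: "A0 = A - (A \<inter> ?U \<union> A \<inter> ?L)"
    using annulus_subset_cell[of e \<rho>] e by (auto simp: A0_def A_def upper_part_iff lower_part_iff)
  then have [measurable]: "A0 \<in> sets borel" by simp
  have disj: "?U \<inter> ?L = {}" using e by (auto simp: upper_part_iff lower_part_iff)
  have UL_W: "?U \<subseteq> ?W" "?L \<subseteq> ?W"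
  proof -
    have "\<bar>x $ i\<bar> \<le> norm x" for x by (rule component_le_norm_cart)
    then have "x \<notin> cball 0 \<rho>" if "\<rho> < \<bar>x $ i\<bar>" for x using that by (simp add: not_le order_less_le_trans)
    then show "?U \<subseteq> ?W" "?L \<subseteq> ?W" using e by (auto simp: upper_part_iff lower_part_iff)
  qed
  have A0_bad: "A0 \<subseteq> bad_part e \<rho> i"
    using annulus_subset_cell[of e \<rho>] by (auto simp: A0_def A_def bad_part_def)
  have Ad0: "0 \<le> ?Ad" by (simp add: unit_sphere_area_def)
  have w: "0 < ?w" by simp
  have A_lower: "?w * (e / 2) ^ ?d / 2 \<le> measure lborel A"
    using annulus_lower_bound[OF \<rho>, where 'a = "real ^ 'n"] by (simp add: A_def)
  moreover have RR: "0 < ?w * (e / 2) ^ ?d / 2" using e w by simp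
  ultimately have A_pos: "0 < measure lborel A" by linarith
  have lam0: "0 \<le> lam" using Ad0 \<rho> A_pos by (simp add: lam_def)
  have q0: "0 \<le> q" using e by (simp add: q_def)
  have lam_le: "lam \<le> (2 ^ (?d + 1) * ?Ad / ?w) * q"
  proof -
    have "lam \<le> ?Ad * \<rho> ^ m / (?w * (e / 2) ^ ?d / 2)"
      unfolding lam_def using A_lower RR Ad0 e by (intro divide_left_mono mult_pos_pos A_pos mult_nonneg_nonneg) auto
    also have "\<dots> = (2 ^ (?d + 1) * ?Ad / ?w) * q" by (simp add: q_def power_divide field_simps)
    finally show ?thesis .
  qed
  define B where "B = ?Ad / ?w"
  have B0: "0 \<le> B" using Ad0 w by (simp add: B_def)
  have K_eq: "?K = 2 ^ (2 * ?d + 1) * real ?d * B" by (simp add: cell_const_def B_def)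
  have lam_B: "lam \<le> 2 ^ (?d + 1) * B * q" using lam_le by (simp add: B_def)
  have p2: "(1::real) \<le> 2 ^ ?d" by simp
  have d1: "1 \<le> real ?d" using d by simp
  have K0: "0 \<le> ?K" using B0 by (simp add: K_eq)
  have lam_K': "lam * (real ?d * e * 2 ^ ?d) \<le> ?K * q * e"
  proof -
    have "lam * (real ?d * e * 2 ^ ?d) \<le> (2 ^ (?d + 1) * B * q) * (real ?d * e * 2 ^ ?d)"
      using e by (intro mult_right_mono lam_B) auto
    also have "\<dots> = ?K * q * e" by (simp add: K_eq power_add power_mult power2_eq_square mult_ac flip: power_mult_distrib)
    finally show ?thesis .
  qed
  have lam_K: "lam \<le> ?K * q"
  proof -
    have "1 * 1 \<le> real ?d * 2 ^ ?d" using d1 p2 by (intro mult_mono) auto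
    then have "lam * 1 \<le> lam * (real ?d * 2 ^ ?d)" using lam0 by (intro mult_left_mono) auto
    then have "lam * e \<le> (?K * q) * e" using lam_K' e by (simp add: mult_ac)
    then show ?thesis using e by simp
  qed
  have C1_K: "2 * ?Ad / ?w \<le> ?K"
  proof -
    have "2 \<le> 2 ^ (2 * ?d + 1) * real ?d"
    proof -
      have "2 * 1 \<le> (2::real) ^ (2 * ?d + 1) * real ?d" using d1 by (intro mult_mono) auto
      then show ?thesis by simp
    qed
    then have "2 * B \<le> 2 ^ (2 * ?d + 1) * real ?d * B" by (intro mult_right_mono B0)
    then show ?thesis by (simp add: K_eq B_def)
  qed
  define J where "J E = (LINT x|lborel. indicator E x * f x)" for E
  have bounded: "bounded A" "bounded A0" "bounded (A \<inter> ?U)" "bounded (A \<inter> ?L)" "bounded ?U" "bounded ?L"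
    using e bounded_subset[OF bounded_open_cell] annulus_subset_cell[of e \<rho>] UL_W
    by (auto simp: A_def A0_def upper_part_def lower_part_def intro: bounded_subset[of "ball 0 (e / 2)"])
  have int: "integrable lborel (\<lambda>x. indicator E x * f x)" if "bounded E" "E \<in> sets borel" for E
    by (rule integrable_indicator_continuous[OF f that])
  have J_Un: "J (E \<union> F) = J E + J F" if "E \<inter> F = {}" "bounded E" "bounded F" "E \<in> sets borel" "F \<in> sets borel" for E F
  proof -
    have "J (E \<union> F) = (LINT x|lborel. indicator E x * f x + indicator F x * f x)"
      unfolding J_def using that(1) by (intro Bochner_Integration.integral_cong) (auto split: split_indicator)
    then show ?thesis unfolding J_def using int that by simp
  qed
  have JA: "J A = J (A \<inter> ?U) + J (A \<inter> ?L) + J A0"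
  proof -
    have "A = (A \<inter> ?U \<union> A \<inter> ?L) \<union> A0" by (auto simp: A0_eq)
    then have "J A = J ((A \<inter> ?U \<union> A \<inter> ?L) \<union> A0)" by simp
    also have "\<dots> = J (A \<inter> ?U \<union> A \<inter> ?L) + J A0"
      by (rule J_Un) (use bounded in \<open>auto simp: A0_eq\<close>)
    also have "J (A \<inter> ?U \<union> A \<inter> ?L) = J (A \<inter> ?U) + J (A \<inter> ?L)"
      by (rule J_Un) (use bounded disj in auto)
    finally show ?thesis .
  qed
  have JUL: "J (?U \<union> ?L) = J ?U + J ?L" by (rule J_Un) (use bounded disj in auto)
  define mu where "mu = measure lborel (A \<inter> ?U)"
  define p where "p = measure lborel ?U"
  have p: "measure lborel ?L = p" "0 < p" using e \<rho> by (auto simp: p_def measure_lower_part measure_upper_part)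
  \<comment> \<open>The reflection \<open>uminus\<close> exchanges the two halves and preserves
    shell and volume, so both halves have the same proportion \<open>mu / p\<close>.\<close>
  have mu: "measure lborel (A \<inter> ?L) = mu"
  proof -
    have "A \<inter> ?L = uminus -` (A \<inter> ?U)"
      using e by (auto simp: A_def lower_part_iff upper_part_iff open_cell_iff)
    moreover have "measure lborel (uminus -` (A \<inter> ?U)) = measure lborel (A \<inter> ?U)"
      by (rule measure_lborel_uminus) simp
    ultimately show ?thesis by (simp only: mu_def)
  qed
  define S where "S = (LINT x|hausdorff_measure m. indicator (sphere 0 \<rho>) x * f x)"
  have coeff: "cell_coeff e \<rho> i = lam * (mu / p)" by (simp add: cell_coeff_def lam_def mu_def p_def A_def m_def)
  have split: "S - cell_coeff e \<rho> i * J (?U \<union> ?L)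
      = (S - lam * J A) + lam * J A0 + lam * (J (A \<inter> ?U) - mu / p * J ?U) + lam * (J (A \<inter> ?L) - mu / p * J ?L)"
    unfolding JA JUL coeff by (simp add: algebra_simps)
  define I where "I E = (\<integral>\<^sup>+x. indicator E x * ennreal (N x) \<partial>lborel)" for E
  let ?I1 = "\<integral>\<^sup>+x. indicator ?W x * (ennreal b + indicator (bad_part e \<rho> i) x) * ennreal (N x) \<partial>lborel"
  let ?I2 = "\<integral>\<^sup>+x. indicator (bad_part e \<rho> i) x * ennreal \<bar>f x\<bar> \<partial>lborel"
  let ?I3 = "\<integral>\<^sup>+x. indicator ?W x * (ennreal (b + e) + indicator (bad_part e \<rho> i) x) * ennreal (N x) \<partial>lborel"
  have e1: "ennreal \<bar>S - lam * J A\<bar> \<le> ennreal (?K * (1 + q)) * ?I1"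
  proof -
    have "ennreal \<bar>S - lam * J A\<bar> \<le> ennreal (2 * ?Ad / ?w) * ?I1"
      unfolding S_def J_def lam_def A_def b_def m_def by (rule sphere_to_annulus[OF d ug \<rho>])
    also have "\<dots> \<le> ennreal (?K * (1 + q)) * ?I1"
    proof (intro mult_right_mono ennreal_leI)
      have "0 \<le> ?K * q" using K0 q0 by simp
      then show "2 * ?Ad / ?w \<le> ?K * (1 + q)" using C1_K by (simp add: distrib_left)
    qed simp
    finally show ?thesis .
  qed
  have e2: "ennreal \<bar>lam * J A0\<bar> \<le> ennreal (?K * (1 + q)) * ?I2"
  proof -
    have "ennreal \<bar>J A0\<bar> \<le> (\<integral>\<^sup>+x. ennreal (norm (indicator A0 x * f x)) \<partial>lborel)"
      unfolding J_def real_norm_def[symmetric] by (rule integral_norm_bound_ennreal[OF int]) (use bounded in auto)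
    also have "\<dots> \<le> ?I2"
      using A0_bad by (intro nn_integral_mono) (auto split: split_indicator)
    finally have *: "ennreal \<bar>J A0\<bar> \<le> ?I2" .
    have "ennreal \<bar>lam * J A0\<bar> = ennreal lam * ennreal \<bar>J A0\<bar>" using lam0 by (simp add: abs_mult ennreal_mult')
    also have "\<dots> \<le> ennreal (?K * (1 + q)) * ?I2"
      using lam_K K0 by (intro mult_mono * ennreal_leI) (auto simp: distrib_left)
    finally show ?thesis .
  qed
  have part: "ennreal \<bar>lam * (J (A \<inter> E) - mu / p * J E)\<bar> \<le> ennreal (?K * (1 + q)) * (ennreal e * I E)"
    if E: "convex E" "E \<in> sets borel" "bounded E" "measure lborel E = p" "E \<subseteq> ?W" "measure lborel (A \<inter> E) = mu" for E
  proof -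
    have "ennreal \<bar>J (A \<inter> E) - mu / p * J E\<bar> \<le> ennreal (real ?d * e * 2 ^ DIM(real ^ 'n)) * I E"
      unfolding J_def I_def E(4)[symmetric] E(6)[symmetric]
      by (rule convex_average_le[OF ug E(1-3)]) (use E p norm_diff_open_cell[of _ e] in auto)
    then have "ennreal lam * ennreal \<bar>J (A \<inter> E) - mu / p * J E\<bar> \<le> ennreal lam * (ennreal (real ?d * e * 2 ^ ?d) * I E)"
      by (intro mult_left_mono) auto
    also have "\<dots> = ennreal (lam * (real ?d * e * 2 ^ ?d)) * I E"
      using lam0 by (simp add: ennreal_mult' mult.assoc)
    also have "\<dots> \<le> ennreal (?K * (1 + q) * e) * I E"
    proof (intro mult_right_mono ennreal_leI)
      have "?K * q * e \<le> ?K * (1 + q) * e" using K0 e by (intro mult_right_mono mult_left_mono) auto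
      then show "lam * (real ?d * e * 2 ^ ?d) \<le> ?K * (1 + q) * e" using lam_K' by linarith
    qed simp
    also have "\<dots> = ennreal (?K * (1 + q)) * (ennreal e * I E)"
    proof -
      have "ennreal (?K * (1 + q) * e) = ennreal (?K * (1 + q)) * ennreal e"
        by (rule ennreal_mult'') (use e in simp)
      then show ?thesis by (simp only: mult.assoc)
    qed
    finally show ?thesis using lam0 by (simp add: abs_mult ennreal_mult')
  qed
  have e3: "ennreal \<bar>lam * (J (A \<inter> ?U) - mu / p * J ?U)\<bar> \<le> ennreal (?K * (1 + q)) * (ennreal e * I ?U)"
    by (rule part) (use bounded UL_W in \<open>auto simp: p_def mu_def upper_part_def convex_box\<close>)
  have e4: "ennreal \<bar>lam * (J (A \<inter> ?L) - mu / p * J ?L)\<bar> \<le> ennreal (?K * (1 + q)) * (ennreal e * I ?L)"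
    by (rule part) (use bounded UL_W p mu in \<open>auto simp: lower_part_def convex_box\<close>)
  have "ennreal \<bar>S - cell_coeff e \<rho> i * J (?U \<union> ?L)\<bar>
      \<le> ennreal (\<bar>S - lam * J A\<bar> + \<bar>lam * J A0\<bar> + \<bar>lam * (J (A \<inter> ?U) - mu / p * J ?U)\<bar> + \<bar>lam * (J (A \<inter> ?L) - mu / p * J ?L)\<bar>)"
  proof -
    have "\<bar>w + x + y + z\<bar> \<le> \<bar>w\<bar> + \<bar>x\<bar> + \<bar>y\<bar> + \<bar>z\<bar>" for w x y z :: real by linarith
    then show ?thesis unfolding split by (intro ennreal_leI)
  qed
  also have "\<dots> = ennreal \<bar>S - lam * J A\<bar> + ennreal \<bar>lam * J A0\<bar> + ennreal \<bar>lam * (J (A \<inter> ?U) - mu / p * J ?U)\<bar>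
      + ennreal \<bar>lam * (J (A \<inter> ?L) - mu / p * J ?L)\<bar>"
    by (simp only: ennreal_plus abs_ge_zero add_nonneg_nonneg)
  also have "\<dots> \<le> ennreal (?K * (1 + q)) * ?I1 + ennreal (?K * (1 + q)) * ?I2
      + ennreal (?K * (1 + q)) * (ennreal e * I ?U) + ennreal (?K * (1 + q)) * (ennreal e * I ?L)"
    by (intro add_mono e1 e2 e3 e4)
  also have "\<dots> = ennreal (?K * (1 + q)) * ((?I1 + ennreal e * (I ?U + I ?L)) + ?I2)"
    by (simp add: distrib_left ac_simps)
  \<comment> \<open>The halves are disjoint and avoid the hole, so the two Poincare errors only add
    \<open>e\<close> to the weight \<open>sqrt (\<rho> / e)\<close>.\<close>
  also have "\<dots> \<le> ennreal (?K * (1 + q)) * (?I3 + ?I2)"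
  proof (intro mult_left_mono add_right_mono)
    have "I ?U + I ?L = (\<integral>\<^sup>+x. indicator ?U x * ennreal (N x) + indicator ?L x * ennreal (N x) \<partial>lborel)"
      unfolding I_def by (rule nn_integral_add[symmetric]) measurable
    also have "\<dots> \<le> (\<integral>\<^sup>+x. indicator ?W x * ennreal (N x) \<partial>lborel)"
      using UL_W disj by (intro nn_integral_mono) (auto split: split_indicator)
    finally have "ennreal e * (I ?U + I ?L) \<le> ennreal e * (\<integral>\<^sup>+x. indicator ?W x * ennreal (N x) \<partial>lborel)"
      by (intro mult_left_mono) auto
    also have "\<dots> = (\<integral>\<^sup>+x. ennreal e * (indicator ?W x * ennreal (N x)) \<partial>lborel)"
      by (rule nn_integral_cmult[symmetric]) measurable
    finally have "?I1 + ennreal e * (I ?U + I ?L) \<le> ?I1 + (\<integral>\<^sup>+x. ennreal e * (indicator ?W x * ennreal (N x)) \<partial>lborel)"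
      by (intro add_left_mono)
    also have "\<dots> = (\<integral>\<^sup>+x. indicator ?W x * (ennreal b + indicator (bad_part e \<rho> i) x) * ennreal (N x)
        + ennreal e * (indicator ?W x * ennreal (N x)) \<partial>lborel)"
      by (rule nn_integral_add[symmetric]) measurable
    also have "\<dots> = ?I3"
    proof (rule nn_integral_cong)
      fix x
      have "ennreal (b + e) = ennreal b + ennreal e" using e by (intro ennreal_plus) (auto simp: b_def)
      then show "indicator ?W x * (ennreal b + indicator (bad_part e \<rho> i) x) * ennreal (N x) + ennreal e * (indicator ?W x * ennreal (N x))
          = indicator ?W x * (ennreal (b + e) + indicator (bad_part e \<rho> i) x) * ennreal (N x)"
        by (simp add: distrib_left distrib_right ac_simps)
    qed
    finally show "?I1 + ennreal e * (I ?U + I ?L) \<le> ?I3" .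
  qed simp
  finally show ?thesis by (simp only: S_def J_def q_def b_def)
qed

lemma cell_estimate:
  fixes f N :: "real ^ 'n \<Rightarrow> real"
  assumes d: "2 \<le> CARD('n)" and ug: "upper_gradient f N" and \<rho>: "0 < \<rho>" "4 * \<rho> \<le> e"
  defines "m \<equiv> CARD('n) - 1"
  shows "ennreal \<bar>(LINT x|hausdorff_measure m. indicator (sphere a \<rho>) x * f x)
      - cell_coeff e \<rho> i * (LINT x|lborel. indicator (upper_part e \<rho> i \<union> lower_part e \<rho> i) (x - a) * f x)\<bar>
    \<le> ennreal (cell_const TYPE('n) * (1 + \<rho> ^ m / e ^ CARD('n)))
      * ((\<integral>\<^sup>+x. indicator (open_cell e - cball 0 \<rho>) (x - a) * (ennreal (sqrt (\<rho> / e) + e) + indicator (bad_part e \<rho> i) (x - a)) * ennreal (N x) \<partial>lborel)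
        + (\<integral>\<^sup>+x. indicator (bad_part e \<rho> i) (x - a) * ennreal \<bar>f x\<bar> \<partial>lborel))"
proof -
  have [measurable]: "f \<in> borel_measurable borel" "N \<in> borel_measurable borel" using upper_gradientD[OF ug] by auto
  have R: "0 \<le> \<rho>" "\<rho> < e" using \<rho> by auto
  \<comment> \<open>Translation invariance of the surface integral is read off from the shell
    formula, which gives the same expression for both sides.\<close>
  have 1: "(LINT x|hausdorff_measure m. indicator (sphere a \<rho>) x * f x)
      = (LINT x|hausdorff_measure m. indicator (sphere 0 \<rho>) x * f (a + x))"
    unfolding m_def using integral_sphere_eq[OF R \<rho>(1), of f a] integral_sphere_eq[OF R \<rho>(1), of "\<lambda>x. f (a + x)" 0] by simp
  have 2: "(LINT x|lborel. indicator E (x - a) * f x) = (LINT x|lborel. indicator E x * f (a + x))" if [measurable]: "E \<in> sets borel" for E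
    using integral_lborel_translate[of "\<lambda>x. indicator E (x - a) * f x" a] by (simp add: add.commute)
  have 3: "(\<integral>\<^sup>+x. g (x - a) * h x \<partial>lborel) = (\<integral>\<^sup>+x. g x * h (a + x) \<partial>lborel)"
    if [measurable]: "g \<in> borel_measurable borel" "h \<in> borel_measurable borel" for g h :: "real ^ 'n \<Rightarrow> ennreal"
    using nn_integral_lborel_affine[of 1 "\<lambda>x. g (x - a) * h x" a] by simp
  have "(\<lambda>x. indicator (open_cell e - cball 0 \<rho>) x * (ennreal (sqrt (\<rho> / e) + e) + indicator (bad_part e \<rho> i) x)) \<in> borel_measurable borel"
    by measurable
  from 3[OF this, of "\<lambda>x. ennreal (N x)"] 3[of "indicator (bad_part e \<rho> i)" "\<lambda>x. ennreal \<bar>f x\<bar>"]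
  show ?thesis
    using cell_estimate_centered[OF d upper_gradient_translate[OF ug, of a] \<rho>, of i, folded m_def]
    by (simp add: 1 2)
qed

section \<open>Geometry of the perforated domain\<close>

lemma cell_interior_iff: "x - lattice_point e k \<in> open_cell e \<Longrightarrow> x \<in> cell e k"
proof -
  assume x: "x - lattice_point e k \<in> open_cell e"
  have "lattice_point e k $ j - e / 2 \<le> x $ j \<and> x $ j \<le> lattice_point e k $ j + e / 2" for j
  proof -
    have "\<bar>x $ j - lattice_point e k $ j\<bar> < e / 2" using x by (simp add: open_cell_iff)
    then show ?thesis by linarith
  qed
  then show "x \<in> cell e k" by (simp add: cell_def mem_box_cart)
qed

lemma open_cells_disjoint:
  assumes "0 < e" "x - lattice_point e k \<in> open_cell e" "x - lattice_point e l \<in> open_cell e"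
  shows "k = l"
proof -
  have "k $ j = l $ j" for j
  proof -
    have "\<bar>x $ j - e * of_int (k $ j)\<bar> < e / 2" "\<bar>x $ j - e * of_int (l $ j)\<bar> < e / 2"
      using assms(2,3) by (auto simp: open_cell_iff lattice_point_def)
    then have "\<bar>e * of_int (k $ j) - e * of_int (l $ j)\<bar> < e" by linarith
    then have "e * \<bar>of_int (k $ j - l $ j)\<bar> < e * 1"
      using assms(1) by (simp add: abs_mult flip: right_diff_distrib)
    then have "\<bar>of_int (k $ j - l $ j) :: real\<bar> < 1" using assms(1) by (simp only: mult_less_cancel_left_pos)
    then show ?thesis by linarith
  qed
  then show ?thesis by (simp add: vec_eq_iff)
qed

lemma cball_subset_open_cell:
  assumes "\<rho> < e / 2" "x \<in> cball a \<rho>"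
  shows "x - a \<in> open_cell e"
proof -
  have "\<bar>(x - a) $ j\<bar> < e / 2" for j
  proof -
    have "\<bar>(x - a) $ j\<bar> \<le> norm (x - a)" by (rule component_le_norm_cart)
    also have "\<dots> \<le> \<rho>" using assms(2) by (simp add: dist_norm norm_minus_commute)
    finally show ?thesis using assms(1) by simp
  qed
  then show ?thesis by (simp add: open_cell_iff)
qed

lemma open_cell_translate_eq: "{x. x - a \<in> open_cell e} = box (a - (\<chi> i. e / 2)) (a + (\<chi> i. e / 2))"
proof -
  have "\<bar>t - s\<bar> < e / 2 \<longleftrightarrow> s - e / 2 < t \<and> t < s + e / 2" for s t :: real by arith
  then show ?thesis by (auto simp: open_cell_iff mem_box_cart)
qed

lemma measure_open_cell_translate:
  fixes a :: "real ^ 'n"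
  shows "0 < e \<Longrightarrow> measure lborel {x. x - a \<in> open_cell e} = e ^ CARD('n)"
  unfolding open_cell_translate_eq by (subst measure_box_cart) auto

lemma measurable_translate_vimage [measurable]:
  fixes B :: "'a::euclidean_space set"
  assumes "B \<in> sets borel"
  shows "{x. x - a \<in> B} \<in> sets borel"
proof -
  have "(\<lambda>x. x - a) -` B \<in> sets borel" by (rule measurable_sets_borel[OF _ assms]) measurable
  then show ?thesis by (simp add: vimage_def)
qed

lemma card_cells_le:
  fixes \<Omega> :: "(real ^ 'n) set"
  assumes e: "0 < e" and \<Omega>: "bounded \<Omega>" "open \<Omega>" and F: "finite F" "F \<subseteq> interior_cells \<Omega> e"
  shows "real (card F) * e ^ CARD('n) \<le> measure lborel \<Omega>"
proof -
  let ?B = "\<lambda>k. {x. x - lattice_point e k \<in> open_cell e}"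
  have "real (card F) * e ^ CARD('n) = (\<Sum>k\<in>F. measure lborel (?B k))"
    using e by (simp add: measure_open_cell_translate)
  also have "\<dots> = measure lborel (\<Union>k\<in>F. ?B k)"
  proof (rule measure_finite_Union[symmetric, OF F(1)])
    show "disjoint_family_on ?B F"
      using open_cells_disjoint[OF e] by (auto simp: disjoint_family_on_def)
    show "?B ` F \<subseteq> sets lborel" by auto
    show "emeasure lborel (?B k) \<noteq> \<infinity>" if "k \<in> F" for k
      unfolding open_cell_translate_eq by (simp add: emeasure_lborel_box_eq)
  qed
  also have "\<dots> \<le> measure lborel \<Omega>"
  proof (rule measure_mono_fmeasurable)
    show "(\<Union>k\<in>F. ?B k) \<subseteq> \<Omega>"
      using F(2) cell_interior_iff by (fastforce simp: interior_cells_def)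
    show "(\<Union>k\<in>F. ?B k) \<in> sets lborel" using F(1) by auto
    show "\<Omega> \<in> fmeasurable lborel"
      using \<Omega> emeasure_bounded_finite[OF \<Omega>(1)] by (intro fmeasurableI) auto
  qed
  finally show ?thesis .
qed

lemma finite_interior_cells:
  fixes \<Omega> :: "(real ^ 'n) set"
  assumes e: "0 < e" and \<Omega>: "bounded \<Omega>" "open \<Omega>"
  shows "finite (interior_cells \<Omega> e)"
proof (rule ccontr)
  assume inf: "infinite (interior_cells \<Omega> e)"
  obtain n where n: "measure lborel \<Omega> / e ^ CARD('n) < real n" using reals_Archimedean2 by blast
  obtain F where F: "finite F" "card F = n" "F \<subseteq> interior_cells \<Omega> e"
    using infinite_arbitrarily_large[OF inf] by blast
  then have "real n * e ^ CARD('n) \<le> measure lborel \<Omega>" using card_cells_le[OF e \<Omega> F(1,3)] by simp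
  then show False using n e by (simp add: divide_less_eq)
qed

context
  fixes \<Omega> :: "(real ^ 'n) set" and e \<rho> :: real
  assumes \<Omega>: "bounded \<Omega>" "open \<Omega>" and e: "0 < e" and \<rho>: "0 < \<rho>" "\<rho> < e / 2"
begin

lemma closure_holes: "closure (holes \<Omega> e \<rho>) = (\<Union>k\<in>interior_cells \<Omega> e. cball (lattice_point e k) \<rho>)"
proof (rule antisym)
  show "closure (holes \<Omega> e \<rho>) \<subseteq> (\<Union>k\<in>interior_cells \<Omega> e. cball (lattice_point e k) \<rho>)"
  proof (rule closure_minimal)
    show "holes \<Omega> e \<rho> \<subseteq> (\<Union>k\<in>interior_cells \<Omega> e. cball (lattice_point e k) \<rho>)"
      unfolding holes_def using ball_subset_cball by blast
    show "closed (\<Union>k\<in>interior_cells \<Omega> e. cball (lattice_point e k) \<rho>)"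
      by (intro closed_UN finite_interior_cells[OF e \<Omega>]) auto
  qed
  have "cball (lattice_point e k) \<rho> \<subseteq> closure (holes \<Omega> e \<rho>)" if "k \<in> interior_cells \<Omega> e" for k
  proof -
    have "cball (lattice_point e k) \<rho> = closure (ball (lattice_point e k) \<rho>)" using \<rho> by simp
    also have "\<dots> \<subseteq> closure (holes \<Omega> e \<rho>)" by (rule closure_mono) (use that in \<open>auto simp: holes_def\<close>)
    finally show ?thesis .
  qed
  then show "(\<Union>k\<in>interior_cells \<Omega> e. cball (lattice_point e k) \<rho>) \<subseteq> closure (holes \<Omega> e \<rho>)" by blast
qed

lemma frontier_holes: "frontier (holes \<Omega> e \<rho>) = (\<Union>k\<in>interior_cells \<Omega> e. sphere (lattice_point e k) \<rho>)"
proof -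
  have "open (holes \<Omega> e \<rho>)" by (auto simp: holes_def)
  then have "frontier (holes \<Omega> e \<rho>) = closure (holes \<Omega> e \<rho>) - holes \<Omega> e \<rho>"
    by (simp add: frontier_def interior_open)
  also have "\<dots> = (\<Union>k\<in>interior_cells \<Omega> e. sphere (lattice_point e k) \<rho>)"
  proof (rule set_eqI, rule iffI)
    fix x assume "x \<in> closure (holes \<Omega> e \<rho>) - holes \<Omega> e \<rho>"
    then show "x \<in> (\<Union>k\<in>interior_cells \<Omega> e. sphere (lattice_point e k) \<rho>)"
      unfolding closure_holes by (force simp: holes_def)
  next
    fix x assume "x \<in> (\<Union>k\<in>interior_cells \<Omega> e. sphere (lattice_point e k) \<rho>)"
    then obtain k where k: "k \<in> interior_cells \<Omega> e" "dist (lattice_point e k) x = \<rho>" by auto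
    have "x \<notin> ball (lattice_point e l) \<rho>" for l
    proof
      assume l: "x \<in> ball (lattice_point e l) \<rho>"
      have "k = l"
        by (rule open_cells_disjoint[OF e]; rule cball_subset_open_cell[OF \<rho>(2)]) (use k l in auto)
      then show False using k l by simp
    qed
    then show "x \<in> closure (holes \<Omega> e \<rho>) - holes \<Omega> e \<rho>"
      unfolding closure_holes using k by (auto simp: holes_def)
  qed
  finally show ?thesis .
qed

lemma open_perforated: "open (perforated \<Omega> e \<rho>)"
  unfolding perforated_def by (rule open_Diff[OF \<Omega>(2)]) simp

lemma perforated_subset: "perforated \<Omega> e \<rho> \<subseteq> \<Omega>"
  by (auto simp: perforated_def)

lemma cell_subset_perforated:
  assumes "k \<in> interior_cells \<Omega> e" "x - lattice_point e k \<in> open_cell e - cball 0 \<rho>"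
  shows "x \<in> perforated \<Omega> e \<rho>"
proof -
  have "x \<in> \<Omega>" using assms cell_interior_iff by (auto simp: interior_cells_def)
  moreover have "x \<notin> cball (lattice_point e l) \<rho>" for l
  proof
    assume l: "x \<in> cball (lattice_point e l) \<rho>"
    have "k = l"
      by (rule open_cells_disjoint[OF e _ cball_subset_open_cell[OF \<rho>(2) l]]) (use assms in auto)
    then show False using l assms by (simp add: dist_norm norm_minus_commute)
  qed
  ultimately show ?thesis by (simp add: perforated_def closure_holes)
qed

text \<open>Points of a sphere moved slightly outward along the ray stay in the same open cell and
  lie off all holes, so the sphere is in the closure of the perforated domain. Thus traces on the
  boundary of the latter are meaningful on the holes.\<close>

lemma frontier_holes_subset: "frontier (holes \<Omega> e \<rho>) \<subseteq> frontier (perforated \<Omega> e \<rho>)"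
proof
  fix x assume x: "x \<in> frontier (holes \<Omega> e \<rho>)"
  then obtain k where k: "k \<in> interior_cells \<Omega> e" and xk: "dist (lattice_point e k) x = \<rho>"
    unfolding frontier_holes by auto
  let ?a = "lattice_point e k"
  have "x \<in> closure (holes \<Omega> e \<rho>)" using x by (simp add: frontier_def)
  then have "x \<notin> perforated \<Omega> e \<rho>" by (simp add: perforated_def)
  moreover have "x \<in> closure (perforated \<Omega> e \<rho>)"
  proof -
    define y where "y n = ?a + (1 + 1 / real (Suc n)) *\<^sub>R (x - ?a)" for n
    have "(\<lambda>n. 1 / real (Suc n)) \<longlonglongrightarrow> 0" by (rule LIMSEQ_Suc[OF lim_1_over_n])
    then have "(\<lambda>n. ?a + (1 + 1 / real (Suc n)) *\<^sub>R (x - ?a)) \<longlonglongrightarrow> ?a + (1 + 0) *\<^sub>R (x - ?a)"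
      by (intro tendsto_intros)
    then have lim: "y \<longlonglongrightarrow> x" by (simp add: y_def[abs_def])
    have "x \<in> {z. z - ?a \<in> open_cell e}"
      using cball_subset_open_cell[OF \<rho>(2), of x ?a] xk by simp
    moreover have "open {z. z - ?a \<in> open_cell e}" unfolding open_cell_translate_eq by (rule open_box)
    ultimately have ev: "\<forall>\<^sub>F n in sequentially. y n \<in> {z. z - ?a \<in> open_cell e}"
      using lim by (metis topological_tendstoD)
    have "y n - ?a \<notin> cball 0 \<rho>" for n
    proof -
      have "norm (y n - ?a) = (1 + 1 / real (Suc n)) * \<rho>"
        using xk by (simp add: y_def dist_norm norm_minus_commute)
      moreover have "0 < 1 / real (Suc n) * \<rho>" using \<rho> by simp
      ultimately show ?thesis by (simp add: distrib_right)
    qed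
    then have "\<forall>\<^sub>F n in sequentially. y n \<in> perforated \<Omega> e \<rho>"
      using ev by (auto elim!: eventually_mono intro: cell_subset_perforated[OF k])
    then show ?thesis
      using lim by (intro Lim_in_closed_set[OF closed_closure _ _ lim])
        (auto elim!: eventually_mono intro: closure_subset[THEN subsetD])
  qed
  ultimately show "x \<in> frontier (perforated \<Omega> e \<rho>)"
    by (simp add: frontier_def interior_open[OF open_perforated])
qed

end

text \<open>The region over which volume integrals are formed: it lies off the holes, so the
  eigenfunction itself is integrated there, and it exhausts \<open>\<Omega>\<close> in
  measure.\<close>

definition good_region :: "(real ^ 'n) set \<Rightarrow> real \<Rightarrow> real \<Rightarrow> 'n \<Rightarrow> (real ^ 'n) set" where
  "good_region \<Omega> e \<rho> i = (\<Union>k\<in>interior_cells \<Omega> e. {x. x - lattice_point e k \<in> upper_part e \<rho> i \<union> lower_part e \<rho> i})"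

definition bad_region :: "(real ^ 'n) set \<Rightarrow> real \<Rightarrow> real \<Rightarrow> 'n \<Rightarrow> (real ^ 'n) set" where
  "bad_region \<Omega> e \<rho> i = (\<Union>k\<in>interior_cells \<Omega> e. {x. x - lattice_point e k \<in> bad_part e \<rho> i})"

lemma region_borel:
  fixes \<Omega> :: "(real ^ 'n) set"
  assumes "bounded \<Omega>" "open \<Omega>" "0 < e"
  shows "good_region \<Omega> e \<rho> i \<in> sets borel" "bad_region \<Omega> e \<rho> i \<in> sets borel"
  using finite_interior_cells[OF assms(3,1,2)] by (auto simp: good_region_def bad_region_def)

lemma parts_subset_punctured_cell:
  assumes "0 \<le> \<rho>" "\<rho> < e / 2"
  shows "upper_part e \<rho> i \<union> lower_part e \<rho> i \<subseteq> open_cell e - cball 0 \<rho>"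
    and "bad_part e \<rho> i \<subseteq> open_cell e - cball 0 \<rho>"
proof -
  have "\<bar>x $ i\<bar> \<le> norm x" for x by (rule component_le_norm_cart)
  then have "x \<notin> cball 0 \<rho>" if "\<rho> < \<bar>x $ i\<bar>" for x using that by (simp add: not_le order_less_le_trans)
  then show "upper_part e \<rho> i \<union> lower_part e \<rho> i \<subseteq> open_cell e - cball 0 \<rho>"
    using assms by (auto simp: upper_part_iff lower_part_iff)
qed (auto simp: bad_part_def)

lemma region_subset_perforated:
  fixes \<Omega> :: "(real ^ 'n) set" and i :: 'n
  assumes \<Omega>: "bounded \<Omega>" "open \<Omega>" and \<rho>: "0 < \<rho>" "\<rho> < e / 2"
  shows "good_region \<Omega> e \<rho> i \<subseteq> perforated \<Omega> e \<rho>" "bad_region \<Omega> e \<rho> i \<subseteq> perforated \<Omega> e \<rho>"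
proof -
  have e: "0 < e" using \<rho> by simp
  note parts_subset_punctured_cell[OF less_imp_le[OF \<rho>(1)] \<rho>(2), of i]
  then show "good_region \<Omega> e \<rho> i \<subseteq> perforated \<Omega> e \<rho>" "bad_region \<Omega> e \<rho> i \<subseteq> perforated \<Omega> e \<rho>"
    using cell_subset_perforated[OF \<Omega> e \<rho>] by (auto simp: good_region_def bad_region_def)
qed

lemma emeasure_hausdorff_sphere_finite:
  fixes a :: "real ^ 'n"
  assumes "0 < \<rho>"
  shows "emeasure (hausdorff_measure (CARD('n) - 1)) (sphere a \<rho>) < top"
proof -
  define m where "m = CARD('n) - 1"
  let ?T = "\<lambda>x. a + \<rho> *\<^sub>R x"
  have "sphere a \<rho> = ?T ` sphere 0 1"
  proof -
    have "y \<in> ?T ` sphere 0 1" if "y \<in> sphere a \<rho>" for y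
      using that assms by (intro image_eqI[of _ _ "(y - a) /\<^sub>R \<rho>"]) (auto simp: dist_norm norm_minus_commute)
    then show ?thesis using assms by (auto simp: dist_norm)
  qed
  moreover have "hausdorff_outer m (?T ` sphere 0 1) \<le> ennreal (\<rho> ^ m) * hausdorff_outer m (sphere (0 :: real ^ 'n) 1)"
    by (rule hausdorff_outer_similarity_le[OF assms]) (use assms in \<open>simp add: dist_norm flip: scaleR_diff_right\<close>)
  moreover have "hausdorff_outer m (sphere (0 :: real ^ 'n) 1) < top"
    using emeasure_hausdorff_unit_sphere_finite[where 'a = "real ^ 'n"]
    by (simp add: emeasure_hausdorff_measure m_def)
  ultimately have "hausdorff_outer m (sphere a \<rho>) < top"
    by (metis ennreal_mult_less_top ennreal_less_top le_less_trans)
  then show ?thesis by (simp add: emeasure_hausdorff_measure m_def)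
qed

lemma integrable_sphere:
  fixes a :: "real ^ 'n" and f :: "real ^ 'n \<Rightarrow> real"
  assumes "0 < \<rho>" "continuous_on UNIV f"
  shows "integrable (hausdorff_measure (CARD('n) - 1)) (\<lambda>x. indicator (sphere a \<rho>) x * f x)"
proof -
  let ?H = "hausdorff_measure (CARD('n) - 1) :: (real ^ 'n) measure"
  have "compact (f ` sphere a \<rho>)"
    by (rule compact_continuous_image[OF continuous_on_subset[OF assms(2)]]) auto
  from compact_imp_bounded[OF this] obtain B where B: "\<forall>z\<in>f ` sphere a \<rho>. norm z \<le> B"
    unfolding bounded_iff by blast
  have [measurable]: "f \<in> borel_measurable borel" using assms(2) by (rule borel_measurable_continuous_onI)
  have "integrable ?H (\<lambda>x. B * indicator (sphere a \<rho>) x)"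
    using emeasure_hausdorff_sphere_finite[OF assms(1), of a] by (intro integrable_mult_right) auto
  then show ?thesis
  proof (rule Bochner_Integration.integrable_bound)
    show "AE x in ?H. norm (indicator (sphere a \<rho>) x * f x) \<le> norm (B * indicator (sphere a \<rho>) x)"
    proof (rule AE_I2)
      fix x
      show "norm (indicator (sphere a \<rho>) x * f x) \<le> norm (B * indicator (sphere a \<rho>) x)"
      proof (cases "x \<in> sphere a \<rho>")
        case True
        then have "norm (f x) \<le> B" using B by blast
        then show ?thesis using True by simp
      qed simp
    qed
  qed measurable
qed

section \<open>The estimate on the perforated domain\<close>

lemma integrable_on_boundedD:
  fixes f :: "'a::euclidean_space \<Rightarrow> real"
  assumes "continuous_on UNIV f" "bounded D" "D \<in> sets borel" "w \<in> borel_measurable borel" "\<And>x. \<bar>w x\<bar> \<le> C"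
  shows "integrable lborel (\<lambda>x. w x * (indicator D x * f x))"
    and "(LINT x|lebesgue_on D. w x * f x) = (LINT x|lborel. w x * (indicator D x * f x))"
proof -
  show "integrable lborel (\<lambda>x. w x * (indicator D x * f x))"
    by (rule integrable_bounded_mult[OF integrable_indicator_continuous[OF assms(1-3)]]) (use assms in auto)
  have [measurable]: "f \<in> borel_measurable borel" "D \<in> sets borel" "w \<in> borel_measurable borel"
    using assms by (auto intro: borel_measurable_continuous_onI)
  have "(LINT x|lebesgue_on D. w x * f x) = (LINT x|lebesgue. indicator D x *\<^sub>R (w x * f x))"
    by (rule integral_restrict_space) (use assms(3) in auto)
  also have "\<dots> = (LINT x|lborel. indicator D x *\<^sub>R (w x * f x))" by (rule integral_completion) measurable
  finally show "(LINT x|lebesgue_on D. w x * f x) = (LINT x|lborel. w x * (indicator D x * f x))"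
    by (simp add: mult_ac)
qed

lemma integral_boundary_measure:
  fixes f :: "real ^ 'n \<Rightarrow> real"
  shows "(LINT x|boundary_measure D. f x) = (LINT x|hausdorff_measure (CARD('n) - 1). indicator (frontier D) x * f x)"
proof -
  have "frontier D \<inter> space (hausdorff_measure (CARD('n) - 1)) \<in> sets (hausdorff_measure (CARD('n) - 1))"
    using borel_closed[OF frontier_closed[of D]] by simp
  then show ?thesis unfolding boundary_measure_def by (subst integral_restrict_space) auto
qed

text \<open>Summation of the cell estimates. The punctured cells are disjoint, so at each point at
  most one summand is nonzero, and sums of indicators over cells are indicators of the regions.
  Their union lies in \<open>D\<close>, which bounds the gradient terms by integrals over
  \<open>D\<close>.\<close>

lemma perforated_estimate:
  fixes \<Omega> :: "(real ^ 'n) set" and f N :: "real ^ 'n \<Rightarrow> real" and i :: 'n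
  assumes d: "2 \<le> CARD('n)" and \<Omega>: "bounded \<Omega>" "open \<Omega>" and \<rho>: "0 < \<rho>" "4 * \<rho> \<le> e"
    and ug: "upper_gradient f N"
  defines "D \<equiv> perforated \<Omega> e \<rho>" and "P \<equiv> good_region \<Omega> e \<rho> i" and "Z \<equiv> bad_region \<Omega> e \<rho> i"
  shows "\<bar>(LINT x|boundary_measure (holes \<Omega> e \<rho>). f x) - cell_coeff e \<rho> i * (LINT x|lebesgue_on D. indicator P x * f x)\<bar>
    \<le> cell_const TYPE('n) * (1 + \<rho> ^ (CARD('n) - 1) / e ^ CARD('n))
      * ((LINT x|lebesgue_on D. (sqrt (\<rho> / e) + e + indicator Z x) * N x) + (LINT x|lebesgue_on D. indicator Z x * \<bar>f x\<bar>))"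
proof -
  let ?I = "interior_cells \<Omega> e" and ?a = "lattice_point e :: int ^ 'n \<Rightarrow> real ^ 'n"
  let ?UL = "upper_part e \<rho> i \<union> lower_part e \<rho> i" and ?W = "open_cell e - cball 0 \<rho> :: (real ^ 'n) set"
  let ?b = "bad_part e \<rho> i"
  let ?H = "hausdorff_measure (CARD('n) - 1) :: (real ^ 'n) measure"
  define C where "C = cell_const TYPE('n) * (1 + \<rho> ^ (CARD('n) - 1) / e ^ CARD('n))"
  define \<delta> where "\<delta> = sqrt (\<rho> / e) + e"
  have e: "0 < e" "\<rho> < e / 2" "0 \<le> \<rho>" using \<rho> by auto
  have \<delta>0: "0 \<le> \<delta>" using e by (simp add: \<delta>_def)
  have C0: "0 \<le> C"
    using e by (auto simp: C_def cell_const_def unit_sphere_area_def intro!: mult_nonneg_nonneg divide_nonneg_nonneg add_nonneg_nonneg)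
  have f: "continuous_on UNIV f" "continuous_on UNIV N" and [measurable]: "f \<in> borel_measurable borel" "N \<in> borel_measurable borel"
    and N0: "\<And>x. 0 \<le> N x" using upper_gradientD[OF ug] by auto
  have finI: "finite ?I" by (rule finite_interior_cells[OF e(1) \<Omega>])
  have [measurable]: "D \<in> sets borel" unfolding D_def by (intro borel_open open_perforated \<Omega> e \<rho>)
  have Ps [measurable]: "P \<in> sets borel" and Zs [measurable]: "Z \<in> sets borel"
    unfolding P_def Z_def by (rule region_borel[OF \<Omega> e(1)])+
  have bD: "bounded D" using bounded_subset[OF \<Omega>(1) perforated_subset[OF \<Omega> e(1) \<rho>(1) e(2)]] by (simp add: D_def)
  have W_D: "x \<in> D" if "k \<in> ?I" "x - ?a k \<in> ?W" for k x
    unfolding D_def by (rule cell_subset_perforated[OF \<Omega> e(1) \<rho>(1) e(2) that])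
  note UL_W = parts_subset_punctured_cell(1)[OF e(3,2), of i] and b_W = parts_subset_punctured_cell(2)[OF e(3,2), of i]
  have uniq: "k = l" if "x - ?a k \<in> ?W" "x - ?a l \<in> ?W" for k l x
    by (rule open_cells_disjoint[OF e(1)]) (use that in auto)
  have dis: "disjoint_family_on (\<lambda>k. {x. x - ?a k \<in> E}) ?I" if "E \<subseteq> ?W" for E
    unfolding disjoint_family_on_def using uniq that by blast
  have sph: "x - ?a k \<in> open_cell e" if "x \<in> sphere (?a k) \<rho>" for x k
    by (rule cball_subset_open_cell[OF e(2)]) (use that in auto)
  have "disjoint_family_on (\<lambda>k. sphere (?a k) \<rho>) ?I"
    unfolding disjoint_family_on_def using open_cells_disjoint[OF e(1) sph sph] by blast
  then have frontier: "indicator (frontier (holes \<Omega> e \<rho>)) x = (\<Sum>k\<in>?I. indicator (sphere (?a k) \<rho>) x :: real)" for x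
    unfolding frontier_holes[OF \<Omega> e(1) \<rho>(1) e(2)] by (rule indicator_UN_disjoint[OF finI])
  have lhs1: "(LINT x|boundary_measure (holes \<Omega> e \<rho>). f x) = (\<Sum>k\<in>?I. LINT x|?H. indicator (sphere (?a k) \<rho>) x * f x)"
    unfolding integral_boundary_measure frontier sum_distrib_right
    by (rule Bochner_Integration.integral_sum) (rule integrable_sphere[OF \<rho>(1) f(1)])
  have Dm: "D \<in> sets borel" by simp
  have Zm: "(\<lambda>x. \<delta> + indicator Z x :: real) \<in> borel_measurable borel" by measurable
  have Zb: "\<bar>\<delta> + indicator Z x :: real\<bar> \<le> \<delta> + 1" for x using \<delta>0 by (cases "x \<in> Z") auto
  have Zm': "(indicator Z :: _ \<Rightarrow> real) \<in> borel_measurable borel"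
    by (rule borel_measurable_indicator) (rule Zs)
  have Zb': "\<bar>indicator Z x :: real\<bar> \<le> 1" for x by (cases "x \<in> Z") auto
  have Pm: "(indicator P :: _ \<Rightarrow> real) \<in> borel_measurable borel"
    by (rule borel_measurable_indicator) (rule Ps)
  have Pb: "\<bar>indicator P x :: real\<bar> \<le> 1" for x by (cases "x \<in> P") auto
  have P_eq: "(\<Sum>k\<in>?I. indicator ?UL (x - ?a k)) = (indicator P x :: real)" for x
    unfolding P_def good_region_def indicator_UN_disjoint[OF finI dis[OF UL_W]] by (simp add: indicator_def)
  have Z_eq: "(\<Sum>k\<in>?I. indicator ?b (x - ?a k)) = (indicator Z x :: ennreal)" for x
    unfolding Z_def bad_region_def indicator_UN_disjoint[OF finI dis[OF b_W]] by (simp add: indicator_def)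
  have P_D: "P \<subseteq> D" and Z_D: "Z \<subseteq> D"
    unfolding P_def Z_def D_def by (rule region_subset_perforated[OF \<Omega> \<rho>(1) e(2)])+
  have lhs2: "(LINT x|lebesgue_on D. indicator P x * f x) = (\<Sum>k\<in>?I. LINT x|lborel. indicator ?UL (x - ?a k) * f x)"
  proof -
    have "(LINT x|lebesgue_on D. indicator P x * f x) = (LINT x|lborel. indicator P x * (indicator D x * f x))"
      by (rule integrable_on_boundedD(2)[OF f(1) bD Dm Pm Pb])
    also have "\<dots> = (LINT x|lborel. (\<Sum>k\<in>?I. indicator ?UL (x - ?a k) * f x))"
    proof (intro Bochner_Integration.integral_cong refl)
      fix x
      have "indicator P x * indicator D x = (indicator P x :: real)" using P_D by (auto split: split_indicator)
      then show "indicator P x * (indicator D x * f x) = (\<Sum>k\<in>?I. indicator ?UL (x - ?a k) * f x)"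
        by (simp only: sum_distrib_right[symmetric] P_eq mult.assoc[symmetric])
    qed
    also have "\<dots> = (\<Sum>k\<in>?I. LINT x|lborel. indicator ?UL (x - ?a k) * f x)"
    proof (rule Bochner_Integration.integral_sum)
      fix k
      have "bounded {x. x - ?a k \<in> ?UL}"
      proof (rule bounded_subset)
        show "bounded (box (?a k - (\<chi> i. e / 2)) (?a k + (\<chi> i. e / 2)))" by simp
        show "{x. x - ?a k \<in> ?UL} \<subseteq> box (?a k - (\<chi> i. e / 2)) (?a k + (\<chi> i. e / 2))"
          unfolding open_cell_translate_eq[symmetric] using UL_W by blast
      qed
      then have "integrable lborel (\<lambda>x. indicator {x. x - ?a k \<in> ?UL} x * f x)"
        by (intro integrable_indicator_continuous[OF f(1)]) auto
      then show "integrable lborel (\<lambda>x. indicator ?UL (x - ?a k) * f x)" by (simp add: indicator_def)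
    qed
    finally show ?thesis .
  qed
  let ?G = "\<lambda>k x. indicator ?W (x - ?a k) * (ennreal \<delta> + indicator ?b (x - ?a k)) * ennreal (N x)"
  let ?B = "\<lambda>k x. indicator ?b (x - ?a k) * ennreal \<bar>f x\<bar>"
  have "ennreal \<bar>(LINT x|boundary_measure (holes \<Omega> e \<rho>). f x) - cell_coeff e \<rho> i * (LINT x|lebesgue_on D. indicator P x * f x)\<bar>
      = ennreal \<bar>\<Sum>k\<in>?I. (LINT x|?H. indicator (sphere (?a k) \<rho>) x * f x) - cell_coeff e \<rho> i * (LINT x|lborel. indicator ?UL (x - ?a k) * f x)\<bar>"
    unfolding lhs1 lhs2 by (simp only: sum_distrib_left sum_subtractf)
  also have "\<dots> \<le> (\<Sum>k\<in>?I. ennreal \<bar>(LINT x|?H. indicator (sphere (?a k) \<rho>) x * f x) - cell_coeff e \<rho> i * (LINT x|lborel. indicator ?UL (x - ?a k) * f x)\<bar>)"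
    by (subst sum_ennreal) (auto intro!: ennreal_leI sum_abs)
  also have "\<dots> \<le> (\<Sum>k\<in>?I. ennreal C * ((\<integral>\<^sup>+x. ?G k x \<partial>lborel) + (\<integral>\<^sup>+x. ?B k x \<partial>lborel)))"
    unfolding C_def \<delta>_def by (intro sum_mono cell_estimate[OF d ug \<rho>])
  also have "\<dots> = ennreal C * ((\<Sum>k\<in>?I. \<integral>\<^sup>+x. ?G k x \<partial>lborel) + (\<Sum>k\<in>?I. \<integral>\<^sup>+x. ?B k x \<partial>lborel))"
    by (simp only: sum_distrib_left[symmetric] sum.distrib)
  also have "\<dots> \<le> ennreal C * (ennreal (LINT x|lebesgue_on D. (\<delta> + indicator Z x) * N x) + ennreal (LINT x|lebesgue_on D. indicator Z x * \<bar>f x\<bar>))"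
  proof (intro mult_left_mono add_mono)
    have "(\<Sum>k\<in>?I. \<integral>\<^sup>+x. ?G k x \<partial>lborel) = (\<integral>\<^sup>+x. (\<Sum>k\<in>?I. ?G k x) \<partial>lborel)"
      by (rule nn_integral_sum[symmetric]) measurable
    also have "\<dots> \<le> (\<integral>\<^sup>+x. ennreal ((\<delta> + indicator Z x) * (indicator D x * N x)) \<partial>lborel)"
    proof (rule nn_integral_mono)
      fix x
      show "(\<Sum>k\<in>?I. ?G k x) \<le> ennreal ((\<delta> + indicator Z x) * (indicator D x * N x))"
      proof (cases "\<exists>k\<in>?I. x - ?a k \<in> ?W")
        case True
        then obtain k where k: "k \<in> ?I" "x - ?a k \<in> ?W" by blast
        have "?G l x = (if l = k then ?G k x else 0)" for l
        proof (cases "l = k")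
          case False
          then have "x - ?a l \<notin> ?W" using uniq[OF k(2), of l] by blast
          then show ?thesis using False by simp
        qed simp
        then have "(\<Sum>l\<in>?I. ?G l x) = (\<Sum>l\<in>?I. if l = k then ?G k x else 0)" by (intro sum.cong) auto
        also have "\<dots> = ?G k x" using k finI by simp
        also have "\<dots> = (ennreal \<delta> + ennreal (indicator Z x)) * ennreal (N x)"
        proof -
          have "x - ?a k \<in> ?b \<longleftrightarrow> x \<in> Z"
            using k uniq b_W unfolding Z_def bad_region_def by blast
          then show ?thesis using k \<delta>0 by (cases "x \<in> Z") (simp_all add: ennreal_plus)
        qed
        also have "\<dots> = ennreal (\<delta> + indicator Z x) * ennreal (N x)"
          using \<delta>0 by (subst ennreal_plus) auto
        also have "\<dots> = ennreal ((\<delta> + indicator Z x) * N x)"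
          by (rule ennreal_mult[symmetric]) (use \<delta>0 N0 in auto)
        finally show ?thesis using W_D[OF k] by simp
      next
        case False
        then have "(\<Sum>k\<in>?I. ?G k x) = 0" by (intro sum.neutral) (auto simp: indicator_def)
        then show ?thesis by simp
      qed
    qed
    also have "\<dots> = ennreal (LINT x|lborel. (\<delta> + indicator Z x) * (indicator D x * N x))"
      by (rule nn_integral_eq_integral[OF integrable_on_boundedD(1)[OF f(2) bD Dm Zm Zb]]) (use \<delta>0 N0 in auto)
    also have "(LINT x|lborel. (\<delta> + indicator Z x) * (indicator D x * N x)) = (LINT x|lebesgue_on D. (\<delta> + indicator Z x) * N x)"
      by (rule integrable_on_boundedD(2)[OF f(2) bD Dm Zm Zb, symmetric])
    finally show "(\<Sum>k\<in>?I. \<integral>\<^sup>+x. ?G k x \<partial>lborel) \<le> ennreal (LINT x|lebesgue_on D. (\<delta> + indicator Z x) * N x)" .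
    have cf: "continuous_on UNIV (\<lambda>x. \<bar>f x\<bar>)" by (intro continuous_intros f)
    have "(\<Sum>k\<in>?I. \<integral>\<^sup>+x. ?B k x \<partial>lborel) = (\<integral>\<^sup>+x. (\<Sum>k\<in>?I. ?B k x) \<partial>lborel)"
      by (rule nn_integral_sum[symmetric]) measurable
    also have "\<dots> = (\<integral>\<^sup>+x. ennreal (indicator Z x * (indicator D x * \<bar>f x\<bar>)) \<partial>lborel)"
      using Z_D by (intro nn_integral_cong) (auto simp: sum_distrib_right[symmetric] Z_eq split: split_indicator)
    also have "\<dots> = ennreal (LINT x|lborel. indicator Z x * (indicator D x * \<bar>f x\<bar>))"
      by (rule nn_integral_eq_integral[OF integrable_on_boundedD(1)[OF cf bD Dm Zm' Zb']]) auto
    also have "(LINT x|lborel. indicator Z x * (indicator D x * \<bar>f x\<bar>)) = (LINT x|lebesgue_on D. indicator Z x * \<bar>f x\<bar>)"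
      by (rule integrable_on_boundedD(2)[OF cf bD Dm Zm' Zb', symmetric])
    finally show "(\<Sum>k\<in>?I. \<integral>\<^sup>+x. ?B k x \<partial>lborel) \<le> ennreal (LINT x|lebesgue_on D. indicator Z x * \<bar>f x\<bar>)" by simp
  qed simp
  also have "\<dots> = ennreal (C * ((LINT x|lebesgue_on D. (\<delta> + indicator Z x) * N x) + (LINT x|lebesgue_on D. indicator Z x * \<bar>f x\<bar>)))"
  proof -
    have "0 \<le> (LINT x|lebesgue_on D. (\<delta> + indicator Z x) * N x)" "0 \<le> (LINT x|lebesgue_on D. indicator Z x * \<bar>f x\<bar>)"
      using \<delta>0 N0 by (auto intro!: integral_nonneg_AE)
    then show ?thesis using C0 by (simp add: ennreal_mult' ennreal_plus)
  qed
  finally show ?thesis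
    unfolding C_def[symmetric] \<delta>_def[symmetric]
  proof (rule ennreal_le_iff[THEN iffD1, rotated])
    have "0 \<le> (LINT x|lebesgue_on D. (\<delta> + indicator Z x) * N x)" "0 \<le> (LINT x|lebesgue_on D. indicator Z x * \<bar>f x\<bar>)"
      using \<delta>0 N0 by (auto intro!: integral_nonneg_AE)
    then show "0 \<le> C * ((LINT x|lebesgue_on D. (\<delta> + indicator Z x) * N x) + (LINT x|lebesgue_on D. indicator Z x * \<bar>f x\<bar>))"
      using C0 by simp
  qed
qed

text \<open>Traces are defined by smooth approximation in \<open>H1\<close> together with L^2
  convergence on the boundary. The estimate is applied to the product of the two approximating
  sequences, and each of its terms is a weighted integral of two L^2-convergent factors, so it
  passes to the limit.\<close>

lemma trace_estimate:
  fixes \<Omega> :: "(real ^ 'n) set" and u V g h :: "real ^ 'n \<Rightarrow> real" and i :: 'n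
  assumes d: "2 \<le> CARD('n)" and \<Omega>: "bounded \<Omega>" "open \<Omega>" and \<rho>: "0 < \<rho>" "4 * \<rho> \<le> e"
  defines "D \<equiv> perforated \<Omega> e \<rho>" and "P \<equiv> good_region \<Omega> e \<rho> i" and "Z \<equiv> bad_region \<Omega> e \<rho> i"
  assumes u: "has_trace D u g" and V: "has_trace D V h"
  shows "\<bar>(LINT x|boundary_measure (holes \<Omega> e \<rho>). g x * h x) - cell_coeff e \<rho> i * (LINT x|lebesgue_on D. indicator P x * (u x * V x))\<bar>
    \<le> cell_const TYPE('n) * (1 + \<rho> ^ (CARD('n) - 1) / e ^ CARD('n))
      * ((LINT x|lebesgue_on D. (sqrt (\<rho> / e) + e + indicator Z x) * (norm (u x) * norm (wgrad D V x)))
        + (LINT x|lebesgue_on D. (sqrt (\<rho> / e) + e + indicator Z x) * (norm (V x) * norm (wgrad D u x)))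
        + (LINT x|lebesgue_on D. indicator Z x * (norm (u x) * norm (V x))))"
proof -
  let ?M = "lebesgue_on D" and ?F = "frontier (holes \<Omega> e \<rho>)"
  define C where "C = cell_const TYPE('n) * (1 + \<rho> ^ (CARD('n) - 1) / e ^ CARD('n))"
  define \<delta> where "\<delta> = sqrt (\<rho> / e) + e"
  have e: "0 < e" "\<rho> < e / 2" using \<rho> by auto
  have \<delta>0: "0 \<le> \<delta>" using e \<rho> by (simp add: \<delta>_def)
  have D: "open D" "bounded D"
    unfolding D_def using open_perforated[OF \<Omega> e(1) \<rho>(1) e(2)] bounded_subset[OF \<Omega>(1) perforated_subset[OF \<Omega> e(1) \<rho>(1) e(2)]] by auto
  have D': "D \<in> sets lebesgue" using D by auto
  have wP: "(indicator P :: _ \<Rightarrow> real) \<in> borel_measurable ?M" and wZ: "(indicator Z :: _ \<Rightarrow> real) \<in> borel_measurable ?M"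
    unfolding P_def Z_def
    by (intro borel_measurable_lebesgue_on borel_measurable_indicator region_borel \<Omega> e)+
  have w\<delta>: "(\<lambda>x. \<delta> + indicator Z x :: real) \<in> borel_measurable ?M"
    by (intro borel_measurable_add borel_measurable_const wZ)
  have bP: "\<bar>indicator P x :: real\<bar> \<le> 1" and bZ: "\<bar>indicator Z x :: real\<bar> \<le> 1" and b\<delta>: "\<bar>\<delta> + indicator Z x :: real\<bar> \<le> \<delta> + 1"
    and bF: "\<bar>indicator ?F x :: real\<bar> \<le> 1" for x
    using \<delta>0 by (auto split: split_indicator)
  have wF: "(indicator ?F :: _ \<Rightarrow> real) \<in> borel_measurable (boundary_measure D)"
  proof -
    have "(indicator ?F :: _ \<Rightarrow> real) \<in> borel_measurable borel"
      by (rule borel_measurable_indicator[OF borel_closed[OF frontier_closed]])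
    then have "(indicator ?F :: _ \<Rightarrow> real) \<in> borel_measurable (hausdorff_measure (CARD('n) - 1))"
      by (simp add: measurable_def)
    then show ?thesis unfolding boundary_measure_def by (rule measurable_restrict_space1)
  qed
  \<comment> \<open>The spheres are part of the boundary of \<open>D\<close>, so an integral over
    them is one over that boundary with a bounded weight, and the boundary convergence in the
    definition of the trace applies.\<close>
  have holes: "(LINT x|boundary_measure (holes \<Omega> e \<rho>). f x) = (LINT x|boundary_measure D. indicator ?F x * f x)" for f :: "real ^ 'n \<Rightarrow> real"
  proof -
    have "indicator (frontier D) x * indicator ?F x = (indicator ?F x :: real)" for x
      using frontier_holes_subset[OF \<Omega> e(1) \<rho>(1) e(2)] unfolding D_def by (auto split: split_indicator)
    then show ?thesis unfolding integral_boundary_measure by (simp only: mult.assoc[symmetric])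
  qed
  obtain \<phi> where \<phi>: "\<And>j::nat. smooth (\<phi> j)" "\<And>j. square_integrable (boundary_measure D) (\<phi> j)"
    "(\<lambda>j. l2norm ?M (\<lambda>x. \<phi> j x - u x)) \<longlonglongrightarrow> 0" "(\<lambda>j. l2norm ?M (\<lambda>x. gradient (\<phi> j) x - wgrad D u x)) \<longlonglongrightarrow> 0"
    "(\<lambda>j. l2norm (boundary_measure D) (\<lambda>x. \<phi> j x - g x)) \<longlonglongrightarrow> 0"
    using has_trace_approx[OF D u] by blast
  obtain \<psi> where \<psi>: "\<And>j::nat. smooth (\<psi> j)" "\<And>j. square_integrable (boundary_measure D) (\<psi> j)"
    "(\<lambda>j. l2norm ?M (\<lambda>x. \<psi> j x - V x)) \<longlonglongrightarrow> 0" "(\<lambda>j. l2norm ?M (\<lambda>x. gradient (\<psi> j) x - wgrad D V x)) \<longlonglongrightarrow> 0"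
    "(\<lambda>j. l2norm (boundary_measure D) (\<lambda>x. \<psi> j x - h x)) \<longlonglongrightarrow> 0"
    using has_trace_approx[OF D V] by blast
  have smooth_sq: "square_integrable ?M f" "square_integrable ?M (gradient f)" if "smooth f" for f
    using smoothD[OF that] by (auto intro!: square_integrable_continuous D(2) D')
  note sq\<phi> = smooth_sq[OF \<phi>(1)] and sq\<psi> = smooth_sq[OF \<psi>(1)]
  have "u \<in> H1 D" "V \<in> H1 D" and sqb: "square_integrable (boundary_measure D) g" "square_integrable (boundary_measure D) h"
    using u V by (auto simp: has_trace_def)
  note squ = H1D[OF \<open>u \<in> H1 D\<close>] and sqV = H1D[OF \<open>V \<in> H1 D\<close>]
  let ?A = "\<lambda>j. \<bar>(LINT x|boundary_measure D. indicator ?F x * (\<phi> j x * \<psi> j x)) - cell_coeff e \<rho> i * (LINT x|?M. indicator P x * (\<phi> j x * \<psi> j x))\<bar>"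
  let ?B = "\<lambda>j. C * ((LINT x|?M. (\<delta> + indicator Z x) * (norm (\<phi> j x) * norm (gradient (\<psi> j) x)))
      + (LINT x|?M. (\<delta> + indicator Z x) * (norm (\<psi> j x) * norm (gradient (\<phi> j) x)))
      + (LINT x|?M. indicator Z x * (norm (\<phi> j x) * norm (\<psi> j x))))"
  have le: "?A j \<le> ?B j" for j
  proof -
    have "(LINT x|?M. (\<delta> + indicator Z x) * (\<bar>\<phi> j x\<bar> * norm (gradient (\<psi> j) x) + \<bar>\<psi> j x\<bar> * norm (gradient (\<phi> j) x)))
      = (LINT x|?M. (\<delta> + indicator Z x) * (norm (\<phi> j x) * norm (gradient (\<psi> j) x))) + (LINT x|?M. (\<delta> + indicator Z x) * (norm (\<psi> j x) * norm (gradient (\<phi> j) x)))"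
      unfolding distrib_left real_norm_def[symmetric]
      by (rule Bochner_Integration.integral_add)
        (rule integrable_bounded_mult[OF _ w\<delta> b\<delta>], rule integrable_norm_mult, rule sq\<phi> sq\<psi>, rule sq\<phi> sq\<psi>)+
    then show ?thesis
      using perforated_estimate[OF d \<Omega> \<rho> upper_gradient_smooth_mult[OF \<phi>(1)[of j] \<psi>(1)[of j]], of i]
      unfolding D_def[symmetric] P_def[symmetric] Z_def[symmetric] C_def[symmetric] \<delta>_def[symmetric] holes
      by (simp add: abs_mult)
  qed
  have A: "?A \<longlonglongrightarrow> \<bar>(LINT x|boundary_measure D. indicator ?F x * (g x * h x)) - cell_coeff e \<rho> i * (LINT x|?M. indicator P x * (u x * V x))\<bar>"
    by (intro tendsto_intros integral_mult_tendsto[OF \<phi>(2) sqb(1) \<phi>(5) \<psi>(2) sqb(2) \<psi>(5) wF bF]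
        integral_mult_tendsto[OF sq\<phi>(1) squ(1) \<phi>(3) sq\<psi>(1) sqV(1) \<psi>(3) wP bP])
  have B: "?B \<longlonglongrightarrow> C * ((LINT x|?M. (\<delta> + indicator Z x) * (norm (u x) * norm (wgrad D V x)))
      + (LINT x|?M. (\<delta> + indicator Z x) * (norm (V x) * norm (wgrad D u x)))
      + (LINT x|?M. indicator Z x * (norm (u x) * norm (V x))))"
    by (intro tendsto_mult tendsto_add tendsto_const
        integral_norm_mult_tendsto[OF sq\<phi>(1) squ(1) \<phi>(3) sq\<psi>(2) sqV(2) \<psi>(4) w\<delta> b\<delta>]
        integral_norm_mult_tendsto[OF sq\<psi>(1) sqV(1) \<psi>(3) sq\<phi>(2) squ(2) \<phi>(4) w\<delta> b\<delta>]
        integral_norm_mult_tendsto[OF sq\<phi>(1) squ(1) \<phi>(3) sq\<psi>(1) sqV(1) \<psi>(3) wZ bZ])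
  have "\<bar>(LINT x|boundary_measure D. indicator ?F x * (g x * h x)) - cell_coeff e \<rho> i * (LINT x|?M. indicator P x * (u x * V x))\<bar>
    \<le> C * ((LINT x|?M. (\<delta> + indicator Z x) * (norm (u x) * norm (wgrad D V x)))
      + (LINT x|?M. (\<delta> + indicator Z x) * (norm (V x) * norm (wgrad D u x)))
      + (LINT x|?M. indicator Z x * (norm (u x) * norm (V x))))"
    by (rule LIMSEQ_le[OF A B]) (use le in blast)
  then show ?thesis unfolding holes C_def \<delta>_def .
qed

section \<open>Asymptotics of the perforation\<close>

lemma bounded_fmeasurable_lborel:
  fixes B :: "'a::euclidean_space set"
  shows "bounded B \<Longrightarrow> B \<in> sets borel \<Longrightarrow> B \<in> fmeasurable lborel"
  using emeasure_bounded_finite[of B] by (auto simp: fmeasurable_def)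

lemma slab_borel [measurable]:
  fixes i :: "'n::finite"
  shows "{x \<in> open_cell e. \<bar>x $ i\<bar> \<le> \<rho>} \<in> sets borel"
proof -
  have "closed {x::real ^ 'n. \<bar>x $ i\<bar> \<le> \<rho>}" by (intro closed_Collect_le continuous_intros)
  moreover have "{x \<in> open_cell e. \<bar>x $ i\<bar> \<le> \<rho>} = open_cell e \<inter> {x. \<bar>x $ i\<bar> \<le> \<rho>}" by auto
  ultimately show ?thesis by (auto intro: borel_closed)
qed

lemma measure_lborel_translate:
  fixes B :: "'a::euclidean_space set"
  assumes "B \<in> sets borel"
  shows "measure lborel {x. x - a \<in> B} = measure lborel B"
proof -
  have "emeasure lborel ((\<lambda>x. x - a) -` B) = emeasure lborel B"
    by (rule emeasure_lborel_isometry[OF _ _ assms]) (auto simp: dist_norm)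
  then show ?thesis by (simp add: measure_def vimage_def)
qed

lemma measure_bad_part:
  fixes i :: "'n::finite"
  assumes "0 < \<rho>" "\<rho> < e / 2"
  shows "measure lborel (bad_part e \<rho> i)
    \<le> e ^ CARD('n) * (2 * (\<rho> / e) + unit_ball_vol (real CARD('n)) * sqrt (\<rho> / e) ^ CARD('n))"
proof -
  let ?S = "{x \<in> open_cell e :: (real ^ 'n) set. \<bar>x $ i\<bar> \<le> \<rho>}" and ?B = "ball 0 (sqrt (\<rho> * e)) :: (real ^ 'n) set"
  have e: "0 < e" using assms by simp
  have "bounded ?S" by (rule bounded_subset[OF bounded_open_cell]) auto
  then have f: "?S \<in> fmeasurable lborel" "?B \<in> fmeasurable lborel" by (intro bounded_fmeasurable_lborel; simp add: slab_borel)+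
  have "measure lborel (bad_part e \<rho> i) \<le> measure lborel (?S \<union> ?B)"
    by (rule measure_mono_fmeasurable) (use f bad_part_borel in \<open>auto simp: bad_part_def\<close>)
  also have "\<dots> \<le> measure lborel ?S + measure lborel ?B" by (rule measure_Un_le) (use f in \<open>auto simp: fmeasurable_def\<close>)
  also have "measure lborel ?S = 2 * \<rho> * e ^ (CARD('n) - 1)" by (rule measure_slab[OF assms])
  also have "measure lborel ?B = unit_ball_vol (real CARD('n)) * sqrt (\<rho> * e) ^ CARD('n)"
    using assms e by (simp add: content_ball)
  also have "sqrt (\<rho> * e) = e * sqrt (\<rho> / e)"
  proof -
    have "\<rho> * e = (\<rho> / e) * e\<^sup>2" using e by (simp add: power2_eq_square)
    then show ?thesis using e by (simp only: real_sqrt_mult) simp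
  qed
  also have "e ^ (CARD('n) - 1) = e ^ CARD('n) / e" using e by (simp add: power_diff)
  finally show ?thesis using e by (simp add: field_simps power_mult_distrib)
qed

lemma measure_bad_region:
  fixes \<Omega> :: "(real ^ 'n) set" and i :: 'n
  assumes \<Omega>: "bounded \<Omega>" "open \<Omega>" and \<rho>: "0 < \<rho>" "\<rho> < e / 2"
  shows "measure lborel (bad_region \<Omega> e \<rho> i)
    \<le> measure lborel \<Omega> * (2 * (\<rho> / e) + unit_ball_vol (real CARD('n)) * sqrt (\<rho> / e) ^ CARD('n))"
proof -
  let ?I = "interior_cells \<Omega> e" and ?b = "2 * (\<rho> / e) + unit_ball_vol (real CARD('n)) * sqrt (\<rho> / e) ^ CARD('n)"
  have e: "0 < e" using \<rho> by simp
  have fin: "finite ?I" by (rule finite_interior_cells[OF e \<Omega>])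
  have "measure lborel (bad_region \<Omega> e \<rho> i) \<le> (\<Sum>k\<in>?I. measure lborel {x. x - lattice_point e k \<in> bad_part e \<rho> i})"
    unfolding bad_region_def by (rule measure_UNION_le[OF fin]) simp
  also have "\<dots> = (\<Sum>k\<in>?I. measure lborel (bad_part e \<rho> i))"
    by (intro sum.cong refl measure_lborel_translate bad_part_borel)
  also have "\<dots> \<le> (\<Sum>k\<in>?I. e ^ CARD('n) * ?b)" by (intro sum_mono measure_bad_part \<rho>)
  also have "\<dots> = (real (card ?I) * e ^ CARD('n)) * ?b" by simp
  also have "\<dots> \<le> measure lborel \<Omega> * ?b"
    using e \<rho> by (intro mult_right_mono card_cells_le[OF e \<Omega> fin subset_refl]) auto
  finally show ?thesis .
qed

text \<open>Each interior cell loses, up to null sets, exactly the slab of relative thickness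
  \<open>2 * (\<rho> / e)\<close>, which contains the hole.\<close>

lemma measure_good_region:
  fixes \<Omega> :: "(real ^ 'n) set" and i :: 'n
  assumes \<Omega>: "bounded \<Omega>" "open \<Omega>" and \<rho>: "0 < \<rho>" "\<rho> < e / 2"
  shows "measure lborel (good_region \<Omega> e \<rho> i) = real (card (interior_cells \<Omega> e)) * e ^ CARD('n) * (1 - 2 * (\<rho> / e))"
proof -
  let ?I = "interior_cells \<Omega> e" and ?U = "upper_part e \<rho> i" and ?L = "lower_part e \<rho> i"
  have e: "0 < e" using \<rho> by simp
  have fin: "finite ?I" by (rule finite_interior_cells[OF e \<Omega>])
  have sub: "?U \<union> ?L \<subseteq> open_cell e" using \<rho> by (auto simp: upper_part_iff lower_part_iff)
  have f: "?U \<in> fmeasurable lborel" "?L \<in> fmeasurable lborel"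
    using bounded_subset[OF bounded_open_cell[of e], of ?U] bounded_subset[OF bounded_open_cell[of e], of ?L] sub
    by (auto intro!: bounded_fmeasurable_lborel)
  have "measure lborel (good_region \<Omega> e \<rho> i) = (\<Sum>k\<in>?I. measure lborel {x. x - lattice_point e k \<in> ?U \<union> ?L})"
    unfolding good_region_def
  proof (rule measure_finite_Union[OF fin])
    show "(\<lambda>k. {x. x - lattice_point e k \<in> ?U \<union> ?L}) ` ?I \<subseteq> sets lborel"
      using measurable_translate_vimage[of "?U \<union> ?L"] by auto
    show "disjoint_family_on (\<lambda>k. {x. x - lattice_point e k \<in> ?U \<union> ?L}) ?I"
      using open_cells_disjoint[OF e] sub unfolding disjoint_family_on_def by blast
    fix k
    have "bounded {x. x - lattice_point e k \<in> ?U \<union> ?L}"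
    proof (rule bounded_subset)
      show "bounded {x. x - lattice_point e k \<in> open_cell e}" unfolding open_cell_translate_eq by simp
    qed (use sub in auto)
    from emeasure_bounded_finite[OF this]
    show "emeasure lborel {x. x - lattice_point e k \<in> ?U \<union> ?L} \<noteq> \<infinity>" by simp
  qed
  also have "\<dots> = (\<Sum>k\<in>?I. measure lborel (?U \<union> ?L))" by (intro sum.cong refl measure_lborel_translate) simp
  also have "measure lborel (?U \<union> ?L) = measure lborel ?U + measure lborel ?L"
    by (rule measure_Un_AE[OF AE_I2]) (use f \<rho> in \<open>auto simp: upper_part_iff lower_part_iff\<close>)
  also have "\<dots> = e ^ CARD('n) * (1 - 2 * (\<rho> / e))"
    using e by (simp only: measure_upper_part[OF \<rho>] measure_lower_part[OF \<rho>]) (simp add: power_diff field_simps)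
  finally show ?thesis by simp
qed

text \<open>Rounding the coordinates of \<open>x / e\<close> gives a cell containing
  \<open>x\<close>. It lies within distance \<open>d * e\<close> of \<open>x\<close>, hence inside
  the open set for small \<open>e\<close>.\<close>

lemma interior_cells_exhaust:
  fixes \<Omega> :: "(real ^ 'n) set"
  assumes \<Omega>: "open \<Omega>" "x \<in> \<Omega>" and e: "\<And>n. 0 < e n" "e \<longlonglongrightarrow> 0"
  shows "\<forall>\<^sub>F n in sequentially. \<exists>k\<in>interior_cells \<Omega> (e n). x \<in> cell (e n) k"
proof -
  obtain r where r: "0 < r" "cball x r \<subseteq> \<Omega>" using \<Omega> open_contains_cball by blast
  have "(\<lambda>n. real CARD('n) * e n) \<longlonglongrightarrow> real CARD('n) * 0" by (intro tendsto_intros e)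
  then have "\<forall>\<^sub>F n in sequentially. real CARD('n) * e n < r" using r(1) by (intro order_tendstoD(2)) auto
  then show ?thesis
  proof eventually_elim
    case (elim n)
    define k :: "int ^ 'n" where "k = (\<chi> j. round (x $ j / e n))"
    have cell_iff: "y \<in> cell (e n) k \<longleftrightarrow> (\<forall>j. \<bar>y $ j - e n * of_int (k $ j)\<bar> \<le> e n / 2)" for y
    proof -
      have "s - e n / 2 \<le> t \<and> t \<le> s + e n / 2 \<longleftrightarrow> \<bar>t - s\<bar> \<le> e n / 2" for s t :: real by arith
      then show ?thesis by (simp add: cell_def mem_box_cart lattice_point_def)
    qed
    have "\<bar>x $ j - e n * of_int (k $ j)\<bar> \<le> e n / 2" for j
    proof -
      have "x $ j - e n * of_int (k $ j) = - (e n * (of_int (round (x $ j / e n)) - x $ j / e n))"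
        using e(1)[of n] by (simp add: k_def right_diff_distrib)
      then have "\<bar>x $ j - e n * of_int (k $ j)\<bar> = e n * \<bar>of_int (round (x $ j / e n)) - x $ j / e n\<bar>"
        using e(1)[of n] by (simp only: abs_minus_cancel abs_mult abs_of_pos)
      also have "\<dots> \<le> e n * (1 / 2)"
        using e(1)[of n] by (intro mult_left_mono of_int_round_abs_le) simp
      finally show ?thesis by simp
    qed
    then have x: "x \<in> cell (e n) k" by (simp add: cell_iff)
    have "cell (e n) k \<subseteq> cball x r"
    proof
      fix y assume y: "y \<in> cell (e n) k"
      have "norm (x - y) \<le> (\<Sum>j\<in>UNIV. \<bar>(x - y) $ j\<bar>)" by (rule norm_le_l1_cart)
      also have "\<dots> \<le> (\<Sum>j\<in>(UNIV::'n set). e n)"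
      proof (rule sum_mono)
        fix j
        have "\<bar>y $ j - e n * of_int (k $ j)\<bar> \<le> e n / 2" "\<bar>x $ j - e n * of_int (k $ j)\<bar> \<le> e n / 2"
          using x y by (auto simp: cell_iff)
        then show "\<bar>(x - y) $ j\<bar> \<le> e n" unfolding vector_minus_component by linarith
      qed
      finally show "y \<in> cball x r" using elim by (simp add: dist_norm)
    qed
    then show ?case using x r by (auto simp: interior_cells_def)
  qed
qed

text \<open>From below, the union of the interior cells tends to \<open>\<Omega>\<close> in measure
  by dominated convergence, since every point is eventually covered. From above, the open cells are
  disjoint subsets of \<open>\<Omega>\<close>.\<close>

lemma card_cells_tendsto:
  fixes \<Omega> :: "(real ^ 'n) set"
  assumes \<Omega>: "bounded \<Omega>" "open \<Omega>" and e: "\<And>n. 0 < e n" "e \<longlonglongrightarrow> 0"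
  shows "(\<lambda>n. real (card (interior_cells \<Omega> (e n))) * e n ^ CARD('n)) \<longlonglongrightarrow> measure lborel \<Omega>"
proof -
  define F where "F n = (\<Union>k\<in>interior_cells \<Omega> (e n). cell (e n) k)" for n
  have fin: "finite (interior_cells \<Omega> (e n))" for n by (rule finite_interior_cells[OF e(1) \<Omega>])
  have F: "F n \<in> sets borel" "F n \<subseteq> \<Omega>" for n
    using fin by (auto simp: F_def cell_def interior_cells_def)
  have O: "\<Omega> \<in> fmeasurable lborel" using \<Omega> by (simp add: bounded_fmeasurable_lborel)
  have "(\<lambda>n. LINT x|lborel. indicator (F n) x :: real) \<longlonglongrightarrow> (LINT x|lborel. indicator \<Omega> x)"
  proof (rule integral_dominated_convergence[where w = "indicator \<Omega>"])
    show "integrable lborel (indicator \<Omega> :: _ \<Rightarrow> real)" using O by (simp add: fmeasurable_def)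
    show "AE x in lborel. (\<lambda>n. indicator (F n) x) \<longlonglongrightarrow> (indicator \<Omega> x :: real)"
    proof (rule AE_I2, rule tendsto_eventually)
      fix x
      show "\<forall>\<^sub>F n in sequentially. indicator (F n) x = (indicator \<Omega> x :: real)"
      proof (cases "x \<in> \<Omega>")
        case True
        show ?thesis using interior_cells_exhaust[OF \<Omega>(2) True e]
          by eventually_elim (use True in \<open>auto simp: F_def\<close>)
      next
        case False
        then have "x \<notin> F n" for n using F(2) by blast
        then show ?thesis using False by simp
      qed
    qed
  qed (use \<Omega> F in \<open>auto split: split_indicator\<close>)
  then have 1: "(\<lambda>n. measure lborel (F n)) \<longlonglongrightarrow> measure lborel \<Omega>" by simp
  have 2: "measure lborel (F n) \<le> real (card (interior_cells \<Omega> (e n))) * e n ^ CARD('n)" for n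
  proof -
    have cell: "measure lborel (cell (e n) k) = e n ^ CARD('n)" for k :: "int ^ 'n"
    proof -
      have "measure lborel (cell (e n) k) = measure lborel {x. x - lattice_point (e n) k \<in> open_cell (e n)}"
        unfolding open_cell_translate_eq cell_def by (simp add: measure_lborel_box_eq measure_lborel_cbox_eq)
      then show ?thesis using e(1)[of n] by (simp add: measure_open_cell_translate)
    qed
    have "measure lborel (F n) \<le> (\<Sum>k\<in>interior_cells \<Omega> (e n). measure lborel (cell (e n) k))"
      unfolding F_def by (rule measure_UNION_le[OF fin]) (simp add: cell_def)
    then show ?thesis by (simp add: cell)
  qed
  have 3: "real (card (interior_cells \<Omega> (e n))) * e n ^ CARD('n) \<le> measure lborel \<Omega>" for n
    by (rule card_cells_le[OF e(1) \<Omega> fin subset_refl])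
  show ?thesis
    by (rule tendsto_sandwich[OF _ _ 1 tendsto_const]) (use 2 3 in auto)
qed

text \<open>By reflection the two halves of the shell have equal volume, so neither exceeds one
  half; what they miss lies in the slab, whose volume is of order \<open>\<rho> / e\<close> relative
  to the shell.\<close>

lemma cell_coeff_ratio:
  fixes i :: "'n::finite"
  assumes \<rho>: "0 < \<rho>" "4 * \<rho> \<le> e"
  defines "A \<equiv> annulus \<rho> (e / 2) :: (real ^ 'n) set"
  shows "measure lborel (A \<inter> upper_part e \<rho> i) / measure lborel A \<le> 1 / 2"
    and "1 / 2 - 2 * 2 ^ CARD('n) / unit_ball_vol (real CARD('n)) * (\<rho> / e) \<le> measure lborel (A \<inter> upper_part e \<rho> i) / measure lborel A"
proof -
  let ?U = "upper_part e \<rho> i" and ?L = "lower_part e \<rho> i" and ?w = "unit_ball_vol (real CARD('n))"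
  let ?S = "{x \<in> open_cell e :: (real ^ 'n) set. \<bar>x $ i\<bar> \<le> \<rho>}"
  define mu where "mu = measure lborel (A \<inter> ?U)"
  have e: "0 < e" "\<rho> < e / 2" "0 \<le> \<rho>" using \<rho> by auto
  have w0: "0 < ?w" by simp
  then have w: "0 < ?w" "?w \<noteq> 0" by (blast, linarith)
  have As: "A \<in> sets borel" by (auto simp: A_def)
  have bA: "bounded A" unfolding A_def by (rule bounded_subset[of "ball 0 (e / 2)"]) auto
  have fA: "A \<inter> B \<in> fmeasurable lborel" if "B \<in> sets borel" for B
    by (rule bounded_fmeasurable_lborel) (use bounded_subset[OF bA] As that in auto)
  have fA': "A \<in> fmeasurable lborel" using fA[of UNIV] by simp
  have mu: "measure lborel (A \<inter> ?L) = mu"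
  proof -
    have "A \<inter> ?L = uminus -` (A \<inter> ?U)"
      using e by (auto simp: A_def lower_part_iff upper_part_iff open_cell_iff)
    moreover have "measure lborel (uminus -` (A \<inter> ?U)) = measure lborel (A \<inter> ?U)"
      by (rule measure_lborel_uminus) (use As in auto)
    ultimately show ?thesis by (simp add: mu_def)
  qed
  have UL: "measure lborel (A \<inter> ?U \<union> A \<inter> ?L) = mu + mu"
    unfolding mu[symmetric] mu_def[symmetric, folded mu]
    by (subst measure_Un_AE[OF AE_I2]) (use fA[of ?U] fA[of ?L] e mu in \<open>auto simp: upper_part_iff lower_part_iff mu_def\<close>)
  have low: "?w * (e / 2) ^ CARD('n) / 2 \<le> measure lborel A"
    using annulus_lower_bound[OF \<rho>, where 'a = "real ^ 'n"] by (simp add: A_def)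
  have "0 < ?w * (e / 2) ^ CARD('n) / 2" using e w by simp
  then have pos: "0 < measure lborel A" using low by linarith
  have "mu + mu \<le> measure lborel A"
    unfolding UL[symmetric] by (rule measure_mono_fmeasurable) (use As fA' in auto)
  then show "measure lborel (A \<inter> ?U) / measure lborel A \<le> 1 / 2"
    using pos by (simp add: mu_def[symmetric] field_simps)
  have "bounded ?S" by (rule bounded_subset[OF bounded_open_cell]) auto
  then have fS: "?S \<in> fmeasurable lborel" by (intro bounded_fmeasurable_lborel slab_borel)
  have "measure lborel A \<le> measure lborel ((A \<inter> ?U \<union> A \<inter> ?L) \<union> ?S)"
  proof (rule measure_mono_fmeasurable)
    show "A \<subseteq> (A \<inter> ?U \<union> A \<inter> ?L) \<union> ?S"
      using annulus_subset_cell[of e \<rho>] e by (auto simp: A_def upper_part_iff lower_part_iff)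
  qed (use As fS fA[of ?U] fA[of ?L] in auto)
  also have "\<dots> \<le> measure lborel (A \<inter> ?U \<union> A \<inter> ?L) + measure lborel ?S"
    by (rule measure_Un_le) (use As slab_borel in auto)
  also have "\<dots> = (mu + mu) + 2 * \<rho> * e ^ (CARD('n) - 1)" by (simp only: UL measure_slab[OF \<rho>(1) e(2)])
  \<comment> \<open>The volume of the slab is written as a multiple of the lower bound
    \<open>low\<close> for the shell, so that it becomes a fraction of the shell in the next
    step.\<close>
  also have "2 * \<rho> * e ^ (CARD('n) - 1) = (4 * 2 ^ CARD('n) / ?w * (\<rho> / e)) * (?w * (e / 2) ^ CARD('n) / 2)"
    using e w(2) by (simp add: power_diff power_divide)
  also have "\<dots> \<le> (4 * 2 ^ CARD('n) / ?w * (\<rho> / e)) * measure lborel A"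
    using e w \<rho>(1) by (intro mult_left_mono low mult_nonneg_nonneg divide_nonneg_nonneg) simp_all
  finally have le: "measure lborel A * (1 - 4 * 2 ^ CARD('n) / ?w * (\<rho> / e)) \<le> 2 * mu"
    by (simp add: algebra_simps)
  have divide_le: "(1 - t) / 2 \<le> q / M" if "0 < M" "M * (1 - t) \<le> 2 * q" for t q M :: real
    using that by (simp add: field_simps)
  from le have "(1 - 4 * 2 ^ CARD('n) / ?w * (\<rho> / e)) / 2 \<le> mu / measure lborel A"
    by (rule divide_le[OF pos])
  then show "1 / 2 - 2 * 2 ^ CARD('n) / ?w * (\<rho> / e) \<le> measure lborel (A \<inter> ?U) / measure lborel A"
    by (simp add: mu_def diff_divide_distrib mult_ac)
qed

text \<open>Half of the shell is compared with half of the cell: both proportions tend to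
  \<open>1 / 2\<close> and cancel, which leaves the area of the sphere over
  \<open>e ^ d\<close>.\<close>

lemma cell_coeff_tendsto:
  fixes i :: "'n::finite"
  assumes \<rho>: "\<And>n. 0 < \<rho> n" "\<And>n. 4 * \<rho> n \<le> e n" and ratio: "(\<lambda>n. \<rho> n / e n) \<longlonglongrightarrow> 0"
    and crit: "(\<lambda>n. \<rho> n ^ (CARD('n) - 1) / e n ^ CARD('n)) \<longlonglongrightarrow> \<beta>"
  shows "(\<lambda>n. cell_coeff (e n) (\<rho> n) i) \<longlonglongrightarrow> unit_sphere_area TYPE('n) * \<beta>"
proof -
  let ?m = "CARD('n) - 1" and ?Ad = "unit_sphere_area TYPE('n)"
  let ?A = "\<lambda>n. annulus (\<rho> n) (e n / 2) :: (real ^ 'n) set"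
  define s where "s n = measure lborel (?A n \<inter> upper_part (e n) (\<rho> n) i) / measure lborel (?A n)" for n
  let ?c = "2 * 2 ^ CARD('n) / unit_ball_vol (real CARD('n))"
  have s: "s \<longlonglongrightarrow> 1 / 2"
  proof (rule tendsto_sandwich[OF _ _ _ tendsto_const])
    have "(\<lambda>n. 1 / 2 - ?c * (\<rho> n / e n)) \<longlonglongrightarrow> 1 / 2 - ?c * 0" by (intro tendsto_intros ratio)
    then show "(\<lambda>n. 1 / 2 - ?c * (\<rho> n / e n)) \<longlonglongrightarrow> 1 / 2" by simp
  qed (use cell_coeff_ratio[OF \<rho>, of _ i] in \<open>auto simp: s_def\<close>)
  have "(\<lambda>n. ?Ad * (\<rho> n ^ ?m / e n ^ CARD('n)) * s n * (1 / (1 / 2 - \<rho> n / e n))) \<longlonglongrightarrow> ?Ad * \<beta> * (1 / 2) * (1 / (1 / 2 - 0))"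
    by (intro tendsto_intros crit s ratio) simp
  moreover have "cell_coeff (e n) (\<rho> n) i = ?Ad * (\<rho> n ^ ?m / e n ^ CARD('n)) * s n * (1 / (1 / 2 - \<rho> n / e n))" for n
  proof -
    have e: "0 < e n" "\<rho> n < e n / 2" using \<rho>[of n] by auto
    have "measure lborel (upper_part (e n) (\<rho> n) i) = (e n / 2 - \<rho> n) * e n ^ ?m" by (rule measure_upper_part[OF \<rho>(1) e(2)])
    also have "\<dots> = e n ^ CARD('n) * (1 / 2 - \<rho> n / e n)" using e by (simp add: power_diff field_simps)
    finally show ?thesis unfolding cell_coeff_def s_def by simp
  qed
  ultimately show ?thesis by simp
qed

text \<open>The power \<open>(\<rho> / e) ^ (d - 1)\<close> equals \<open>e\<close> times the
  critical quantity and so tends to \<open>0 * \<beta>\<close>; as \<open>d - 1 \<ge> 1\<close> the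
  root can be taken.\<close>

lemma hole_ratio_tendsto_0:
  fixes \<rho> e :: "nat \<Rightarrow> real"
  assumes d: "2 \<le> d" and pos: "\<And>n. 0 < \<rho> n" "\<And>n. 0 < e n" and e: "e \<longlonglongrightarrow> 0"
    and crit: "(\<lambda>n. \<rho> n ^ (d - 1) / e n ^ d) \<longlonglongrightarrow> \<beta>"
  shows "(\<lambda>n. \<rho> n / e n) \<longlonglongrightarrow> 0"
proof -
  have "(\<lambda>n. e n * (\<rho> n ^ (d - 1) / e n ^ d)) \<longlonglongrightarrow> 0 * \<beta>" by (intro tendsto_intros e crit)
  moreover have "e n * (\<rho> n ^ (d - 1) / e n ^ d) = (\<rho> n / e n) ^ (d - 1)" for n
  proof -
    have "e n ^ d = e n * e n ^ (d - 1)" using d by (cases d) auto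
    then show ?thesis using pos(2)[of n] by (simp add: power_divide)
  qed
  ultimately have "(\<lambda>n. (\<rho> n / e n) ^ (d - 1)) \<longlonglongrightarrow> 0" by simp
  then have "(\<lambda>n. root (d - 1) ((\<rho> n / e n) ^ (d - 1))) \<longlonglongrightarrow> root (d - 1) 0" by (rule tendsto_real_root)
  moreover have "root (d - 1) ((\<rho> n / e n) ^ (d - 1)) = \<rho> n / e n" for n
    using d pos[of n] by (intro real_root_power_cancel) auto
  ultimately show ?thesis by simp
qed

section \<open>The limit\<close>

lemma integral_lebesgue_on_subset:
  fixes f :: "'a::euclidean_space \<Rightarrow> real"
  assumes "D \<subseteq> \<Omega>" "D \<in> sets lebesgue" "\<Omega> \<in> sets lebesgue"
  shows "(LINT x|lebesgue_on D. f x) = (LINT x|lebesgue_on \<Omega>. indicator D x * f x)"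
proof -
  have "(\<lambda>x. indicator \<Omega> x *\<^sub>R (indicator D x * f x)) = (\<lambda>x. indicator D x *\<^sub>R f x)"
    using assms(1) by (intro ext) (auto split: split_indicator)
  then show ?thesis using assms by (simp add: integral_restrict_space)
qed

lemma borel_lebesgue_on:
  assumes "E \<in> sets borel" "E \<subseteq> D" "D \<in> sets lebesgue"
  shows "E \<in> sets (lebesgue_on D)" "measure (lebesgue_on D) E = measure lborel E"
  using assms by (auto simp: sets_restrict_space_iff measure_restrict_space)

lemma l2norm_subset_le:
  fixes f f' :: "'a::euclidean_space \<Rightarrow> 'b::euclidean_space"
  assumes D: "D \<subseteq> \<Omega>" "D \<in> sets lebesgue" "\<Omega> \<in> sets lebesgue"
    and f': "square_integrable (lebesgue_on \<Omega>) f'" and f: "f \<in> borel_measurable (lebesgue_on D)"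
    and eq: "AE x in lebesgue_on D. f x = f' x"
  shows "l2norm (lebesgue_on D) f \<le> l2norm (lebesgue_on \<Omega>) f'"
proof -
  have "f' \<in> borel_measurable (lebesgue_on D)"
    by (rule square_integrable_measurable[OF square_integrable_lebesgue_on_subset[OF D f']])
  then have "l2norm (lebesgue_on D) f = l2norm (lebesgue_on D) f'" by (rule l2norm_cong_AE[OF eq f])
  also have "\<dots> \<le> l2norm (lebesgue_on \<Omega>) f'"
  proof -
    have int: "integrable (lebesgue_on \<Omega>) (\<lambda>x. (norm (f' x))\<^sup>2)" using f' by (simp add: square_integrable_def)
    have m: "(indicator D :: _ \<Rightarrow> real) \<in> borel_measurable (lebesgue_on \<Omega>)"
      by (rule borel_measurable_indicator) (use D in \<open>simp add: sets_restrict_space_iff\<close>)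
    have "(LINT x|lebesgue_on \<Omega>. indicator D x * (norm (f' x))\<^sup>2) \<le> (LINT x|lebesgue_on \<Omega>. (norm (f' x))\<^sup>2)"
      by (rule integral_mono[OF integrable_bounded_mult[OF int m, of 1] int]) (auto split: split_indicator)
    then show ?thesis unfolding l2norm_def integral_lebesgue_on_subset[OF D] by simp
  qed
  finally show ?thesis .
qed

lemma l2norm_indicator_tendsto_0:
  fixes f :: "'a::euclidean_space \<Rightarrow> 'b::euclidean_space"
  assumes \<Omega>: "bounded \<Omega>" "open \<Omega>" and f: "square_integrable (lebesgue_on \<Omega>) f"
    and E: "\<And>n. E n \<in> sets borel" "\<And>n. E n \<subseteq> \<Omega>" "(\<lambda>n. measure lborel (E n)) \<longlonglongrightarrow> 0"
  shows "(\<lambda>n. l2norm (lebesgue_on \<Omega>) (\<lambda>x. indicator (E n) x *\<^sub>R f x)) \<longlonglongrightarrow> 0"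
proof -
  have \<Omega>': "\<Omega> \<in> sets lebesgue" using \<Omega>(2) by auto
  interpret finite_measure "lebesgue_on \<Omega>" by (rule finite_measure_lebesgue_on_bounded[OF \<Omega>(1) \<Omega>'])
  have "(\<lambda>n. LINT x|lebesgue_on \<Omega>. indicator (E n) x * (norm (f x))\<^sup>2) \<longlonglongrightarrow> 0"
    by (rule integral_shrinking_sets_tendsto_0)
      (use f E borel_lebesgue_on[OF E(1,2) \<Omega>'] emeasure_finite in \<open>auto simp: square_integrable_def less_top[symmetric]\<close>)
  then have "(\<lambda>n. sqrt (LINT x|lebesgue_on \<Omega>. indicator (E n) x * (norm (f x))\<^sup>2)) \<longlonglongrightarrow> sqrt 0" by (rule tendsto_real_sqrt)
  moreover have "indicator (E n) x * (norm (f x))\<^sup>2 = (norm (indicator (E n) x *\<^sub>R f x))\<^sup>2" for n x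
    by (auto split: split_indicator)
  ultimately show ?thesis by (simp add: l2norm_def)
qed

text \<open>Pairing with a fixed L^2 function is bounded in the norm of \<open>H1\<close>, so weak
  convergence in \<open>H1\<close> implies weak convergence in L^2.\<close>

lemma H1_functional_integral:
  assumes w: "square_integrable (lebesgue_on D) w"
  shows "H1_functional D (\<lambda>v. LINT x|lebesgue_on D. v x * w x)"
  unfolding H1_functional_def
proof (intro conjI ballI allI exI[of _ "l2norm (lebesgue_on D) w"])
  fix u v :: "real ^ 'a \<Rightarrow> real" and a b :: real assume "u \<in> H1 D" "v \<in> H1 D"
  then have "integrable (lebesgue_on D) (\<lambda>x. u x * w x)" "integrable (lebesgue_on D) (\<lambda>x. v x * w x)"
    by (auto intro!: integrable_mult_square_integrable w H1D)
  then show "(LINT x|lebesgue_on D. (a * u x + b * v x) * w x) = a * (LINT x|lebesgue_on D. u x * w x) + b * (LINT x|lebesgue_on D. v x * w x)"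
    by (simp add: distrib_right mult.assoc)
next
  fix u assume u: "u \<in> H1 D"
  have "\<bar>LINT x|lebesgue_on D. u x * w x\<bar> \<le> l2norm (lebesgue_on D) u * l2norm (lebesgue_on D) w"
    by (rule integral_mult_le_l2norm[OF H1D(1)[OF u] w])
  also have "\<dots> \<le> H1_norm D u * l2norm (lebesgue_on D) w"
    by (intro mult_right_mono l2norm_le_H1_norm) simp
  finally show "\<bar>LINT x|lebesgue_on D. u x * w x\<bar> \<le> l2norm (lebesgue_on D) w * H1_norm D u" by (simp add: mult.commute)
qed

text \<open>Each pairing with a fixed L^2 function converges and is thus bounded in
  \<open>n\<close>; the uniform boundedness principle does the rest.\<close>

lemma H1_weakly_converges_l2_bounded:
  assumes "H1_weakly_converges D f u"
  obtains K where "\<And>n. l2norm (lebesgue_on D) (f n) \<le> K"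
proof -
  have f: "f n \<in> H1 D" for n using assms by (simp add: H1_weakly_converges_def)
  have "\<exists>K. \<forall>n. l2norm (lebesgue_on D) (f n) \<le> K"
  proof (rule l2_weakly_bounded_imp_bounded)
    fix w :: "real ^ 'a \<Rightarrow> real" assume "square_integrable (lebesgue_on D) w"
    then have "(\<lambda>n. LINT x|lebesgue_on D. f n x * w x) \<longlonglongrightarrow> (LINT x|lebesgue_on D. u x * w x)"
      using assms H1_functional_integral unfolding H1_weakly_converges_def by blast
    then have "Bseq (\<lambda>n. LINT x|lebesgue_on D. f n x * w x)" by (intro convergent_imp_Bseq convergentI)
    then show "\<exists>C. \<forall>n. \<bar>LINT x|lebesgue_on D. f n x * w x\<bar> \<le> C" by (auto simp: Bseq_def)
  qed (rule H1D(1)[OF f])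
  then show ?thesis using that by blast
qed

lemma steklov_energy:
  assumes "steklov_solution D s u g" "(LINT x|boundary_measure D. g x * g x) = 1"
  shows "(l2norm (lebesgue_on D) (wgrad D u))\<^sup>2 = s"
proof -
  have "(LINT x|lebesgue_on D. wgrad D u x \<bullet> wgrad D u x) = s * (LINT x|boundary_measure D. g x * g x)"
    using assms(1) unfolding steklov_solution_def by blast
  then show ?thesis by (simp add: assms(2) l2norm_power2 power2_norm_eq_inner)
qed

text \<open>The information extracted from the eigenvalue problem is a uniform bound
  \<open>K\<close> on the gradients; that extracted from the extensions \<open>X n\<close> is
  agreement with \<open>u n\<close> off the holes and weak convergence.\<close>

lemma hole_trace_limit:
  fixes \<Omega> :: "(real ^ 'n) set" and e \<rho> :: "nat \<Rightarrow> real" and u g X tV :: "nat \<Rightarrow> real ^ 'n \<Rightarrow> real"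
  assumes d: "2 \<le> CARD('n)" and \<Omega>: "bounded \<Omega>" "open \<Omega>"
    and \<rho>: "\<And>n. 0 < \<rho> n" "\<And>n. 4 * \<rho> n \<le> e n" and e: "e \<longlonglongrightarrow> 0"
    and crit: "(\<lambda>n. \<rho> n ^ (CARD('n) - 1) / e n ^ CARD('n)) \<longlonglongrightarrow> \<beta>"
  defines "D \<equiv> \<lambda>n. perforated \<Omega> (e n) (\<rho> n)"
  assumes u: "\<And>n. has_trace (D n) (u n) (g n)" and energy: "\<And>n. l2norm (lebesgue_on (D n)) (wgrad (D n) (u n)) \<le> K"
    and X: "\<And>n. AE x in lebesgue_on (D n). X n x = u n x" and weak: "H1_weakly_converges \<Omega> X U"
    and V: "V \<in> H1 \<Omega>" "\<And>n. has_trace (D n) V (tV n)"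
  shows "(\<lambda>n. LINT x|boundary_measure (holes \<Omega> (e n) (\<rho> n)). g n x * tV n x)
    \<longlonglongrightarrow> unit_sphere_area TYPE('n) * \<beta> * (LINT x|lebesgue_on \<Omega>. U x * V x)"
proof -
  \<comment> \<open>Any coordinate direction serves for the slab; the limit does not mention
    it.\<close>
  fix i :: 'n
  let ?M = "lebesgue_on \<Omega>"
  define P where "P n = good_region \<Omega> (e n) (\<rho> n) i" for n
  define Z where "Z n = bad_region \<Omega> (e n) (\<rho> n) i" for n
  define C where "C n = cell_const TYPE('n) * (1 + \<rho> n ^ (CARD('n) - 1) / e n ^ CARD('n))" for n
  define \<delta> where "\<delta> n = sqrt (\<rho> n / e n) + e n" for n
  define \<kappa> where "\<kappa> n = cell_coeff (e n) (\<rho> n) i" for n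
  let ?G = "wgrad \<Omega> V"
  have e0: "0 < e n" and \<rho>e: "\<rho> n < e n / 2" for n using \<rho>[of n] by auto
  have \<delta>0: "0 \<le> \<delta> n" for n using e0[of n] \<rho>(1)[of n] by (simp add: \<delta>_def)
  have C0: "0 \<le> C n" for n
    using e0[of n] \<rho>(1)[of n]
    by (auto simp: C_def cell_const_def unit_sphere_area_def intro!: mult_nonneg_nonneg divide_nonneg_nonneg add_nonneg_nonneg)
  have \<Omega>': "\<Omega> \<in> sets lebesgue" using \<Omega>(2) by auto
  have D: "open (D n)" "D n \<subseteq> \<Omega>" for n
    unfolding D_def by (intro open_perforated perforated_subset \<Omega> e0 \<rho> \<rho>e)+
  have D': "D n \<in> sets lebesgue" for n using D(1)[of n] by auto
  have D_eq: "perforated \<Omega> (e n) (\<rho> n) = D n" for n by (simp add: D_def)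
  note sub = D(2) D' \<Omega>'
  have PZ: "P n \<in> sets borel" "Z n \<in> sets borel" "P n \<subseteq> D n" "Z n \<subseteq> D n" for n
    unfolding P_def Z_def D_def by (intro region_borel region_subset_perforated \<Omega> e0 \<rho> \<rho>e)+
  have P\<Omega>: "P n \<subseteq> \<Omega>" and Z\<Omega>: "Z n \<subseteq> \<Omega>" for n using PZ D(2) by blast+
  have ratio: "(\<lambda>n. \<rho> n / e n) \<longlonglongrightarrow> 0" by (rule hole_ratio_tendsto_0[OF d \<rho>(1) e0 e crit])
  have sqrt_ratio: "(\<lambda>n. sqrt (\<rho> n / e n)) \<longlonglongrightarrow> 0" using tendsto_real_sqrt[OF ratio] by simp
  have Zlim: "(\<lambda>n. measure lborel (Z n)) \<longlonglongrightarrow> 0"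
  proof (rule tendsto_sandwich[OF _ _ tendsto_const])
    have "(\<lambda>n. measure lborel \<Omega> * (2 * (\<rho> n / e n) + unit_ball_vol (real CARD('n)) * sqrt (\<rho> n / e n) ^ CARD('n)))
      \<longlonglongrightarrow> measure lborel \<Omega> * (2 * 0 + unit_ball_vol (real CARD('n)) * 0 ^ CARD('n))"
      by (intro tendsto_intros ratio sqrt_ratio)
    then show "(\<lambda>n. measure lborel \<Omega> * (2 * (\<rho> n / e n) + unit_ball_vol (real CARD('n)) * sqrt (\<rho> n / e n) ^ CARD('n))) \<longlonglongrightarrow> 0"
      by (simp add: zero_power)
    show "\<forall>\<^sub>F n in sequentially. measure lborel (Z n) \<le> measure lborel \<Omega> * (2 * (\<rho> n / e n) + unit_ball_vol (real CARD('n)) * sqrt (\<rho> n / e n) ^ CARD('n))"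
      unfolding Z_def by (intro always_eventually allI measure_bad_region \<Omega> \<rho> \<rho>e)
  qed auto
  have Plim: "(\<lambda>n. measure lborel (\<Omega> - P n)) \<longlonglongrightarrow> 0"
  proof -
    have "(\<lambda>n. real (card (interior_cells \<Omega> (e n))) * e n ^ CARD('n) * (1 - 2 * (\<rho> n / e n))) \<longlonglongrightarrow> measure lborel \<Omega> * (1 - 2 * 0)"
      by (intro tendsto_intros ratio card_cells_tendsto \<Omega> e0 e)
    then have "(\<lambda>n. measure lborel (P n)) \<longlonglongrightarrow> measure lborel \<Omega>"
      unfolding P_def measure_good_region[OF \<Omega> \<rho>(1) \<rho>e] by simp
    then have "(\<lambda>n. measure lborel \<Omega> - measure lborel (P n)) \<longlonglongrightarrow> measure lborel \<Omega> - measure lborel \<Omega>"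
      by (intro tendsto_intros)
    moreover have "measure lborel (\<Omega> - P n) = measure lborel \<Omega> - measure lborel (P n)" for n
      by (rule measure_Diff)
        (use emeasure_bounded_finite[OF \<Omega>(1)] \<Omega>(2) PZ(1)[of n] P\<Omega>[of n] in \<open>auto simp: less_top\<close>)
    ultimately show ?thesis by simp
  qed
  have \<kappa>lim: "\<kappa> \<longlonglongrightarrow> unit_sphere_area TYPE('n) * \<beta>"
    unfolding \<kappa>_def by (rule cell_coeff_tendsto[OF \<rho> ratio crit])
  have \<delta>lim: "\<delta> \<longlonglongrightarrow> 0" unfolding \<delta>_def using tendsto_add[OF sqrt_ratio e] by simp
  have Clim: "C \<longlonglongrightarrow> cell_const TYPE('n) * (1 + \<beta>)" unfolding C_def by (intro tendsto_intros crit)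
  obtain L where L: "\<And>n. l2norm ?M (X n) \<le> L" using H1_weakly_converges_l2_bounded[OF weak] by blast
  have L0: "0 \<le> L" using L[of 0] l2norm_nonneg order_trans by blast
  have K0: "0 \<le> K" using energy[of 0] l2norm_nonneg order_trans by blast
  have XH: "X n \<in> H1 \<Omega>" for n using weak by (simp add: H1_weakly_converges_def)
  note sqX = H1D(1)[OF XH] and sqV = H1D(1,2)[OF V(1)]
  have uH: "u n \<in> H1 (D n)" for n using u[of n] by (simp add: has_trace_def)
  note squ = H1D(1,2)[OF uH]
  note VD = H1_subset[OF D(2) D(1) \<Omega>(2,1) V(1)]
  note sqVD = H1D(1,2)[OF VD(1)]
  have ZD: "Z n \<in> sets (lebesgue_on (D n))" for n by (rule borel_lebesgue_on[OF PZ(2,4) D'])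
  let ?zV = "\<lambda>n. l2norm ?M (\<lambda>x. indicator (Z n) x *\<^sub>R V x)" and ?zG = "\<lambda>n. l2norm ?M (\<lambda>x. indicator (Z n) x *\<^sub>R ?G x)"
  have Z\<Omega>M: "Z n \<in> sets ?M" for n by (rule borel_lebesgue_on[OF PZ(2) Z\<Omega> \<Omega>'])
  have nu: "l2norm (lebesgue_on (D n)) (u n) \<le> L" for n
  proof -
    have "l2norm (lebesgue_on (D n)) (u n) \<le> l2norm ?M (X n)"
      by (rule l2norm_subset_le[OF sub sqX square_integrable_measurable[OF squ(1)]]) (use X[of n] in \<open>auto simp: eq_commute\<close>)
    then show ?thesis using L[of n] by simp
  qed
  have nV: "l2norm (lebesgue_on (D n)) V \<le> l2norm ?M V" for n
    by (rule l2norm_subset_le[OF sub sqV(1) square_integrable_measurable[OF sqVD(1)]]) simp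
  have nG: "l2norm (lebesgue_on (D n)) (wgrad (D n) V) \<le> l2norm ?M ?G" for n
    by (rule l2norm_subset_le[OF sub sqV(2) square_integrable_measurable[OF sqVD(2)] VD(2)])
  have nzV: "l2norm (lebesgue_on (D n)) (\<lambda>x. indicator (Z n) x *\<^sub>R V x) \<le> ?zV n" for n
    by (rule l2norm_subset_le[OF sub square_integrable_indicator[OF sqV(1) Z\<Omega>M] square_integrable_measurable[OF square_integrable_indicator[OF sqVD(1) ZD]]]) simp
  have nzG: "l2norm (lebesgue_on (D n)) (\<lambda>x. indicator (Z n) x *\<^sub>R wgrad (D n) V x) \<le> ?zG n" for n
    by (rule l2norm_subset_le[OF sub square_integrable_indicator[OF sqV(2) Z\<Omega>M] square_integrable_measurable[OF square_integrable_indicator[OF sqVD(2) ZD]]])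
      (use VD(2)[of n] in eventually_elim, simp)
  have zV: "?zV \<longlonglongrightarrow> 0" and zG: "?zG \<longlonglongrightarrow> 0"
    by (intro l2norm_indicator_tendsto_0 \<Omega> sqV PZ Z\<Omega> Zlim)+
  let ?lhs = "\<lambda>n. LINT x|boundary_measure (holes \<Omega> (e n) (\<rho> n)). g n x * tV n x"
  let ?main = "\<lambda>n. LINT x|?M. indicator (P n) x * (X n x * V x)"
  \<comment> \<open>Every product has one factor that is merely bounded, by \<open>L\<close> for
    \<open>u n\<close> or by \<open>K\<close> for its gradient; the other comes from the fixed
    \<open>V\<close> and carries \<open>\<delta> n\<close> or a norm over \<open>Z n\<close>, both
    tending to 0. The prefactor \<open>C n\<close> converges because of the critical
    scaling.\<close>
  let ?err = "\<lambda>n. C n * (L * (\<delta> n * l2norm ?M ?G + ?zG n) + K * (\<delta> n * l2norm ?M V + ?zV n) + L * ?zV n)"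
  have main_eq: "(LINT x|lebesgue_on (D n). indicator (P n) x * (u n x * V x)) = ?main n" for n
  proof -
    have "(LINT x|lebesgue_on (D n). indicator (P n) x * (u n x * V x)) = (LINT x|lebesgue_on (D n). indicator (P n) x * (X n x * V x))"
    proof (rule integral_cong_AE)
      have m: "(indicator (P n) :: _ \<Rightarrow> real) \<in> borel_measurable (lebesgue_on (D n))"
        by (rule borel_measurable_indicator[OF borel_lebesgue_on(1)[OF PZ(1,3) D']])
      have "X n \<in> borel_measurable (lebesgue_on (D n))"
        by (rule square_integrable_measurable[OF square_integrable_lebesgue_on_subset[OF sub sqX]])
      then show "(\<lambda>x. indicator (P n) x * (X n x * V x)) \<in> borel_measurable (lebesgue_on (D n))"
        by (intro borel_measurable_times m square_integrable_measurable[OF sqVD(1)])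
      show "(\<lambda>x. indicator (P n) x * (u n x * V x)) \<in> borel_measurable (lebesgue_on (D n))"
        by (intro borel_measurable_times m square_integrable_measurable[OF sqVD(1)] square_integrable_measurable[OF squ(1)])
      show "AE x in lebesgue_on (D n). indicator (P n) x * (u n x * V x) = indicator (P n) x * (X n x * V x)"
        using X[of n] by eventually_elim simp
    qed
    also have "\<dots> = (LINT x|?M. indicator (D n) x * (indicator (P n) x * (X n x * V x)))"
      by (rule integral_lebesgue_on_subset[OF sub])
    also have "\<dots> = ?main n"
      using PZ(3)[of n] by (intro Bochner_Integration.integral_cong) (auto split: split_indicator)
    finally show ?thesis .
  qed
  have est: "\<bar>?lhs n - \<kappa> n * ?main n\<bar> \<le> ?err n" for n
  proof -
    \<comment> \<open>The factors are reordered so that the one from \<open>V\<close> comes last,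
      and \<open>0 +\<close> is inserted so that the weighted Cauchy-Schwarz bound also covers the
      third term, with \<open>\<delta> = 0\<close>.\<close>
    have "\<bar>?lhs n - \<kappa> n * ?main n\<bar> \<le> C n *
       ((LINT x|lebesgue_on (D n). (\<delta> n + indicator (Z n) x) * (norm (u n x) * norm (wgrad (D n) V x)))
        + (LINT x|lebesgue_on (D n). (\<delta> n + indicator (Z n) x) * (norm (wgrad (D n) (u n) x) * norm (V x)))
        + (LINT x|lebesgue_on (D n). (0 + indicator (Z n) x) * (norm (u n x) * norm (V x))))"
      using trace_estimate[OF d \<Omega> \<rho>(1)[of n] \<rho>(2)[of n] u[of n, unfolded D_def] V(2)[of n, unfolded D_def], of i]
      unfolding D_eq P_def[symmetric] Z_def[symmetric] C_def[symmetric] \<delta>_def[symmetric] \<kappa>_def[symmetric] main_eq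
      by (simp only: mult.commute[of "norm (V _)"] add_0)
    also have "\<dots> \<le> C n * (l2norm (lebesgue_on (D n)) (u n) * (\<delta> n * l2norm (lebesgue_on (D n)) (wgrad (D n) V) + l2norm (lebesgue_on (D n)) (\<lambda>x. indicator (Z n) x *\<^sub>R wgrad (D n) V x))
        + l2norm (lebesgue_on (D n)) (wgrad (D n) (u n)) * (\<delta> n * l2norm (lebesgue_on (D n)) V + l2norm (lebesgue_on (D n)) (\<lambda>x. indicator (Z n) x *\<^sub>R V x))
        + l2norm (lebesgue_on (D n)) (u n) * (0 * l2norm (lebesgue_on (D n)) V + l2norm (lebesgue_on (D n)) (\<lambda>x. indicator (Z n) x *\<^sub>R V x)))"
      by (intro mult_left_mono add_mono integral_weighted_le_l2norm squ sqVD ZD \<delta>0 C0 order_refl)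
    also have "\<dots> \<le> C n * (L * (\<delta> n * l2norm ?M ?G + ?zG n) + K * (\<delta> n * l2norm ?M V + ?zV n) + L * (0 * l2norm ?M V + ?zV n))"
      by (intro mult_left_mono mult_mono add_mono nu nV nG nzV nzG energy \<delta>0 C0 L0 K0 order_refl l2norm_nonneg add_nonneg_nonneg mult_nonneg_nonneg)
    finally show ?thesis by simp
  qed
  have "?err \<longlonglongrightarrow> cell_const TYPE('n) * (1 + \<beta>) * (L * (0 * l2norm ?M ?G + 0) + K * (0 * l2norm ?M V + 0) + L * 0)"
    by (intro tendsto_intros Clim \<delta>lim zV zG)
  then have "?err \<longlonglongrightarrow> 0" by simp
  then have "(\<lambda>n. ?lhs n - \<kappa> n * ?main n) \<longlonglongrightarrow> 0"
    by (rule Lim_null_comparison[rotated]) (use est in \<open>auto intro: always_eventually\<close>)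
  moreover have "?main \<longlonglongrightarrow> (LINT x|?M. U x * V x)"
  proof -
    \<comment> \<open>Weak convergence needs a fixed test function, so the indicator of
      \<open>P n\<close> is removed first: the discarded part pairs the bounded \<open>X n\<close>
      with \<open>V\<close> on sets whose measure tends to 0.\<close>
    let ?E = "\<lambda>n x. indicator (\<Omega> - P n) x *\<^sub>R V x"
    have sqE: "square_integrable ?M (?E n)" for n
      by (rule square_integrable_indicator[OF sqV(1)], rule borel_lebesgue_on[OF _ _ \<Omega>']) (use PZ(1) \<Omega>(2) in auto)
    have "(\<lambda>n. L * l2norm ?M (?E n)) \<longlonglongrightarrow> L * 0"
      by (intro tendsto_intros l2norm_indicator_tendsto_0 \<Omega> sqV Plim) (use PZ(1) \<Omega>(2) in auto)
    then have lim0: "(\<lambda>n. L * l2norm ?M (?E n)) \<longlonglongrightarrow> 0" by simp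
    have "\<bar>LINT x|?M. X n x * ?E n x\<bar> \<le> L * l2norm ?M (?E n)" for n
      using integral_mult_le_l2norm[OF sqX sqE, of n n] mult_right_mono[OF L[of n] l2norm_nonneg] by (rule order_trans)
    then have "(\<lambda>n. LINT x|?M. X n x * ?E n x) \<longlonglongrightarrow> 0"
      by (intro Lim_null_comparison[OF _ lim0]) (auto intro: always_eventually)
    moreover have "(\<lambda>n. LINT x|?M. X n x * V x) \<longlonglongrightarrow> (LINT x|?M. U x * V x)"
      using weak H1_functional_integral[OF sqV(1)] unfolding H1_weakly_converges_def by blast
    ultimately have "(\<lambda>n. (LINT x|?M. X n x * V x) - (LINT x|?M. X n x * ?E n x)) \<longlonglongrightarrow> (LINT x|?M. U x * V x) - 0"
      by (intro tendsto_diff)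
    moreover have "(LINT x|?M. X n x * V x) - (LINT x|?M. X n x * ?E n x) = ?main n" for n
    proof -
      have "(LINT x|?M. X n x * V x) - (LINT x|?M. X n x * ?E n x) = (LINT x|?M. X n x * V x - X n x * ?E n x)"
        by (rule Bochner_Integration.integral_diff[symmetric]) (intro integrable_mult_square_integrable sqX sqV sqE)+
      also have "\<dots> = ?main n"
        by (intro Bochner_Integration.integral_cong) (auto split: split_indicator)
      finally show ?thesis .
    qed
    ultimately show ?thesis by simp
  qed
  ultimately have "(\<lambda>n. (?lhs n - \<kappa> n * ?main n) + \<kappa> n * ?main n) \<longlonglongrightarrow> 0 + unit_sphere_area TYPE('n) * \<beta> * (LINT x|?M. U x * V x)"
    by (intro tendsto_add tendsto_mult \<kappa>lim)
  then show ?thesis by simp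
qed

theorem proposition20:
  fixes \<Omega> :: "(real ^ 'n) set"
    and r :: "real \<Rightarrow> real"
    and \<sigma> :: "real \<Rightarrow> nat \<Rightarrow> real"
    and u g Uext :: "real \<Rightarrow> nat \<Rightarrow> real ^ 'n \<Rightarrow> real"
    and \<beta> :: real
    and k :: nat
    and \<epsilon> :: "nat \<Rightarrow> real"
    and U :: "real ^ 'n \<Rightarrow> real"
  assumes dim: "CARD('n) \<ge> 2"
    and domain: "bounded_lipschitz_domain \<Omega>"
    and r_mono: "mono_on {0<..<1} r"
    and r_bounds: "\<And>e. 0 < e \<Longrightarrow> e < 1 \<Longrightarrow> 0 < r e \<and> r e < e / 2"
    and eigen: "\<And>e. 0 < e \<Longrightarrow> e < 1 \<Longrightarrow>
                  steklov_system (perforated \<Omega> e (r e)) (\<sigma> e) (u e) (g e)"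
    and ext: "\<And>e j. 0 < e \<Longrightarrow> e < 1 \<Longrightarrow>
                  harmonic_extension \<Omega> (holes \<Omega> e (r e)) (u e j) (Uext e j)"
    and beta_nonneg: "\<beta> \<ge> 0"
    and critical: "((\<lambda>e. r e ^ (CARD('n) - 1) / e ^ CARD('n)) \<longlongrightarrow> \<beta>) (at_right 0)"
    and k_pos: "k \<ge> 1"
    and eps_range: "\<And>n. 0 < \<epsilon> n \<and> \<epsilon> n < 1"
    and eps_lim: "\<epsilon> \<longlonglongrightarrow> 0"
    and U_conv: "H1_weakly_converges \<Omega> (\<lambda>n. Uext (\<epsilon> n) k) U"
    and sigma_conv: "convergent (\<lambda>n. \<sigma> (\<epsilon> n) k)"
  shows "\<forall>V\<in>H1 \<Omega>. \<forall>tV :: nat \<Rightarrow> real ^ 'n \<Rightarrow> real.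
           (\<forall>n. has_trace (perforated \<Omega> (\<epsilon> n) (r (\<epsilon> n))) V (tV n)) \<longrightarrow>
           (\<lambda>n. LINT x|boundary_measure (holes \<Omega> (\<epsilon> n) (r (\<epsilon> n))). g (\<epsilon> n) k x * tV n x)
             \<longlonglongrightarrow> unit_sphere_area TYPE('n) * \<beta> * (LINT x|lebesgue_on \<Omega>. U x * V x)"
proof (intro ballI allI impI)
  fix V and tV :: "nat \<Rightarrow> real ^ 'n \<Rightarrow> real"
  assume V: "V \<in> H1 \<Omega>" and tV: "\<forall>n. has_trace (perforated \<Omega> (\<epsilon> n) (r (\<epsilon> n))) V (tV n)"
  have \<Omega>: "bounded \<Omega>" "open \<Omega>" using domain by (auto simp: bounded_lipschitz_domain_def)
  have \<epsilon>0: "0 < \<epsilon> n" and \<rho>0: "0 < r (\<epsilon> n)" for n using eps_range r_bounds by auto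
  have crit: "(\<lambda>n. r (\<epsilon> n) ^ (CARD('n) - 1) / \<epsilon> n ^ CARD('n)) \<longlonglongrightarrow> \<beta>"
  proof (rule filterlim_compose[OF critical])
    show "filterlim \<epsilon> (at_right 0) sequentially"
      using eps_lim \<epsilon>0 by (simp add: filterlim_at order_less_imp_not_eq2)
  qed
  \<comment> \<open>The cell estimate requires \<open>4 * \<rho> \<le> e\<close>, more than the
    bound \<open>r e < e / 2\<close> provides. The critical scaling forces the ratio to 0, so it
    holds from some index \<open>N\<close> on; the limit is proved for the sequence shifted by
    \<open>N\<close>.\<close>
  have "(\<lambda>n. r (\<epsilon> n) / \<epsilon> n) \<longlonglongrightarrow> 0" by (rule hole_ratio_tendsto_0[OF dim \<rho>0 \<epsilon>0 eps_lim crit])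
  then have "\<forall>\<^sub>F n in sequentially. r (\<epsilon> n) / \<epsilon> n < 1 / 4" by (rule order_tendstoD) simp
  then obtain N where N: "r (\<epsilon> n) / \<epsilon> n < 1 / 4" if "N \<le> n" for n by (auto simp: eventually_sequentially)
  have small: "4 * r (\<epsilon> (n + N)) \<le> \<epsilon> (n + N)" for n
    using N[of "n + N"] \<epsilon>0[of "n + N"] by (simp add: field_simps)
  \<comment> \<open>A bound for the eigenvalues is, by testing with the eigenfunction and
    normalising its trace, a bound for the squared L^2 norms of the gradients.\<close>
  obtain B where B: "\<And>n. \<bar>\<sigma> (\<epsilon> n) k\<bar> \<le> B"
    using convergent_imp_Bseq[OF sigma_conv] by (auto simp: Bseq_def)
  have sol: "steklov_solution (perforated \<Omega> (\<epsilon> n) (r (\<epsilon> n))) (\<sigma> (\<epsilon> n) k) (u (\<epsilon> n) k) (g (\<epsilon> n) k)"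
    and one: "(LINT x|boundary_measure (perforated \<Omega> (\<epsilon> n) (r (\<epsilon> n))). g (\<epsilon> n) k x * g (\<epsilon> n) k x) = 1" for n
    using eigen[of "\<epsilon> n"] eps_range[of n] by (auto simp: steklov_system_def orthonormal_basis_L2_def)
  have "(\<lambda>n. LINT x|boundary_measure (holes \<Omega> (\<epsilon> (n + N)) (r (\<epsilon> (n + N)))). g (\<epsilon> (n + N)) k x * tV (n + N) x)
    \<longlonglongrightarrow> unit_sphere_area TYPE('n) * \<beta> * (LINT x|lebesgue_on \<Omega>. U x * V x)"
  proof (rule hole_trace_limit[OF dim \<Omega> \<rho>0 small LIMSEQ_ignore_initial_segment[OF eps_lim] LIMSEQ_ignore_initial_segment[OF crit]])
    fix n
    show "has_trace (perforated \<Omega> (\<epsilon> (n + N)) (r (\<epsilon> (n + N)))) (u (\<epsilon> (n + N)) k) (g (\<epsilon> (n + N)) k)"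
      using sol[of "n + N"] by (simp add: steklov_solution_def)
    have "(l2norm (lebesgue_on (perforated \<Omega> (\<epsilon> (n + N)) (r (\<epsilon> (n + N))))) (wgrad (perforated \<Omega> (\<epsilon> (n + N)) (r (\<epsilon> (n + N)))) (u (\<epsilon> (n + N)) k)))\<^sup>2 \<le> B"
      unfolding steklov_energy[OF sol one] using B[of "n + N"] by simp
    then show "l2norm (lebesgue_on (perforated \<Omega> (\<epsilon> (n + N)) (r (\<epsilon> (n + N))))) (wgrad (perforated \<Omega> (\<epsilon> (n + N)) (r (\<epsilon> (n + N)))) (u (\<epsilon> (n + N)) k)) \<le> sqrt B"
      by (rule real_le_rsqrt)
    show "AE x in lebesgue_on (perforated \<Omega> (\<epsilon> (n + N)) (r (\<epsilon> (n + N)))). Uext (\<epsilon> (n + N)) k x = u (\<epsilon> (n + N)) k x"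
      using ext[of "\<epsilon> (n + N)" k] eps_range[of "n + N"] unfolding perforated_def harmonic_extension_def by blast
    show "has_trace (perforated \<Omega> (\<epsilon> (n + N)) (r (\<epsilon> (n + N)))) V (tV (n + N))" using tV by simp
  next
    show "H1_weakly_converges \<Omega> (\<lambda>n. Uext (\<epsilon> (n + N)) k) U"
      using U_conv unfolding H1_weakly_converges_def by (auto intro: LIMSEQ_ignore_initial_segment[where f = "\<lambda>n. _ (Uext (\<epsilon> n) k)"])
  qed (rule V)
  then show "(\<lambda>n. LINT x|boundary_measure (holes \<Omega> (\<epsilon> n) (r (\<epsilon> n))). g (\<epsilon> n) k x * tV n x)
    \<longlonglongrightarrow> unit_sphere_area TYPE('n) * \<beta> * (LINT x|lebesgue_on \<Omega>. U x * V x)"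
    by (rule LIMSEQ_offset)
qed

end
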